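(* Let $(M,g)$ be an $n$-dimensional Riemannian manifold with scalar curvature $R$ and let $V\subset M$ be an open subset. Suppose that $$\int_V R\,d\mathrm{vol}\ \ge\ 0$$ and that there is some $\tau_0>0$ such that $$\int_V f^2\log f^2\,d\mathrm{vol}\ \le\ \int_V 4\tau|\nabla f|^2\,d\mathrm{vol}-n-\frac n2\log(4\pi\tau)$$ for all $f\in W_0^{1,2}(V)$ with $\int_V f^2\,d\mathrm{vol}=1$ and all $0<\tau<\tau_0$. Then $V$ is flat.
   Context: $M$ is a smooth manifold with smooth Riemannian metric $g$; it is not assumed complete. The convention $0\log 0=0$ is used. "$V$ is flat" means the Riemann curvature tensor of $g$ vanishes identically on $V$. *)

theory Defs
  imports "HOL-Analysis.Analysis"
begin

section \<open>Smooth functions on open subsets of Euclidean space\<close>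

primrec Ck_on :: "nat \<Rightarrow> (real^'n) set \<Rightarrow> (real^'n \<Rightarrow> 'b::real_normed_vector) \<Rightarrow> bool" where
  "Ck_on 0 S f \<longleftrightarrow> continuous_on S f"
| "Ck_on (Suc k) S f \<longleftrightarrow>
     (\<forall>x\<in>S. f differentiable (at x)) \<and> (\<forall>v. Ck_on k S (\<lambda>x. frechet_derivative f (at x) v))"

text \<open>Only meant for open \<open>S\<close>, since derivatives are taken with respect to the whole space.\<close>

definition smooth_on :: "(real^'n) set \<Rightarrow> (real^'n \<Rightarrow> 'b::real_normed_vector) \<Rightarrow> bool" where
  "smooth_on S f \<longleftrightarrow> (\<forall>k. Ck_on k S f)"

definition partial_deriv :: "'n \<Rightarrow> (real^'n \<Rightarrow> real) \<Rightarrow> real^'n \<Rightarrow> real" where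
  "partial_deriv i f x = frechet_derivative f (at x) (axis i 1)"

definition test_function :: "(real^'n) set \<Rightarrow> (real^'n \<Rightarrow> real) \<Rightarrow> bool" where
  "test_function W \<psi> \<longleftrightarrow>
     smooth_on UNIV \<psi> \<and> compact (closure {x. \<psi> x \<noteq> 0}) \<and> closure {x. \<psi> x \<noteq> 0} \<subseteq> W"


section \<open>Smooth manifolds\<close>

text \<open>
  The points of the manifold are the elements of a second countable Hausdorff type \<open>'a\<close>; the
  dimension is \<open>CARD('n)\<close>. A chart is a pair of its domain and its coordinate map, the latter
  being relevant only on the domain.
\<close>

type_synonym ('a, 'n) chart = "'a set \<times> ('a \<Rightarrow> real^'n)"

definition chart_inv :: "('a, 'n) chart \<Rightarrow> real^'n \<Rightarrow> 'a" where
  "chart_inv c = inv_into (fst c) (snd c)"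

definition smooth_atlas ::
    "('a::{t2_space, second_countable_topology}, 'n::finite) chart set \<Rightarrow> bool" where
  "smooth_atlas A \<longleftrightarrow>
     (\<Union>c\<in>A. fst c) = UNIV \<and>
     (\<forall>c\<in>A. open (fst c) \<and> open (snd c ` fst c) \<and>
        homeomorphism (fst c) (snd c ` fst c) (snd c) (chart_inv c)) \<and>
     (\<forall>c\<in>A. \<forall>d\<in>A. smooth_on (snd c ` (fst c \<inter> fst d)) (snd d \<circ> chart_inv c))"

definition smooth_fun_on ::
    "('a::topological_space, 'n::finite) chart set \<Rightarrow> 'a set \<Rightarrow> ('a \<Rightarrow> real) \<Rightarrow> bool" where
  "smooth_fun_on A N f \<longleftrightarrow> (\<forall>c\<in>A. smooth_on (snd c ` (fst c \<inter> N)) (f \<circ> chart_inv c))"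

definition smooth_near ::
    "('a::topological_space, 'n::finite) chart set \<Rightarrow> 'a \<Rightarrow> ('a \<Rightarrow> real) \<Rightarrow> bool" where
  "smooth_near A p f \<longleftrightarrow> (\<exists>N. open N \<and> p \<in> N \<and> smooth_fun_on A N f)"

text \<open>
  Tangent vectors at \<open>p\<close> are the derivations at \<open>p\<close> of the functions that are smooth near \<open>p\<close>.
  They are extended by \<open>0\<close> to all other functions, so that equal derivations are equal in HOL.
\<close>

type_synonym 'a tvec = "('a \<Rightarrow> real) \<Rightarrow> real"

definition tangent_space ::
    "('a::topological_space, 'n::finite) chart set \<Rightarrow> 'a \<Rightarrow> 'a tvec set" where
  "tangent_space A p = {X.
     (\<forall>f. \<not> smooth_near A p f \<longrightarrow> X f = 0) \<and>
     (\<forall>f h. smooth_near A p f \<longrightarrow> smooth_near A p h \<longrightarrow>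
        X (\<lambda>q. f q + h q) = X f + X h \<and>
        X (\<lambda>q. f q * h q) = f p * X h + h p * X f) \<and>
     (\<forall>f a. smooth_near A p f \<longrightarrow> X (\<lambda>q. a * f q) = a * X f)}"

definition coord_vec ::
    "('a::topological_space, 'n::finite) chart set \<Rightarrow> ('a, 'n) chart \<Rightarrow> 'n \<Rightarrow> 'a \<Rightarrow> 'a tvec" where
  "coord_vec A c i p =
     (\<lambda>f. if smooth_near A p f then partial_deriv i (f \<circ> chart_inv c) (snd c p) else 0)"


section \<open>Riemannian metrics\<close>

type_synonym 'a metric = "'a \<Rightarrow> 'a tvec \<Rightarrow> 'a tvec \<Rightarrow> real"

definition metric_matrix ::
    "('a::topological_space, 'n::finite) chart set \<Rightarrow> 'a metric \<Rightarrow> ('a, 'n) chart \<Rightarrow> real^'n \<Rightarrow> real^'n^'n" where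
  "metric_matrix A g c x =
     (\<chi> i j. g (chart_inv c x) (coord_vec A c i (chart_inv c x)) (coord_vec A c j (chart_inv c x)))"

definition riemannian_metric ::
    "('a::topological_space, 'n::finite) chart set \<Rightarrow> 'a metric \<Rightarrow> bool" where
  "riemannian_metric A g \<longleftrightarrow>
     (\<forall>p. \<forall>X\<in>tangent_space A p.
        ((\<exists>f. X f \<noteq> 0) \<longrightarrow> 0 < g p X X) \<and>
        (\<forall>Y\<in>tangent_space A p. g p X Y = g p Y X \<and>
           (\<forall>Z\<in>tangent_space A p. \<forall>a b.
              g p (\<lambda>f. a * X f + b * Y f) Z = a * g p X Z + b * g p Y Z))) \<and>
     (\<forall>c\<in>A. \<forall>i j. smooth_on (snd c ` fst c) (\<lambda>x. metric_matrix A g c x $ i $ j))"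


section \<open>Curvature\<close>

text \<open>\<open>christoffel A g c k i j\<close> is $\Gamma^k_{ij}$ in the coordinates of the chart \<open>c\<close>.\<close>

definition christoffel ::
    "('a::topological_space, 'n::finite) chart set \<Rightarrow> 'a metric \<Rightarrow> ('a, 'n) chart
      \<Rightarrow> 'n \<Rightarrow> 'n \<Rightarrow> 'n \<Rightarrow> real^'n \<Rightarrow> real" where
  "christoffel A g c k i j x =
     (1/2) * (\<Sum>l\<in>UNIV. matrix_inv (metric_matrix A g c x) $ k $ l *
       (partial_deriv i (\<lambda>y. metric_matrix A g c y $ j $ l) x +
        partial_deriv j (\<lambda>y. metric_matrix A g c y $ i $ l) x -
        partial_deriv l (\<lambda>y. metric_matrix A g c y $ i $ j) x))"

text \<open>
  \<open>riemann A g c l k i j\<close> is the component $R^l{}_{kij}$ of the curvature tensor, with the sign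
  convention $R(\partial_i,\partial_j)\partial_k
    = \nabla_{\partial_i}\nabla_{\partial_j}\partial_k - \nabla_{\partial_j}\nabla_{\partial_i}\partial_k
    = \sum_l R^l{}_{kij}\,\partial_l$. The Ricci tensor is the trace over \<open>l = i\<close>, so round spheres
  have positive scalar curvature.
\<close>

definition riemann ::
    "('a::topological_space, 'n::finite) chart set \<Rightarrow> 'a metric \<Rightarrow> ('a, 'n) chart
      \<Rightarrow> 'n \<Rightarrow> 'n \<Rightarrow> 'n \<Rightarrow> 'n \<Rightarrow> real^'n \<Rightarrow> real" where
  "riemann A g c l k i j x =
     partial_deriv i (christoffel A g c l j k) x - partial_deriv j (christoffel A g c l i k) x +
     (\<Sum>m\<in>UNIV. christoffel A g c l i m x * christoffel A g c m j k x -
                christoffel A g c l j m x * christoffel A g c m i k x)"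

definition ricci ::
    "('a::topological_space, 'n::finite) chart set \<Rightarrow> 'a metric \<Rightarrow> ('a, 'n) chart
      \<Rightarrow> 'n \<Rightarrow> 'n \<Rightarrow> real^'n \<Rightarrow> real" where
  "ricci A g c j k x = (\<Sum>i\<in>UNIV. riemann A g c i k i j x)"

text \<open>The value of the scalar curvature does not depend on the chart chosen around the point.\<close>

definition scalar_curvature ::
    "('a::topological_space, 'n::finite) chart set \<Rightarrow> 'a metric \<Rightarrow> 'a \<Rightarrow> real" where
  "scalar_curvature A g p =
     (let c = (SOME c. c \<in> A \<and> p \<in> fst c); x = snd c p
      in \<Sum>j\<in>UNIV. \<Sum>k\<in>UNIV. matrix_inv (metric_matrix A g c x) $ j $ k * ricci A g c j k x)"

definition flat_on ::
    "('a::topological_space, 'n::finite) chart set \<Rightarrow> 'a metric \<Rightarrow> 'a set \<Rightarrow> bool" where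
  "flat_on A g V \<longleftrightarrow>
     (\<forall>c\<in>A. \<forall>p\<in>fst c \<inter> V. \<forall>l k i j. riemann A g c l k i j (snd c p) = 0)"


section \<open>Riemannian volume and integration\<close>

text \<open>The unique Borel measure that is $\sqrt{\det(g_{ij})}\,dx$ in every chart.\<close>

definition riemannian_volume ::
    "('a::topological_space, 'n::finite) chart set \<Rightarrow> 'a metric \<Rightarrow> 'a measure" where
  "riemannian_volume A g = (THE \<mu>. sets \<mu> = sets borel \<and>
     (\<forall>c\<in>A. \<forall>B\<in>sets borel. B \<subseteq> fst c \<longrightarrow>
        emeasure \<mu> B =
          (\<integral>\<^sup>+x. ennreal (sqrt (det (metric_matrix A g c x))) * indicator (snd c ` B) x \<partial>lborel)))"

definition volume_on ::
    "('a::topological_space, 'n::finite) chart set \<Rightarrow> 'a metric \<Rightarrow> 'a set \<Rightarrow> 'a measure" where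
  "volume_on A g V = restrict_space (riemannian_volume A g) V"

text \<open>
  Integrals with values in $[-\infty,\infty]$. They are needed because \<open>V\<close> may be non-compact and
  have infinite volume, whereas the Bochner integral of a non-integrable function is \<open>0\<close>.
\<close>

definition has_extended_integral :: "'a measure \<Rightarrow> ('a \<Rightarrow> real) \<Rightarrow> bool" where
  "has_extended_integral M f \<longleftrightarrow> f \<in> borel_measurable M \<and>
     ((\<integral>\<^sup>+p. ennreal (f p) \<partial>M) < \<infinity> \<or> (\<integral>\<^sup>+p. ennreal (- f p) \<partial>M) < \<infinity>)"

definition extended_integral :: "'a measure \<Rightarrow> ('a \<Rightarrow> real) \<Rightarrow> ereal" where
  "extended_integral M f =
     enn2ereal (\<integral>\<^sup>+p. ennreal (f p) \<partial>M) - enn2ereal (\<integral>\<^sup>+p. ennreal (- f p) \<partial>M)"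


section \<open>Sobolev spaces\<close>

definition locally_integrable_on :: "(real^'n) set \<Rightarrow> (real^'n \<Rightarrow> real) \<Rightarrow> bool" where
  "locally_integrable_on W u \<longleftrightarrow> (\<forall>K. compact K \<longrightarrow> K \<subseteq> W \<longrightarrow> set_integrable lborel K u)"

definition weak_partial_deriv ::
    "(real^'n) set \<Rightarrow> 'n \<Rightarrow> (real^'n \<Rightarrow> real) \<Rightarrow> (real^'n \<Rightarrow> real) \<Rightarrow> bool" where
  "weak_partial_deriv W i u v \<longleftrightarrow>
     locally_integrable_on W u \<and> locally_integrable_on W v \<and>
     (\<forall>\<psi>. test_function W \<psi> \<longrightarrow>
        (LINT x:W|lborel. u x * partial_deriv i \<psi> x) = - (LINT x:W|lborel. v x * \<psi> x))"

text \<open>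
  \<open>X\<close> represents the weak gradient of \<open>f\<close> on \<open>V\<close>, that is, $g(X,\partial_i)$ is the weak
  \<open>i\<close>-th partial derivative of \<open>f\<close> in every chart. Such an \<open>X\<close> is unique almost everywhere on \<open>V\<close>.
\<close>

definition weak_gradient ::
    "('a::topological_space, 'n::finite) chart set \<Rightarrow> 'a metric \<Rightarrow> 'a set
      \<Rightarrow> ('a \<Rightarrow> real) \<Rightarrow> ('a \<Rightarrow> 'a tvec) \<Rightarrow> bool" where
  "weak_gradient A g V f X \<longleftrightarrow>
     (\<forall>p\<in>V. X p \<in> tangent_space A p) \<and>
     (\<forall>c\<in>A. \<forall>i. weak_partial_deriv (snd c ` (fst c \<inter> V)) i (f \<circ> chart_inv c)
        ((\<lambda>p. g p (X p) (coord_vec A c i p)) \<circ> chart_inv c))"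

text \<open>Elements of the Sobolev spaces are represented by functions whose values outside \<open>V\<close> are irrelevant.\<close>

definition W12 ::
    "('a::topological_space, 'n::finite) chart set \<Rightarrow> 'a metric \<Rightarrow> 'a set \<Rightarrow> ('a \<Rightarrow> real) set" where
  "W12 A g V = {f. f \<in> borel_measurable (volume_on A g V) \<and>
     integrable (volume_on A g V) (\<lambda>p. (f p)\<^sup>2) \<and>
     (\<exists>X. weak_gradient A g V f X \<and> integrable (volume_on A g V) (\<lambda>p. g p (X p) (X p)))}"

definition Cc_infinity ::
    "('a::topological_space, 'n::finite) chart set \<Rightarrow> 'a set \<Rightarrow> ('a \<Rightarrow> real) set" where
  "Cc_infinity A V = {\<psi>. smooth_fun_on A UNIV \<psi> \<and>
     compact (closure {p. \<psi> p \<noteq> 0}) \<and> closure {p. \<psi> p \<noteq> 0} \<subseteq> V}"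

text \<open>The closure of the smooth functions with compact support in \<open>V\<close> with respect to the Sobolev norm.\<close>

definition W12_0 ::
    "('a::topological_space, 'n::finite) chart set \<Rightarrow> 'a metric \<Rightarrow> 'a set \<Rightarrow> ('a \<Rightarrow> real) set" where
  "W12_0 A g V = {f \<in> W12 A g V. \<forall>\<epsilon>>0. \<exists>\<psi>\<in>Cc_infinity A V. \<exists>Z.
     weak_gradient A g V (\<lambda>p. f p - \<psi> p) Z \<and>
     (\<integral>\<^sup>+p. ennreal ((f p - \<psi> p)\<^sup>2) \<partial>volume_on A g V) +
     (\<integral>\<^sup>+p. ennreal (g p (Z p) (Z p)) \<partial>volume_on A g V) < ennreal \<epsilon>}"

end

(*
  In coordinates around a point of V, test the inequality with the function psi for which psi^2 dvol
  is a cut off Gaussian of variance 2 tau. After an integration by parts the inequality says that the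
  Gaussian average of tau (Q(Gamma) - R) + (ln det G + tr G^(-1) - n)/2 is nonnegative, where Q is
  quadratic in the Christoffel symbols. In normal coordinates Q(Gamma) has order two and the last
  term order four, so the leading term as tau -> 0 is -tau R, and R <= 0 on V. With the hypothesis on
  the integral of R this gives R = 0 on V. The next term, of order tau^2, is then a quadratic form in
  the second derivatives h of the metric at the point, and it is nonnegative in all coordinates in
  which the first derivatives vanish there. A cubic change of coordinates, which does not affect the
  curvature, makes the totally symmetric part and the trace of h vanish; then the form equals minus
  half the squared norm of the part of h that determines the curvature tensor, which therefore is 0.
*)

theory Submission
  imports Defs "HOL-Probability.Distributions"
begin

section \<open>Smooth functions\<close>

text \<open>For the flat metric the full Gaussian gives equality in the logarithmic Sobolev
  inequality, so only curvature terms survive, and they come out of an exact identity. The test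
  function depends on the coordinates while the inequality does not; hence nonnegativity holds in
  every coordinate system. The cutoff is \<open>1\<close> on a ball and the integrands are bounded
  beyond it, so a bound \<open>C * norm y ^ m\<close> near the origin becomes global and dominated
  convergence needs no tail estimates. The mass lost by cutting off enters with the favourable sign.
  The obstacle at order \<open>\<tau>\<^sup>2\<close> is that the quadratic form in the second
  derivatives of the metric need not have a sign: it contains squares of traces with a positive
  factor, and a part that depends only on the choice of coordinates. The sign appears once a change
  of coordinates has removed both, and the vanishing of the scalar curvature is exactly the
  condition under which the traces can be removed too. Coordinates that are normal to first order
  suffice, so polynomial maps replace the exponential map.\<close>

lemma Ck_on_cong_imp:
  fixes f h :: "real^'n \<Rightarrow> 'b::real_normed_vector"
  assumes "open S" "\<And>x. x \<in> S \<Longrightarrow> f x = h x" "Ck_on k S f"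
  shows "Ck_on k S h"
  using assms(2,3)
proof (induction k arbitrary: f h)
  case 0
  then show ?case by (simp cong: continuous_on_cong_simp)
next
  case (Suc k)
  have h: "(h has_derivative frechet_derivative f (at x)) (at x)" if "x \<in> S" for x
  proof -
    have "(f has_derivative frechet_derivative f (at x)) (at x)"
      using Suc.prems that by (simp add: frechet_derivative_works)
    then show ?thesis
      using has_derivative_transform_within_open[OF _ assms(1) that] Suc.prems(1) by blast
  qed
  have "Ck_on k S (\<lambda>x. frechet_derivative h (at x) v)" for v
  proof (rule Suc.IH)
    show "Ck_on k S (\<lambda>x. frechet_derivative f (at x) v)" using Suc.prems by simp
    show "frechet_derivative f (at x) v = frechet_derivative h (at x) v" if "x \<in> S" for x
      using frechet_derivative_at[OF h[OF that]] by simp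
  qed
  then show ?case using h by (auto simp: differentiable_def)
qed

lemma Ck_on_cong:
  fixes f h :: "real^'n \<Rightarrow> 'b::real_normed_vector"
  assumes "open S" "\<And>x. x \<in> S \<Longrightarrow> f x = h x"
  shows "Ck_on k S f \<longleftrightarrow> Ck_on k S h"
  using Ck_on_cong_imp[OF assms(1)] assms(2) by metis

text \<open>On an open set any explicit derivative agrees with the one chosen by
  \<open>frechet_derivative\<close>. The closure properties below therefore exhibit a formula
  \<open>D\<close> for the derivative and recurse on it.\<close>

lemma Ck_on_SucI':
  assumes "open S" "\<And>x. x \<in> S \<Longrightarrow> (f has_derivative D x) (at x)"
    "\<And>v. Ck_on k S (\<lambda>x. D x v)"
  shows "Ck_on (Suc k) S f"
proof -
  have "Ck_on k S (\<lambda>x. frechet_derivative f (at x) v)" for v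
  proof (rule Ck_on_cong_imp[OF assms(1) _ assms(3)])
    show "D x v = frechet_derivative f (at x) v" if "x \<in> S" for x
      using frechet_derivative_at[OF assms(2)[OF that]] by simp
  qed
  then show ?thesis using assms(2) by (auto simp: differentiable_def)
qed

lemma Ck_on_Suc_has_derivative:
  "Ck_on (Suc k) S f \<Longrightarrow> x \<in> S \<Longrightarrow> (f has_derivative frechet_derivative f (at x)) (at x)"
  by (simp add: frechet_derivative_works)

lemma Ck_on_subset: "Ck_on k S f \<Longrightarrow> T \<subseteq> S \<Longrightarrow> Ck_on k T f"
  by (induction k arbitrary: f) (auto intro: continuous_on_subset)

lemma Ck_on_SucD: "Ck_on (Suc k) S f \<Longrightarrow> Ck_on k S f"
proof (induction k arbitrary: f)
  case 0
  then show ?case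
    by (simp add: continuous_at_imp_continuous_on differentiable_imp_continuous_within)
next
  case (Suc k)
  from Suc.prems have "Ck_on (Suc k) S (\<lambda>x. frechet_derivative f (at x) v)" for v
    by (subst (asm) Ck_on.simps) auto
  then have "Ck_on k S (\<lambda>x. frechet_derivative f (at x) v)" for v by (rule Suc.IH)
  with Suc.prems show ?case by simp
qed

lemma Ck_on_const [simp]: "Ck_on k S (\<lambda>x. c)"
  by (induction k arbitrary: c) (auto simp: frechet_derivative_const)

lemma Ck_on_bounded_linear:
  assumes "open S" "bounded_linear L" "Ck_on k S f"
  shows "Ck_on k S (\<lambda>x. L (f x))"
  using assms(3)
proof (induction k arbitrary: f)
  case 0
  then show ?case
    using assms(2) by (auto intro: bounded_linear.continuous_on)
next
  case (Suc k)
  show ?case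
  proof (rule Ck_on_SucI'[OF assms(1)])
    show "((\<lambda>x. L (f x)) has_derivative (\<lambda>v. L (frechet_derivative f (at x) v))) (at x)" if "x \<in> S" for x
      using Suc.prems that by (intro bounded_linear.has_derivative[OF assms(2)] Ck_on_Suc_has_derivative)
    show "Ck_on k S (\<lambda>x. L (frechet_derivative f (at x) v))" for v
      using Suc.prems by (intro Suc.IH) auto
  qed
qed

lemma Ck_on_add:
  assumes "open S" "Ck_on k S f" "Ck_on k S h"
  shows "Ck_on k S (\<lambda>x. f x + h x)"
  using assms(2,3)
proof (induction k arbitrary: f h)
  case 0
  then show ?case by (auto intro: continuous_intros)
next
  case (Suc k)
  show ?case
  proof (rule Ck_on_SucI'[OF assms(1)])
    show "((\<lambda>x. f x + h x) has_derivative (\<lambda>v. frechet_derivative f (at x) v + frechet_derivative h (at x) v)) (at x)"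
      if "x \<in> S" for x
      using Suc.prems that by (intro has_derivative_add Ck_on_Suc_has_derivative)
    show "Ck_on k S (\<lambda>x. frechet_derivative f (at x) v + frechet_derivative h (at x) v)" for v
      using Suc.prems by (intro Suc.IH) auto
  qed
qed

lemma Ck_on_sum:
  assumes "open S" "\<And>i. i \<in> I \<Longrightarrow> Ck_on k S (f i)"
  shows "Ck_on k S (\<lambda>x. \<Sum>i\<in>I. f i x)"
  using assms(2)
  by (induction I rule: infinite_finite_induct) (auto intro: Ck_on_add[OF assms(1)])

text \<open>The Leibniz rule gives a sum of two expressions of the same shape with one argument
  differentiated; the other argument is of class \<open>k\<close> by \<open>Ck_on_SucD\<close>, so
  the induction hypothesis applies to both.\<close>

lemma Ck_on_bilinear:
  assumes "open S" "bounded_bilinear B" "Ck_on k S f" "Ck_on k S h"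
  shows "Ck_on k S (\<lambda>x. B (f x) (h x))"
  using assms(3,4)
proof (induction k arbitrary: f h)
  case 0
  then show ?case using bounded_bilinear.continuous_on[OF assms(2)] by auto
next
  case (Suc k)
  show ?case
  proof (rule Ck_on_SucI'[OF assms(1)])
    show "((\<lambda>x. B (f x) (h x)) has_derivative
        (\<lambda>v. B (f x) (frechet_derivative h (at x) v) + B (frechet_derivative f (at x) v) (h x))) (at x)"
      if "x \<in> S" for x
      using Suc.prems that by (intro bounded_bilinear.FDERIV[OF assms(2)] Ck_on_Suc_has_derivative)
    show "Ck_on k S (\<lambda>x. B (f x) (frechet_derivative h (at x) v) + B (frechet_derivative f (at x) v) (h x))" for v
      using Suc.prems Suc.prems[THEN Ck_on_SucD] by (intro Ck_on_add[OF assms(1)] Suc.IH) auto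
  qed
qed

lemma vec_expansion: "(x::real^'m) = (\<Sum>i\<in>UNIV. (x $ i) *\<^sub>R axis i 1)"
  by (simp add: basis_expansion flip: scalar_mult_eq_scaleR)

lemma Ck_on_vec:
  fixes f :: "real^'n \<Rightarrow> real^'m"
  assumes "open S" "\<And>i. Ck_on k S (\<lambda>x. f x $ i)"
  shows "Ck_on k S f"
proof -
  have "Ck_on k S (\<lambda>x. \<Sum>i\<in>UNIV. (f x $ i) *\<^sub>R (axis i 1 :: real^'m))"
    by (intro Ck_on_sum Ck_on_bounded_linear[OF assms(1) bounded_linear_scaleR_left] assms)
  then show ?thesis by (simp flip: vec_expansion)
qed

lemma linear_vec_expansion:
  assumes "linear L"
  shows "L (x::real^'m) = (\<Sum>i\<in>UNIV. (x $ i) *\<^sub>R L (axis i 1))"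
  by (subst vec_expansion) (simp add: linear_sum[OF assms] linear_scale[OF assms])

lemma Ck_on_compose:
  fixes f :: "real^'n \<Rightarrow> real^'m" and h :: "real^'m \<Rightarrow> 'b::real_normed_vector"
  assumes "open S" "f ` S \<subseteq> T" "Ck_on k S f" "Ck_on k T h"
  shows "Ck_on k S (\<lambda>x. h (f x))"
  using assms(3,4)
proof (induction k arbitrary: h)
  case 0
  then show ?case using assms(2) by (auto intro: continuous_on_compose2)
next
  case (Suc k)
  \<comment> \<open>The derivative of \<open>h\<close> is expanded in the standard basis, which
    turns the derivative of the composite into a finite sum of products. The factor with
    \<open>h\<close> is again a composite with the same \<open>f\<close>; this is why the induction
    varies \<open>h\<close> only.\<close>
  let ?D = "\<lambda>x v. \<Sum>j\<in>UNIV. (frechet_derivative f (at x) v $ j) *\<^sub>R frechet_derivative h (at (f x)) (axis j 1)"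
  have "((\<lambda>x. h (f x)) has_derivative ?D x) (at x)" if "x \<in> S" for x
  proof -
    have h: "(h has_derivative frechet_derivative h (at (f x))) (at (f x))"
      using Suc.prems(2) assms(2) that by (intro Ck_on_Suc_has_derivative) auto
    have "((\<lambda>x. h (f x)) has_derivative (\<lambda>v. frechet_derivative h (at (f x)) (frechet_derivative f (at x) v))) (at x)"
      using diff_chain_at[OF Ck_on_Suc_has_derivative[OF Suc.prems(1) that] h] by (simp add: o_def)
    then show ?thesis
      by (subst (asm) linear_vec_expansion[OF has_derivative_linear[OF h]])
  qed
  moreover have "Ck_on k S (\<lambda>x. ?D x v)" for v
  proof (intro Ck_on_sum Ck_on_bilinear[OF assms(1) bounded_bilinear_scaleR] assms(1))
    fix j
    show "Ck_on k S (\<lambda>x. frechet_derivative f (at x) v $ j)"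
      using Suc.prems by (intro Ck_on_bounded_linear[OF assms(1) bounded_linear_vec_nth]) auto
    show "Ck_on k S (\<lambda>x. frechet_derivative h (at (f x)) (axis j 1))"
      using Suc.prems(2) Ck_on_SucD[OF Suc.prems(1)] by (intro Suc.IH) auto
  qed
  ultimately show ?case by (rule Ck_on_SucI'[OF assms(1)])
qed

text \<open>\<open>Ck_on\<close> speaks of functions on \<open>real^'n\<close>, so an outer function
  of one real variable is given by the sequence \<open>D\<close> of all its derivatives. The
  induction is uniform in \<open>m\<close>, because differentiating \<open>D m\<close> leads to
  \<open>D (Suc m)\<close>.\<close>

lemma Ck_on_compose_real:
  fixes f :: "real^'n \<Rightarrow> real" and D :: "nat \<Rightarrow> real \<Rightarrow> real"
  assumes "open S" "f ` S \<subseteq> T" "Ck_on k S f"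
    and D: "\<And>m t. t \<in> T \<Longrightarrow> (D m has_real_derivative D (Suc m) t) (at t)"
  shows "Ck_on k S (\<lambda>x. D m (f x))"
  using assms(3)
proof (induction k arbitrary: m)
  case 0
  have "continuous_on T (D m)" using D by (meson DERIV_isCont continuous_at_imp_continuous_on)
  with 0 show ?case using assms(2) by (auto intro: continuous_on_compose2)
next
  case (Suc k)
  have "((\<lambda>x. D m (f x)) has_derivative (\<lambda>v. frechet_derivative f (at x) v * D (Suc m) (f x))) (at x)" if "x \<in> S" for x
  proof -
    have "(D m has_derivative (\<lambda>v. v * D (Suc m) (f x))) (at (f x))"
      using D[of "f x" m] assms(2) that by (auto simp: has_field_derivative_def mult_commute_abs)
    from diff_chain_at[OF Ck_on_Suc_has_derivative[OF Suc.prems that] this]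
    show ?thesis by (simp add: o_def)
  qed
  moreover have "Ck_on k S (\<lambda>x. frechet_derivative f (at x) v * D (Suc m) (f x))" for v
    using Suc.prems Ck_on_SucD[OF Suc.prems]
    by (intro Ck_on_bilinear[OF assms(1) bounded_bilinear_mult] Suc.IH) auto
  ultimately show ?case by (rule Ck_on_SucI'[OF assms(1)])
qed

text \<open>Derivatives are taken with respect to the whole space, so the class at a point depends
  only on a neighbourhood. This glues extensions by zero.\<close>

lemma Ck_on_local:
  fixes f :: "real^'n \<Rightarrow> 'b::real_normed_vector"
  assumes "\<And>x. x \<in> S \<Longrightarrow> \<exists>T. open T \<and> x \<in> T \<and> Ck_on k T f"
  shows "Ck_on k S f"
  using assms
proof (induction k arbitrary: f)
  case 0
  show ?case
    unfolding Ck_on.simps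
  proof (rule continuous_at_imp_continuous_on, rule ballI)
    fix x assume "x \<in> S"
    then obtain T where "open T" "x \<in> T" "continuous_on T f" using 0 by auto
    then show "isCont f x" by (simp add: continuous_on_eq_continuous_at)
  qed
next
  case (Suc k)
  have "Ck_on k S (\<lambda>x. frechet_derivative f (at x) v)" for v
  proof (rule Suc.IH)
    fix x assume "x \<in> S"
    from Suc.prems[OF this] obtain T where "open T" "x \<in> T" "Ck_on (Suc k) T f" by blast
    then show "\<exists>T. open T \<and> x \<in> T \<and> Ck_on k T (\<lambda>x. frechet_derivative f (at x) v)" by auto
  qed
  moreover have "f differentiable (at x)" if "x \<in> S" for x
    using Suc.prems[OF that] by auto
  ultimately show ?case by auto
qed

lemma smooth_on_cong:
  assumes "open S" "\<And>x. x \<in> S \<Longrightarrow> f x = h x"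
  shows "smooth_on S f \<longleftrightarrow> smooth_on S h"
  unfolding smooth_on_def using Ck_on_cong[OF assms] by simp

lemma smooth_on_subset: "smooth_on S f \<Longrightarrow> T \<subseteq> S \<Longrightarrow> smooth_on T f"
  unfolding smooth_on_def by (blast intro: Ck_on_subset)

lemma smooth_on_local:
  assumes "\<And>x. x \<in> S \<Longrightarrow> \<exists>T. open T \<and> x \<in> T \<and> smooth_on T f"
  shows "smooth_on S f"
  unfolding smooth_on_def using assms by (metis Ck_on_local smooth_on_def)

lemma smooth_on_frechet_derivative:
  assumes "smooth_on S f"
  shows "smooth_on S (\<lambda>x. frechet_derivative f (at x) v)"
  unfolding smooth_on_def
proof
  fix k
  have "Ck_on (Suc k) S f" using assms unfolding smooth_on_def by blast
  then show "Ck_on k S (\<lambda>x. frechet_derivative f (at x) v)" by simp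
qed

lemma smooth_on_differentiable: "smooth_on S f \<Longrightarrow> x \<in> S \<Longrightarrow> f differentiable (at x)"
  unfolding smooth_on_def by (meson Ck_on.simps(2))

lemma smooth_on_continuous_on: "smooth_on S f \<Longrightarrow> continuous_on S f"
  unfolding smooth_on_def by (meson Ck_on.simps(1))

lemma smooth_on_const: "smooth_on S (\<lambda>x. c)"
  by (simp add: smooth_on_def)

lemma smooth_on_bounded_linear:
  "open S \<Longrightarrow> bounded_linear L \<Longrightarrow> smooth_on S f \<Longrightarrow> smooth_on S (\<lambda>x. L (f x))"
  by (simp add: smooth_on_def Ck_on_bounded_linear)

lemma smooth_on_id: "open S \<Longrightarrow> smooth_on S (\<lambda>x. x)"
proof -
  assume S: "open S"
  have "Ck_on k S (\<lambda>x. x)" for k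
  proof (cases k)
    case (Suc m)
    then show ?thesis
      using S by (auto intro!: Ck_on_SucI'[where D="\<lambda>x v. v"] has_derivative_ident simp del: Ck_on.simps)
  qed (auto intro: continuous_intros)
  then show ?thesis by (simp add: smooth_on_def)
qed

lemma smooth_on_nth: "open S \<Longrightarrow> smooth_on S f \<Longrightarrow> smooth_on S (\<lambda>x. f x $ i)"
  by (rule smooth_on_bounded_linear[OF _ bounded_linear_vec_nth])

lemma smooth_on_coord: "open S \<Longrightarrow> smooth_on S (\<lambda>x. x $ i)"
  by (intro smooth_on_nth smooth_on_id)

lemma smooth_on_add: "open S \<Longrightarrow> smooth_on S f \<Longrightarrow> smooth_on S h \<Longrightarrow> smooth_on S (\<lambda>x. f x + h x)"
  by (simp add: smooth_on_def Ck_on_add)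

lemma smooth_on_mult:
  "open S \<Longrightarrow> smooth_on S f \<Longrightarrow> smooth_on S h \<Longrightarrow> smooth_on S (\<lambda>x. f x * h x :: real)"
  by (simp add: smooth_on_def Ck_on_bilinear[OF _ bounded_bilinear_mult])

lemma smooth_on_minus: "open S \<Longrightarrow> smooth_on S f \<Longrightarrow> smooth_on S (\<lambda>x. - f x)"
  by (rule smooth_on_bounded_linear[OF _ bounded_linear_minus[OF bounded_linear_ident]])

lemma smooth_on_diff: "open S \<Longrightarrow> smooth_on S f \<Longrightarrow> smooth_on S h \<Longrightarrow> smooth_on S (\<lambda>x. f x - h x)"
  using smooth_on_add[of S f "\<lambda>x. - h x"] smooth_on_minus[of S h] by simp

lemma smooth_on_sum:
  "open S \<Longrightarrow> (\<And>i. i \<in> I \<Longrightarrow> smooth_on S (f i)) \<Longrightarrow> smooth_on S (\<lambda>x. \<Sum>i\<in>I. f i x)"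
  by (simp add: smooth_on_def Ck_on_sum)

lemma smooth_on_prod:
  assumes "open S" "\<And>i. i \<in> I \<Longrightarrow> smooth_on S (f i)"
  shows "smooth_on S (\<lambda>x. \<Prod>i\<in>I. f i x :: real)"
  using assms(2)
  by (induction I rule: infinite_finite_induct) (auto intro: smooth_on_mult[OF assms(1)] smooth_on_const)

lemma smooth_on_power: "open S \<Longrightarrow> smooth_on S f \<Longrightarrow> smooth_on S (\<lambda>x. f x ^ m :: real)"
  by (induction m) (auto intro: smooth_on_mult smooth_on_const)

lemma smooth_on_vec: "open S \<Longrightarrow> (\<And>i. smooth_on S (\<lambda>x. f x $ i)) \<Longrightarrow> smooth_on S (f :: real^'n \<Rightarrow> real^'m)"
  by (simp add: smooth_on_def Ck_on_vec)

lemma smooth_on_compose: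
  fixes f :: "real^'n \<Rightarrow> real^'m"
  assumes "open S" "smooth_on S f" "smooth_on T h" "f ` S \<subseteq> T"
  shows "smooth_on S (\<lambda>x. h (f x))"
  using assms unfolding smooth_on_def by (blast intro: Ck_on_compose[OF assms(1,4)])

lemma smooth_on_compose_real:
  fixes f :: "real^'n \<Rightarrow> real"
  assumes "open S" "smooth_on S f" "f ` S \<subseteq> T"
    and "\<And>m t. t \<in> T \<Longrightarrow> (D m has_real_derivative D (Suc m) t) (at t)"
  shows "smooth_on S (\<lambda>x. D m (f x))"
  using assms(2) Ck_on_compose_real[where D=D and T=T, OF assms(1,3) _ assms(4)] by (simp add: smooth_on_def)

lemma smooth_on_exp: "open S \<Longrightarrow> smooth_on S f \<Longrightarrow> smooth_on S (\<lambda>x. exp (f x) :: real)"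
  by (rule smooth_on_compose_real[where D="\<lambda>_. exp" and T=UNIV]) (auto intro: DERIV_exp)

lemma smooth_on_inverse:
  assumes "open S" "smooth_on S f" "\<And>x. x \<in> S \<Longrightarrow> f x \<noteq> 0"
  shows "smooth_on S (\<lambda>x. inverse (f x) :: real)"
proof -
  let ?D = "\<lambda>m t::real. (-1)^m * fact m * inverse t ^ Suc m"
  have "smooth_on S (\<lambda>x. ?D 0 (f x))"
  proof (rule smooth_on_compose_real[OF assms(1,2), where T="-{0}" and D="?D"])
    fix m and t :: real assume "t \<in> -{0}"
    then have t: "t \<noteq> 0" by simp
    show "(?D m has_real_derivative ?D (Suc m) t) (at t)"
      by (rule derivative_eq_intros refl t)+ (simp add: algebra_simps)
  qed (use assms in auto)
  then show ?thesis by simp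
qed

lemma smooth_on_divide:
  assumes "open S" "smooth_on S f" "smooth_on S h" "\<And>x. x \<in> S \<Longrightarrow> h x \<noteq> 0"
  shows "smooth_on S (\<lambda>x. f x / h x :: real)"
  using assms by (simp add: divide_inverse smooth_on_mult smooth_on_inverse)

lemma smooth_on_powr:
  assumes "open S" "smooth_on S f" "\<And>x. x \<in> S \<Longrightarrow> f x > 0"
  shows "smooth_on S (\<lambda>x. f x powr a :: real)"
proof -
  let ?D = "\<lambda>m t::real. (\<Prod>i<m. a - real i) * t powr (a - real m)"
  have "smooth_on S (\<lambda>x. ?D 0 (f x))"
  proof (rule smooth_on_compose_real[OF assms(1,2), where T="{0<..}" and D="?D"])
    fix m and t :: real assume "t \<in> {0<..}"
    then have t: "t > 0" by simp
    show "(?D m has_real_derivative ?D (Suc m) t) (at t)"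
      using t by (auto intro!: derivative_eq_intros simp: algebra_simps)
  qed (use assms in auto)
  then show ?thesis by simp
qed

lemma smooth_on_partial_deriv: "smooth_on S f \<Longrightarrow> smooth_on S (partial_deriv i f)"
  using smooth_on_frechet_derivative[of S f "axis i 1"] by (simp add: partial_deriv_def[abs_def])

lemmas smooth_intros = smooth_on_const smooth_on_coord smooth_on_add smooth_on_mult smooth_on_minus
  smooth_on_diff smooth_on_sum smooth_on_prod smooth_on_power smooth_on_partial_deriv

section \<open>Determinants and inverses of smooth matrix-valued functions\<close>

lemma smooth_on_det:
  fixes M :: "real^'n \<Rightarrow> real^'m^'m"
  assumes "open S" "\<And>i j. smooth_on S (\<lambda>x. M x $ i $ j)"
  shows "smooth_on S (\<lambda>x. det (M x))"
  unfolding det_def using assms by (intro smooth_intros)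

lemma matrix_inv:
  fixes A :: "real^'m^'m"
  assumes "det A \<noteq> 0"
  shows matrix_inv_right: "A ** matrix_inv A = mat 1" and matrix_inv_left: "matrix_inv A ** A = mat 1"
proof -
  have "\<exists>B. A ** B = mat 1 \<and> B ** A = mat 1"
    using assms by (simp add: invertible_det_nz flip: invertible_def)
  then have "A ** matrix_inv A = mat 1 \<and> matrix_inv A ** A = mat 1"
    unfolding matrix_inv_def by (rule someI_ex)
  then show "A ** matrix_inv A = mat 1" "matrix_inv A ** A = mat 1" by auto
qed

text \<open>Cramer's rule for the linear system solved by a column of the inverse. The quotient of
  determinants makes the smooth dependence on the matrix visible.\<close>

lemma matrix_inv_entry:
  fixes A :: "real^'m^'m"
  assumes "det A \<noteq> 0"
  shows "matrix_inv A $ k $ j = det (\<chi> i l. if l = k then axis j 1 $ i else A $ i $ l) / det A"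
proof -
  have "A *v column j (matrix_inv A) = axis j 1"
    by (metis assms matrix_inv_right matrix_vector_mul_assoc matrix_vector_mul_lid matrix_vector_mult_basis)
  then have "column j (matrix_inv A) = (\<chi> k. det (\<chi> i l. if l = k then axis j 1 $ i else A $ i $ l) / det A)"
    using cramer[OF assms] by blast
  then show ?thesis by (simp add: column_def vec_eq_iff)
qed

lemma smooth_on_matrix_inv:
  fixes M :: "real^'n \<Rightarrow> real^'m^'m"
  assumes "open S" "\<And>i j. smooth_on S (\<lambda>x. M x $ i $ j)" "\<And>x. x \<in> S \<Longrightarrow> det (M x) \<noteq> 0"
  shows "smooth_on S (\<lambda>x. matrix_inv (M x) $ k $ j)"
proof -
  have "smooth_on S (\<lambda>x. det (\<chi> i l. if l = k then axis j 1 $ i else M x $ i $ l) / det (M x))"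
  proof (intro smooth_on_divide smooth_on_det assms)
    fix i l
    show "smooth_on S (\<lambda>x. (\<chi> i l. if l = k then axis j 1 $ i else M x $ i $ l) $ i $ l)"
      using assms(2)[of i l] by (cases "l = k") (auto intro: smooth_on_const)
  qed
  then show ?thesis
    using smooth_on_cong[OF assms(1), of "\<lambda>x. matrix_inv (M x) $ k $ j"] assms(3)
    by (simp add: matrix_inv_entry)
qed

subsection \<open>Partial derivatives\<close>

lemma partial_deriv_eq: "(f has_derivative D) (at x) \<Longrightarrow> partial_deriv i f x = D (axis i 1)"
  by (metis frechet_derivative_at partial_deriv_def)

lemma partial_deriv_cong:
  assumes "open S" "x \<in> S" "\<And>y. y \<in> S \<Longrightarrow> f y = h y"
  shows "partial_deriv i f x = partial_deriv i h x"
proof -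
  have *: "f differentiable (at x) \<longleftrightarrow> h differentiable (at x)"
    unfolding differentiable_def using has_derivative_transform_within_open[OF _ assms(1,2)] assms(3) by metis
  have "(f has_derivative D) (at x) \<longleftrightarrow> (h has_derivative D) (at x)" for D
    using has_derivative_transform_within_open[OF _ assms(1,2)] assms(3) by metis
  then show ?thesis by (simp add: partial_deriv_def frechet_derivative_def)
qed

lemma partial_deriv_const [simp]: "partial_deriv i (\<lambda>x. c) x = 0"
  by (rule partial_deriv_eq[OF has_derivative_const, simplified])

lemma partial_deriv_coord: "partial_deriv i (\<lambda>x. x $ j) x = (if i = j then 1 else 0)"
  by (subst partial_deriv_eq[OF bounded_linear.has_derivative[OF bounded_linear_vec_nth has_derivative_ident]])
    (simp add: axis_def)

context
  fixes f h :: "real^'n \<Rightarrow> real" and x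
  assumes f: "f differentiable (at x)" and h: "h differentiable (at x)"
begin

private lemma F: "(f has_derivative frechet_derivative f (at x)) (at x)"
  using f by (simp add: frechet_derivative_works)
private lemma H: "(h has_derivative frechet_derivative h (at x)) (at x)"
  using h by (simp add: frechet_derivative_works)

lemma partial_deriv_add: "partial_deriv i (\<lambda>y. f y + h y) x = partial_deriv i f x + partial_deriv i h x"
  using partial_deriv_eq[OF has_derivative_add[OF F H]] by (simp add: partial_deriv_def)

lemma partial_deriv_diff: "partial_deriv i (\<lambda>y. f y - h y) x = partial_deriv i f x - partial_deriv i h x"
  using partial_deriv_eq[OF has_derivative_diff[OF F H]] by (simp add: partial_deriv_def)

lemma partial_deriv_mult:
  "partial_deriv i (\<lambda>y. f y * h y) x = partial_deriv i f x * h x + f x * partial_deriv i h x"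
  using partial_deriv_eq[OF has_derivative_mult[OF F H]] by (simp add: partial_deriv_def)

end

lemma partial_deriv_cmult:
  "f differentiable (at x) \<Longrightarrow> partial_deriv i (\<lambda>y. c * f y) x = c * partial_deriv i f x"
  by (subst partial_deriv_mult) auto

lemma partial_deriv_sum:
  assumes "\<And>a. a \<in> I \<Longrightarrow> f a differentiable (at x)"
  shows "partial_deriv i (\<lambda>y. \<Sum>a\<in>I. f a y) x = (\<Sum>a\<in>I. partial_deriv i (f a) x)"
  using assms
proof (induction I rule: infinite_finite_induct)
  case (insert a I)
  then show ?case by (simp add: partial_deriv_add differentiable_sum)
qed auto

lemma partial_deriv_chain:
  fixes T :: "real^'n \<Rightarrow> real^'m" and h :: "real^'m \<Rightarrow> real"
  assumes "T differentiable (at x)" "h differentiable (at (T x))"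
  shows "partial_deriv i (\<lambda>y. h (T y)) x
    = (\<Sum>a\<in>UNIV. partial_deriv i (\<lambda>y. T y $ a) x * partial_deriv a h (T x))"
proof -
  have T: "(T has_derivative frechet_derivative T (at x)) (at x)" and
    h: "(h has_derivative frechet_derivative h (at (T x))) (at (T x))"
    using assms by (simp_all add: frechet_derivative_works)
  have "partial_deriv i (\<lambda>y. h (T y)) x = frechet_derivative h (at (T x)) (frechet_derivative T (at x) (axis i 1))"
    using partial_deriv_eq[OF diff_chain_at[OF T h]] by (simp add: o_def)
  also have "\<dots> = (\<Sum>a\<in>UNIV. frechet_derivative T (at x) (axis i 1) $ a * partial_deriv a h (T x))"
    by (subst linear_vec_expansion[OF has_derivative_linear[OF h]]) (simp add: partial_deriv_def)
  also have "\<dots> = (\<Sum>a\<in>UNIV. partial_deriv i (\<lambda>y. T y $ a) x * partial_deriv a h (T x))"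
    by (simp add: partial_deriv_eq[OF bounded_linear.has_derivative[OF bounded_linear_vec_nth T]])
  finally show ?thesis .
qed

lemma partial_deriv_chain_real:
  assumes "f differentiable (at x)" "(\<phi> has_real_derivative d) (at (f x))"
  shows "partial_deriv i (\<lambda>y. \<phi> (f y)) x = d * partial_deriv i f x"
proof -
  have f: "(f has_derivative frechet_derivative f (at x)) (at x)"
    using assms by (simp add: frechet_derivative_works)
  from partial_deriv_eq[OF diff_chain_at[OF f assms(2)[unfolded has_field_derivative_def]]]
  show ?thesis by (simp add: o_def partial_deriv_def)
qed

lemma has_derivative_partial:
  assumes "f differentiable (at x)"
  shows "(f has_derivative (\<lambda>v. \<Sum>a\<in>UNIV. v $ a * partial_deriv a f x)) (at x)"
proof -
  have f: "(f has_derivative frechet_derivative f (at x)) (at x)"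
    using assms by (simp add: frechet_derivative_works)
  moreover have "frechet_derivative f (at x) = (\<lambda>v. \<Sum>a\<in>UNIV. v $ a * partial_deriv a f x)"
    by (rule ext, subst linear_vec_expansion[OF has_derivative_linear[OF f]]) (simp add: partial_deriv_def)
  ultimately show ?thesis by simp
qed

definition jacobian :: "(real^'n \<Rightarrow> real^'m) \<Rightarrow> real^'n \<Rightarrow> real^'n^'m" where
  "jacobian T x = (\<chi> a i. partial_deriv i (\<lambda>y. T y $ a) x)"

lemma jacobian_derivative:
  assumes "T differentiable (at x)"
  shows "(T has_derivative (\<lambda>v. jacobian T x *v v)) (at x)"
proof -
  have D: "(T has_derivative frechet_derivative T (at x)) (at x)"
    using assms by (simp add: frechet_derivative_works)
  have m: "matrix (frechet_derivative T (at x)) = jacobian T x"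
    using partial_deriv_eq[OF bounded_linear.has_derivative[OF bounded_linear_vec_nth D]]
    by (simp add: jacobian_def matrix_def vec_eq_iff)
  have "linear (frechet_derivative T (at x))" using D by (simp add: has_derivative_linear)
  from matrix_vector_mul(2)[OF this] have "frechet_derivative T (at x) = (\<lambda>v. jacobian T x *v v)" by (simp add: m)
  with D show ?thesis by simp
qed

lemma line_has_real_derivative:
  assumes "f differentiable (at (x + t *\<^sub>R z))"
  shows "((\<lambda>t. f (x + t *\<^sub>R z)) has_real_derivative (\<Sum>a\<in>UNIV. z $ a * partial_deriv a f (x + t *\<^sub>R z))) (at t)"
proof -
  have "((\<lambda>t. x + t *\<^sub>R z) has_derivative (\<lambda>s. s *\<^sub>R z)) (at t)"
    by (auto intro!: derivative_eq_intros)
  note * = diff_chain_at[OF this has_derivative_partial[OF assms]]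
  have "(\<lambda>v. \<Sum>a\<in>UNIV. v $ a * partial_deriv a f (x + t *\<^sub>R z)) \<circ> (\<lambda>s. s *\<^sub>R z)
    = (*) (\<Sum>a\<in>UNIV. z $ a * partial_deriv a f (x + t *\<^sub>R z))"
    by (auto simp: fun_eq_iff sum_distrib_left mult_ac)
  with * show ?thesis
    by (simp add: has_field_derivative_def o_def)
qed


text \<open>Schwarz's argument: two applications of the mean value theorem express the second
  difference over a square of side \<open>r\<close> through one mixed derivative at some point of
  the square. The second difference is symmetric in the two directions, so the other mixed
  derivative takes the same value at a possibly different point.\<close>

lemma partial_deriv_commute_aux:
  fixes f :: "real^'n \<Rightarrow> real"
  assumes "open S" "smooth_on S f" "x \<in> S" "e > 0"
  shows "\<exists>y w. dist y x < e \<and> dist w x < e \<and>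
    partial_deriv i (partial_deriv j f) y = partial_deriv j (partial_deriv i f) w"
proof -
  obtain d where d: "d > 0" "ball x d \<subseteq> S"
    using assms open_contains_ball by blast
  \<comment> \<open>With a third, two steps of length at most \<open>r\<close> stay within
    \<open>2 * r < 3 * r\<close> of \<open>x\<close>, hence inside \<open>S\<close> and closer than
    \<open>e\<close>.\<close>
  define r where "r = min d e / 3"
  have r: "r > 0" "3 * r \<le> d" "3 * r \<le> e" using d assms by (auto simp: r_def)
  have near: "dist (x + s *\<^sub>R axis a 1 + t *\<^sub>R axis b 1) x < e \<and> x + s *\<^sub>R axis a 1 + t *\<^sub>R axis b 1 \<in> S"
    if "0 \<le> s" "s \<le> r" "0 \<le> t" "t \<le> r" for s t and a b :: 'n
  proof -
    have "norm (s *\<^sub>R axis a 1 + t *\<^sub>R axis b (1::real)) \<le> s + t"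
      using norm_triangle_ineq[of "s *\<^sub>R axis a (1::real)" "t *\<^sub>R axis b 1"] that by simp
    then have "dist (x + s *\<^sub>R axis a 1 + t *\<^sub>R axis b 1) x < 3 * r"
      using that r by (simp add: dist_norm add.assoc)
    then show ?thesis using r d by (auto simp: dist_commute)
  qed
  have line: "((\<lambda>t. h (y + t *\<^sub>R axis a 1)) has_real_derivative partial_deriv a h (y + t *\<^sub>R axis a 1)) (at t)"
    if "smooth_on S h" "y + t *\<^sub>R axis a 1 \<in> S" for h y t and a :: 'n
    using line_has_real_derivative[of h y t "axis a 1"] smooth_on_differentiable[OF that]
    by (simp add: axis_def if_distrib[of "\<lambda>x. x * _"] cong: if_cong)
  have *: "\<exists>y. dist y x < e \<and>
      f (x + r *\<^sub>R axis a 1 + r *\<^sub>R axis b 1) - f (x + r *\<^sub>R axis a 1) - f (x + r *\<^sub>R axis b 1) + f x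
      = r * r * partial_deriv b (partial_deriv a f) y" for a b
  proof -
    define \<phi> where "\<phi> = (\<lambda>s. f (x + r *\<^sub>R axis b 1 + s *\<^sub>R axis a 1) - f (x + s *\<^sub>R axis a 1))"
    have "\<exists>\<xi>. 0 < \<xi> \<and> \<xi> < r \<and> \<phi> r - \<phi> 0 = (r - 0) *
      (partial_deriv a f (x + r *\<^sub>R axis b 1 + \<xi> *\<^sub>R axis a 1) - partial_deriv a f (x + \<xi> *\<^sub>R axis a 1))"
    proof (rule MVT2[OF r(1)])
      fix s assume s: "0 \<le> s" "s \<le> r"
      show "(\<phi> has_real_derivative partial_deriv a f (x + r *\<^sub>R axis b 1 + s *\<^sub>R axis a 1)
        - partial_deriv a f (x + s *\<^sub>R axis a 1)) (at s)"
        unfolding \<phi>_def using near[of r s b a] near[of 0 s b a] s r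
        by (intro DERIV_diff line assms) auto
    qed
    then obtain \<xi> where \<xi>: "0 < \<xi>" "\<xi> < r" and e1: "\<phi> r - \<phi> 0 = r *
      (partial_deriv a f (x + r *\<^sub>R axis b 1 + \<xi> *\<^sub>R axis a 1) - partial_deriv a f (x + \<xi> *\<^sub>R axis a 1))" by auto
    have "\<exists>\<eta>. 0 < \<eta> \<and> \<eta> < r \<and>
      partial_deriv a f (x + \<xi> *\<^sub>R axis a 1 + r *\<^sub>R axis b 1) - partial_deriv a f (x + \<xi> *\<^sub>R axis a 1 + 0 *\<^sub>R axis b 1)
      = (r - 0) * partial_deriv b (partial_deriv a f) (x + \<xi> *\<^sub>R axis a 1 + \<eta> *\<^sub>R axis b 1)"
    proof (rule MVT2[OF r(1)])
      fix s assume s: "0 \<le> s" "s \<le> r"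
      show "((\<lambda>s. partial_deriv a f (x + \<xi> *\<^sub>R axis a 1 + s *\<^sub>R axis b 1)) has_real_derivative
        partial_deriv b (partial_deriv a f) (x + \<xi> *\<^sub>R axis a 1 + s *\<^sub>R axis b 1)) (at s)"
        using near[of \<xi> s a b] s \<xi> by (intro line smooth_on_partial_deriv assms) auto
    qed
    then obtain \<eta> where \<eta>: "0 < \<eta>" "\<eta> < r" and e2:
      "partial_deriv a f (x + \<xi> *\<^sub>R axis a 1 + r *\<^sub>R axis b 1) - partial_deriv a f (x + \<xi> *\<^sub>R axis a 1)
      = r * partial_deriv b (partial_deriv a f) (x + \<xi> *\<^sub>R axis a 1 + \<eta> *\<^sub>R axis b 1)" by auto
    have "f (x + r *\<^sub>R axis a 1 + r *\<^sub>R axis b 1) - f (x + r *\<^sub>R axis a 1) - f (x + r *\<^sub>R axis b 1) + f x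
      = \<phi> r - \<phi> 0" by (simp add: \<phi>_def algebra_simps)
    also have "\<dots> = r * r * partial_deriv b (partial_deriv a f) (x + \<xi> *\<^sub>R axis a 1 + \<eta> *\<^sub>R axis b 1)"
      using e1 e2 by (simp add: add_ac)
    finally show ?thesis using near[of \<xi> \<eta> a b] \<xi> \<eta> by auto
  qed
  obtain y where y: "dist y x < e" "f (x + r *\<^sub>R axis j 1 + r *\<^sub>R axis i 1) - f (x + r *\<^sub>R axis j 1) - f (x + r *\<^sub>R axis i 1) + f x
      = r * r * partial_deriv i (partial_deriv j f) y" using * by blast
  obtain w where w: "dist w x < e" "f (x + r *\<^sub>R axis i 1 + r *\<^sub>R axis j 1) - f (x + r *\<^sub>R axis i 1) - f (x + r *\<^sub>R axis j 1) + f x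
      = r * r * partial_deriv j (partial_deriv i f) w" using * by blast
  have "r * r * partial_deriv i (partial_deriv j f) y = r * r * partial_deriv j (partial_deriv i f) w"
    using y(2) w(2) unfolding add.assoc add.commute[of "r *\<^sub>R axis j 1" "r *\<^sub>R axis i 1"] by linarith
  then have "partial_deriv i (partial_deriv j f) y = partial_deriv j (partial_deriv i f) w"
    using r by simp
  with y w show ?thesis by blast
qed

lemma partial_deriv_commute:
  fixes f :: "real^'n \<Rightarrow> real"
  assumes "open S" "smooth_on S f" "x \<in> S"
  shows "partial_deriv i (partial_deriv j f) x = partial_deriv j (partial_deriv i f) x"
proof (rule ccontr)
  let ?a = "partial_deriv i (partial_deriv j f)" and ?b = "partial_deriv j (partial_deriv i f)"
  assume "?a x \<noteq> ?b x"
  then have e: "dist (?a x) (?b x) / 2 > 0" by simp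
  have "isCont ?a x" "isCont ?b x"
    using assms by (metis smooth_on_partial_deriv smooth_on_continuous_on continuous_on_eq_continuous_at)+
  then obtain d1 d2 where d: "d1 > 0" "d2 > 0"
    "\<And>y. dist y x < d1 \<Longrightarrow> dist (?a y) (?a x) < dist (?a x) (?b x) / 2"
    "\<And>y. dist y x < d2 \<Longrightarrow> dist (?b y) (?b x) < dist (?a x) (?b x) / 2"
    using e unfolding continuous_at_eps_delta by metis
  have "min d1 d2 > 0" using d by simp
  from partial_deriv_commute_aux[OF assms this, of i j]
  obtain y w where "dist y x < min d1 d2" "dist w x < min d1 d2" "?a y = ?b w" by blast
  with d(3)[of y] d(4)[of w] show False
    using dist_triangle_half_l[of "?a x" "?a y" "dist (?a x) (?b x)" "?b x"] by (auto simp: dist_commute)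
qed

section \<open>Change of variables\<close>

text \<open>
  The change of variables theorem of the library needs a well-ordered index type. The copy
  \<open>'a wo\<close> of a finite type \<open>'a\<close> carries the well-order of some enumeration.
\<close>

typedef 'a wo = "UNIV :: 'a set" ..

lemma wo_inverse [simp]: "Rep_wo (Abs_wo i) = i" "Abs_wo (Rep_wo j) = j"
  by (simp_all add: Abs_wo_inverse Rep_wo_inverse)

lemma bij_Rep_wo: "bij Rep_wo" and bij_Abs_wo: "bij Abs_wo"
  by (rule bij_betw_byWitness[where f'=Abs_wo], auto) (rule bij_betw_byWitness[where f'=Rep_wo], auto)

instance wo :: (finite) finite
proof
  have "(UNIV :: 'a wo set) = range Abs_wo" by (rule bij_is_surj[OF bij_Abs_wo, symmetric])
  then show "finite (UNIV :: 'a wo set)" by (metis finite finite_imageI)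
qed

definition wo_index :: "'a::finite wo \<Rightarrow> nat" where
  "wo_index = (SOME f. inj f)"

lemma inj_wo_index: "inj wo_index"
proof -
  have "\<exists>f :: 'a::finite wo \<Rightarrow> nat. inj f"
    using finite_imp_inj_to_nat_seg[of "UNIV :: 'a wo set"] by auto
  then show ?thesis unfolding wo_index_def by (rule someI_ex)
qed

instantiation wo :: (finite) wellorder
begin
definition less_eq_wo :: "'a wo \<Rightarrow> 'a wo \<Rightarrow> bool" where "x \<le> y \<longleftrightarrow> wo_index x \<le> wo_index y"
definition less_wo :: "'a wo \<Rightarrow> 'a wo \<Rightarrow> bool" where "x < y \<longleftrightarrow> wo_index x < wo_index y"
instance
proof
  fix P :: "'a wo \<Rightarrow> bool" and a :: "'a wo"
  assume *: "\<And>x. (\<And>y. y < x \<Longrightarrow> P y) \<Longrightarrow> P x"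
  show "P a"
    by (induction "wo_index a" arbitrary: a rule: less_induct) (metis * less_wo_def)
qed (auto simp: less_eq_wo_def less_wo_def dest: injD[OF inj_wo_index])
end

definition to_wo :: "real^'n \<Rightarrow> real^('n::finite) wo" where "to_wo x = (\<chi> i. x $ Rep_wo i)"
definition of_wo :: "real^('n::finite) wo \<Rightarrow> real^'n" where "of_wo y = (\<chi> i. y $ Abs_wo i)"

lemma to_wo_of_wo [simp]: "to_wo (of_wo y) = y" "of_wo (to_wo x) = x"
  by (simp_all add: to_wo_def of_wo_def vec_eq_iff)

lemma linear_to_wo: "linear to_wo" and linear_of_wo: "linear of_wo"
  by (auto intro!: linearI simp: to_wo_def of_wo_def vec_eq_iff)

lemma measurable_to_wo [measurable]: "to_wo \<in> borel_measurable borel"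
  and measurable_of_wo [measurable]: "of_wo \<in> borel_measurable borel"
  by (auto intro!: borel_measurable_continuous_onI linear_continuous_on
      simp: linear_to_wo linear_of_wo linear_conv_bounded_linear[symmetric])

text \<open>Relabelling the coordinates maps boxes to boxes with the same side lengths, and Lebesgue
  measure is determined by its values on boxes.\<close>

lemma distr_of_wo: "distr lborel borel (of_wo :: real^('n::finite) wo \<Rightarrow> real^'n) = lborel"
proof (rule lborel_eqI[symmetric])
  fix l u :: "real^'n" assume le: "\<And>b. b \<in> Basis \<Longrightarrow> l \<bullet> b \<le> u \<bullet> b"
  have le': "l $ i \<le> u $ i" for i using le[of "axis i 1"] by (simp add: inner_axis axis_in_Basis_iff)
  have "emeasure (distr lborel borel of_wo) (box l u) = emeasure lborel (of_wo -` box l u \<inter> space lborel)"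
    by (rule emeasure_distr) auto
  also have "of_wo -` box l u \<inter> space lborel = box (to_wo l) (to_wo u)"
    by (auto simp: mem_box_cart to_wo_def of_wo_def) (metis wo_inverse(1) | metis wo_inverse(2))+
  also have "emeasure lborel (box (to_wo l) (to_wo u)) = (\<Prod>b\<in>Basis. (to_wo u - to_wo l) \<bullet> b)"
    using le' by (subst emeasure_lborel_box_eq) (auto simp: Basis_vec_def inner_axis to_wo_def)
  also have "(\<Prod>b\<in>Basis. (to_wo u - to_wo l) \<bullet> b) = (\<Prod>i\<in>UNIV. u $ Rep_wo i - l $ Rep_wo i)"
    by (simp add: Basis_vec_def UNION_singleton_eq_range prod.reindex inj_on_def axis_eq_axis inner_axis to_wo_def)
  also have "\<dots> = (\<Prod>i\<in>UNIV. u $ i - l $ i)"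
    by (rule prod.reindex_bij_betw[OF bij_Rep_wo])
  also have "\<dots> = (\<Prod>b\<in>Basis. (u - l) \<bullet> b)"
    by (simp add: Basis_vec_def UNION_singleton_eq_range prod.reindex inj_on_def axis_eq_axis inner_axis)
  finally show "emeasure (distr lborel borel of_wo) (box l u) = (\<Prod>b\<in>Basis. (u - l) \<bullet> b)" .
qed simp

lemma nn_integral_of_wo:
  assumes [measurable]: "f \<in> borel_measurable borel"
  shows "(\<integral>\<^sup>+y. f (of_wo y) \<partial>lborel) = (\<integral>\<^sup>+x. f x \<partial>(lborel :: (real^'n::finite) measure))"
  by (subst distr_of_wo[symmetric]) (simp add: nn_integral_distr)

text \<open>Conjugation by the relabelling turns transpositions into transpositions, and a
  permutation is built from these.\<close>

lemma sign_conj: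
  assumes "p permutes (UNIV :: 'n::finite set)"
  shows "sign (Abs_wo \<circ> p \<circ> Rep_wo) = sign p"
  using finite_class.finite_UNIV assms
proof (induction rule: permutes_rev_induct)
  case id
  then show ?case by (simp add: o_def flip: id_def)
next
  case (swap a b p)
  have eq: "Abs_wo \<circ> (p \<circ> Transposition.transpose a b) \<circ> Rep_wo
    = (Abs_wo \<circ> p \<circ> Rep_wo) \<circ> Transposition.transpose (Abs_wo a) (Abs_wo b)"
    by (auto simp: fun_eq_iff Transposition.transpose_def)
  have "bij (Abs_wo \<circ> p \<circ> Rep_wo)"
    using swap permutes_bij[of p] by (auto intro!: bij_comp bij_Abs_wo bij_Rep_wo)
  then have "permutation (Abs_wo \<circ> p \<circ> Rep_wo)" by (simp add: permutation)
  moreover have "permutation p" using swap by (auto simp: permutation permutes_bij)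
  ultimately have "sign ((Abs_wo \<circ> p \<circ> Rep_wo) \<circ> Transposition.transpose (Abs_wo a) (Abs_wo b))
      = sign (p \<circ> Transposition.transpose a b)"
    using swap by (simp only: sign_compose permutation_swap_id sign_swap_id inj_eq[OF bij_is_inj[OF bij_Abs_wo]])
  then show ?case unfolding eq .
qed

lemma det_wo:
  fixes A :: "real^'n^'n::finite"
  shows "det (\<chi> i j. A $ Rep_wo i $ Rep_wo j) = det A"
proof -
  let ?c = "\<lambda>p. Abs_wo \<circ> p \<circ> Rep_wo"
  have bij: "bij_betw ?c {p. p permutes UNIV} {p. p permutes UNIV}"
  proof (rule bij_betw_byWitness[where f'="\<lambda>p. Rep_wo \<circ> p \<circ> Abs_wo"])
    show "?c ` {p. p permutes UNIV} \<subseteq> {p. p permutes UNIV}"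
      "(\<lambda>p. Rep_wo \<circ> p \<circ> Abs_wo) ` {p. p permutes UNIV} \<subseteq> {p. p permutes UNIV}"
      by (auto intro!: bij_imp_permutes bij_comp bij_Abs_wo bij_Rep_wo dest: permutes_bij)
  qed (auto simp: fun_eq_iff)
  have "det (\<chi> i j. A $ Rep_wo i $ Rep_wo j)
      = (\<Sum>p | p permutes UNIV. of_int (sign p) * (\<Prod>i\<in>UNIV. A $ Rep_wo i $ Rep_wo (p i)))"
    by (simp add: det_def)
  also have "\<dots> = (\<Sum>p | p permutes UNIV. of_int (sign (?c p)) * (\<Prod>i\<in>UNIV. A $ Rep_wo i $ Rep_wo (?c p i)))"
    by (rule sum.reindex_bij_betw[OF bij, symmetric])
  also have "\<dots> = (\<Sum>p | p permutes UNIV. of_int (sign p) * (\<Prod>i\<in>UNIV. A $ i $ p i))"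
  proof (rule sum.cong)
    fix p :: "'n \<Rightarrow> 'n" assume "p \<in> {p. p permutes UNIV}"
    then show "of_int (sign (?c p)) * (\<Prod>i\<in>UNIV. A $ Rep_wo i $ Rep_wo (?c p i))
      = of_int (sign p) * (\<Prod>i\<in>UNIV. A $ i $ p i)"
      using prod.reindex_bij_betw[OF bij_Rep_wo, of "\<lambda>i. A $ i $ p i"] by (simp add: sign_conj)
  qed simp
  finally show ?thesis by (simp add: det_def)
qed

lemma change_of_variables_real:
  fixes u :: "real^'m::{finite,wellorder} \<Rightarrow> real" and g :: "real^'m::_ \<Rightarrow> real^'m::_"
  assumes "S \<in> sets lebesgue" "\<And>x. x \<in> S \<Longrightarrow> (g has_derivative g' x) (at x within S)" "inj_on g S"
  shows "(\<lambda>x. \<bar>det (matrix (g' x))\<bar> * u (g x)) absolutely_integrable_on S \<and>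
           integral S (\<lambda>x. \<bar>det (matrix (g' x))\<bar> * u (g x)) = b
     \<longleftrightarrow> u absolutely_integrable_on (g ` S) \<and> integral (g ` S) u = b"
proof -
  \<comment> \<open>Real integrands are read as vectors with a single entry, the form in which the
    library states the theorem.\<close>
  have "(\<lambda>x. \<bar>det (matrix (g' x))\<bar> *\<^sub>R vec (u (g x)) :: real ^ 1) absolutely_integrable_on S \<and>
           integral S (\<lambda>x. \<bar>det (matrix (g' x))\<bar> *\<^sub>R vec (u (g x))) = (vec b :: real ^ 1)
         \<longleftrightarrow> (\<lambda>x. vec (u x) :: real ^ 1) absolutely_integrable_on (g ` S) \<and>
           integral (g ` S) (\<lambda>x. vec (u x)) = (vec b :: real ^ 1)"
    using assms by (rule has_absolute_integral_change_of_variables)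
  then show ?thesis
    by (simp add: absolutely_integrable_on_1_iff integral_on_1_eq vec_eq_iff)
qed

text \<open>The extended integral of a nonnegative function is its Lebesgue integral if that exists
  and infinity otherwise. The equivalence of the two integrabilities in
  \<open>change_of_variables_real\<close> matches both cases.\<close>

lemma change_of_variables_nn_wo:
  fixes u :: "real^'m::{finite,wellorder} \<Rightarrow> real" and g :: "real^'m::_ \<Rightarrow> real^'m::_"
  assumes S: "S \<in> sets borel" "g ` S \<in> sets borel"
    and der: "\<And>x. x \<in> S \<Longrightarrow> (g has_derivative g' x) (at x)" and inj: "inj_on g S"
    and u0: "\<And>x. x \<in> g ` S \<Longrightarrow> 0 \<le> u x"
    and m1: "(\<lambda>x. indicator S x * (\<bar>det (matrix (g' x))\<bar> * u (g x))) \<in> borel_measurable borel"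
    and m2: "(\<lambda>y. indicator (g ` S) y * u y) \<in> borel_measurable borel"
  shows "(\<integral>\<^sup>+x. ennreal (indicator S x * (\<bar>det (matrix (g' x))\<bar> * u (g x))) \<partial>lborel)
    = (\<integral>\<^sup>+y. ennreal (indicator (g ` S) y * u y) \<partial>lborel)"
proof -
  have *: "(\<integral>\<^sup>+x. ennreal (indicator B x * v x) \<partial>lborel) = (if v absolutely_integrable_on B then ennreal (integral B v) else \<infinity>)"
    if B: "B \<in> sets borel" "\<And>x. x \<in> B \<Longrightarrow> 0 \<le> v x" and m: "(\<lambda>x. indicator B x * v x) \<in> borel_measurable borel"
    for B and v :: "real^'m::_ \<Rightarrow> real"
  proof -
    have nn: "0 \<le> indicator B x * v x" for x using B(2) by (cases "x \<in> B") auto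
    have eq: "v absolutely_integrable_on B \<longleftrightarrow> integrable lborel (\<lambda>x. indicator B x * v x)"
      unfolding set_integrable_def using m by (simp add: integrable_completion)
    show ?thesis
    proof (cases "v absolutely_integrable_on B")
      case True
      then have i: "integrable lborel (\<lambda>x. indicator B x * v x)" by (simp add: eq)
      have "integral B v = (LINT x:B|lebesgue. v x)"
        using True by (simp add: set_lebesgue_integral_eq_integral(2))
      also have "\<dots> = (LINT x|lborel. indicator B x * v x)"
        unfolding set_lebesgue_integral_def using m by (simp add: integral_completion)
      finally show ?thesis
        using True nn_integral_eq_integral[OF i] nn by simp
    next
      case False
      then have "\<not> integrable lborel (\<lambda>x. indicator B x * v x)" by (simp add: eq)
      moreover have "integrable lborel (\<lambda>x. indicator B x * v x)"
        if "(\<integral>\<^sup>+x. ennreal (indicator B x * v x) \<partial>lborel) < \<infinity>"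
        by (rule integrableI_nonneg[OF _ AE_I2[OF nn] that]) (use m in simp)
      ultimately have "(\<integral>\<^sup>+x. ennreal (indicator B x * v x) \<partial>lborel) = \<infinity>"
        by (metis infinity_ennreal_def less_top)
      with False show ?thesis by simp
    qed
  qed
  have "S \<in> sets lebesgue" using S(1) by auto
  note cov = change_of_variables_real[where u=u, OF this has_derivative_at_withinI[OF der] inj]
  let ?v = "\<lambda>x. \<bar>det (matrix (g' x))\<bar> * u (g x)"
  have "(\<integral>\<^sup>+x. ennreal (indicator S x * ?v x) \<partial>lborel)
    = (if ?v absolutely_integrable_on S then ennreal (integral S ?v) else \<infinity>)"
    using u0 by (intro * S m1) auto
  moreover have "(\<integral>\<^sup>+y. ennreal (indicator (g ` S) y * u y) \<partial>lborel)
    = (if u absolutely_integrable_on (g ` S) then ennreal (integral (g ` S) u) else \<infinity>)"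
    using u0 by (intro * S m2) auto
  ultimately show ?thesis
    using cov[of "integral (g ` S) u"] cov[of "integral S ?v"] by auto
qed

text \<open>The map is conjugated by the relabelling of coordinates; neither the Jacobian
  determinant (\<open>det_wo\<close>) nor Lebesgue measure (\<open>distr_of_wo\<close>) is
  affected.\<close>

lemma change_of_variables_nn:
  fixes u :: "real^'n::finite \<Rightarrow> real" and g :: "real^'n \<Rightarrow> real^'n"
  assumes S: "S \<in> sets borel" "g ` S \<in> sets borel"
    and der: "\<And>x. x \<in> S \<Longrightarrow> (g has_derivative g' x) (at x)" and inj: "inj_on g S"
    and u0: "\<And>x. x \<in> g ` S \<Longrightarrow> 0 \<le> u x"
    and m1: "(\<lambda>x. indicator S x * (\<bar>det (matrix (g' x))\<bar> * u (g x))) \<in> borel_measurable borel"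
    and m2: "(\<lambda>y. indicator (g ` S) y * u y) \<in> borel_measurable borel"
  shows "(\<integral>\<^sup>+x. ennreal (indicator S x * (\<bar>det (matrix (g' x))\<bar> * u (g x))) \<partial>lborel)
    = (\<integral>\<^sup>+y. ennreal (indicator (g ` S) y * u y) \<partial>lborel)"
proof -
  define G where "G = to_wo \<circ> g \<circ> of_wo"
  define G' where "G' = (\<lambda>y. to_wo \<circ> g' (of_wo y) \<circ> of_wo)"
  let ?S = "to_wo ` S"
  have ind: "indicator (to_wo ` B) y = (indicator B (of_wo y) :: real)" for B :: "(real^'n) set" and y
    by (auto simp: indicator_def image_iff) (metis to_wo_of_wo(1))
  have GS: "G ` ?S = to_wo ` (g ` S)" by (auto simp: G_def image_image)
  have meas: "to_wo ` B \<in> sets borel" if "B \<in> sets borel" for B :: "(real^'n) set"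
  proof -
    have "to_wo ` B = of_wo -` B \<inter> space borel"
      by (auto simp: image_iff) (metis to_wo_of_wo(1))
    then show ?thesis using measurable_sets[OF measurable_of_wo that] by simp
  qed
  have D: "(G has_derivative G' y) (at y)" if "y \<in> ?S" for y
  proof -
    have "of_wo y \<in> S" using that by auto
    from der[OF this] show ?thesis unfolding G_def G'_def
      by (intro diff_chain_at linear_imp_has_derivative) (auto simp: linear_to_wo linear_of_wo)
  qed
  have det: "det (matrix (G' y)) = det (matrix (g' (of_wo y)))" for y
  proof -
    have ax: "of_wo (axis j 1) = axis (Rep_wo j) 1" for j :: "'n wo"
      by (auto simp: of_wo_def axis_def vec_eq_iff)
    have "matrix (G' y) = (\<chi> i j. matrix (g' (of_wo y)) $ Rep_wo i $ Rep_wo j)"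
      by (simp add: matrix_def G'_def vec_eq_iff ax to_wo_def)
    then show ?thesis by (simp add: det_wo)
  qed
  have "(\<integral>\<^sup>+y. ennreal (indicator ?S y * (\<bar>det (matrix (G' y))\<bar> * u (of_wo (G y)))) \<partial>lborel)
    = (\<integral>\<^sup>+y. ennreal (indicator (G ` ?S) y * u (of_wo y)) \<partial>lborel)"
  proof (rule change_of_variables_nn_wo[OF _ _ D, where u="\<lambda>y. u (of_wo y)"])
    show "inj_on G ?S" using inj by (auto simp: inj_on_def G_def) (metis to_wo_of_wo(2))
    show "(\<lambda>x. indicator ?S x * (\<bar>det (matrix (G' x))\<bar> * u (of_wo (G x)))) \<in> borel_measurable borel"
      unfolding ind det using measurable_compose[OF measurable_of_wo m1] by (simp add: G_def)
    show "(\<lambda>y. indicator (G ` ?S) y * u (of_wo y)) \<in> borel_measurable borel"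
      unfolding ind GS using measurable_compose[OF measurable_of_wo m2] by simp
    show "?S \<in> sets borel" "G ` ?S \<in> sets borel" by (auto simp only: GS meas S)
    show "\<And>y. y \<in> G ` ?S \<Longrightarrow> 0 \<le> u (of_wo y)" unfolding GS using u0 by auto
  qed
  then show ?thesis
    unfolding ind det GS
    using nn_integral_of_wo[of "\<lambda>x. ennreal (indicator S x * (\<bar>det (matrix (g' x))\<bar> * u (g x)))"]
      nn_integral_of_wo[of "\<lambda>y. ennreal (indicator (g ` S) y * u y)"] m1 m2
    by (simp add: G_def)
qed

section \<open>Charts and tangent vectors\<close>

locale atlas =
  fixes A :: "('a::{t2_space, second_countable_topology}, 'n::finite) chart set"
  assumes atlas: "smooth_atlas A"
begin

lemma chart_cover: "\<exists>c\<in>A. p \<in> fst c"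
  using atlas unfolding smooth_atlas_def by (metis UNIV_I UN_E)

lemma chart_open: "c \<in> A \<Longrightarrow> open (fst c)" "c \<in> A \<Longrightarrow> open (snd c ` fst c)"
  using atlas unfolding smooth_atlas_def by auto

lemma chart_homeomorphism: "c \<in> A \<Longrightarrow> homeomorphism (fst c) (snd c ` fst c) (snd c) (chart_inv c)"
  using atlas unfolding smooth_atlas_def by auto

lemma chart_inv_left [simp]: "c \<in> A \<Longrightarrow> p \<in> fst c \<Longrightarrow> chart_inv c (snd c p) = p"
  using homeomorphism_apply1[OF chart_homeomorphism] by blast

lemma chart_inv_right: "c \<in> A \<Longrightarrow> x \<in> snd c ` fst c \<Longrightarrow> snd c (chart_inv c x) = x"
  using homeomorphism_apply2[OF chart_homeomorphism] by blast

lemma chart_inv_in: "c \<in> A \<Longrightarrow> x \<in> snd c ` fst c \<Longrightarrow> chart_inv c x \<in> fst c"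
  by auto

lemma chart_continuous: "c \<in> A \<Longrightarrow> continuous_on (fst c) (snd c)"
  "c \<in> A \<Longrightarrow> continuous_on (snd c ` fst c) (chart_inv c)"
  using chart_homeomorphism homeomorphism_def by blast+

lemma chart_image_eq: "c \<in> A \<Longrightarrow> snd c ` (fst c \<inter> N) = snd c ` fst c \<inter> chart_inv c -` N"
  by (auto intro!: rev_image_eqI)

lemma chart_image_open: "c \<in> A \<Longrightarrow> open N \<Longrightarrow> open (snd c ` (fst c \<inter> N))"
  unfolding chart_image_eq
  by (intro continuous_open_preimage chart_continuous chart_open)

lemma transition_smooth:
  "c \<in> A \<Longrightarrow> d \<in> A \<Longrightarrow> smooth_on (snd c ` (fst c \<inter> fst d)) (\<lambda>x. snd d (chart_inv c x))"
  using atlas unfolding smooth_atlas_def by (simp add: o_def)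

lemma smooth_near_chart:
  assumes "smooth_near A p f" "c \<in> A" "p \<in> fst c"
  obtains W where "open W" "snd c p \<in> W" "W \<subseteq> snd c ` fst c" "smooth_on W (\<lambda>x. f (chart_inv c x))"
proof -
  obtain N where "open N" "p \<in> N" "smooth_fun_on A N f" using assms unfolding smooth_near_def by auto
  with assms that[of "snd c ` (fst c \<inter> N)"] chart_image_open show thesis
    unfolding smooth_fun_on_def by (auto simp: o_def)
qed

lemma smooth_near_differentiable:
  assumes "smooth_near A p f" "c \<in> A" "p \<in> fst c"
  shows "(\<lambda>x. f (chart_inv c x)) differentiable (at (snd c p))"
  using smooth_near_chart[OF assms] smooth_on_differentiable by metis

lemma smooth_near_combine:
  assumes f: "smooth_near A p f" and h: "smooth_near A p h"
    and \<phi>: "\<And>(S :: (real^'n) set) u v. open S \<Longrightarrow> smooth_on S u \<Longrightarrow> smooth_on S v \<Longrightarrow> smooth_on S (\<lambda>x. \<phi> (u x) (v x))"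
  shows "smooth_near A p (\<lambda>q. \<phi> (f q) (h q))"
proof -
  obtain N1 N2 where N: "open N1" "p \<in> N1" "smooth_fun_on A N1 f" "open N2" "p \<in> N2" "smooth_fun_on A N2 h"
    using f h unfolding smooth_near_def by auto
  have "smooth_fun_on A (N1 \<inter> N2) (\<lambda>q. \<phi> (f q) (h q))"
    unfolding smooth_fun_on_def
  proof
    fix c assume c: "c \<in> A"
    have "smooth_on (snd c ` (fst c \<inter> (N1 \<inter> N2))) (\<lambda>x. f (chart_inv c x))"
      "smooth_on (snd c ` (fst c \<inter> (N1 \<inter> N2))) (\<lambda>x. h (chart_inv c x))"
      using N(3,6) c by (auto simp: smooth_fun_on_def o_def intro: smooth_on_subset)
    then show "smooth_on (snd c ` (fst c \<inter> (N1 \<inter> N2))) ((\<lambda>q. \<phi> (f q) (h q)) \<circ> chart_inv c)"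
      using \<phi>[OF chart_image_open[OF c open_Int[OF N(1,4)]]] by (simp add: o_def)
  qed
  with N show ?thesis unfolding smooth_near_def by (metis IntI open_Int)
qed

lemma smooth_near_coord:
  assumes "c \<in> A" "p \<in> fst c"
  shows "smooth_near A p (\<lambda>q. snd c q $ k)"
  unfolding smooth_near_def smooth_fun_on_def
proof (intro exI[of _ "fst c"] conjI ballI)
  fix d assume d: "d \<in> A"
  show "smooth_on (snd d ` (fst d \<inter> fst c)) ((\<lambda>q. snd c q $ k) \<circ> chart_inv d)"
    using smooth_on_nth[OF chart_image_open[OF d chart_open(1)[OF assms(1)]] transition_smooth[OF d assms(1)]]
    by (simp add: o_def)
qed (use assms chart_open in auto)

lemma coord_vec_tangent:
  assumes "c \<in> A" "p \<in> fst c"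
  shows "coord_vec A c i p \<in> tangent_space A p"
proof -
  note D = smooth_near_differentiable[OF _ assms]
  have "smooth_near A p (\<lambda>q. a * f q)" if "smooth_near A p f" for a f
    by (rule smooth_near_combine[OF that that, of "\<lambda>u v. a * u"]) (intro smooth_intros)
  then show ?thesis
    using smooth_near_combine[where \<phi>="(+)"] smooth_near_combine[where \<phi>="(*)"] assms
    by (auto simp: tangent_space_def coord_vec_def o_def smooth_on_add smooth_on_mult D
        partial_deriv_add partial_deriv_mult partial_deriv_cmult algebra_simps)
qed

lemma coord_vec_coord:
  assumes "c \<in> A" "p \<in> fst c"
  shows "coord_vec A c i p (\<lambda>q. snd c q $ k) = (if i = k then 1 else 0)"
proof -
  have "partial_deriv i (\<lambda>x. snd c (chart_inv c x) $ k) (snd c p) = partial_deriv i (\<lambda>x. x $ k) (snd c p)"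
    by (rule partial_deriv_cong[OF chart_open(2)[OF assms(1)]]) (use assms chart_inv_right in auto)
  then show ?thesis
    using smooth_near_coord[OF assms] by (simp add: coord_vec_def o_def partial_deriv_coord)
qed

lemma tangent_lincomb:
  assumes "X \<in> tangent_space A p" "Y \<in> tangent_space A p"
  shows "(\<lambda>f. a * X f + b * Y f) \<in> tangent_space A p"
  using assms by (auto simp: tangent_space_def algebra_simps)

lemma tangent_zero: "(\<lambda>f. 0) \<in> tangent_space A p"
  by (auto simp: tangent_space_def)

lemma tangent_sum:
  assumes "finite I" "\<And>i. i \<in> I \<Longrightarrow> X i \<in> tangent_space A p"
  shows "(\<lambda>f. \<Sum>i\<in>I. a i * X i f) \<in> tangent_space A p"
  using assms
proof (induction I)
  case (insert i I)
  then show ?case using tangent_lincomb[of "X i" p "\<lambda>f. \<Sum>i\<in>I. a i * X i f" "a i" 1] by simp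
qed (simp add: tangent_zero)

text \<open>The chain rule for the transition map. On functions that are not smooth near
  \<open>p\<close> both sides have the default value \<open>0\<close>.\<close>

lemma coord_vec_change:
  assumes c: "c \<in> A" and d: "d \<in> A" and p: "p \<in> fst c" "p \<in> fst d"
  shows "coord_vec A d i p = (\<lambda>f. \<Sum>j\<in>UNIV.
    partial_deriv i (\<lambda>x. snd c (chart_inv d x) $ j) (snd d p) * coord_vec A c j p f)"
proof
  fix f
  show "coord_vec A d i p f = (\<Sum>j\<in>UNIV.
    partial_deriv i (\<lambda>x. snd c (chart_inv d x) $ j) (snd d p) * coord_vec A c j p f)"
  proof (cases "smooth_near A p f")
    case True
    let ?T = "\<lambda>x. snd c (chart_inv d x)"
    have o: "open (snd d ` (fst d \<inter> fst c))" using chart_image_open[OF d chart_open(1)[OF c]] .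
    have Tp: "?T (snd d p) = snd c p" using p d by simp
    have "?T differentiable (at (snd d p))"
      using transition_smooth[OF d c] p by (auto intro: smooth_on_differentiable)
    from partial_deriv_chain[where h="\<lambda>x. f (chart_inv c x)", OF this]
    have "partial_deriv i (\<lambda>x. f (chart_inv c (?T x))) (snd d p) = (\<Sum>j\<in>UNIV.
      partial_deriv i (\<lambda>x. ?T x $ j) (snd d p) * partial_deriv j (\<lambda>x. f (chart_inv c x)) (snd c p))"
      using smooth_near_differentiable[OF True c p(1)] Tp by simp
    moreover have "partial_deriv i (\<lambda>x. f (chart_inv c (?T x))) (snd d p)
      = partial_deriv i (\<lambda>x. f (chart_inv d x)) (snd d p)"
      by (rule partial_deriv_cong[OF o]) (use p c d in auto)
    ultimately show ?thesis using True by (simp add: coord_vec_def o_def)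
  qed (simp add: coord_vec_def)
qed

end

section \<open>The metric in coordinates\<close>

definition pos_def :: "real^'n^'n \<Rightarrow> bool" where
  "pos_def M \<longleftrightarrow> transpose M = M \<and> (\<forall>v. v \<noteq> 0 \<longrightarrow> 0 < v \<bullet> (M *v v))"

lemma inner_matrix_vector: "u \<bullet> (M *v v) = (\<Sum>i\<in>UNIV. \<Sum>j\<in>UNIV. u $ i * M $ i $ j * (v $ j :: real))"
  by (simp add: inner_vec_def matrix_vector_mult_def sum_distrib_left mult.assoc)

text \<open>Gram-Schmidt for the inner product given by \<open>M\<close>. While fewer than
  \<open>CARD('n)\<close> vectors have been found, some nonzero vector is orthogonal in the
  Euclidean sense to all \<open>M *v e i\<close>; normalised, it becomes the next one. The resulting
  frame is the linear part of the normal coordinates.\<close>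

lemma pos_def_orthonormal:
  fixes M :: "real^'n^'n"
  assumes "pos_def M"
  shows "\<exists>L :: real^'n^'n. transpose L ** M ** L = mat 1"
proof -
  have sym: "u \<bullet> (M *v v) = v \<bullet> (M *v u)" for u v
    using assms by (metis dot_lmul_matrix inner_commute pos_def_def transpose_matrix_vector)
  have "\<exists>e. \<forall>i\<in>I. \<forall>j\<in>I. e i \<bullet> (M *v e j) = (if i = j then 1 else 0)" for I :: "'n set"
    using finite[of I]
  proof (induction I)
    case (insert k I)
    then obtain e where e: "\<forall>i\<in>I. \<forall>j\<in>I. e i \<bullet> (M *v e j) = (if i = j then 1 else 0)" by blast
    let ?S = "(\<lambda>i. M *v e i) ` I"
    have "dim ?S \<le> card ?S" by (rule dim_le_card') auto
    also have "\<dots> \<le> card I" by (rule card_image_le) auto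
    also have "\<dots> < CARD('n)" using insert.hyps by (intro psubset_card_mono) auto
    finally have "dim ?S < DIM(real^'n)" by simp
    from orthogonal_to_subspace_exists[OF this]
    obtain v where v: "v \<noteq> 0" "\<And>y. y \<in> span ?S \<Longrightarrow> orthogonal v y" by blast
    have v0: "v \<bullet> (M *v e i) = 0" if "i \<in> I" for i
      using v(2)[OF span_base, of "M *v e i"] that by (auto simp: orthogonal_def)
    define a where "a = sqrt (v \<bullet> (M *v v))"
    have a: "a > 0" "a * a = v \<bullet> (M *v v)"
      using assms v(1) by (auto simp: a_def pos_def_def less_imp_le)
    let ?e = "e (k := (1/a) *\<^sub>R v)"
    have "?e i \<bullet> (M *v ?e j) = (if i = j then 1 else 0)" if "i \<in> insert k I" "j \<in> insert k I" for i j
      using that insert.hyps(2) e v0 sym[of "e i" v] a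
      by (auto simp: matrix_vector_mult_scaleR divide_simps)
    then show ?case by (intro exI[of _ ?e] ballI)
  qed simp
  from this[of UNIV] obtain e :: "'n \<Rightarrow> real^'n" where e: "\<forall>i j. e i \<bullet> (M *v e j) = (if i = j then 1 else 0)" by auto
  have "transpose (\<chi> a i. e i $ a) ** M ** (\<chi> a i. e i $ a) = mat 1"
  proof (subst vec_eq_iff, intro allI, subst vec_eq_iff, intro allI)
    fix i j
    have "(transpose (\<chi> a i. e i $ a) ** M ** (\<chi> a i. e i $ a)) $ i $ j = e i \<bullet> (M *v e j)"
      unfolding inner_matrix_vector
      by (subst sum.swap) (simp add: matrix_matrix_mult_def transpose_def sum_distrib_left sum_distrib_right mult_ac)
    then show "(transpose (\<chi> a i. e i $ a) ** M ** (\<chi> a i. e i $ a)) $ i $ j = mat 1 $ i $ j"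
      by (simp add: e mat_def)
  qed
  then show ?thesis by blast
qed

lemma pos_def_det:
  fixes M :: "real^'n^'n"
  assumes "pos_def M"
  shows "det M > 0"
proof -
  obtain L :: "real^'n^'n" where "transpose L ** M ** L = mat 1" using pos_def_orthonormal[OF assms] by blast
  then have "det L * det M * det L = 1" by (metis det_I det_mul det_transpose)
  then have "det M * (det L)\<^sup>2 = 1" by (simp add: power2_eq_square mult_ac)
  then show ?thesis by (metis zero_less_mult_iff zero_less_one zero_le_power2 not_less)
qed

locale metric_atlas = atlas A for A :: "('a::{t2_space, second_countable_topology}, 'n::finite) chart set" +
  fixes g :: "'a metric"
  assumes g: "\<forall>p. \<forall>X\<in>tangent_space A p.
        ((\<exists>f. X f \<noteq> 0) \<longrightarrow> 0 < g p X X) \<and>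
        (\<forall>Y\<in>tangent_space A p. g p X Y = g p Y X \<and>
           (\<forall>Z\<in>tangent_space A p. \<forall>a b.
              g p (\<lambda>f. a * X f + b * Y f) Z = a * g p X Z + b * g p Y Z))"
begin

lemma g_commute: "X \<in> tangent_space A p \<Longrightarrow> Y \<in> tangent_space A p \<Longrightarrow> g p X Y = g p Y X"
  using g by blast

lemma g_linear: "X \<in> tangent_space A p \<Longrightarrow> Y \<in> tangent_space A p \<Longrightarrow> Z \<in> tangent_space A p \<Longrightarrow>
    g p (\<lambda>f. a * X f + b * Y f) Z = a * g p X Z + b * g p Y Z"
  using g by blast

lemma g_pos: "X \<in> tangent_space A p \<Longrightarrow> X f \<noteq> 0 \<Longrightarrow> 0 < g p X X"
  using g by blast

lemma g_zero: "Z \<in> tangent_space A p \<Longrightarrow> g p (\<lambda>f. 0) Z = 0"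
  using g_linear[OF tangent_zero tangent_zero, of Z p 0 0] by simp

lemma g_sum_left:
  assumes "finite I" "\<And>i. i \<in> I \<Longrightarrow> X i \<in> tangent_space A p" "Z \<in> tangent_space A p"
  shows "g p (\<lambda>f. \<Sum>i\<in>I. a i * X i f) Z = (\<Sum>i\<in>I. a i * g p (X i) Z)"
  using assms(1,2)
proof (induction I)
  case (insert i I)
  then show ?case
    using g_linear[of "X i" p "\<lambda>f. \<Sum>i\<in>I. a i * X i f" Z "a i" 1] assms(3) tangent_sum[where X=X and a=a, OF insert.hyps(1)] by simp
qed (simp add: g_zero assms)

lemma g_sum_right:
  assumes "finite I" "\<And>i. i \<in> I \<Longrightarrow> X i \<in> tangent_space A p" "Z \<in> tangent_space A p"
  shows "g p Z (\<lambda>f. \<Sum>i\<in>I. a i * X i f) = (\<Sum>i\<in>I. a i * g p Z (X i))"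
proof -
  have "(\<lambda>f. \<Sum>i\<in>I. a i * X i f) \<in> tangent_space A p" using assms by (intro tangent_sum)
  then show ?thesis
    using g_sum_left[where X=X and a=a, OF assms] g_commute[OF assms(3)] assms by (simp cong: sum.cong)
qed

abbreviation gm :: "('a, 'n) chart \<Rightarrow> real^'n \<Rightarrow> real^'n^'n" where
  "gm \<equiv> metric_matrix A g"

lemma gm_at: "c \<in> A \<Longrightarrow> p \<in> fst c \<Longrightarrow> gm c (snd c p) $ i $ j = g p (coord_vec A c i p) (coord_vec A c j p)"
  by (simp add: metric_matrix_def)

lemma gm_change:
  assumes c: "c \<in> A" and d: "d \<in> A" and x: "x \<in> snd d ` (fst d \<inter> fst c)"
  shows "gm d x $ i $ j = (\<Sum>a\<in>UNIV. \<Sum>b\<in>UNIV. partial_deriv i (\<lambda>y. snd c (chart_inv d y) $ a) x *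
    partial_deriv j (\<lambda>y. snd c (chart_inv d y) $ b) x * gm c (snd c (chart_inv d x)) $ a $ b)"
proof -
  obtain p where p: "p \<in> fst c" "p \<in> fst d" "x = snd d p" using x by auto
  note tan = coord_vec_tangent[OF c p(1)]
  show ?thesis
    using d p(2,3) gm_at[OF c p(1)]
    by (simp add: gm_at coord_vec_change[OF c d p(1,2)] g_sum_left g_sum_right tan tangent_sum
        sum_distrib_left mult.assoc)
qed

text \<open>The tangent vector with coefficients \<open>v\<close> takes the value
  \<open>v $ k\<close> on the \<open>k\<close>-th coordinate function. It is therefore nonzero when
  \<open>v\<close> is, and \<open>g_pos\<close> applies.\<close>

lemma gm_pos_def:
  assumes c: "c \<in> A" and x: "x \<in> snd c ` fst c"
  shows "pos_def (gm c x)"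
proof -
  obtain p where p: "p \<in> fst c" "x = snd c p" using x by auto
  note tan = coord_vec_tangent[OF c p(1)]
  have "transpose (gm c x) = gm c x"
    unfolding p(2) using gm_at[OF c p(1)] g_commute[OF tan tan] by (simp add: vec_eq_iff transpose_def)
  moreover have "0 < v \<bullet> (gm c x *v v)" if v: "v \<noteq> 0" for v
  proof -
    let ?X = "\<lambda>f. \<Sum>i\<in>UNIV. v $ i * coord_vec A c i p f"
    obtain k where k: "v $ k \<noteq> 0" using v by (auto simp: vec_eq_iff)
    have "?X (\<lambda>q. snd c q $ k) = v $ k"
      by (simp add: coord_vec_coord[OF c p(1)] if_distrib cong: if_cong)
    then have "?X (\<lambda>q. snd c q $ k) \<noteq> 0" using k by simp
    then have "0 < g p ?X ?X" by (intro g_pos[where X="?X"] tangent_sum tan) auto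
    also have "g p ?X ?X = v \<bullet> (gm c x *v v)"
      using p gm_at[OF c p(1)]
      by (simp add: g_sum_left g_sum_right tan tangent_sum inner_matrix_vector sum_distrib_left mult_ac)
    finally show ?thesis .
  qed
  ultimately show ?thesis by (simp add: pos_def_def)
qed

lemma gm_det_pos: "c \<in> A \<Longrightarrow> x \<in> snd c ` fst c \<Longrightarrow> det (gm c x) > 0"
  by (intro pos_def_det gm_pos_def)

lemma gm_change_matrix:
  assumes c: "c \<in> A" and d: "d \<in> A" and x: "x \<in> snd d ` (fst d \<inter> fst c)"
  defines "T \<equiv> \<lambda>y. snd c (chart_inv d y)"
  shows "gm d x = Finite_Cartesian_Product.transpose (jacobian T x) ** gm c (T x) ** jacobian T x"
  unfolding vec_eq_iff gm_change[OF c d x]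
  by (subst sum.swap) (simp add: matrix_matrix_mult_def Finite_Cartesian_Product.transpose_def jacobian_def T_def sum_distrib_right sum_distrib_left mult_ac)

lemma gm_det_change:
  assumes c: "c \<in> A" and d: "d \<in> A" and x: "x \<in> snd d ` (fst d \<inter> fst c)"
  defines "T \<equiv> \<lambda>y. snd c (chart_inv d y)"
  shows "sqrt (det (gm d x)) = \<bar>det (jacobian T x)\<bar> * sqrt (det (gm c (T x)))"
proof -
  have "det (gm d x) = (det (jacobian T x))\<^sup>2 * det (gm c (T x))"
    unfolding gm_change_matrix[OF c d x] T_def by (simp add: det_mul det_transpose power2_eq_square)
  then show ?thesis by (simp add: real_sqrt_mult)
qed

end

section \<open>The Riemannian volume\<close>

locale riemannian = metric_atlas +
  assumes gm_smooth: "c \<in> A \<Longrightarrow> smooth_on (snd c ` fst c) (\<lambda>x. metric_matrix A g c x $ i $ j)"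
begin

definition gdens :: "('a, 'b) chart \<Rightarrow> real^'b \<Rightarrow> real" where
  "gdens c x = sqrt (det (gm c x))"

lemma gdens_pos: "c \<in> A \<Longrightarrow> x \<in> snd c ` fst c \<Longrightarrow> 0 < gdens c x"
  by (simp add: gdens_def gm_det_pos)

lemma gdens_continuous: "c \<in> A \<Longrightarrow> continuous_on (snd c ` fst c) (gdens c)"
  unfolding gdens_def
  by (intro continuous_on_real_sqrt smooth_on_continuous_on smooth_on_det gm_smooth chart_open)

definition chart_measure :: "('a, 'b) chart \<Rightarrow> 'a measure" where
  "chart_measure c = distr (density (restrict_space lborel (snd c ` fst c)) (\<lambda>x. ennreal (gdens c x)))
     borel (chart_inv c)"

lemma sets_chart_measure [measurable_cong, simp]: "sets (chart_measure c) = sets borel"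
  by (simp add: chart_measure_def)

lemma chart_inv_measurable:
  assumes "c \<in> A"
  shows "chart_inv c \<in> measurable (restrict_space lborel (snd c ` fst c)) borel"
proof -
  have "chart_inv c \<in> borel_measurable (restrict_space borel (snd c ` fst c))"
    using assms by (intro borel_measurable_continuous_on_restrict chart_continuous)
  then show ?thesis by (simp cong: measurable_cong_sets add: sets_restrict_space)
qed

lemma gdens_measurable:
  assumes "c \<in> A"
  shows "gdens c \<in> borel_measurable (restrict_space lborel (snd c ` fst c))"
proof -
  have "gdens c \<in> borel_measurable (restrict_space borel (snd c ` fst c))"
    using assms by (intro borel_measurable_continuous_on_restrict gdens_continuous)
  then show ?thesis by (simp cong: measurable_cong_sets add: sets_restrict_space)
qed

lemma chart_image_borel:
  assumes "c \<in> A" "B \<in> sets borel" "B \<subseteq> fst c"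
  shows "snd c ` B \<in> sets borel"
proof -
  have "chart_inv c -` B \<inter> space (restrict_space lborel (snd c ` fst c)) \<in> sets (restrict_space lborel (snd c ` fst c))"
    by (rule measurable_sets[OF chart_inv_measurable assms(2)]) fact
  also have "chart_inv c -` B \<inter> space (restrict_space lborel (snd c ` fst c)) = snd c ` B"
    using assms by (force simp: space_restrict_space)
  finally show ?thesis
    using chart_open(2)[OF assms(1)] by (simp add: sets_restrict_space_iff)
qed

lemma nn_integral_chart_measure:
  assumes c: "c \<in> A" and [measurable]: "F \<in> borel_measurable borel"
  shows "(\<integral>\<^sup>+p. F p \<partial>chart_measure c)
    = (\<integral>\<^sup>+x. ennreal (gdens c x) * F (chart_inv c x) * indicator (snd c ` fst c) x \<partial>lborel)"
proof -
  note [measurable] = chart_inv_measurable[OF c] gdens_measurable[OF c]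
  have "(\<integral>\<^sup>+p. F p \<partial>chart_measure c)
    = (\<integral>\<^sup>+x. ennreal (gdens c x) * F (chart_inv c x) \<partial>restrict_space lborel (snd c ` fst c))"
    unfolding chart_measure_def by (simp add: nn_integral_distr nn_integral_density)
  also have "\<dots> = (\<integral>\<^sup>+x. ennreal (gdens c x) * F (chart_inv c x) * indicator (snd c ` fst c) x \<partial>lborel)"
    using chart_open(2)[OF c] by (intro nn_integral_restrict_space) auto
  finally show ?thesis .
qed

lemma emeasure_chart_measure:
  assumes c: "c \<in> A" and B: "B \<in> sets borel" "B \<subseteq> fst c"
  shows "emeasure (chart_measure c) B = (\<integral>\<^sup>+x. ennreal (gdens c x) * indicator (snd c ` B) x \<partial>lborel)"
proof -
  have "emeasure (chart_measure c) B = (\<integral>\<^sup>+p. indicator B p \<partial>chart_measure c)"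
    using B by (subst nn_integral_indicator) auto
  also have "\<dots> = (\<integral>\<^sup>+x. ennreal (gdens c x) * indicator B (chart_inv c x) * indicator (snd c ` fst c) x \<partial>lborel)"
    using B by (intro nn_integral_chart_measure[OF c]) auto
  also have "\<dots> = (\<integral>\<^sup>+x. ennreal (gdens c x) * indicator (snd c ` B) x \<partial>lborel)"
    using B c by (intro nn_integral_cong) (force simp: indicator_def)
  finally show ?thesis .
qed

lemma emeasure_chart_measure_Int:
  assumes c: "c \<in> A" and B: "B \<in> sets borel"
  shows "emeasure (chart_measure c) B = emeasure (chart_measure c) (B \<inter> fst c)"
proof -
  have "emeasure (chart_measure c) B' = (\<integral>\<^sup>+x. ennreal (gdens c x) * indicator B' (chart_inv c x) * indicator (snd c ` fst c) x \<partial>lborel)"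
    if "B' \<in> sets borel" for B'
    using that by (subst nn_integral_chart_measure[OF c, symmetric]) auto
  note * = this[OF B] this[OF sets.Int[OF B borel_open[OF chart_open(1)[OF c]]]]
  show ?thesis
    unfolding * using chart_inv_in[OF c] by (intro nn_integral_cong) (auto simp: indicator_def)
qed

lemma gdens_borel:
  assumes "c \<in> A" "S \<in> sets borel" "S \<subseteq> snd c ` fst c"
  shows "(\<lambda>x. indicator S x * gdens c x) \<in> borel_measurable borel"
proof -
  have "(\<lambda>x. indicator S x *\<^sub>R gdens c x) \<in> borel_measurable borel"
    using assms by (intro borel_measurable_continuous_on_indicator continuous_on_subset[OF gdens_continuous]) auto
  then show ?thesis by simp
qed

text \<open>Change of variables along the transition map: by \<open>gm_det_change\<close> its
  Jacobian factor is exactly the quotient of the two densities.\<close>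

lemma chart_measure_consistent:
  assumes c: "c \<in> A" and d: "d \<in> A" and B: "B \<in> sets borel" "B \<subseteq> fst c" "B \<subseteq> fst d"
  shows "emeasure (chart_measure c) B = emeasure (chart_measure d) B"
proof -
  let ?T = "\<lambda>y. snd c (chart_inv d y)" and ?S = "snd d ` B"
  have TS: "?T ` ?S = snd c ` B"
    using B d by (force simp: image_image)
  have Sb: "?S \<in> sets borel" "?T ` ?S \<in> sets borel"
    unfolding TS using B c d by (auto intro: chart_image_borel)
  have sub: "?S \<subseteq> snd d ` (fst d \<inter> fst c)" "snd c ` B \<subseteq> snd c ` fst c" "?S \<subseteq> snd d ` fst d" using B by auto
  have D: "(?T has_derivative (\<lambda>v. jacobian ?T y *v v)) (at y)" if "y \<in> ?S" for y
    using smooth_on_differentiable[OF transition_smooth[OF d c]] sub that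
    by (intro jacobian_derivative) auto
  have dens: "\<bar>det (jacobian ?T y)\<bar> * gdens c (?T y) = gdens d y" if "y \<in> ?S" for y
    unfolding gdens_def using gm_det_change[OF c d, of y] sub that by auto
  have eq: "indicator ?S y * (\<bar>det (matrix ((*v) (jacobian ?T y)))\<bar> * gdens c (?T y))
      = indicator ?S y * gdens d y" for y
    using dens by (auto simp: indicator_def)
  have "(\<integral>\<^sup>+y. ennreal (indicator ?S y * (\<bar>det (matrix ((*v) (jacobian ?T y)))\<bar> * gdens c (?T y))) \<partial>lborel)
     = (\<integral>\<^sup>+x. ennreal (indicator (?T ` ?S) x * gdens c x) \<partial>lborel)"
  proof (rule change_of_variables_nn[OF Sb D])
    show "inj_on ?T ?S"
    proof (rule inj_on_inverseI[where g="\<lambda>x. snd d (chart_inv c x)"])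
      show "snd d (chart_inv c (?T y)) = y" if "y \<in> ?S" for y
        using that B c d by (auto simp: subset_iff)
    qed
    show "0 \<le> gdens c x" if "x \<in> ?T ` ?S" for x
      using gdens_pos[OF c, of x] that sub(2) unfolding TS by auto
    show "(\<lambda>y. indicator ?S y * (\<bar>det (matrix ((*v) (jacobian ?T y)))\<bar> * gdens c (?T y))) \<in> borel_measurable borel"
      unfolding eq using d Sb(1) sub(3) by (rule gdens_borel)
    show "(\<lambda>x. indicator (?T ` ?S) x * gdens c x) \<in> borel_measurable borel"
      using c Sb(2) sub(2) unfolding TS by (intro gdens_borel)
  qed
  then have "(\<integral>\<^sup>+y. ennreal (indicator ?S y * gdens d y) \<partial>lborel) = (\<integral>\<^sup>+x. ennreal (indicator (snd c ` B) x * gdens c x) \<partial>lborel)"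
    unfolding eq TS .
  moreover have "ennreal (indicator S x * gdens e x) = ennreal (gdens e x) * indicator S x" for e and S :: "(real^'b) set" and x
    by (simp add: indicator_def)
  ultimately show ?thesis
    using B c d by (simp add: emeasure_chart_measure)
qed

section \<open>Existence and uniqueness of the Riemannian volume\<close>

lemma countable_charts: "\<exists>c. (\<forall>k::nat. c k \<in> A) \<and> (\<Union>k. fst (c k)) = UNIV"
proof -
  obtain F where F: "F \<subseteq> fst ` A" "countable F" "\<Union>F = \<Union>(fst ` A)"
    using Lindelof[of "fst ` A"] chart_open(1) by blast
  have U: "\<Union>F = UNIV" using F(3) chart_cover by auto
  then have "F \<noteq> {}" by auto
  have "\<forall>k. \<exists>c. c \<in> A \<and> fst c = from_nat_into F k"
    using from_nat_into[OF \<open>F \<noteq> {}\<close>] F(1) by (metis imageE subsetD)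
  from choice[OF this] obtain c where c: "\<And>k. c k \<in> A" "\<And>k. fst (c k) = from_nat_into F k" by auto
  have "(\<Union>k. fst (c k)) = \<Union>F"
    using range_from_nat_into[OF \<open>F \<noteq> {}\<close> F(2)] by (simp add: c(2))
  with U c(1) show ?thesis by auto
qed

text \<open>The property under the \<open>THE\<close> of \<open>riemannian_volume\<close>, named
  because that description denotes something definite only once existence and uniqueness are
  known.\<close>

definition volume_spec :: "'a measure \<Rightarrow> bool" where
  "volume_spec \<mu> \<longleftrightarrow> sets \<mu> = sets borel \<and>
     (\<forall>c\<in>A. \<forall>B\<in>sets borel. B \<subseteq> fst c \<longrightarrow> emeasure \<mu> B =
          (\<integral>\<^sup>+x. ennreal (sqrt (det (gm c x))) * indicator (snd c ` B) x \<partial>lborel))"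

lemma volume_spec_chart:
  "volume_spec \<mu> \<Longrightarrow> c \<in> A \<Longrightarrow> B \<in> sets borel \<Longrightarrow> B \<subseteq> fst c \<Longrightarrow> emeasure \<mu> B = emeasure (chart_measure c) B"
  by (simp add: volume_spec_def emeasure_chart_measure gdens_def)

text \<open>The domains of countably many charts, made disjoint, cut every Borel set into pieces
  whose measure is prescribed by a chart. This gives uniqueness, and summing the chart measures of
  the pieces gives existence; by \<open>chart_measure_consistent\<close> any other chart containing
  a piece assigns it the same measure.\<close>

lemma volume_spec_ex1: "\<exists>!\<mu>. volume_spec \<mu>"
proof -
  obtain c where c': "\<forall>k::nat. c k \<in> A" and U: "(\<Union>k. fst (c k)) = UNIV"
    using countable_charts by (elim exE conjE)
  have c: "c k \<in> A" for k using c' by simp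
  define D where "D = disjointed (\<lambda>k::nat. fst (c k))"
  have Db: "D k \<in> sets borel" for k
    unfolding D_def disjointed_def using chart_open(1)[OF c] by auto
  have Dsub: "D k \<subseteq> fst (c k)" for k unfolding D_def by (rule disjointed_subset)
  have Ddisj: "disjoint_family D" unfolding D_def by (rule disjoint_family_disjointed)
  have DU: "(\<Union>k. D k) = UNIV" unfolding D_def using U by (simp add: UN_disjointed_eq)
  let ?m = "\<lambda>B. \<Sum>k. emeasure (chart_measure (c k)) (B \<inter> D k)"
  have split: "emeasure \<mu> B = (\<Sum>k. emeasure \<mu> (B \<inter> D k))" if "sets \<mu> = sets borel" "B \<in> sets borel" for \<mu> :: "'a measure" and B
  proof -
    have "(\<Sum>k. emeasure \<mu> (B \<inter> D k)) = emeasure \<mu> (\<Union>k. B \<inter> D k)"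
    proof (rule suminf_emeasure)
      show "disjoint_family (\<lambda>k. B \<inter> D k)" using Ddisj unfolding disjoint_family_on_def by blast
    qed (use that Db in auto)
    also have "(\<Union>k. B \<inter> D k) = B" using DU by auto
    finally show ?thesis by simp
  qed
  define \<mu> where "\<mu> = measure_of UNIV (sets borel) ?m"
  have sets: "sets \<mu> = sets borel"
    unfolding \<mu>_def by (simp add: sets.sigma_sets_eq[of borel, simplified])
  have em: "emeasure \<mu> B = ?m B" if "B \<in> sets borel" for B
  proof (rule emeasure_measure_of[OF \<mu>_def])
    show "positive (sets \<mu>) ?m" by (simp add: positive_def)
    show "countably_additive (sets \<mu>) ?m"
    proof (rule countably_additiveI)
      fix B :: "nat \<Rightarrow> 'a set"
      assume B: "range B \<subseteq> sets \<mu>" "disjoint_family B"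
      then have Bb: "B i \<in> sets borel" for i using sets by auto
      \<comment> \<open>The two infinite sums are exchanged by reading one of them as an integral
        over the counting measure.\<close>
      have "(\<Sum>i. ?m (B i)) = (\<Sum>i. \<integral>\<^sup>+k. emeasure (chart_measure (c k)) (B i \<inter> D k) \<partial>count_space UNIV)"
        by (simp add: nn_integral_count_space_nat)
      also have "\<dots> = (\<integral>\<^sup>+k. (\<Sum>i. emeasure (chart_measure (c k)) (B i \<inter> D k)) \<partial>count_space UNIV)"
        by (rule nn_integral_suminf[symmetric]) simp
      also have "\<dots> = (\<integral>\<^sup>+k. emeasure (chart_measure (c k)) (\<Union>i. B i \<inter> D k) \<partial>count_space UNIV)"
        using B(2) Bb Db by (intro nn_integral_cong suminf_emeasure) (auto simp: disjoint_family_on_def)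
      also have "\<dots> = ?m (\<Union>i. B i)"
        by (simp add: nn_integral_count_space_nat)
      finally show "(\<Sum>i. ?m (B i)) = ?m (\<Union>i. B i)" .
    qed
  qed (use sets that in auto)
  have "volume_spec \<mu>"
    unfolding volume_spec_def
  proof (intro conjI ballI impI sets)
    fix e B assume e: "e \<in> A" and B: "B \<in> sets borel" "B \<subseteq> fst e"
    have "emeasure \<mu> B = (\<Sum>k. emeasure (chart_measure e) (B \<inter> D k))"
      unfolding em[OF B(1)] using B Db Dsub
      by (intro suminf_cong chart_measure_consistent c e) blast+
    also have "\<dots> = emeasure (chart_measure e) B" using B by (subst split[symmetric]) auto
    finally show "emeasure \<mu> B = (\<integral>\<^sup>+x. ennreal (sqrt (det (gm e x))) * indicator (snd e ` B) x \<partial>lborel)"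
      using e B by (simp add: emeasure_chart_measure gdens_def)
  qed
  moreover have "\<nu> = \<mu>" if "volume_spec \<nu>" for \<nu>
  proof (rule measure_eqI)
    have \<nu>: "sets \<nu> = sets borel" using that by (simp add: volume_spec_def)
    then show "sets \<nu> = sets \<mu>" using sets by simp
    fix B assume "B \<in> sets \<nu>"
    then have B: "B \<in> sets borel" using \<nu> by simp
    have "emeasure \<nu> B = (\<Sum>k. emeasure (chart_measure (c k)) (B \<inter> D k))"
      unfolding split[OF \<nu> B] using Db B Dsub
      by (intro suminf_cong volume_spec_chart[OF that] c) blast+
    then show "emeasure \<nu> B = emeasure \<mu> B" using em[OF B] by simp
  qed
  ultimately show ?thesis by blast
qed

abbreviation vol :: "'a measure" where "vol \<equiv> riemannian_volume A g"

lemma volume_spec_vol: "volume_spec vol"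
proof -
  have "vol = (THE \<mu>. volume_spec \<mu>)" by (simp add: riemannian_volume_def volume_spec_def)
  then show ?thesis using theI'[OF volume_spec_ex1] by simp
qed

lemma sets_vol [measurable_cong, simp]: "sets vol = sets borel"
  using volume_spec_vol by (simp add: volume_spec_def)

lemma space_vol [simp]: "space vol = UNIV"
  using sets_eq_imp_space_eq[OF sets_vol] by simp

lemma density_vol_chart:
  assumes c: "c \<in> A"
  shows "density vol (indicator (fst c)) = chart_measure c"
proof (rule measure_eqI)
  fix B assume "B \<in> sets (density vol (indicator (fst c)))"
  then have B: "B \<in> sets borel" by simp
  have o: "fst c \<in> sets borel" using chart_open(1)[OF c] by auto
  have "emeasure (density vol (indicator (fst c))) B = (\<integral>\<^sup>+p. indicator (fst c) p * indicator B p \<partial>vol)"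
    using B o by (intro emeasure_density) auto
  also have "\<dots> = (\<integral>\<^sup>+p. indicator (B \<inter> fst c) p \<partial>vol)"
    by (intro nn_integral_cong) (auto simp: indicator_def)
  also have "\<dots> = emeasure vol (B \<inter> fst c)" using B o by (subst nn_integral_indicator) auto
  also have "\<dots> = emeasure (chart_measure c) (B \<inter> fst c)"
    using B o by (intro volume_spec_chart[OF volume_spec_vol c]) auto
  finally show "emeasure (density vol (indicator (fst c))) B = emeasure (chart_measure c) B"
    using emeasure_chart_measure_Int[OF c B] by simp
qed simp

lemma nn_integral_vol_chart:
  assumes c: "c \<in> A" and F: "F \<in> borel_measurable borel"
  shows "(\<integral>\<^sup>+p. indicator (fst c) p * F p \<partial>vol)
    = (\<integral>\<^sup>+x. ennreal (gdens c x) * F (chart_inv c x) * indicator (snd c ` fst c) x \<partial>lborel)"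
proof -
  have o: "fst c \<in> sets borel" using chart_open(1)[OF c] by auto
  show ?thesis
    unfolding nn_integral_chart_measure[OF c F, symmetric] density_vol_chart[OF c, symmetric]
    using F o by (subst nn_integral_density) auto
qed

section \<open>Functions and integrals carried from a chart to the manifold\<close>

definition ext :: "('a, 'b) chart \<Rightarrow> (real^'b \<Rightarrow> real) \<Rightarrow> 'a \<Rightarrow> real" where
  "ext c u p = (if p \<in> fst c then u (snd c p) else 0)"

lemma ext_measurable:
  assumes c: "c \<in> A" and u: "u \<in> borel_measurable borel"
  shows "ext c u \<in> borel_measurable borel"
proof -
  have o: "fst c \<in> sets borel" using chart_open(1)[OF c] by auto
  have "snd c \<in> borel_measurable (restrict_space borel (fst c))"
    by (intro borel_measurable_continuous_on_restrict chart_continuous c)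
  then have "(\<lambda>p. u (snd c p)) \<in> borel_measurable (restrict_space borel (fst c))"
    using u by (rule measurable_compose)
  then show ?thesis
    unfolding ext_def[abs_def] using o by (subst measurable_If_restrict_space_iff) auto
qed

lemma nn_integral_ext:
  assumes c: "c \<in> A" and V: "open V" and u: "u \<in> borel_measurable borel"
    and supp: "\<And>x. x \<notin> snd c ` (fst c \<inter> V) \<Longrightarrow> u x = 0"
  shows "(\<integral>\<^sup>+p. ennreal (ext c u p) \<partial>volume_on A g V) = (\<integral>\<^sup>+x. ennreal (u x * gdens c x) \<partial>lborel)"
proof -
  have "ext c u p = 0" if "p \<notin> V" for p
  proof -
    have "snd c p \<notin> snd c ` (fst c \<inter> V)" if "p \<in> fst c"
      using that \<open>p \<notin> V\<close> c unfolding chart_image_eq[OF c] by simp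
    then show ?thesis using supp by (auto simp: ext_def)
  qed
  then have "(\<integral>\<^sup>+p. ennreal (ext c u p) \<partial>volume_on A g V) = (\<integral>\<^sup>+p. ennreal (ext c u p) \<partial>vol)"
    unfolding volume_on_def using V
    by (subst nn_integral_restrict_space) (auto intro!: nn_integral_cong simp: indicator_def)
  also have "\<dots> = (\<integral>\<^sup>+p. indicator (fst c) p * ennreal (ext c u p) \<partial>vol)"
    by (intro nn_integral_cong) (auto simp: indicator_def ext_def)
  also have "\<dots> = (\<integral>\<^sup>+x. ennreal (gdens c x) * ennreal (ext c u (chart_inv c x)) * indicator (snd c ` fst c) x \<partial>lborel)"
    using ext_measurable[OF c u] by (intro nn_integral_vol_chart[OF c]) auto
  also have "\<dots> = (\<integral>\<^sup>+x. ennreal (u x * gdens c x) \<partial>lborel)"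
  proof (intro nn_integral_cong)
    fix x
    show "ennreal (gdens c x) * ennreal (ext c u (chart_inv c x)) * indicator (snd c ` fst c) x = ennreal (u x * gdens c x)"
    proof (cases "x \<in> snd c ` fst c")
      case True
      then show ?thesis
        using chart_inv_right[OF c True] gdens_pos[OF c True] chart_inv_in[OF c True]
        by (simp add: ext_def ennreal_mult'' less_imp_le mult.commute)
    next
      case False
      then have "x \<notin> snd c ` (fst c \<inter> V)" by blast
      from supp[OF this] show ?thesis using False by simp
    qed
  qed
  finally show ?thesis .
qed

lemma ext_integral:
  assumes c: "c \<in> A" and V: "open V" and u: "u \<in> borel_measurable borel"
    and supp: "\<And>x. x \<notin> snd c ` (fst c \<inter> V) \<Longrightarrow> u x = 0"
    and int: "integrable lborel (\<lambda>x. u x * gdens c x)"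
  shows "integrable (volume_on A g V) (ext c u)"
    and "(LINT p|volume_on A g V. ext c u p) = (LINT x|lborel. u x * gdens c x)"
proof -
  have m: "ext c u \<in> borel_measurable (volume_on A g V)"
    unfolding volume_on_def using ext_measurable[OF c u]
    by (intro measurable_restrict_space1) simp
  have s: "(\<lambda>x. - u x) \<in> borel_measurable borel" "\<And>x. x \<notin> snd c ` (fst c \<inter> V) \<Longrightarrow> - u x = 0"
    using u supp by auto
  have neg: "(\<integral>\<^sup>+p. ennreal (- ext c u p) \<partial>volume_on A g V) = (\<integral>\<^sup>+x. ennreal (- (u x * gdens c x)) \<partial>lborel)"
    using nn_integral_ext[OF c V s] by (simp add: ext_def if_distrib[of uminus] cong: if_cong)
  note pos = nn_integral_ext[OF c V u supp]
  show i: "integrable (volume_on A g V) (ext c u)"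
    using int m by (simp add: real_integrable_def pos neg)
  show "(LINT p|volume_on A g V. ext c u p) = (LINT x|lborel. u x * gdens c x)"
    using i int by (simp add: real_lebesgue_integral_def pos neg)
qed

end

lemma extended_integral_integrable:
  assumes "integrable M f"
  shows "has_extended_integral M f" "extended_integral M f = ereal (LINT p|M. f p)"
proof -
  have f: "(\<integral>\<^sup>+p. ennreal (f p) \<partial>M) < \<infinity>" "(\<integral>\<^sup>+p. ennreal (- f p) \<partial>M) < \<infinity>"
    using assms by (auto simp: real_integrable_def less_top)
  then show "has_extended_integral M f"
    using assms by (simp add: has_extended_integral_def)
  show "extended_integral M f = ereal (LINT p|M. f p)"
    unfolding extended_integral_def real_lebesgue_integral_def[OF assms]
    using f by (cases "\<integral>\<^sup>+p. ennreal (f p) \<partial>M"; cases "\<integral>\<^sup>+p. ennreal (- f p) \<partial>M") (auto simp: enn2ereal_ennreal)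
qed

section \<open>Integration by parts\<close>

lemma lborel_integral_translate:
  fixes f :: "real^'n \<Rightarrow> real"
  assumes [measurable]: "f \<in> borel_measurable borel"
  shows "(LINT x|lborel. f (x + c)) = (LINT x|lborel. f x)"
    and "integrable lborel (\<lambda>x. f (x + c)) \<longleftrightarrow> integrable lborel f"
proof -
  have "(LINT x|distr lborel borel ((+) c). f x) = (LINT x|lborel. f (c + x))"
    by (rule integral_distr) auto
  then show "(LINT x|lborel. f (x + c)) = (LINT x|lborel. f x)"
    by (simp add: lborel_distr_plus add.commute)
  have "integrable (distr lborel borel ((+) c)) f \<longleftrightarrow> integrable lborel (\<lambda>x. f (c + x))"
    by (rule integrable_distr_eq) auto
  then show "integrable lborel (\<lambda>x. f (x + c)) \<longleftrightarrow> integrable lborel f"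
    by (simp add: lborel_distr_plus add.commute)
qed

text \<open>The difference \<open>F (x + axis i 1) - F x\<close> is integrated over \<open>x\<close>
  in two ways. By translation invariance the result is \<open>0\<close>. By the fundamental theorem
  and Fubini it is the average, over shifts \<open>s\<close> between \<open>0\<close> and
  \<open>1\<close>, of the integrals of the translated derivative, all of which coincide.\<close>

lemma integral_partial_deriv_zero:
  fixes F :: "real^'n \<Rightarrow> real"
  assumes sm: "smooth_on UNIV F" and iF: "integrable lborel F" and iD: "integrable lborel (partial_deriv i F)"
  shows "(LINT x|lborel. partial_deriv i F x) = 0"
proof -
  let ?e = "axis i 1 :: real^'n" and ?D = "partial_deriv i F"
  have cD: "continuous_on UNIV ?D" and cF: "continuous_on UNIV F"
    using sm by (auto intro: smooth_on_continuous_on smooth_on_partial_deriv)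
  have [measurable]: "?D \<in> borel_measurable borel" "F \<in> borel_measurable borel"
    using cD cF by (auto intro: borel_measurable_continuous_onI)
  have der: "((\<lambda>s. F (x + s *\<^sub>R ?e)) has_real_derivative ?D (x + s *\<^sub>R ?e)) (at s)" for x s
    using line_has_real_derivative[of F x s ?e] smooth_on_differentiable[OF sm]
    by (simp add: axis_def if_distrib[of "\<lambda>x. x * _"] cong: if_cong)
  have ftc: "(LINT s|lborel. indicator {0..1} s *\<^sub>R ?D (x + s *\<^sub>R ?e)) = F (x + ?e) - F x" for x
  proof -
    have "(LINT s|lborel. indicator {0..1} s *\<^sub>R ?D (x + s *\<^sub>R ?e)) = F (x + 1 *\<^sub>R ?e) - F (x + 0 *\<^sub>R ?e)"
    proof (rule integral_FTC_atLeastAtMost)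
      show "((\<lambda>s. F (x + s *\<^sub>R ?e)) has_vector_derivative ?D (x + s *\<^sub>R ?e)) (at s within {0..1})" for s
        using der has_real_derivative_iff_has_vector_derivative has_vector_derivative_at_within by blast
      show "continuous_on {0..1} (\<lambda>s. ?D (x + s *\<^sub>R ?e))"
        by (intro continuous_on_compose2[OF cD] continuous_intros) auto
    qed simp
    then show ?thesis by simp
  qed
  have m: "(\<lambda>(s, x). indicator {0..1} s *\<^sub>R ?D (x + s *\<^sub>R ?e)) \<in> borel_measurable (lborel \<Otimes>\<^sub>M lborel)"
    by measurable
  have tr: "integrable lborel (\<lambda>x. ?D (x + s *\<^sub>R ?e))" for s
    using iD by (simp add: lborel_integral_translate)
  have nrm: "(LINT x|lborel. norm (indicator {0..1} s *\<^sub>R ?D (x + s *\<^sub>R ?e))) = indicator {0..1} s *\<^sub>R (LINT x|lborel. \<bar>?D x\<bar>)" for s :: real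
    using lborel_integral_translate(1)[of "\<lambda>x. \<bar>?D x\<bar>" "s *\<^sub>R ?e"]
    by (simp add: abs_mult)
  have int: "integrable (lborel \<Otimes>\<^sub>M lborel) (\<lambda>(s, x). indicator {0..1} s *\<^sub>R ?D (x + s *\<^sub>R ?e))"
  proof (rule lborel_pair.Fubini_integrable[OF m])
    show "integrable lborel (\<lambda>s. LINT x|lborel. norm (case (s, x) of (s, x) \<Rightarrow> indicator {0..1} s *\<^sub>R ?D (x + s *\<^sub>R ?e)))"
      unfolding prod.case nrm by (intro integrable_scaleR_left) (auto simp: integrable_indicator_iff)
    show "AE s in lborel. integrable lborel (\<lambda>x. case (s, x) of (s, x) \<Rightarrow> indicator {0..1} s *\<^sub>R ?D (x + s *\<^sub>R ?e))"
      unfolding prod.case using tr by simp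
  qed
  have "(LINT x|lborel. LINT s|lborel. indicator {0..1} s *\<^sub>R ?D (x + s *\<^sub>R ?e))
    = (LINT s|lborel. LINT x|lborel. indicator {0..1} s *\<^sub>R ?D (x + s *\<^sub>R ?e))"
    by (rule lborel_pair.Fubini_integral[OF int])
  also have "\<dots> = (LINT s|lborel. indicator {0..1::real} s *\<^sub>R (LINT x|lborel. ?D x))"
    using lborel_integral_translate(1)[of ?D] by simp
  also have "\<dots> = (LINT x|lborel. ?D x)" by simp
  finally have "(LINT x|lborel. ?D x) = (LINT x|lborel. F (x + ?e) - F x)" by (simp only: ftc)
  also have "\<dots> = 0"
    using iF by (simp add: lborel_integral_translate Bochner_Integration.integral_diff)
  finally show ?thesis .
qed

lemma integrable_compact_support:
  fixes f :: "real^'n \<Rightarrow> real"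
  assumes "continuous_on UNIV f" "compact K" "\<And>x. x \<notin> K \<Longrightarrow> f x = 0"
  shows "integrable lborel f"
proof -
  have "integrable lborel (\<lambda>x. indicator K x *\<^sub>R f x)"
    using assms by (intro borel_integrable_compact continuous_on_subset[OF assms(1)]) auto
  also have "(\<lambda>x. indicator K x *\<^sub>R f x) = f" using assms(3) by (auto simp: fun_eq_iff indicator_def)
  finally show ?thesis .
qed

text \<open>A point outside \<open>W\<close> has the open set \<open>- K\<close>, where
  \<open>f\<close> vanishes, as a neighbourhood.\<close>

lemma smooth_zero_extension:
  fixes f :: "real^'n \<Rightarrow> real"
  assumes "open W" "smooth_on W f" "closed K" "K \<subseteq> W" "\<And>x. x \<notin> K \<Longrightarrow> f x = 0"
  shows "smooth_on UNIV f"
proof (rule smooth_on_local)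
  fix x
  show "\<exists>T. open T \<and> x \<in> T \<and> smooth_on T f"
  proof (cases "x \<in> W")
    case False
    have "smooth_on (- K) f"
      using smooth_on_cong[of "- K" f "\<lambda>x. 0"] assms(3,5) by (simp add: smooth_on_const open_Compl)
    then show ?thesis using assms(3,4) False by (intro exI[of _ "- K"]) (auto simp: open_Compl)
  qed (use assms in auto)
qed

lemma partial_deriv_zero_off:
  fixes f :: "real^'n \<Rightarrow> real"
  assumes "closed K" "\<And>x. x \<notin> K \<Longrightarrow> f x = 0" "x \<notin> K"
  shows "partial_deriv i f x = 0"
  using partial_deriv_cong[of "- K" x f "\<lambda>x. 0"] assms by (simp add: open_Compl)

lemma integral_partial_deriv_compact_support:
  fixes F :: "real^'n \<Rightarrow> real"
  assumes "smooth_on UNIV F" "compact K" "\<And>x. x \<notin> K \<Longrightarrow> F x = 0"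
  shows "integrable lborel (partial_deriv i F)" "(LINT x|lborel. partial_deriv i F x) = 0"
proof -
  note K = compact_imp_closed[OF assms(2)]
  show *: "integrable lborel (partial_deriv i F)"
    using partial_deriv_zero_off[OF K assms(3)] assms
    by (intro integrable_compact_support[where K=K] smooth_on_continuous_on smooth_on_partial_deriv)
  show "(LINT x|lborel. partial_deriv i F x) = 0"
    using assms by (intro integral_partial_deriv_zero * integrable_compact_support[where K=K] smooth_on_continuous_on)
qed

lemma test_functionD:
  assumes "test_function W \<psi>"
  shows "smooth_on UNIV \<psi>" "compact (closure {x. \<psi> x \<noteq> 0})" "closure {x. \<psi> x \<noteq> 0} \<subseteq> W"
    "\<And>x. x \<notin> closure {x. \<psi> x \<noteq> 0} \<Longrightarrow> \<psi> x = 0"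
  using assms closure_subset[of "{x. \<psi> x \<noteq> 0}"] by (auto simp: test_function_def)

lemma compact_closed_subset: "compact S \<Longrightarrow> T \<subseteq> S \<Longrightarrow> closed T \<Longrightarrow> compact T"
  using compact_Int_closed[of S T] by (simp add: Int_absorb1)

lemma test_functionI:
  assumes "smooth_on UNIV \<psi>" "compact K" "K \<subseteq> W" "\<And>x. x \<notin> K \<Longrightarrow> \<psi> x = 0"
  shows "test_function W \<psi>"
proof -
  have "closure {x. \<psi> x \<noteq> 0} \<subseteq> K"
    using assms by (intro closure_minimal compact_imp_closed) auto
  then show ?thesis
    using assms compact_closed_subset[OF assms(2) _ closed_closure] by (simp add: test_function_def)
qed

lemma weak_partial_deriv_smooth:
  fixes u :: "real^'n \<Rightarrow> real"
  assumes W: "open W" and u: "smooth_on W u"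
  shows "weak_partial_deriv W i u (partial_deriv i u)"
proof -
  have li: "locally_integrable_on W v" if "smooth_on W v" for v :: "real^'n \<Rightarrow> real"
    unfolding locally_integrable_on_def set_integrable_def
    by (intro allI impI borel_integrable_compact continuous_on_subset[OF smooth_on_continuous_on[OF that]])
  have "(LINT x:W|lborel. u x * partial_deriv i \<psi> x) = - (LINT x:W|lborel. partial_deriv i u x * \<psi> x)"
    if "test_function W \<psi>" for \<psi>
  proof -
    note \<psi> = test_functionD[OF that]
    let ?K = "closure {x. \<psi> x \<noteq> 0}"
    \<comment> \<open>The functions \<open>v\<close> are arbitrary off \<open>W\<close>. The
      indicator turns their products with functions supported in \<open>?K\<close> into globally
      smooth functions, to which the integral theorems apply.\<close>
    have ext: "smooth_on UNIV (\<lambda>x. indicator W x * (v x * w x))"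
      if "smooth_on W v" "smooth_on UNIV w" "\<And>x. x \<notin> ?K \<Longrightarrow> w x = 0" for v w :: "real^'n \<Rightarrow> real"
    proof (rule smooth_zero_extension[OF W _ closed_closure \<psi>(3)])
      have "smooth_on W (\<lambda>x. v x * w x)"
        using that(1) smooth_on_subset[OF that(2), of W] by (intro smooth_on_mult W) auto
      then show "smooth_on W (\<lambda>x. indicator W x * (v x * w x))"
        using smooth_on_cong[OF W, of "\<lambda>x. indicator W x * (v x * w x)" "\<lambda>x. v x * w x"] by simp
    qed (use that in auto)
    have d\<psi>: "partial_deriv i \<psi> x = 0" if "x \<notin> ?K" for x
      by (rule partial_deriv_zero_off[OF closed_closure \<psi>(4) that])
    let ?F = "\<lambda>x. indicator W x * (u x * \<psi> x)"
    have F: "smooth_on UNIV ?F" by (rule ext[OF u \<psi>(1) \<psi>(4)])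
    have F0: "?F x = 0" if "x \<notin> ?K" for x using \<psi>(4)[OF that] by simp
    have i1: "integrable lborel (\<lambda>x. indicator W x * (u x * partial_deriv i \<psi> x))"
    proof (rule integrable_compact_support[OF smooth_on_continuous_on \<psi>(2)])
      show "smooth_on UNIV (\<lambda>x. indicator W x * (u x * partial_deriv i \<psi> x))"
        by (rule ext[OF u smooth_on_partial_deriv[OF \<psi>(1)] d\<psi>])
      fix x assume "x \<notin> ?K"
      from d\<psi>[OF this] show "indicator W x * (u x * partial_deriv i \<psi> x) = 0" by simp
    qed
    have i2: "integrable lborel (\<lambda>x. indicator W x * (partial_deriv i u x * \<psi> x))"
    proof (rule integrable_compact_support[OF smooth_on_continuous_on \<psi>(2)])
      show "smooth_on UNIV (\<lambda>x. indicator W x * (partial_deriv i u x * \<psi> x))"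
        by (rule ext[OF smooth_on_partial_deriv[OF u] \<psi>(1) \<psi>(4)])
      fix x assume "x \<notin> ?K"
      from \<psi>(4)[OF this] show "indicator W x * (partial_deriv i u x * \<psi> x) = 0" by simp
    qed
    have "partial_deriv i ?F x = indicator W x * (u x * partial_deriv i \<psi> x) + indicator W x * (partial_deriv i u x * \<psi> x)" for x
    proof (cases "x \<in> W")
      case True
      have "partial_deriv i ?F x = partial_deriv i (\<lambda>x. u x * \<psi> x) x"
        by (rule partial_deriv_cong[OF W True]) simp
      then show ?thesis
        using True smooth_on_differentiable[OF u True] smooth_on_differentiable[OF \<psi>(1), of x]
        by (simp add: partial_deriv_mult)
    next
      case False
      then have "x \<notin> ?K" using \<psi>(3) by auto
      have "partial_deriv i ?F x = 0"
        by (rule partial_deriv_zero_off[OF closed_closure F0 \<open>x \<notin> ?K\<close>])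
      then show ?thesis using False by simp
    qed
    then have "(LINT x|lborel. indicator W x * (u x * partial_deriv i \<psi> x)) + (LINT x|lborel. indicator W x * (partial_deriv i u x * \<psi> x)) = 0"
      using integral_partial_deriv_compact_support(2)[OF F \<psi>(2) F0, of i] i1 i2
      by (simp add: Bochner_Integration.integral_add)
    then show ?thesis by (simp add: set_lebesgue_integral_def)
  qed
  then show ?thesis
    unfolding weak_partial_deriv_def using li[OF u] li[OF smooth_on_partial_deriv[OF u]] by blast
qed

lemma weak_partial_deriv_cong:
  assumes "\<And>x. x \<in> W \<Longrightarrow> u x = u' x" "\<And>x. x \<in> W \<Longrightarrow> v x = v' x"
  shows "weak_partial_deriv W i u v \<longleftrightarrow> weak_partial_deriv W i u' v'"
proof -
  have li: "locally_integrable_on W a \<longleftrightarrow> locally_integrable_on W b" if "\<And>x. x \<in> W \<Longrightarrow> a x = b x" for a b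
  proof -
    have "(\<lambda>x. indicator K x *\<^sub>R a x) = (\<lambda>x. indicator K x *\<^sub>R b x)" if "K \<subseteq> W" for K
      using that \<open>\<And>x. x \<in> W \<Longrightarrow> a x = b x\<close> by (auto simp: fun_eq_iff indicator_def)
    then show ?thesis unfolding locally_integrable_on_def set_integrable_def by auto
  qed
  have si: "(LINT x:W|lborel. a x * w x) = (LINT x:W|lborel. b x * w x)" if "\<And>x. x \<in> W \<Longrightarrow> a x = b x" for a b w
    unfolding set_lebesgue_integral_def using that by (intro Bochner_Integration.integral_cong) (auto simp: indicator_def)
  show ?thesis
    unfolding weak_partial_deriv_def using li[of u u'] li[of v v'] si[of u u'] si[of v v'] assms by simp
qed

section \<open>The logarithmic Sobolev inequality in a chart\<close>

text \<open>The last hypothesis of the theorem as a single formula, which can be handed from lemma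
  to lemma.\<close>

definition log_sobolev ::
    "('a::{t2_space, second_countable_topology}, 'n::finite) chart set \<Rightarrow> 'a metric \<Rightarrow> 'a set \<Rightarrow> real \<Rightarrow> bool" where
  "log_sobolev A g V \<tau>\<^sub>0 \<longleftrightarrow> (\<forall>f X \<tau>. f \<in> W12_0 A g V \<longrightarrow> weak_gradient A g V f X \<longrightarrow>
           (LINT p|volume_on A g V. (f p)\<^sup>2) = 1 \<longrightarrow> 0 < \<tau> \<longrightarrow> \<tau> < \<tau>\<^sub>0 \<longrightarrow>
           has_extended_integral (volume_on A g V) (\<lambda>p. (f p)\<^sup>2 * ln ((f p)\<^sup>2)) \<longrightarrow>
           extended_integral (volume_on A g V) (\<lambda>p. (f p)\<^sup>2 * ln ((f p)\<^sup>2))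
             \<le> ereal ((LINT p|volume_on A g V. 4 * \<tau> * g p (X p) (X p))
                  - real CARD('n) - real CARD('n) / 2 * ln (4 * pi * \<tau>)))"

text \<open>The squared length of the gradient of \<open>\<psi>\<close> for the metric with matrix
  \<open>G\<close>.\<close>

definition energy :: "(real^'n \<Rightarrow> real^'n^'n) \<Rightarrow> (real^'n \<Rightarrow> real) \<Rightarrow> real^'n \<Rightarrow> real" where
  "energy G \<psi> x = (\<Sum>i\<in>UNIV. \<Sum>k\<in>UNIV. matrix_inv (G x) $ k $ i * partial_deriv k \<psi> x * partial_deriv i \<psi> x)"

context riemannian
begin

text \<open>The differential of \<open>\<psi>\<close> with its index raised by the inverse metric.
  The zero derivation elsewhere matches the extension by zero \<open>ext\<close>.\<close>

definition grad :: "('a, 'b) chart \<Rightarrow> 'a set \<Rightarrow> (real^'b \<Rightarrow> real) \<Rightarrow> 'a \<Rightarrow> 'a tvec" where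
  "grad c V \<psi> p = (if p \<in> fst c \<inter> V then
     (\<lambda>h. \<Sum>i\<in>UNIV. (\<Sum>k\<in>UNIV. matrix_inv (gm c (snd c p)) $ k $ i * partial_deriv k \<psi> (snd c p)) * coord_vec A c i p h)
     else (\<lambda>h. 0))"

lemma grad_tangent: "c \<in> A \<Longrightarrow> grad c V \<psi> p \<in> tangent_space A p"
  by (auto simp: grad_def tangent_zero intro!: tangent_sum coord_vec_tangent)

lemma grad_coord:
  assumes c: "c \<in> A" and p: "p \<in> fst c" "p \<in> V"
  shows "g p (grad c V \<psi> p) (coord_vec A c j p) = partial_deriv j \<psi> (snd c p)"
proof -
  let ?x = "snd c p"
  note tan = coord_vec_tangent[OF c p(1)]
  have "matrix_inv (gm c ?x) ** gm c ?x = mat 1"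
    using gm_det_pos[OF c, of ?x] p by (intro matrix_inv_left) auto
  then have inv: "(\<Sum>i\<in>UNIV. matrix_inv (gm c ?x) $ k $ i * gm c ?x $ i $ j) = (if k = j then 1 else 0)" for k
    by (simp add: vec_eq_iff matrix_matrix_mult_def mat_def)
  have "g p (grad c V \<psi> p) (coord_vec A c j p)
    = (\<Sum>i\<in>UNIV. \<Sum>k\<in>UNIV. partial_deriv k \<psi> ?x * (matrix_inv (gm c ?x) $ k $ i * gm c ?x $ i $ j))"
    unfolding grad_def using p
    by (simp only: IntI if_True g_sum_left[OF finite tan tan] gm_at[OF c p(1)])
      (simp add: sum_distrib_right sum_distrib_left mult_ac)
  also have "\<dots> = (\<Sum>k\<in>UNIV. partial_deriv k \<psi> ?x * (\<Sum>i\<in>UNIV. matrix_inv (gm c ?x) $ k $ i * gm c ?x $ i $ j))"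
    by (subst sum.swap) (simp add: sum_distrib_left)
  also have "\<dots> = partial_deriv j \<psi> ?x"
    unfolding inv by (simp add: if_distrib cong: if_cong)
  finally show ?thesis .
qed

section \<open>Test functions of a chart as elements of the Sobolev space\<close>

context
  fixes c V \<psi>
  assumes c: "c \<in> A" and V: "open V" and \<psi>: "test_function (snd c ` (fst c \<inter> V)) \<psi>"
begin

private abbreviation "K \<equiv> closure {x. \<psi> x \<noteq> 0}"

lemma image_supp: "compact (chart_inv c ` K)" "chart_inv c ` K \<subseteq> fst c \<inter> V"
  and ext_supp: "p \<notin> chart_inv c ` K \<Longrightarrow> ext c \<psi> p = 0"
proof -
  note t = test_functionD[OF \<psi>]
  show "compact (chart_inv c ` K)"
    using t(2,3) by (intro compact_continuous_image continuous_on_subset[OF chart_continuous(2)[OF c]]) auto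
  show "chart_inv c ` K \<subseteq> fst c \<inter> V" using t(3) c by auto
  show "ext c \<psi> p = 0" if "p \<notin> chart_inv c ` K"
  proof (cases "p \<in> fst c")
    case True
    then have "snd c p \<notin> K" using that imageI[of "snd c p" K "chart_inv c"] chart_inv_left[OF c True] by auto
    from t(4)[OF this] show ?thesis by (simp add: ext_def)
  qed (simp add: ext_def)
qed

text \<open>The Hausdorff property is used here: the image of the compact support is closed in the
  manifold. Hence a point outside the domain of \<open>c\<close> has a whole neighbourhood on which
  the extension by zero vanishes, and smoothness needs to be checked only in the overlap of the
  charts.\<close>

lemma ext_chart_local:
  assumes d: "d \<in> A" and x: "x \<in> snd d ` fst d"
  obtains "x \<in> snd d ` (fst d \<inter> fst c)" "open (snd d ` (fst d \<inter> fst c))"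
      "\<And>y. y \<in> snd d ` (fst d \<inter> fst c) \<Longrightarrow> (ext c \<psi> \<circ> chart_inv d) y = \<psi> (snd c (chart_inv d y))"
  | T where "chart_inv d x \<notin> fst c" "open T" "x \<in> T" "\<And>y. y \<in> T \<Longrightarrow> (ext c \<psi> \<circ> chart_inv d) y = 0"
proof (cases "chart_inv d x \<in> fst c")
  case True
  have "x \<in> snd d ` (fst d \<inter> fst c)" unfolding chart_image_eq[OF d] using True x by auto
  moreover have "(ext c \<psi> \<circ> chart_inv d) y = \<psi> (snd c (chart_inv d y))" if "y \<in> snd d ` (fst d \<inter> fst c)" for y
    using that d by (auto simp: ext_def)
  ultimately show thesis using that(1) chart_image_open[OF d chart_open(1)[OF c]] by blast
next
  case False
  let ?N = "- chart_inv c ` K"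
  have N: "open ?N" using compact_imp_closed[OF image_supp(1)] by (rule open_Compl)
  have "x \<in> snd d ` (fst d \<inter> ?N)" unfolding chart_image_eq[OF d] using False x image_supp(2) by auto
  moreover have "(ext c \<psi> \<circ> chart_inv d) y = 0" if "y \<in> snd d ` (fst d \<inter> ?N)" for y
    using that d by (auto intro!: ext_supp)
  ultimately show thesis using that(2)[OF False chart_image_open[OF d N]] by blast
qed

lemma ext_Cc_infinity: "ext c \<psi> \<in> Cc_infinity A V"
proof -
  have "smooth_on (snd d ` (fst d \<inter> UNIV)) (ext c \<psi> \<circ> chart_inv d)" if d: "d \<in> A" for d
  proof (rule smooth_on_local)
    fix x assume "x \<in> snd d ` (fst d \<inter> UNIV)"
    then have "x \<in> snd d ` fst d" by simp
    with d show "\<exists>T. open T \<and> x \<in> T \<and> smooth_on T (ext c \<psi> \<circ> chart_inv d)"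
    proof (cases rule: ext_chart_local)
      case 1
      have "smooth_on (snd d ` (fst d \<inter> fst c)) (\<lambda>y. \<psi> (snd c (chart_inv d y)))"
        by (rule smooth_on_compose[OF 1(2) transition_smooth[OF d c] test_functionD(1)[OF \<psi>]]) simp
      then have "smooth_on (snd d ` (fst d \<inter> fst c)) (ext c \<psi> \<circ> chart_inv d)"
        by (subst smooth_on_cong[where h="\<lambda>y. \<psi> (snd c (chart_inv d y))", OF 1(2,3)])
      with 1 show ?thesis by blast
    next
      case (2 T)
      have "smooth_on T (ext c \<psi> \<circ> chart_inv d)"
        by (rule iffD2[OF smooth_on_cong[OF 2(2,4)] smooth_on_const])
      with 2 show ?thesis by blast
    qed
  qed
  moreover have "closure {p. ext c \<psi> p \<noteq> 0} \<subseteq> chart_inv c ` K"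
    using ext_supp compact_imp_closed[OF image_supp(1)] by (intro closure_minimal) auto
  ultimately show ?thesis
    using image_supp compact_closed_subset[OF image_supp(1)] unfolding Cc_infinity_def smooth_fun_on_def by auto
qed

lemma grad_all_coord:
  assumes d: "d \<in> A" and p: "p \<in> fst d" "p \<in> V"
  shows "g p (grad c V \<psi> p) (coord_vec A d i p) = partial_deriv i (ext c \<psi> \<circ> chart_inv d) (snd d p)"
proof -
  have x: "snd d p \<in> snd d ` fst d" using p by auto
  have T0: "chart_inv d (snd d p) = p" using d p by simp
  from d x show ?thesis
  proof (cases rule: ext_chart_local)
    case 1
    let ?T = "\<lambda>y. snd c (chart_inv d y)"
    have pc: "p \<in> fst c" using 1(1) d p unfolding chart_image_eq[OF d] by simp
    note tan = coord_vec_tangent[OF c pc]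
    have "partial_deriv i (ext c \<psi> \<circ> chart_inv d) (snd d p) = partial_deriv i (\<lambda>y. \<psi> (?T y)) (snd d p)"
      by (rule partial_deriv_cong[OF 1(2,1,3)])
    also have "\<dots> = (\<Sum>a\<in>UNIV. partial_deriv i (\<lambda>y. ?T y $ a) (snd d p) * partial_deriv a \<psi> (snd c p))"
      using partial_deriv_chain[OF smooth_on_differentiable[OF transition_smooth[OF d c] 1(1)]
        smooth_on_differentiable[OF test_functionD(1)[OF \<psi>]]] T0 by simp
    also have "\<dots> = g p (grad c V \<psi> p) (coord_vec A d i p)"
      unfolding coord_vec_change[OF c d pc p(1)]
      by (subst g_sum_right) (auto simp: tan grad_tangent c grad_coord pc p)
    finally show ?thesis by simp
  next
    case (2 T)
    have "partial_deriv i (ext c \<psi> \<circ> chart_inv d) (snd d p) = partial_deriv i (\<lambda>y. 0) (snd d p)"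
      by (rule partial_deriv_cong[OF 2(2-4)])
    then show ?thesis
      using 2(1) T0 by (simp add: grad_def g_zero coord_vec_tangent[OF d p(1)])
  qed
qed

lemma ext_weak_gradient: "weak_gradient A g V (ext c \<psi>) (grad c V \<psi>)"
  unfolding weak_gradient_def
proof (intro conjI ballI allI)
  show "grad c V \<psi> p \<in> tangent_space A p" for p by (rule grad_tangent[OF c])
  fix d i assume d: "d \<in> A"
  let ?W = "snd d ` (fst d \<inter> V)"
  have "smooth_on (snd d ` (fst d \<inter> UNIV)) (ext c \<psi> \<circ> chart_inv d)"
    using ext_Cc_infinity d unfolding Cc_infinity_def smooth_fun_on_def by blast
  then have "smooth_on ?W (ext c \<psi> \<circ> chart_inv d)" by (rule smooth_on_subset) auto
  from weak_partial_deriv_smooth[OF chart_image_open[OF d V] this]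
  have "weak_partial_deriv ?W i (ext c \<psi> \<circ> chart_inv d) (partial_deriv i (ext c \<psi> \<circ> chart_inv d))" .
  moreover have "partial_deriv i (ext c \<psi> \<circ> chart_inv d) x
    = ((\<lambda>p. g p (grad c V \<psi> p) (coord_vec A d i p)) \<circ> chart_inv d) x" if "x \<in> ?W" for x
    using that d grad_all_coord[OF d] by auto
  ultimately show "weak_partial_deriv ?W i (ext c \<psi> \<circ> chart_inv d)
      ((\<lambda>p. g p (grad c V \<psi> p) (coord_vec A d i p)) \<circ> chart_inv d)"
    using weak_partial_deriv_cong[of ?W] by blast
qed

lemma grad_energy: "g p (grad c V \<psi> p) (grad c V \<psi> p) = ext c (energy (gm c) \<psi>) p"
proof (cases "p \<in> fst c \<inter> V")
  case True
  then have p: "p \<in> fst c" "p \<in> V" by auto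
  note tan = coord_vec_tangent[OF c p(1)]
  have "g p (grad c V \<psi> p) (grad c V \<psi> p) = (\<Sum>i\<in>UNIV. (\<Sum>k\<in>UNIV. matrix_inv (gm c (snd c p)) $ k $ i * partial_deriv k \<psi> (snd c p)) *
     g p (grad c V \<psi> p) (coord_vec A c i p))"
    by (subst (2) grad_def) (use p in \<open>simp add: g_sum_right tan grad_tangent c\<close>)
  then show ?thesis
    using p by (simp add: grad_coord c ext_def energy_def sum_distrib_right)
next
  case False
  note t = test_functionD[OF \<psi>]
  have "ext c (energy (gm c) \<psi>) p = 0"
  proof (cases "p \<in> fst c")
    case True
    then have "p \<notin> V" using False by auto
    then have "snd c p \<notin> snd c ` (fst c \<inter> V)" unfolding chart_image_eq[OF c] using True c by simp
    then have "snd c p \<notin> K" using t(3) by blast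
    then have "partial_deriv i \<psi> (snd c p) = 0" for i
      by (intro partial_deriv_zero_off[OF closed_closure] t(4))
    then show ?thesis by (simp add: ext_def energy_def)
  qed (simp add: ext_def)
  moreover have "grad c V \<psi> p = (\<lambda>h. 0)" using False by (auto simp: grad_def)
  ultimately show ?thesis using g_zero[OF tangent_zero] by simp
qed

lemma compact_support_integrals:
  fixes u :: "real^'b \<Rightarrow> real"
  assumes u: "u \<in> borel_measurable borel" "\<And>x. x \<notin> K \<Longrightarrow> u x = 0" "bounded (range u)"
  shows "integrable lborel (\<lambda>x. u x * gdens c x)" "integrable (volume_on A g V) (ext c u)"
    and "(LINT p|volume_on A g V. ext c u p) = (LINT x|lborel. u x * gdens c x)"
proof -
  note t = test_functionD[OF \<psi>]
  have KU: "K \<subseteq> snd c ` fst c" using t(3) by auto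
  obtain C where C: "\<And>x. \<bar>u x\<bar> \<le> C" using u(3) by (auto simp: bounded_iff)
  have "integrable lborel (\<lambda>x. C * (indicator K x *\<^sub>R gdens c x))"
    by (intro integrable_mult_right borel_integrable_compact t(2) continuous_on_subset[OF gdens_continuous[OF c] KU])
  then show *: "integrable lborel (\<lambda>x. u x * gdens c x)"
  proof (rule Bochner_Integration.integrable_bound)
    have "(\<lambda>x. u x * (indicator K x * gdens c x)) \<in> borel_measurable lborel"
      using u(1) gdens_borel[OF c _ KU] by simp
    also have "(\<lambda>x. u x * (indicator K x * gdens c x)) = (\<lambda>x. u x * gdens c x)"
      using u(2) by (auto simp: fun_eq_iff indicator_def)
    finally show "(\<lambda>x. u x * gdens c x) \<in> borel_measurable lborel" .
    show "AE x in lborel. norm (u x * gdens c x) \<le> norm (C * (indicator K x *\<^sub>R gdens c x))"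
    proof (rule AE_I2)
      fix x
      show "norm (u x * gdens c x) \<le> norm (C * (indicator K x *\<^sub>R gdens c x))"
        using u(2)[of x] C[of x] by (cases "x \<in> K") (auto simp: abs_mult intro!: mult_right_mono)
    qed
  qed
  have supp: "u x = 0" if "x \<notin> snd c ` (fst c \<inter> V)" for x using u(2) t(3) that by auto
  show "integrable (volume_on A g V) (ext c u)"
    "(LINT p|volume_on A g V. ext c u p) = (LINT x|lborel. u x * gdens c x)"
    by (rule ext_integral[OF c V u(1) supp *]; assumption)+
qed


lemma ext_W12_0:
  shows "ext c \<psi> \<in> W12_0 A g V"
    and "integrable (volume_on A g V) (\<lambda>p. (ext c \<psi> p)\<^sup>2)"
    and "(LINT p|volume_on A g V. (ext c \<psi> p)\<^sup>2) = (LINT x|lborel. (\<psi> x)\<^sup>2 * gdens c x)"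
    and "(LINT p|volume_on A g V. g p (grad c V \<psi> p) (grad c V \<psi> p)) = (LINT x|lborel. energy (gm c) \<psi> x * gdens c x)"
    and "has_extended_integral (volume_on A g V) (\<lambda>p. (ext c \<psi> p)\<^sup>2 * ln ((ext c \<psi> p)\<^sup>2))"
    and "extended_integral (volume_on A g V) (\<lambda>p. (ext c \<psi> p)\<^sup>2 * ln ((ext c \<psi> p)\<^sup>2))
      = ereal (LINT x|lborel. (\<psi> x)\<^sup>2 * ln ((\<psi> x)\<^sup>2) * gdens c x)"
proof -
  note t = test_functionD[OF \<psi>]
  have cont: "continuous_on UNIV \<psi>" using t(1) by (rule smooth_on_continuous_on)
  have bdd: "bounded (range u)" if "continuous_on K u" "\<And>x. x \<notin> K \<Longrightarrow> u x = 0" for u :: "real^'b \<Rightarrow> real"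
  proof -
    have "bounded (insert 0 (u ` K))"
      using compact_imp_bounded[OF compact_continuous_image[OF that(1) t(2)]] by simp
    then show ?thesis by (rule bounded_subset) (use that(2) in auto)
  qed
  have m\<psi>: "\<psi> \<in> borel_measurable borel" using cont by (rule borel_measurable_continuous_onI)
  have e1: "(\<lambda>p. (ext c \<psi> p)\<^sup>2) = ext c (\<lambda>x. (\<psi> x)\<^sup>2)" by (auto simp: ext_def fun_eq_iff)
  have z1: "(\<psi> x)\<^sup>2 = 0" "(\<psi> x)\<^sup>2 * ln ((\<psi> x)\<^sup>2) = 0" if "x \<notin> K" for x
    using t(4)[OF that] by simp_all
  have c1: "integrable (volume_on A g V) (ext c (\<lambda>x. (\<psi> x)\<^sup>2))"
    "(LINT p|volume_on A g V. ext c (\<lambda>x. (\<psi> x)\<^sup>2) p) = (LINT x|lborel. (\<psi> x)\<^sup>2 * gdens c x)"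
    by (intro compact_support_integrals bdd z1 borel_measurable_power m\<psi> continuous_on_power continuous_on_subset[OF cont] subset_UNIV; assumption)+
  show i1: "integrable (volume_on A g V) (\<lambda>p. (ext c \<psi> p)\<^sup>2)"
    and "(LINT p|volume_on A g V. (ext c \<psi> p)\<^sup>2) = (LINT x|lborel. (\<psi> x)\<^sup>2 * gdens c x)"
    unfolding e1 by (rule c1)+
  have d\<psi>: "partial_deriv i \<psi> x = 0" if "x \<notin> K" for i x
    by (rule partial_deriv_zero_off[OF closed_closure t(4) that])
  have K: "K \<subseteq> snd c ` fst c" using t(3) by auto
  have z: "energy (gm c) \<psi> x = 0" if "x \<notin> K" for x using d\<psi>[OF that] by (simp add: energy_def)
  have ce: "continuous_on (snd c ` fst c) (energy (gm c) \<psi>)"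
    unfolding energy_def[abs_def] using gm_det_pos[OF c]
    by (intro smooth_on_continuous_on smooth_intros smooth_on_matrix_inv chart_open c gm_smooth)
      (auto intro: smooth_on_subset[OF t(1)] simp: less_imp_neq[symmetric])
  have me: "energy (gm c) \<psi> \<in> borel_measurable borel"
  proof -
    have "(\<lambda>x. indicator K x *\<^sub>R energy (gm c) \<psi> x) \<in> borel_measurable borel"
      by (intro borel_measurable_continuous_on_indicator continuous_on_subset[OF ce K]) simp
    also have "(\<lambda>x. indicator K x *\<^sub>R energy (gm c) \<psi> x) = energy (gm c) \<psi>"
      using z by (auto simp: fun_eq_iff indicator_def)
    finally show ?thesis .
  qed
  have c2: "integrable (volume_on A g V) (ext c (energy (gm c) \<psi>))"
    "(LINT p|volume_on A g V. ext c (energy (gm c) \<psi>) p) = (LINT x|lborel. energy (gm c) \<psi> x * gdens c x)"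
    by (intro compact_support_integrals bdd me z continuous_on_subset[OF ce K]; assumption)+
  have i2: "integrable (volume_on A g V) (\<lambda>p. g p (grad c V \<psi> p) (grad c V \<psi> p))"
    unfolding grad_energy by (rule c2)
  show "(LINT p|volume_on A g V. g p (grad c V \<psi> p) (grad c V \<psi> p)) = (LINT x|lborel. energy (gm c) \<psi> x * gdens c x)"
    unfolding grad_energy by (rule c2)
  have e3: "(\<lambda>p. (ext c \<psi> p)\<^sup>2 * ln ((ext c \<psi> p)\<^sup>2)) = ext c (\<lambda>x. (\<psi> x)\<^sup>2 * ln ((\<psi> x)\<^sup>2))"
    by (auto simp: ext_def fun_eq_iff)
  have "bounded (range (\<lambda>x. (\<psi> x)\<^sup>2 * ln ((\<psi> x)\<^sup>2)))"
  proof -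
    obtain C where C: "\<And>x. \<bar>\<psi> x\<bar> \<le> C"
      using bdd[OF continuous_on_subset[OF cont] t(4)] by (auto simp: bounded_iff)
    \<comment> \<open>The upper bound comes from \<open>ln s \<le> s - 1\<close>, the lower one from
      the same inequality at \<open>1 / s\<close>.\<close>
    have "\<bar>s * ln s\<bar> \<le> 1 + C\<^sup>2 * C\<^sup>2" if s: "0 \<le> s" "s \<le> C\<^sup>2" for s :: real
    proof (cases "s = 0")
      case False
      then have s0: "s > 0" using s by simp
      have "ln s \<le> s" using ln_le_minus_one[OF s0] by simp
      then have 1: "s * ln s \<le> C\<^sup>2 * C\<^sup>2" using s s0 by (meson mult_left_mono mult_mono order_trans less_imp_le)
      have "- ln s \<le> 1 / s" using ln_le_minus_one[of "1/s"] s0 by (simp add: ln_div)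
      then have "s * (- ln s) \<le> s * (1 / s)" using s0 by (intro mult_left_mono) auto
      then have "- (s * ln s) \<le> 1" using s0 by simp
      with 1 show ?thesis by (simp add: abs_le_iff add_increasing add_increasing2)
    qed simp
    moreover have "(\<psi> x)\<^sup>2 \<le> C\<^sup>2" for x using C[of x] power_mono[OF C[of x], of 2] by simp
    ultimately show ?thesis unfolding bounded_iff by (intro exI[of _ "1 + C\<^sup>2 * C\<^sup>2"]) auto
  qed
  note bd3 = this
  have m3: "(\<lambda>x. (\<psi> x)\<^sup>2 * ln ((\<psi> x)\<^sup>2)) \<in> borel_measurable borel" using m\<psi> by measurable
  have c3: "integrable (volume_on A g V) (ext c (\<lambda>x. (\<psi> x)\<^sup>2 * ln ((\<psi> x)\<^sup>2)))"
    "(LINT p|volume_on A g V. ext c (\<lambda>x. (\<psi> x)\<^sup>2 * ln ((\<psi> x)\<^sup>2)) p) = (LINT x|lborel. (\<psi> x)\<^sup>2 * ln ((\<psi> x)\<^sup>2) * gdens c x)"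
    by (rule compact_support_integrals[OF m3 z1(2) bd3]; assumption)+
  show "has_extended_integral (volume_on A g V) (\<lambda>p. (ext c \<psi> p)\<^sup>2 * ln ((ext c \<psi> p)\<^sup>2))"
    "extended_integral (volume_on A g V) (\<lambda>p. (ext c \<psi> p)\<^sup>2 * ln ((ext c \<psi> p)\<^sup>2))
      = ereal (LINT x|lborel. (\<psi> x)\<^sup>2 * ln ((\<psi> x)\<^sup>2) * gdens c x)"
    unfolding e3 using extended_integral_integrable[OF c3(1)] c3(2) by simp_all
  \<comment> \<open>The function lies in \<open>Cc_infinity\<close> itself and serves as its own
    approximant, so the closure condition of \<open>W12_0\<close> needs only the zero gradient of a
    zero difference.\<close>
  have wz: "weak_gradient A g V (\<lambda>p. ext c \<psi> p - ext c \<psi> p) (\<lambda>p f. 0)"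
    unfolding weak_gradient_def
  proof (intro conjI ballI allI)
    fix d i assume d: "d \<in> A"
    have "weak_partial_deriv (snd d ` (fst d \<inter> V)) i (\<lambda>x. 0) (partial_deriv i (\<lambda>x. 0))"
      by (rule weak_partial_deriv_smooth[OF chart_image_open[OF d V] smooth_on_const])
    then show "weak_partial_deriv (snd d ` (fst d \<inter> V)) i ((\<lambda>p. ext c \<psi> p - ext c \<psi> p) \<circ> chart_inv d)
         ((\<lambda>p. g p (\<lambda>f. 0) (coord_vec A d i p)) \<circ> chart_inv d)"
    proof (rule iffD1[OF weak_partial_deriv_cong, rotated -1])
      fix x assume "x \<in> snd d ` (fst d \<inter> V)"
      then have "chart_inv d x \<in> fst d" using d by auto
      from g_zero[OF coord_vec_tangent[OF d this]]
      show "partial_deriv i (\<lambda>x. 0) x = ((\<lambda>p. g p (\<lambda>f. 0) (coord_vec A d i p)) \<circ> chart_inv d) x" by simp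
    qed simp
  qed (simp add: tangent_zero)
  have "ext c \<psi> \<in> borel_measurable (volume_on A g V)"
    unfolding volume_on_def using ext_measurable[OF c m\<psi>] by (intro measurable_restrict_space1) simp
  then have "ext c \<psi> \<in> W12 A g V"
    unfolding W12_def using i1 i2 ext_weak_gradient by blast
  moreover have "\<exists>\<phi>\<in>Cc_infinity A V. \<exists>Z. weak_gradient A g V (\<lambda>p. ext c \<psi> p - \<phi> p) Z \<and>
     (\<integral>\<^sup>+p. ennreal ((ext c \<psi> p - \<phi> p)\<^sup>2) \<partial>volume_on A g V) +
     (\<integral>\<^sup>+p. ennreal (g p (Z p) (Z p)) \<partial>volume_on A g V) < ennreal \<epsilon>" if "\<epsilon> > 0" for \<epsilon>
    using that wz g_zero[OF tangent_zero]
    by (intro bexI[OF _ ext_Cc_infinity] exI[of _ "\<lambda>p f. 0"]) simp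
  ultimately show "ext c \<psi> \<in> W12_0 A g V" unfolding W12_0_def by simp
qed

lemma log_sobolev_chart:
  assumes "log_sobolev A g V \<tau>\<^sub>0" "(LINT x|lborel. (\<psi> x)\<^sup>2 * gdens c x) = 1" "0 < \<tau>" "\<tau> < \<tau>\<^sub>0"
  shows "(LINT x|lborel. (\<psi> x)\<^sup>2 * ln ((\<psi> x)\<^sup>2) * gdens c x)
    \<le> 4 * \<tau> * (LINT x|lborel. energy (gm c) \<psi> x * gdens c x) - real CARD('b) - real CARD('b) / 2 * ln (4 * pi * \<tau>)"
proof -
  have "extended_integral (volume_on A g V) (\<lambda>p. (ext c \<psi> p)\<^sup>2 * ln ((ext c \<psi> p)\<^sup>2))
             \<le> ereal ((LINT p|volume_on A g V. 4 * \<tau> * g p (grad c V \<psi> p) (grad c V \<psi> p))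
                  - real CARD('b) - real CARD('b) / 2 * ln (4 * pi * \<tau>))"
    using assms(1)[unfolded log_sobolev_def, rule_format, OF ext_W12_0(1) ext_weak_gradient _ assms(3,4) ext_W12_0(5)]
      ext_W12_0(3) assms(2) by simp
  then show ?thesis unfolding ext_W12_0(6) by (simp add: ext_W12_0(4) mult.assoc)
qed

end

end

section \<open>Curvature in coordinates\<close>

text \<open>The curvature formulas are restated for a bare matrix field, because the coordinate
  changes below produce metric matrices that need not belong to a chart of the atlas.\<close>

definition Gam :: "(real^'n \<Rightarrow> real^'n^'n) \<Rightarrow> 'n \<Rightarrow> 'n \<Rightarrow> 'n \<Rightarrow> real^'n \<Rightarrow> real" where
  "Gam G k i j x = (1/2) * (\<Sum>l\<in>UNIV. matrix_inv (G x) $ k $ l *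
       (partial_deriv i (\<lambda>y. G y $ j $ l) x + partial_deriv j (\<lambda>y. G y $ i $ l) x - partial_deriv l (\<lambda>y. G y $ i $ j) x))"

definition Riem :: "(real^'n \<Rightarrow> real^'n^'n) \<Rightarrow> 'n \<Rightarrow> 'n \<Rightarrow> 'n \<Rightarrow> 'n \<Rightarrow> real^'n \<Rightarrow> real" where
  "Riem G l k i j x = partial_deriv i (Gam G l j k) x - partial_deriv j (Gam G l i k) x +
     (\<Sum>m\<in>UNIV. Gam G l i m x * Gam G m j k x - Gam G l j m x * Gam G m i k x)"

definition Scal :: "(real^'n \<Rightarrow> real^'n^'n) \<Rightarrow> real^'n \<Rightarrow> real" where
  "Scal G x = (\<Sum>j\<in>UNIV. \<Sum>k\<in>UNIV. matrix_inv (G x) $ j $ k * (\<Sum>i\<in>UNIV. Riem G i k i j x))"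

lemma christoffel_Gam: "christoffel A g c = Gam (metric_matrix A g c)"
  by (intro ext) (simp add: christoffel_def Gam_def)

lemma riemann_Riem: "riemann A g c = Riem (metric_matrix A g c)"
  by (intro ext) (simp add: riemann_def Riem_def christoffel_Gam)

section \<open>Christoffel calculus of a metric on an open set\<close>

locale metric_field =
  fixes \<Omega> :: "(real^'n) set" and G :: "real^'n \<Rightarrow> real^'n^'n"
  assumes op: "open \<Omega>" and smooth: "\<And>i j. smooth_on \<Omega> (\<lambda>x. G x $ i $ j)"
    and pos: "\<And>x. x \<in> \<Omega> \<Longrightarrow> pos_def (G x)"
begin

abbreviation "Gi x \<equiv> matrix_inv (G x)"

lemma det_pos: "x \<in> \<Omega> \<Longrightarrow> det (G x) > 0"
  by (intro pos_def_det pos)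

lemma det_nz: "x \<in> \<Omega> \<Longrightarrow> det (G x) \<noteq> 0"
  using det_pos by force

lemma G_sym: "x \<in> \<Omega> \<Longrightarrow> G x $ i $ j = G x $ j $ i"
proof -
  assume "x \<in> \<Omega>"
  then have "transpose (G x) = G x" using pos[of x] by (simp add: pos_def_def)
  from arg_cong[OF this, of "\<lambda>M. M $ j $ i"] show ?thesis by (simp add: transpose_def)
qed

lemma Gi_smooth: "smooth_on \<Omega> (\<lambda>x. Gi x $ i $ j)"
  by (intro smooth_on_matrix_inv op smooth det_nz)

lemma G_Gi: "x \<in> \<Omega> \<Longrightarrow> (\<Sum>j\<in>UNIV. G x $ i $ j * Gi x $ j $ k) = (if i = k then 1 else 0)"
  using matrix_inv_right[OF det_nz, of x] by (simp add: vec_eq_iff matrix_matrix_mult_def mat_def)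

lemma Gi_G: "x \<in> \<Omega> \<Longrightarrow> (\<Sum>j\<in>UNIV. Gi x $ i $ j * G x $ j $ k) = (if i = k then 1 else 0)"
  using matrix_inv_left[OF det_nz, of x] by (simp add: vec_eq_iff matrix_matrix_mult_def mat_def)

lemma Gi_sym: "x \<in> \<Omega> \<Longrightarrow> Gi x $ i $ j = Gi x $ j $ i"
proof -
  assume x: "x \<in> \<Omega>"
  have "transpose (G x) = G x" using pos[OF x] by (simp add: pos_def_def)
  then have "transpose (Gi x) ** G x = mat 1"
    by (metis matrix_inv_right[OF det_nz[OF x]] matrix_transpose_mul transpose_mat)
  then have "transpose (Gi x) = Gi x"
    by (metis matrix_inv_right[OF det_nz[OF x]] matrix_mul_assoc matrix_mul_lid matrix_mul_rid)
  from arg_cong[OF this, of "\<lambda>M. M $ j $ i"] show ?thesis by (simp add: transpose_def)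
qed

definition dG :: "'n \<Rightarrow> 'n \<Rightarrow> 'n \<Rightarrow> real^'n \<Rightarrow> real" where
  "dG k i j x = partial_deriv k (\<lambda>y. G y $ i $ j) x"

lemma dG_smooth: "smooth_on \<Omega> (dG k i j)"
  unfolding dG_def[abs_def] by (intro smooth_on_partial_deriv smooth)

lemma dG_sym: "x \<in> \<Omega> \<Longrightarrow> dG k i j x = dG k j i x"
  unfolding dG_def by (rule partial_deriv_cong[OF op]) (auto intro: G_sym)

text \<open>The Christoffel symbols of the first kind.\<close>

definition lowGam :: "'n \<Rightarrow> 'n \<Rightarrow> 'n \<Rightarrow> real^'n \<Rightarrow> real" where
  "lowGam l i j x = (1/2) * (dG i j l x + dG j i l x - dG l i j x)"

lemma Gam_low: "Gam G k i j x = (\<Sum>l\<in>UNIV. Gi x $ k $ l * lowGam l i j x)"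
  by (simp add: Gam_def lowGam_def dG_def sum_distrib_left mult_ac)

lemma Gam_smooth: "smooth_on \<Omega> (Gam G k i j)"
  unfolding Gam_low[abs_def] lowGam_def by (intro smooth_intros op Gi_smooth dG_smooth)

lemma Gam_sym: "x \<in> \<Omega> \<Longrightarrow> Gam G k i j x = Gam G k j i x"
  unfolding Gam_low lowGam_def using dG_sym[of x] by (simp add: add.commute)

lemma low_Gam: "x \<in> \<Omega> \<Longrightarrow> (\<Sum>k\<in>UNIV. G x $ l $ k * Gam G k i j x) = lowGam l i j x"
proof -
  assume x: "x \<in> \<Omega>"
  have "(\<Sum>k\<in>UNIV. G x $ l $ k * Gam G k i j x) = (\<Sum>k\<in>UNIV. \<Sum>m\<in>UNIV. G x $ l $ k * Gi x $ k $ m * lowGam m i j x)"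
    by (simp add: Gam_low sum_distrib_left mult.assoc)
  also have "\<dots> = (\<Sum>m\<in>UNIV. (\<Sum>k\<in>UNIV. G x $ l $ k * Gi x $ k $ m) * lowGam m i j x)"
    by (subst sum.swap) (simp add: sum_distrib_right)
  also have "\<dots> = lowGam l i j x"
    by (simp add: G_Gi[OF x] if_distrib[of "\<lambda>a. a * _"] cong: if_cong)
  finally show ?thesis .
qed

text \<open>This is the compatibility of the Levi-Civita connection with the metric, in lowered
  form.\<close>

lemma dG_low: "x \<in> \<Omega> \<Longrightarrow> dG k i j x = lowGam j k i x + lowGam i k j x"
  using dG_sym[of x k j i] by (simp add: lowGam_def field_simps)

lemma diffable: "smooth_on \<Omega> f \<Longrightarrow> x \<in> \<Omega> \<Longrightarrow> f differentiable (at x)"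
  by (rule smooth_on_differentiable)

text \<open>Differentiate \<open>G ** Gi = 1\<close> and solve for the derivative of the
  inverse.\<close>

lemma dGi_aux:
  assumes x: "x \<in> \<Omega>"
  shows "partial_deriv k (\<lambda>y. Gi y $ i $ j) x = - (\<Sum>a\<in>UNIV. \<Sum>b\<in>UNIV. Gi x $ i $ a * dG k a b x * Gi x $ b $ j)"
proof -
  let ?d = "\<lambda>a. partial_deriv k (\<lambda>y. Gi y $ a $ j) x"
  note D = diffable[OF smooth x] diffable[OF Gi_smooth x]
  have z: "(\<Sum>b\<in>UNIV. dG k a b x * Gi x $ b $ j) + (\<Sum>b\<in>UNIV. G x $ a $ b * ?d b) = 0" for a
  proof -
    have "partial_deriv k (\<lambda>y. \<Sum>b\<in>UNIV. G y $ a $ b * Gi y $ b $ j) x = partial_deriv k (\<lambda>y. if a = j then 1 else 0) x"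
      by (rule partial_deriv_cong[OF op x]) (rule G_Gi)
    then show ?thesis
      using D by (simp add: partial_deriv_sum partial_deriv_mult dG_def sum.distrib)
  qed
  have "?d i = (\<Sum>b\<in>UNIV. (\<Sum>a\<in>UNIV. Gi x $ i $ a * G x $ a $ b) * ?d b)"
    by (simp add: Gi_G[OF x] if_distrib[of "\<lambda>a. a * _"] cong: if_cong)
  also have "\<dots> = (\<Sum>a\<in>UNIV. Gi x $ i $ a * (\<Sum>b\<in>UNIV. G x $ a $ b * ?d b))"
    unfolding sum_distrib_right by (subst sum.swap) (simp add: sum_distrib_left mult.assoc)
  also have "\<dots> = (\<Sum>a\<in>UNIV. Gi x $ i $ a * - (\<Sum>b\<in>UNIV. dG k a b x * Gi x $ b $ j))"
    using z by (simp add: add_eq_0_iff)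
  finally show ?thesis by (simp add: sum_distrib_left sum_negf mult.assoc)
qed

lemma dGi:
  assumes x: "x \<in> \<Omega>"
  shows "partial_deriv k (\<lambda>y. Gi y $ i $ j) x = - (\<Sum>l\<in>UNIV. Gam G i k l x * Gi x $ l $ j) - (\<Sum>l\<in>UNIV. Gam G j k l x * Gi x $ i $ l)"
proof -
  have "(\<Sum>a\<in>UNIV. \<Sum>b\<in>UNIV. Gi x $ i $ a * dG k a b x * Gi x $ b $ j)
    = (\<Sum>a\<in>UNIV. \<Sum>b\<in>UNIV. Gi x $ i $ a * lowGam a k b x * Gi x $ b $ j) + (\<Sum>a\<in>UNIV. \<Sum>b\<in>UNIV. Gi x $ i $ a * (Gi x $ j $ b * lowGam b k a x))"
    using Gi_sym[OF x, of _ j] by (simp add: dG_low[OF x] algebra_simps sum.distrib)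
  also have "(\<Sum>a\<in>UNIV. \<Sum>b\<in>UNIV. Gi x $ i $ a * lowGam a k b x * Gi x $ b $ j) = (\<Sum>l\<in>UNIV. Gam G i k l x * Gi x $ l $ j)"
    by (subst sum.swap) (simp add: Gam_low sum_distrib_right)
  also have "(\<Sum>a\<in>UNIV. \<Sum>b\<in>UNIV. Gi x $ i $ a * (Gi x $ j $ b * lowGam b k a x)) = (\<Sum>l\<in>UNIV. Gam G j k l x * Gi x $ i $ l)"
    by (simp add: Gam_low sum_distrib_right sum_distrib_left mult_ac)
  finally show ?thesis by (simp add: dGi_aux[OF x])
qed

text \<open>The partial derivative of \<open>ln (sqrt (det (G x)))\<close> in direction
  \<open>k\<close>, by \<open>partial_deriv_det\<close>; the trace of the Christoffel symbols is the
  form in which it enters the curvature.\<close>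

definition w :: "'n \<Rightarrow> real^'n \<Rightarrow> real" where "w k x = (\<Sum>l\<in>UNIV. Gam G l l k x)"

lemma w_smooth: "smooth_on \<Omega> (w k)"
  unfolding w_def[abs_def] by (intro smooth_intros op Gam_smooth)

lemma w_trace:
  assumes x: "x \<in> \<Omega>"
  shows "w k x = (1/2) * (\<Sum>i\<in>UNIV. \<Sum>j\<in>UNIV. Gi x $ i $ j * dG k i j x)"
proof -
  have sw: "(\<Sum>i\<in>UNIV. \<Sum>j\<in>UNIV. Gi x $ i $ j * dG i k j x) = (\<Sum>i\<in>UNIV. \<Sum>j\<in>UNIV. Gi x $ i $ j * dG j k i x)"
    by (subst sum.swap) (simp add: Gi_sym[OF x])
  have "w k x = (1/2) * ((\<Sum>i\<in>UNIV. \<Sum>j\<in>UNIV. Gi x $ i $ j * dG i k j x) + (\<Sum>i\<in>UNIV. \<Sum>j\<in>UNIV. Gi x $ i $ j * dG k i j x)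
    - (\<Sum>i\<in>UNIV. \<Sum>j\<in>UNIV. Gi x $ i $ j * dG j k i x))"
    using dG_sym[OF x, of _ _ k]
    by (simp add: w_def Gam_low lowGam_def sum_distrib_left sum.distrib sum_subtractf algebra_simps)
  then show ?thesis unfolding sw by simp
qed

text \<open>Minus the Laplacian of the \<open>i\<close>-th coordinate function.\<close>

definition Gc :: "'n \<Rightarrow> real^'n \<Rightarrow> real" where
  "Gc i x = (\<Sum>j\<in>UNIV. \<Sum>k\<in>UNIV. Gi x $ j $ k * Gam G i j k x)"

lemma Gc_smooth: "smooth_on \<Omega> (Gc i)"
  unfolding Gc_def[abs_def] by (intro smooth_intros op Gam_smooth Gi_smooth)

text \<open>The quadratic expression in the Christoffel symbols that remains beside the scalar
  curvature after integration by parts; see \<open>e1_near\<close>.\<close>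

definition GG :: "real^'n \<Rightarrow> real" where
  "GG x = (\<Sum>i\<in>UNIV. \<Sum>j\<in>UNIV. \<Sum>k\<in>UNIV. \<Sum>l\<in>UNIV. Gi x $ i $ j * Gam G k i l x * Gam G l j k x)"

text \<open>Second derivatives of the metric are confined to a coordinate divergence, so that
  integration by parts against the Gaussian removes them. Of the two remaining quadratic terms the
  one in \<open>w\<close> is what the energy of the amplitude produces, and it will cancel.\<close>

lemma Scal_identity:
  assumes x: "x \<in> \<Omega>"
  shows "Scal G x = (\<Sum>i\<in>UNIV. partial_deriv i (\<lambda>y. Gc i y - (\<Sum>k\<in>UNIV. Gi y $ i $ k * w k y)) x)
    - (\<Sum>i\<in>UNIV. \<Sum>j\<in>UNIV. Gi x $ i $ j * w i x * w j x) + GG x"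
proof -
  note D = diffable[OF Gam_smooth x] diffable[OF Gi_smooth x] diffable[OF w_smooth x] diffable[OF Gc_smooth x]
  define dGam where "dGam a i j k = partial_deriv a (Gam G i j k) x" for a i j k
  define dw where "dw a k = partial_deriv a (w k) x" for a k
  define dH where "dH a i j = partial_deriv a (\<lambda>y. Gi y $ i $ j) x" for a i j
  let ?\<Gamma> = "\<lambda>k i j. Gam G k i j x"
  have dw: "dw j k = (\<Sum>i\<in>UNIV. dGam j i i k)" for j k
    unfolding dw_def dGam_def w_def[abs_def] using D by (subst partial_deriv_sum) auto
  have ws: "w m x = (\<Sum>i\<in>UNIV. ?\<Gamma> i i m)" for m by (simp add: w_def)
  have dH: "dH k i j = - (\<Sum>l\<in>UNIV. ?\<Gamma> i k l * Gi x $ l $ j) - (\<Sum>l\<in>UNIV. ?\<Gamma> j k l * Gi x $ i $ l)" for k i j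
    unfolding dH_def by (rule dGi[OF x])
  have S1: "Scal G x = (\<Sum>j\<in>UNIV. \<Sum>k\<in>UNIV. \<Sum>i\<in>UNIV. Gi x $ j $ k * dGam i i j k)
     - (\<Sum>j\<in>UNIV. \<Sum>k\<in>UNIV. Gi x $ j $ k * dw j k) + (\<Sum>m\<in>UNIV. w m x * Gc m x)
     - (\<Sum>j\<in>UNIV. \<Sum>k\<in>UNIV. \<Sum>i\<in>UNIV. \<Sum>m\<in>UNIV. Gi x $ j $ k * ?\<Gamma> i j m * ?\<Gamma> m i k)"
  proof -
    have a: "(\<Sum>i\<in>UNIV. Riem G i k i j x) = (\<Sum>i\<in>UNIV. dGam i i j k) - dw j k + (\<Sum>m\<in>UNIV. w m x * ?\<Gamma> m j k)
        - (\<Sum>i\<in>UNIV. \<Sum>m\<in>UNIV. ?\<Gamma> i j m * ?\<Gamma> m i k)" for j k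
    proof -
      have "(\<Sum>m\<in>UNIV. w m x * ?\<Gamma> m j k) = (\<Sum>i\<in>UNIV. \<Sum>m\<in>UNIV. ?\<Gamma> i i m * ?\<Gamma> m j k)"
        by (subst sum.swap) (simp add: ws sum_distrib_right)
      then show ?thesis
        by (simp add: Riem_def dw dGam_def sum.distrib sum_subtractf)
    qed
    have b: "(\<Sum>m\<in>UNIV. w m x * Gc m x) = (\<Sum>j\<in>UNIV. \<Sum>k\<in>UNIV. \<Sum>m\<in>UNIV. Gi x $ j $ k * (w m x * ?\<Gamma> m j k))"
      unfolding Gc_def sum_distrib_left
      by (subst sum.swap, rule sum.cong[OF refl], subst sum.swap) (simp add: mult_ac)
    show ?thesis
      unfolding Scal_def a b
      by (simp add: algebra_simps sum.distrib sum_subtractf sum_distrib_left)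
  qed
  have V: "(\<Sum>i\<in>UNIV. partial_deriv i (\<lambda>y. Gc i y - (\<Sum>k\<in>UNIV. Gi y $ i $ k * w k y)) x)
     = (\<Sum>i\<in>UNIV. \<Sum>j\<in>UNIV. \<Sum>k\<in>UNIV. dH i j k * ?\<Gamma> i j k) + (\<Sum>i\<in>UNIV. \<Sum>j\<in>UNIV. \<Sum>k\<in>UNIV. Gi x $ j $ k * dGam i i j k)
     - (\<Sum>i\<in>UNIV. \<Sum>k\<in>UNIV. dH i i k * w k x) - (\<Sum>i\<in>UNIV. \<Sum>k\<in>UNIV. Gi x $ i $ k * dw i k)"
  proof -
    have d1: "partial_deriv i (Gc i) x = (\<Sum>j\<in>UNIV. \<Sum>k\<in>UNIV. dH i j k * ?\<Gamma> i j k) + (\<Sum>j\<in>UNIV. \<Sum>k\<in>UNIV. Gi x $ j $ k * dGam i i j k)" for i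
      unfolding Gc_def[abs_def] dH_def dGam_def using D
      by (simp add: partial_deriv_sum partial_deriv_mult differentiable_sum differentiable_mult sum.distrib)
    have d2: "partial_deriv i (\<lambda>y. \<Sum>k\<in>UNIV. Gi y $ i $ k * w k y) x = (\<Sum>k\<in>UNIV. dH i i k * w k x) + (\<Sum>k\<in>UNIV. Gi x $ i $ k * dw i k)" for i
      unfolding dH_def dw_def using D
      by (simp add: partial_deriv_sum partial_deriv_mult differentiable_mult sum.distrib)
    have "partial_deriv i (\<lambda>y. Gc i y - (\<Sum>k\<in>UNIV. Gi y $ i $ k * w k y)) x
      = partial_deriv i (Gc i) x - partial_deriv i (\<lambda>y. \<Sum>k\<in>UNIV. Gi y $ i $ k * w k y) x" for i
      using D by (intro partial_deriv_diff differentiable_sum differentiable_mult) auto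
    then show ?thesis by (simp add: d1 d2 sum.distrib sum_subtractf)
  qed
  define Q where "Q = (\<Sum>j\<in>UNIV. \<Sum>k\<in>UNIV. \<Sum>i\<in>UNIV. \<Sum>m\<in>UNIV. Gi x $ j $ k * ?\<Gamma> i j m * ?\<Gamma> m i k)"
  \<comment> \<open>Each of the two terms in the derivative of the inverse metric contracts to
    \<open>Q\<close>, by the symmetry of the lower indices of the Christoffel symbols.\<close>
  have H1: "(\<Sum>i\<in>UNIV. \<Sum>j\<in>UNIV. \<Sum>k\<in>UNIV. dH i j k * ?\<Gamma> i j k) = - 2 * Q"
  proof -
    have "(\<Sum>i\<in>UNIV. \<Sum>j\<in>UNIV. \<Sum>k\<in>UNIV. \<Sum>l\<in>UNIV. ?\<Gamma> j i l * Gi x $ l $ k * ?\<Gamma> i j k) = Q"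
      unfolding Q_def sum.cartesian_product UNIV_Times_UNIV
      by (rule sum.reindex_bij_witness[of _ "\<lambda>(j, k, i, m). (m, i, k, j)" "\<lambda>(i, j, k, l). (l, k, j, i)"])
        (auto simp: Gam_sym[OF x])
    moreover have "(\<Sum>i\<in>UNIV. \<Sum>j\<in>UNIV. \<Sum>k\<in>UNIV. \<Sum>l\<in>UNIV. ?\<Gamma> k i l * Gi x $ j $ l * ?\<Gamma> i j k) = Q"
      unfolding Q_def sum.cartesian_product UNIV_Times_UNIV
      by (rule sum.reindex_bij_witness[of _ "\<lambda>(j, k, i, m). (i, j, m, k)" "\<lambda>(i, j, k, l). (j, l, i, k)"])
        (auto simp: Gam_sym[OF x])
    ultimately show ?thesis
      unfolding dH by (simp add: algebra_simps sum_subtractf sum_negf sum_distrib_left sum_distrib_right)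
  qed
  have H2: "(\<Sum>i\<in>UNIV. \<Sum>k\<in>UNIV. dH i i k * w k x) = - (\<Sum>i\<in>UNIV. \<Sum>j\<in>UNIV. Gi x $ i $ j * w i x * w j x) - (\<Sum>m\<in>UNIV. w m x * Gc m x)"
  proof -
    have "(\<Sum>i\<in>UNIV. \<Sum>k\<in>UNIV. \<Sum>l\<in>UNIV. ?\<Gamma> i i l * Gi x $ l $ k * w k x) = (\<Sum>i\<in>UNIV. \<Sum>j\<in>UNIV. Gi x $ i $ j * w i x * w j x)"
      unfolding ws[of "_ :: 'n"] sum_distrib_left sum_distrib_right
      unfolding sum.cartesian_product UNIV_Times_UNIV
      by (rule sum.reindex_bij_witness[of _ "\<lambda>(l, k, b, i). (i, k, l, b)" "\<lambda>(i, k, l, b). (l, k, b, i)"])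
        auto
    moreover have "(\<Sum>i\<in>UNIV. \<Sum>k\<in>UNIV. \<Sum>l\<in>UNIV. ?\<Gamma> k i l * Gi x $ i $ l * w k x) = (\<Sum>m\<in>UNIV. w m x * Gc m x)"
      unfolding Gc_def sum_distrib_left
      by (subst sum.swap) (simp add: mult_ac)
    ultimately show ?thesis
      unfolding dH by (simp add: algebra_simps sum_subtractf sum_negf sum_distrib_left sum_distrib_right)
  qed
  have H3: "GG x = Q"
    unfolding Q_def GG_def sum.cartesian_product UNIV_Times_UNIV
    by (rule sum.cong) (auto simp: Gam_sym[OF x])
  have H4: "(\<Sum>i\<in>UNIV. \<Sum>j\<in>UNIV. \<Sum>k\<in>UNIV. Gi x $ j $ k * dGam i i j k) = (\<Sum>j\<in>UNIV. \<Sum>k\<in>UNIV. \<Sum>i\<in>UNIV. Gi x $ j $ k * dGam i i j k)"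
    by (subst sum.swap, rule sum.cong[OF refl], rule sum.swap)
  show ?thesis
    unfolding S1 V H1 H2 H3 H4 Q_def[symmetric] by simp
qed

text \<open>Jacobi's formula, obtained by differentiating the Leibniz expansion row by row.\<close>

lemma partial_deriv_det:
  assumes x: "x \<in> \<Omega>"
  shows "partial_deriv k (\<lambda>y. det (G y)) x = 2 * w k x * det (G x)"
proof -
  note D = diffable[OF smooth x]
  have "((\<lambda>y. det (G y)) has_derivative (\<lambda>v. \<Sum>p | p permutes UNIV. of_int (sign p) *
      (\<Sum>i\<in>UNIV. frechet_derivative (\<lambda>y. G y $ i $ p i) (at x) v * (\<Prod>j\<in>UNIV - {i}. G x $ j $ p j)))) (at x)"
    unfolding det_def using D
    by (intro has_derivative_sum has_derivative_mult_right has_derivative_prod) (simp add: frechet_derivative_works)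
  from partial_deriv_eq[OF this, of k]
  have "partial_deriv k (\<lambda>y. det (G y)) x = (\<Sum>p | p permutes UNIV. of_int (sign p) *
      (\<Sum>i\<in>UNIV. dG k i (p i) x * (\<Prod>j\<in>UNIV - {i}. G x $ j $ p j)))"
    by (simp add: dG_def partial_deriv_def)
  also have "\<dots> = (\<Sum>i\<in>UNIV. \<Sum>p | p permutes UNIV. of_int (sign p) * (dG k i (p i) x * (\<Prod>j\<in>UNIV - {i}. G x $ j $ p j)))"
    unfolding sum_distrib_left by (rule sum.swap)
  also have "\<dots> = (\<Sum>i\<in>UNIV. det (\<chi> a. if a = i then (\<chi> b. dG k i b x) else G x $ a))"
  proof (rule sum.cong[OF refl])
    fix i :: 'n
    have "dG k i (p i) x * (\<Prod>j\<in>UNIV - {i}. G x $ j $ p j) = (\<Prod>j\<in>UNIV. (\<chi> a. if a = i then (\<chi> b. dG k i b x) else G x $ a) $ j $ p j)" for p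
      by (subst prod.remove[of _ i]) (auto intro!: prod.cong)
    then show "(\<Sum>p | p permutes UNIV. of_int (sign p) * (dG k i (p i) x * (\<Prod>j\<in>UNIV - {i}. G x $ j $ p j)))
      = det (\<chi> a. if a = i then (\<chi> b. dG k i b x) else G x $ a)" by (simp add: det_def)
  qed
  also have "\<dots> = (\<Sum>i\<in>UNIV. (\<Sum>j\<in>UNIV. Gi x $ i $ j * dG k i j x) * det (G x))"
  proof (rule sum.cong[OF refl])
    fix i :: 'n
    \<comment> \<open>The coefficients of the differentiated row as a combination of the rows of
      \<open>G x\<close>. Replacing row \<open>i\<close> by this combination multiplies the
      determinant by \<open>u $ i\<close>.\<close>
    define u where "u = (\<chi> a. \<Sum>b\<in>UNIV. dG k i b x * Gi x $ b $ a)"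
    have "(\<Sum>a\<in>UNIV. u $ a *s row a (G x)) = (\<chi> b. dG k i b x)"
    proof (subst vec_eq_iff, rule allI)
      fix b
      have "(\<Sum>a\<in>UNIV. u $ a *s row a (G x)) $ b = (\<Sum>a\<in>UNIV. \<Sum>e\<in>UNIV. dG k i e x * (Gi x $ e $ a * G x $ a $ b))"
        by (simp add: u_def row_def sum_distrib_right mult.assoc)
      also have "\<dots> = (\<Sum>e\<in>UNIV. dG k i e x * (\<Sum>a\<in>UNIV. Gi x $ e $ a * G x $ a $ b))"
        by (subst sum.swap) (simp add: sum_distrib_left)
      finally show "(\<Sum>a\<in>UNIV. u $ a *s row a (G x)) $ b = (\<chi> b. dG k i b x) $ b"
        by (simp add: Gi_G[OF x] if_distrib cong: if_cong)
    qed
    then have "det (\<chi> a. if a = i then (\<chi> b. dG k i b x) else G x $ a) = u $ i * det (G x)"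
      using cramer_lemma_transpose[where x=u and k=i and A="G x"] by (simp add: row_def vec_nth_inverse cong: if_cong)
    then show "det (\<chi> a. if a = i then (\<chi> b. dG k i b x) else G x $ a) = (\<Sum>j\<in>UNIV. Gi x $ i $ j * dG k i j x) * det (G x)"
      by (simp add: u_def mult.commute Gi_sym[OF x, of i])
  qed
  finally show ?thesis by (simp add: w_trace[OF x] sum_distrib_right)
qed

lemma Scal_continuous: "continuous_on \<Omega> (Scal G)"
proof -
  have "smooth_on \<Omega> (Scal G)"
    unfolding Scal_def[abs_def] Riem_def by (intro smooth_intros op Gam_smooth Gi_smooth)
  then show ?thesis by (rule smooth_on_continuous_on)
qed

end


subsection \<open>Change of coordinates\<close>

definition pdm :: "'n \<Rightarrow> (real^'n \<Rightarrow> real^'m^'m) \<Rightarrow> real^'n \<Rightarrow> real^'m^'m" where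
  "pdm i M x = (\<chi> a b. partial_deriv i (\<lambda>y. M y $ a $ b) x)"

definition mdiff :: "(real^'n \<Rightarrow> real^'m^'m) \<Rightarrow> real^'n \<Rightarrow> bool" where
  "mdiff M x \<longleftrightarrow> (\<forall>a b. (\<lambda>y. M y $ a $ b) differentiable (at x))"

lemma pdm_mult:
  assumes "mdiff M x" "mdiff N x"
  shows "pdm i (\<lambda>y. M y ** N y) x = pdm i M x ** N x + M x ** pdm i N x"
  using assms
  by (simp add: pdm_def mdiff_def matrix_matrix_mult_def vec_eq_iff partial_deriv_sum partial_deriv_mult
      differentiable_mult sum.distrib)

lemma pdm_add:
  assumes "mdiff M x" "mdiff N x"
  shows "pdm i (\<lambda>y. M y + N y) x = pdm i M x + pdm i N x"
  using assms by (simp add: pdm_def mdiff_def vec_eq_iff partial_deriv_add)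

lemma pdm_cong:
  assumes "open S" "x \<in> S" "\<And>y. y \<in> S \<Longrightarrow> M y = N y"
  shows "pdm i M x = pdm i N x"
proof -
  have "partial_deriv i (\<lambda>y. M y $ a $ b) x = partial_deriv i (\<lambda>y. N y $ a $ b) x" for a b
    by (rule partial_deriv_cong[OF assms(1,2)]) (simp add: assms(3))
  then show ?thesis by (simp add: pdm_def)
qed

lemma pdm_scale_sum:
  assumes "\<And>a. f a differentiable (at x)" "\<And>a. mdiff (M a) x"
  shows "pdm i (\<lambda>y. \<Sum>a\<in>UNIV. f a y *\<^sub>R M a y) x
    = (\<Sum>a\<in>UNIV. partial_deriv i (f a) x *\<^sub>R M a x) + (\<Sum>a\<in>UNIV. f a x *\<^sub>R pdm i (M a) x)"
  using assms
  by (simp add: pdm_def mdiff_def vec_eq_iff partial_deriv_sum partial_deriv_mult differentiable_mult sum.distrib)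

lemma mdiff_mult: "mdiff M x \<Longrightarrow> mdiff N x \<Longrightarrow> mdiff (\<lambda>y. M y ** N y) x"
  by (simp add: mdiff_def matrix_matrix_mult_def differentiable_mult differentiable_sum)

lemma mdiff_smooth: "(\<And>a b. smooth_on S (\<lambda>y. M y $ a $ b)) \<Longrightarrow> x \<in> S \<Longrightarrow> mdiff M x"
  by (auto simp: mdiff_def intro: smooth_on_differentiable)

lemma matrix_diff_ldistrib: "A ** (B - C) = A ** B - A ** (C :: real^'n^'m)"
  by (simp add: matrix_matrix_mult_def vec_eq_iff algebra_simps sum_subtractf)

lemma matrix_diff_rdistrib: "(A - B) ** C = A ** C - B ** (C :: real^'n^'m)"
  by (simp add: matrix_matrix_mult_def vec_eq_iff algebra_simps sum_subtractf)

lemma matrix_add_rdistrib': "(A + B) ** C = A ** C + B ** (C :: real^'n^'m)"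
  by (simp add: matrix_matrix_mult_def vec_eq_iff algebra_simps sum.distrib)

lemma matrix_mult_scaleR: "(c *\<^sub>R A) ** B = c *\<^sub>R (A ** B)" "A ** (c *\<^sub>R B) = c *\<^sub>R (A ** (B :: real^'n^'m))"
  by (simp_all add: matrix_matrix_mult_def vec_eq_iff sum_distrib_left mult_ac)

lemma matrix_sum_ldistrib: "A ** (\<Sum>a\<in>I. B a) = (\<Sum>a\<in>I. A ** (B a :: real^'n^'m))"
  by (induction I rule: infinite_finite_induct) (auto simp: matrix_add_ldistrib times0_right)

lemma matrix_sum_rdistrib: "(\<Sum>a\<in>I. B a) ** A = (\<Sum>a\<in>I. B a ** (A :: real^'n^'m))"
  by (induction I rule: infinite_finite_induct) (auto simp: matrix_add_rdistrib' times0_left)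

lemmas matrix_distribs = matrix_add_ldistrib matrix_add_rdistrib' matrix_diff_ldistrib matrix_diff_rdistrib

context metric_field
begin

text \<open>The components of the connection form. With them the curvature becomes the matrix
  expression \<open>FM\<close>, the curvature form, and a change of coordinates acts as a gauge
  transformation by the Jacobian.\<close>

definition GamM :: "'n \<Rightarrow> real^'n \<Rightarrow> real^'n^'n" where "GamM i x = (\<chi> l k. Gam G l i k x)"

definition FM :: "'n \<Rightarrow> 'n \<Rightarrow> real^'n \<Rightarrow> real^'n^'n" where
  "FM i j x = pdm i (GamM j) x - pdm j (GamM i) x + GamM i x ** GamM j x - GamM j x ** GamM i x"

lemma Riem_FM: "Riem G l k i j x = FM i j x $ l $ k"
  by (simp add: Riem_def FM_def pdm_def GamM_def matrix_matrix_mult_def sum_subtractf)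

lemma Scal_FM: "Scal G x = (\<Sum>j\<in>UNIV. \<Sum>k\<in>UNIV. Gi x $ j $ k * (\<Sum>i\<in>UNIV. FM i j x $ i $ k))"
  by (simp add: Scal_def Riem_FM)

lemma mdiff_GamM: "x \<in> \<Omega> \<Longrightarrow> mdiff (GamM i) x"
  by (rule mdiff_smooth[of \<Omega>]) (simp_all add: GamM_def Gam_smooth)

end

text \<open>\<open>T\<close> leads from the new coordinates to the old ones, so \<open>G'\<close> is
  the pullback of \<open>G\<close>. Both the chart transitions and the polynomial changes of
  coordinates are instances.\<close>

locale metric_change = old: metric_field \<Omega> G + new: metric_field \<Omega>' G'
  for \<Omega> :: "(real^'n) set" and G and \<Omega>' :: "(real^'n) set" and G' +
  fixes T :: "real^'n \<Rightarrow> real^'n" and J :: "real^'n \<Rightarrow> real^'n^'n"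
  assumes T: "smooth_on \<Omega>' T" "T ` \<Omega>' \<subseteq> \<Omega>"
    and J: "\<And>y a i. J y $ a $ i = partial_deriv i (\<lambda>y. T y $ a) y"
    and J_inv: "\<And>y. y \<in> \<Omega>' \<Longrightarrow> det (J y) \<noteq> 0"
    and G': "\<And>y. y \<in> \<Omega>' \<Longrightarrow> G' y = transpose (J y) ** G (T y) ** J y"
begin

lemma T_smooth: "smooth_on \<Omega>' (\<lambda>y. T y $ a)"
  by (rule smooth_on_nth[OF new.op T(1)])

lemma J_smooth: "smooth_on \<Omega>' (\<lambda>y. J y $ a $ i)"
  unfolding J by (rule smooth_on_partial_deriv[OF T_smooth])

lemma pull_smooth: "smooth_on \<Omega> f \<Longrightarrow> smooth_on \<Omega>' (\<lambda>y. f (T y))"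
  by (rule smooth_on_compose[OF new.op T(1) _ T(2)])

lemma pull_deriv:
  assumes "smooth_on \<Omega> f" "y \<in> \<Omega>'"
  shows "partial_deriv i (\<lambda>y. f (T y)) y = (\<Sum>a\<in>UNIV. J y $ a $ i * partial_deriv a f (T y))"
  unfolding J using assms T
  by (intro partial_deriv_chain smooth_on_differentiable[of \<Omega>'] smooth_on_differentiable[of \<Omega>]) auto

definition P :: "'n \<Rightarrow> real^'n \<Rightarrow> real^'n^'n" where "P i = pdm i J"

lemma P_entry: "P i y $ a $ k = partial_deriv i (\<lambda>y. J y $ a $ k) y"
  by (simp add: P_def pdm_def)

lemma P_smooth: "smooth_on \<Omega>' (\<lambda>y. P i y $ a $ k)"
  unfolding P_entry by (rule smooth_on_partial_deriv[OF J_smooth])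

lemma P_sym: "y \<in> \<Omega>' \<Longrightarrow> P i y $ a $ k = P k y $ a $ i"
  unfolding P_entry J by (rule partial_deriv_commute[OF new.op T_smooth])

lemma dP_sym: "y \<in> \<Omega>' \<Longrightarrow> pdm j (P i) y = pdm i (P j) y"
  unfolding pdm_def P_entry vec_eq_iff
  by (auto intro!: partial_deriv_commute[OF new.op J_smooth])

text \<open>The components of the old connection form pulled back by \<open>T\<close>.\<close>

definition AM :: "'n \<Rightarrow> real^'n \<Rightarrow> real^'n^'n" where
  "AM i y = (\<Sum>a\<in>UNIV. J y $ a $ i *\<^sub>R old.GamM a (T y))"

lemma dG_change:
  assumes y: "y \<in> \<Omega>'"
  shows "new.dG i k l y
    = (\<Sum>a\<in>UNIV. \<Sum>b\<in>UNIV. \<Sum>e\<in>UNIV. J y $ a $ i * J y $ b $ k * J y $ e $ l * old.dG a b e (T y))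
    + (\<Sum>b\<in>UNIV. \<Sum>e\<in>UNIV. P i y $ b $ k * G (T y) $ b $ e * J y $ e $ l)
    + (\<Sum>b\<in>UNIV. \<Sum>e\<in>UNIV. P i y $ b $ l * G (T y) $ b $ e * J y $ e $ k)" (is "_ = ?D3 + ?S k l + ?S l k")
proof -
  have Ty: "T y \<in> \<Omega>" using T y by auto
  have G'e: "G' z $ k $ l = (\<Sum>b\<in>UNIV. \<Sum>e\<in>UNIV. J z $ b $ k * G (T z) $ b $ e * J z $ e $ l)" if "z \<in> \<Omega>'" for z
    unfolding G'[OF that] matrix_matrix_mult_def transpose_def
    by (subst sum.swap) (simp add: sum_distrib_right)
  note df = smooth_on_differentiable[OF J_smooth y] smooth_on_differentiable[OF pull_smooth[OF old.smooth] y]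
  have "new.dG i k l y = partial_deriv i (\<lambda>z. \<Sum>b\<in>UNIV. \<Sum>e\<in>UNIV. J z $ b $ k * G (T z) $ b $ e * J z $ e $ l) y"
    unfolding new.dG_def by (rule partial_deriv_cong[OF new.op y G'e])
  also have "\<dots> = (\<Sum>b\<in>UNIV. \<Sum>e\<in>UNIV. P i y $ b $ k * G (T y) $ b $ e * J y $ e $ l
      + J y $ b $ k * (\<Sum>a\<in>UNIV. J y $ a $ i * old.dG a b e (T y)) * J y $ e $ l
      + J y $ b $ k * G (T y) $ b $ e * P i y $ e $ l)"
    using df pull_deriv[OF old.smooth y]
    by (simp add: partial_deriv_sum partial_deriv_mult differentiable_mult differentiable_sum P_entry old.dG_def algebra_simps)
  also have "\<dots> = ?S k l + (\<Sum>b\<in>UNIV. \<Sum>e\<in>UNIV. \<Sum>a\<in>UNIV. J y $ a $ i * J y $ b $ k * J y $ e $ l * old.dG a b e (T y))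
      + (\<Sum>b\<in>UNIV. \<Sum>e\<in>UNIV. J y $ b $ k * G (T y) $ b $ e * P i y $ e $ l)"
    by (simp add: sum.distrib sum_distrib_left sum_distrib_right mult_ac)
  also have "(\<Sum>b\<in>UNIV. \<Sum>e\<in>UNIV. \<Sum>a\<in>UNIV. J y $ a $ i * J y $ b $ k * J y $ e $ l * old.dG a b e (T y)) = ?D3"
    unfolding sum.cartesian_product UNIV_Times_UNIV
    by (rule sum.reindex_bij_witness[of _ "\<lambda>(a, b, e). (b, e, a)" "\<lambda>(b, e, a). (a, b, e)"]) auto
  also have "(\<Sum>b\<in>UNIV. \<Sum>e\<in>UNIV. J y $ b $ k * G (T y) $ b $ e * P i y $ e $ l) = ?S l k"
    by (subst sum.swap) (simp add: old.G_sym[OF Ty] mult_ac)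
  finally show ?thesis by simp
qed

text \<open>The inhomogeneous transformation law of a connection, with \<open>P\<close> the second
  derivatives of \<open>T\<close>. Both sides are compared after multiplication by the invertible
  matrix \<open>transpose (J y) ** G (T y)\<close>, which lowers an index and reduces the claim to
  first derivatives of the metrics.\<close>

lemma GamM_change:
  assumes y: "y \<in> \<Omega>'"
  shows "J y ** new.GamM i y = AM i y ** J y + P i y"
proof -
  have Ty: "T y \<in> \<Omega>" using T y by auto
  define D3 where "D3 i k l = (\<Sum>a\<in>UNIV. \<Sum>b\<in>UNIV. \<Sum>e\<in>UNIV. J y $ a $ i * J y $ b $ k * J y $ e $ l * old.dG a b e (T y))" for i k l
  define S where "S i k l = (\<Sum>b\<in>UNIV. \<Sum>e\<in>UNIV. P i y $ b $ k * G (T y) $ b $ e * J y $ e $ l)" for i k l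
  \<comment> \<open>Mixed derivatives of \<open>T\<close> commute. In the combination defining
    \<open>lowGam\<close> all second-derivative terms then cancel in pairs, except for a single
    \<open>S i k l\<close>.\<close>
  have Ssym: "S i k l = S k i l" for i k l
    unfolding S_def using P_sym[OF y, of i] by simp
  have dG': "new.dG i k l y = D3 i k l + S i k l + S i l k" for i k l
    unfolding D3_def S_def by (rule dG_change[OF y])
  have low: "new.lowGam l i k y = (1/2) * (D3 i k l + D3 k i l - D3 l i k) + S i k l" for l k
    unfolding new.lowGam_def dG' using Ssym[of i l k] Ssym[of k l i] Ssym[of k i l] by simp
  have X1: "(transpose (J y) ** G (T y) ** (AM i y ** J y)) $ l $ k = (1/2) * (D3 i k l + D3 k i l - D3 l i k)" for l k
  proof -
    have "(transpose (J y) ** G (T y) ** (AM i y ** J y)) $ l $ k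
      = (\<Sum>b\<in>UNIV. (\<Sum>e\<in>UNIV. J y $ e $ l * G (T y) $ e $ b) * (\<Sum>c\<in>UNIV. (\<Sum>a\<in>UNIV. J y $ a $ i * Gam G b a c (T y)) * J y $ c $ k))"
      by (simp add: matrix_matrix_mult_def transpose_def AM_def old.GamM_def)
    also have "\<dots> = (\<Sum>b\<in>UNIV. \<Sum>c\<in>UNIV. \<Sum>a\<in>UNIV. \<Sum>e\<in>UNIV. J y $ e $ l * J y $ a $ i * J y $ c $ k * (G (T y) $ e $ b * Gam G b a c (T y)))"
      by (simp add: sum_distrib_left sum_distrib_right mult_ac)
    also have "\<dots> = (\<Sum>e\<in>UNIV. \<Sum>c\<in>UNIV. \<Sum>a\<in>UNIV. \<Sum>b\<in>UNIV. J y $ e $ l * J y $ a $ i * J y $ c $ k * (G (T y) $ e $ b * Gam G b a c (T y)))"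
      unfolding sum.cartesian_product UNIV_Times_UNIV
      by (rule sum.reindex_bij_witness[of _ "\<lambda>(e, c, a, b). (b, c, a, e)" "\<lambda>(b, c, a, e). (e, c, a, b)"]) auto
    also have "\<dots> = (\<Sum>e\<in>UNIV. \<Sum>c\<in>UNIV. \<Sum>a\<in>UNIV. J y $ e $ l * J y $ a $ i * J y $ c $ k * old.lowGam e a c (T y))"
      by (simp add: sum_distrib_left[symmetric] old.low_Gam[OF Ty])
    also have "\<dots> = (1/2) * ((\<Sum>e\<in>UNIV. \<Sum>c\<in>UNIV. \<Sum>a\<in>UNIV. J y $ e $ l * J y $ a $ i * J y $ c $ k * old.dG a c e (T y))
       + (\<Sum>e\<in>UNIV. \<Sum>c\<in>UNIV. \<Sum>a\<in>UNIV. J y $ e $ l * J y $ a $ i * J y $ c $ k * old.dG c a e (T y))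
       - (\<Sum>e\<in>UNIV. \<Sum>c\<in>UNIV. \<Sum>a\<in>UNIV. J y $ e $ l * J y $ a $ i * J y $ c $ k * old.dG e a c (T y)))"
      by (simp add: old.lowGam_def sum.distrib sum_subtractf sum_distrib_left algebra_simps)
    also have "(\<Sum>e\<in>UNIV. \<Sum>c\<in>UNIV. \<Sum>a\<in>UNIV. J y $ e $ l * J y $ a $ i * J y $ c $ k * old.dG a c e (T y)) = D3 i k l"
      unfolding D3_def sum.cartesian_product UNIV_Times_UNIV
      by (rule sum.reindex_bij_witness[of _ "\<lambda>(a, b, e). (e, b, a)" "\<lambda>(e, c, a). (a, c, e)"]) auto
    also have "(\<Sum>e\<in>UNIV. \<Sum>c\<in>UNIV. \<Sum>a\<in>UNIV. J y $ e $ l * J y $ a $ i * J y $ c $ k * old.dG c a e (T y)) = D3 k i l"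
      unfolding D3_def sum.cartesian_product UNIV_Times_UNIV
      by (rule sum.reindex_bij_witness[of _ "\<lambda>(a, b, e). (e, a, b)" "\<lambda>(e, c, a). (c, a, e)"]) auto
    also have "(\<Sum>e\<in>UNIV. \<Sum>c\<in>UNIV. \<Sum>a\<in>UNIV. J y $ e $ l * J y $ a $ i * J y $ c $ k * old.dG e a c (T y)) = D3 l i k"
      unfolding D3_def sum.cartesian_product UNIV_Times_UNIV
      by (rule sum.reindex_bij_witness[of _ "\<lambda>(a, b, e). (a, e, b)" "\<lambda>(e, c, a). (e, a, c)"]) auto
    finally show ?thesis .
  qed
  have X2: "(transpose (J y) ** G (T y) ** P i y) $ l $ k = S i k l" for l k
    unfolding S_def matrix_matrix_mult_def transpose_def
    by (simp add: sum_distrib_left sum_distrib_right old.G_sym[OF Ty] mult_ac)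
  have X3: "(transpose (J y) ** G (T y) ** (J y ** new.GamM i y)) $ l $ k = new.lowGam l i k y" for l k
  proof -
    have "transpose (J y) ** G (T y) ** (J y ** new.GamM i y) = G' y ** new.GamM i y"
      by (simp add: G'[OF y] matrix_mul_assoc)
    then show ?thesis using new.low_Gam[OF y] by (simp add: matrix_matrix_mult_def new.GamM_def)
  qed
  have eq: "transpose (J y) ** G (T y) ** (J y ** new.GamM i y) = transpose (J y) ** G (T y) ** (AM i y ** J y + P i y)"
    by (simp add: vec_eq_iff X1 X2 X3 low matrix_add_ldistrib)
  have "det (transpose (J y) ** G (T y)) \<noteq> 0"
    using J_inv[OF y] old.det_nz[OF Ty] by (simp add: det_mul det_transpose)
  from matrix_inv_left[OF this] eq show ?thesis
    by (metis matrix_mul_assoc matrix_mul_lid)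
qed

text \<open>Differentiate \<open>GamM_change\<close> and antisymmetrise in \<open>i\<close> and
  \<open>j\<close>: the third derivatives of \<open>T\<close> drop out by \<open>dP_sym\<close>, and
  the mixed terms with \<open>P\<close> cancel against those of the products \<open>gg\<close>. What
  is left is the pulled-back curvature form.\<close>

lemma FM_change:
  assumes y: "y \<in> \<Omega>'"
  shows "J y ** new.FM i j y = (\<Sum>b\<in>UNIV. \<Sum>a\<in>UNIV. (J y $ b $ i * J y $ a $ j) *\<^sub>R old.FM b a (T y)) ** J y"
proof -
  have Ty: "T y \<in> \<Omega>" using T y by auto
  have mJ: "mdiff J y" using J_smooth y by (rule mdiff_smooth)
  have mP: "mdiff (P i) y" for i using P_smooth y by (rule mdiff_smooth)
  have mGT: "mdiff (\<lambda>y. old.GamM a (T y)) y" for a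
    by (rule mdiff_smooth[of \<Omega>']) (simp_all add: y old.GamM_def pull_smooth old.Gam_smooth)
  have dJ: "(\<lambda>y. J y $ a $ i) differentiable (at y)" for a i
    using J_smooth y by (rule smooth_on_differentiable)
  have mA: "mdiff (AM i) y" for i
  proof (rule mdiff_smooth[OF _ y])
    show "smooth_on \<Omega>' (\<lambda>y. AM i y $ a $ b)" for a b
      unfolding AM_def by (simp add: old.GamM_def) (intro smooth_intros new.op J_smooth pull_smooth old.Gam_smooth)
  qed
  have mN: "mdiff (new.GamM i) y" for i by (rule new.mdiff_GamM[OF y])
  have dA: "pdm i (AM j) y = (\<Sum>a\<in>UNIV. P i y $ a $ j *\<^sub>R old.GamM a (T y))
     + (\<Sum>a\<in>UNIV. J y $ a $ j *\<^sub>R (\<Sum>b\<in>UNIV. J y $ b $ i *\<^sub>R pdm b (old.GamM a) (T y)))" for i j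
  proof -
    have "pdm i (\<lambda>y. old.GamM a (T y)) y = (\<Sum>b\<in>UNIV. J y $ b $ i *\<^sub>R pdm b (old.GamM a) (T y))" for a
      using pull_deriv[OF old.Gam_smooth y] by (simp add: pdm_def vec_eq_iff old.GamM_def)
    then show ?thesis
      unfolding AM_def[abs_def] by (subst pdm_scale_sum[OF dJ mGT]) (simp add: P_entry)
  qed
  have dAA: "pdm i (AM j) y - pdm j (AM i) y
    = (\<Sum>b\<in>UNIV. \<Sum>a\<in>UNIV. (J y $ b $ i * J y $ a $ j) *\<^sub>R (pdm b (old.GamM a) (T y) - pdm a (old.GamM b) (T y)))"
  proof -
    have "(\<Sum>a\<in>UNIV. J y $ a $ j *\<^sub>R (\<Sum>b\<in>UNIV. J y $ b $ i *\<^sub>R pdm b (old.GamM a) (T y)))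
      = (\<Sum>b\<in>UNIV. \<Sum>a\<in>UNIV. (J y $ b $ i * J y $ a $ j) *\<^sub>R pdm b (old.GamM a) (T y))"
      by (subst sum.swap) (simp add: scaleR_sum_right mult.commute)
    moreover have "(\<Sum>a\<in>UNIV. J y $ a $ i *\<^sub>R (\<Sum>b\<in>UNIV. J y $ b $ j *\<^sub>R pdm b (old.GamM a) (T y)))
      = (\<Sum>b\<in>UNIV. \<Sum>a\<in>UNIV. (J y $ b $ i * J y $ a $ j) *\<^sub>R pdm a (old.GamM b) (T y))"
      by (simp add: scaleR_sum_right)
    ultimately show ?thesis
      unfolding dA using P_sym[OF y, of i _ j] by (simp add: scaleR_right_diff_distrib sum_subtractf)
  qed
  have AA: "AM i y ** AM j y - AM j y ** AM i y
    = (\<Sum>b\<in>UNIV. \<Sum>a\<in>UNIV. (J y $ b $ i * J y $ a $ j) *\<^sub>R (old.GamM b (T y) ** old.GamM a (T y) - old.GamM a (T y) ** old.GamM b (T y)))"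
  proof -
    have "AM i y ** AM j y = (\<Sum>b\<in>UNIV. \<Sum>a\<in>UNIV. (J y $ b $ i * J y $ a $ j) *\<^sub>R (old.GamM b (T y) ** old.GamM a (T y)))" for i j
      unfolding AM_def matrix_sum_rdistrib by (simp add: matrix_sum_ldistrib matrix_mult_scaleR scaleR_sum_right mult.commute)
    note * = this
    have "AM j y ** AM i y = (\<Sum>b\<in>UNIV. \<Sum>a\<in>UNIV. (J y $ b $ i * J y $ a $ j) *\<^sub>R (old.GamM a (T y) ** old.GamM b (T y)))"
      unfolding * by (subst sum.swap) (simp add: mult.commute)
    then show ?thesis unfolding *[of i j] by (simp add: scaleR_right_diff_distrib sum_subtractf)
  qed
  have FA: "(\<Sum>b\<in>UNIV. \<Sum>a\<in>UNIV. (J y $ b $ i * J y $ a $ j) *\<^sub>R old.FM b a (T y))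
    = pdm i (AM j) y - pdm j (AM i) y + (AM i y ** AM j y - AM j y ** AM i y)"
    unfolding dAA AA old.FM_def sum.distrib[symmetric] scaleR_add_right[symmetric]
    by (intro sum.cong refl arg_cong[where f="(*\<^sub>R) _"]) simp
  have d: "P j y ** new.GamM i y + J y ** pdm j (new.GamM i) y = pdm j (AM i) y ** J y + AM i y ** P j y + pdm j (P i) y" for i j
  proof -
    have "pdm j (\<lambda>y. J y ** new.GamM i y) y = pdm j (\<lambda>y. AM i y ** J y + P i y) y"
      by (rule pdm_cong[OF new.op y GamM_change])
    then show ?thesis
      by (simp add: pdm_mult pdm_add mJ mP mA mN mdiff_mult P_def[symmetric])
  qed
  have dij: "J y ** pdm i (new.GamM j) y = pdm i (AM j) y ** J y + AM j y ** P i y + pdm j (P i) y - P i y ** new.GamM j y"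
    using d[of i j] dP_sym[OF y, of i j] by (simp add: algebra_simps)
  have dji: "J y ** pdm j (new.GamM i) y = pdm j (AM i) y ** J y + AM i y ** P j y + pdm j (P i) y - P j y ** new.GamM i y"
    using d[of j i] by (simp add: algebra_simps)
  have gg: "J y ** (new.GamM i y ** new.GamM j y) = AM i y ** AM j y ** J y + AM i y ** P j y + P i y ** new.GamM j y" for i j
    by (simp add: matrix_mul_assoc GamM_change[OF y] matrix_add_rdistrib')
      (simp add: matrix_mul_assoc[symmetric] GamM_change[OF y] matrix_add_ldistrib)
  show ?thesis
    unfolding FA new.FM_def matrix_distribs dij dji gg by (simp add: algebra_simps)
qed

lemma Gi_change: "y \<in> \<Omega>' \<Longrightarrow> (\<Sum>j\<in>UNIV. \<Sum>k\<in>UNIV. J y $ a $ j * new.Gi y $ j $ k * J y $ q $ k) = old.Gi (T y) $ a $ q"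
proof -
  assume y: "y \<in> \<Omega>'"
  have Ty: "T y \<in> \<Omega>" using T y by auto
  let ?J = "J y" and ?H = "new.Gi y"
  have "transpose ?J ** G (T y) ** ?J ** ?H = mat 1"
    using matrix_inv_right[OF new.det_nz[OF y]] by (simp add: G'[OF y])
  then have "?J ** ?H ** (transpose ?J ** G (T y)) = mat 1"
    by (metis matrix_left_right_inverse matrix_mul_assoc)
  then have "?J ** ?H ** transpose ?J ** (G (T y) ** old.Gi (T y)) = old.Gi (T y)"
    by (metis matrix_mul_assoc matrix_mul_lid)
  then have H: "?J ** ?H ** transpose ?J = old.Gi (T y)"
    using matrix_inv_right[OF old.det_nz[OF Ty]] by simp
  show ?thesis
    unfolding H[symmetric] matrix_matrix_mult_def transpose_def
    by (subst sum.swap) (simp add: sum_distrib_right)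
qed

text \<open>The trace of \<open>FM_change\<close>: one form index meets the upper matrix index,
  where the Jacobian cancels its inverse (\<open>tr\<close>), and the other two indices meet the
  inverse metric, where \<open>Gi_change\<close> applies.\<close>

lemma Scal_change:
  assumes y: "y \<in> \<Omega>'"
  shows "Scal G' y = Scal G (T y)"
proof -
  have Ty: "T y \<in> \<Omega>" using T y by auto
  let ?J = "J y" and ?K = "matrix_inv (J y)" and ?H = "new.Gi y"
  have JK: "?J ** ?K = mat 1" "?K ** ?J = mat 1"
    using matrix_inv_right[OF J_inv[OF y]] matrix_inv_left[OF J_inv[OF y]] by auto
  define M where "M b a = old.FM b a (T y)" for b a
  have F: "new.FM i j y = (\<Sum>b\<in>UNIV. \<Sum>a\<in>UNIV. (?J $ b $ i * ?J $ a $ j) *\<^sub>R (?K ** M b a ** ?J))" for i j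
  proof -
    have "new.FM i j y = ?K ** (?J ** new.FM i j y)" using JK by (simp add: matrix_mul_assoc)
    then show ?thesis
      unfolding FM_change[OF y] M_def
      by (simp add: matrix_mul_assoc matrix_sum_ldistrib matrix_sum_rdistrib matrix_mult_scaleR)
  qed
  have tr: "(\<Sum>i\<in>UNIV. ?J $ b $ i * (?K ** M b a ** ?J) $ i $ k) = (\<Sum>q\<in>UNIV. M b a $ b $ q * ?J $ q $ k)" for b a k
  proof -
    have "(\<Sum>i\<in>UNIV. ?J $ b $ i * (?K ** M b a ** ?J) $ i $ k) = (?J ** (?K ** M b a ** ?J)) $ b $ k"
      by (simp add: matrix_matrix_mult_def)
    also have "?J ** (?K ** M b a ** ?J) = M b a ** ?J" using JK by (simp add: matrix_mul_assoc)
    finally show ?thesis by (simp add: matrix_matrix_mult_def)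
  qed
  have "Scal G' y = (\<Sum>j\<in>UNIV. \<Sum>k\<in>UNIV. \<Sum>i\<in>UNIV. \<Sum>b\<in>UNIV. \<Sum>a\<in>UNIV. ?H $ j $ k * ?J $ a $ j * (?J $ b $ i * (?K ** M b a ** ?J) $ i $ k))"
    unfolding new.Scal_FM F by (simp add: sum_distrib_left mult_ac)
  also have "\<dots> = (\<Sum>b\<in>UNIV. \<Sum>a\<in>UNIV. \<Sum>j\<in>UNIV. \<Sum>k\<in>UNIV. \<Sum>i\<in>UNIV. ?H $ j $ k * ?J $ a $ j * (?J $ b $ i * (?K ** M b a ** ?J) $ i $ k))"
    unfolding sum.cartesian_product UNIV_Times_UNIV
    by (rule sum.reindex_bij_witness[of _ "\<lambda>(b, a, j, k, i). (j, k, i, b, a)" "\<lambda>(j, k, i, b, a). (b, a, j, k, i)"]) auto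
  also have "\<dots> = (\<Sum>b\<in>UNIV. \<Sum>a\<in>UNIV. \<Sum>j\<in>UNIV. \<Sum>k\<in>UNIV. \<Sum>q\<in>UNIV. M b a $ b $ q * (?J $ a $ j * ?H $ j $ k * ?J $ q $ k))"
    by (simp only: sum_distrib_left[symmetric] tr) (simp add: sum_distrib_left mult_ac)
  also have "\<dots> = (\<Sum>a\<in>UNIV. \<Sum>q\<in>UNIV. \<Sum>b\<in>UNIV. \<Sum>j\<in>UNIV. \<Sum>k\<in>UNIV. M b a $ b $ q * (?J $ a $ j * ?H $ j $ k * ?J $ q $ k))"
    unfolding sum.cartesian_product UNIV_Times_UNIV
    by (rule sum.reindex_bij_witness[of _ "\<lambda>(a, q, b, j, k). (b, a, j, k, q)" "\<lambda>(b, a, j, k, q). (a, q, b, j, k)"]) auto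
  also have "\<dots> = Scal G (T y)"
    unfolding old.Scal_FM
    by (simp only: sum_distrib_left[symmetric] Gi_change[OF y]) (simp add: M_def sum_distrib_left mult_ac)
  finally show ?thesis .
qed

end

section \<open>A smooth cutoff function\<close>

text \<open>A polynomial in \<open>1 / t\<close> is allowed in front of the exponential because the
  family is then closed under differentiation; this supplies the sequence of derivatives for
  \<open>smooth_on_compose_real\<close>.\<close>

definition flat_exp :: "real poly \<Rightarrow> real \<Rightarrow> real" where
  "flat_exp p t = (if t \<le> 0 then 0 else poly p (inverse t) * exp (- inverse t))"

lemma flat_exp_tendsto:
  fixes p :: "real poly"
  shows "((\<lambda>t. poly p (inverse t) * exp (- inverse t)) \<longlongrightarrow> 0) (at_right 0)"
proof -
  have 1: "((\<lambda>s. poly p s * exp (- s)) \<longlongrightarrow> 0) at_top"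
  proof -
    have "((\<lambda>s. \<Sum>i\<le>degree p. coeff p i * (s ^ i / exp s)) \<longlongrightarrow> (\<Sum>i\<le>degree p. coeff p i * 0)) at_top"
      by (intro tendsto_sum tendsto_mult[OF tendsto_const]) (simp add: tendsto_power_div_exp_0)
    also have "(\<lambda>s. \<Sum>i\<le>degree p. coeff p i * (s ^ i / exp s)) = (\<lambda>s. poly p s * exp (- s))"
      by (simp add: poly_altdef sum_distrib_left sum_distrib_right exp_minus divide_inverse mult_ac fun_eq_iff)
    finally show ?thesis by simp
  qed
  show ?thesis
    using filterlim_compose[OF 1 filterlim_inverse_at_top_right] .
qed

text \<open>In the variable \<open>s = 1 / t\<close> the operator \<open>d/dt\<close> is
  \<open>- s\<^sup>2 d/ds\<close>, which gives the factor \<open>[:0, 0, 1:]\<close>. At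
  \<open>0\<close> the difference quotient is a function of the same kind with one more factor
  \<open>s\<close> and tends to \<open>0\<close> by \<open>flat_exp_tendsto\<close>.\<close>

lemma flat_exp_deriv:
  "(flat_exp p has_real_derivative flat_exp ([:0, 0, 1:] * (p - pderiv p)) t) (at t)"
proof -
  let ?q = "[:0, 0, 1:] * (p - pderiv p)"
  consider "t < 0" | "t = 0" | "t > 0" by linarith
  then show ?thesis
  proof cases
    case 1
    have "(flat_exp p has_real_derivative 0) (at t)"
      by (rule has_field_derivative_transform_within_open[of "\<lambda>_. 0" _ _ "{..<0}"])
        (use 1 in \<open>auto simp: flat_exp_def\<close>)
    then show ?thesis using 1 by (simp add: flat_exp_def)
  next
    case 2
    have "((\<lambda>h. flat_exp p h / h) \<longlongrightarrow> 0) (at 0)"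
    proof (rule filterlim_split_at)
      show "((\<lambda>h. flat_exp p h / h) \<longlongrightarrow> 0) (at_left 0)"
        by (rule tendsto_eventually) (auto simp: eventually_at_filter flat_exp_def)
      have "((\<lambda>t. poly ([:0, 1:] * p) (inverse t) * exp (- inverse t)) \<longlongrightarrow> 0) (at_right 0)"
        by (rule flat_exp_tendsto)
      then show "((\<lambda>h. flat_exp p h / h) \<longlongrightarrow> 0) (at_right 0)"
        by (rule Lim_transform_eventually) (auto simp: eventually_at_filter flat_exp_def divide_inverse)
    qed
    then show ?thesis using 2 by (simp add: DERIV_def flat_exp_def)
  next
    case 3
    have "((\<lambda>t. poly p (inverse t) * exp (- inverse t)) has_real_derivative flat_exp ?q t) (at t)"
      using 3
      by (auto intro!: derivative_eq_intros poly_DERIV DERIV_chain2[where f="poly p"]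
          simp: flat_exp_def algebra_simps power2_eq_square)
    then show ?thesis
      by (rule has_field_derivative_transform_within_open[of _ _ _ "{0<..}"])
        (use 3 in \<open>auto simp: flat_exp_def\<close>)
  qed
qed

text \<open>The quotient \<open>?a / (?a + ?b)\<close>: the numerator vanishes for
  \<open>norm y \<ge> 2 * r\<close>, the second summand for \<open>norm y \<le> r\<close>, and never
  both. Squared norms keep the arguments smooth at the origin.\<close>

lemma smooth_cutoff:
  fixes r :: real
  assumes r: "r > 0"
  obtains \<eta> :: "real^'n \<Rightarrow> real" where "smooth_on UNIV \<eta>" "\<And>y. 0 \<le> \<eta> y" "\<And>y. \<eta> y \<le> 1"
    "\<And>y. norm y \<le> r \<Longrightarrow> \<eta> y = 1" "\<And>y. norm y \<ge> 2 * r \<Longrightarrow> \<eta> y = 0"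
proof -
  define D where "D m = flat_exp (((\<lambda>p. [:0, 0, 1:] * (p - pderiv p)) ^^ m) 1)" for m
  define E where "E = D 0"
  have E: "E t = (if t \<le> 0 then 0 else exp (- inverse t))" for t by (simp add: E_def D_def flat_exp_def)
  have Esm: "smooth_on UNIV (\<lambda>y. E (f y))" if "smooth_on UNIV f" for f :: "real^'n \<Rightarrow> real"
    unfolding E_def
    by (rule smooth_on_compose_real[OF open_UNIV that, where T=UNIV]) (auto simp only: D_def funpow.simps o_apply flat_exp_deriv)
  have nsm: "smooth_on UNIV (\<lambda>y::real^'n. (norm y)\<^sup>2)"
  proof -
    have "(\<lambda>y::real^'n. (norm y)\<^sup>2) = (\<lambda>y. \<Sum>i\<in>UNIV. y $ i * y $ i)"
      by (simp add: power2_norm_eq_inner inner_vec_def)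
    then show ?thesis by (simp add: smooth_intros)
  qed
  let ?a = "\<lambda>y::real^'n. E (4 * r\<^sup>2 - (norm y)\<^sup>2)" and ?b = "\<lambda>y::real^'n. E ((norm y)\<^sup>2 - r\<^sup>2)"
  have nn: "0 \<le> E t" for t by (simp add: E)
  have pos: "?a y + ?b y > 0" for y
  proof (cases "(norm y)\<^sup>2 > r\<^sup>2")
    case True
    then have "?b y > 0" by (simp add: E)
    then show ?thesis using nn[of "4 * r\<^sup>2 - (norm y)\<^sup>2"] by linarith
  next
    case False
    then have "4 * r\<^sup>2 - (norm y)\<^sup>2 > 0" using zero_less_power[OF r, of 2] by linarith
    then have "?a y > 0" by (simp add: E)
    then show ?thesis using nn[of "(norm y)\<^sup>2 - r\<^sup>2"] by linarith
  qed
  show thesis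
  proof (rule that[of "\<lambda>y. ?a y / (?a y + ?b y)"])
    show "smooth_on UNIV (\<lambda>y. ?a y / (?a y + ?b y))"
      using pos by (intro smooth_on_divide smooth_on_add Esm smooth_on_diff smooth_on_const nsm open_UNIV) (metis less_irrefl)
    fix y :: "real^'n"
    show "0 \<le> ?a y / (?a y + ?b y)" using nn pos[of y] by (intro divide_nonneg_pos) auto
    show "?a y / (?a y + ?b y) \<le> 1" using nn pos[of y] by (simp add: divide_le_eq_1)
    show "?a y / (?a y + ?b y) = 1" if "norm y \<le> r"
    proof -
      have "?b y = 0" using power_mono[OF that norm_ge_zero, of 2] by (simp add: E)
      then show ?thesis using pos[of y] by simp
    qed
    show "?a y / (?a y + ?b y) = 0" if "norm y \<ge> 2 * r"
    proof -
      have "(2 * r)\<^sup>2 \<le> (norm y)\<^sup>2" using that r by (intro power_mono) auto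
      then show ?thesis by (simp add: E power_mult_distrib)
    qed
  qed
qed

section \<open>Gaussian integrals\<close>

text \<open>The Euclidean heat kernel at time \<open>\<tau>\<close>. Each coordinate has variance
  \<open>2 * \<tau>\<close>, whence the factors \<open>2\<close> and \<open>4\<close> in the moments
  below.\<close>

definition gauss :: "real \<Rightarrow> real^'n \<Rightarrow> real" where
  "gauss \<tau> y = (1 / sqrt (4 * pi * \<tau>)) ^ CARD('n) * exp (- (norm y)\<^sup>2 / (4 * \<tau>))"

lemma norm_sq_sum: "(norm (y::real^'n))\<^sup>2 = (\<Sum>i\<in>UNIV. (y $ i)\<^sup>2)"
  unfolding power2_norm_eq_inner inner_vec_def by (simp add: power2_eq_square)

lemma gauss_prod:
  assumes "\<tau> > 0"
  shows "gauss \<tau> (y::real^'n) = (\<Prod>b\<in>Basis. normal_density 0 (sqrt (2 * \<tau>)) (y \<bullet> b))"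
proof -
  have "(\<Prod>b\<in>Basis. normal_density 0 (sqrt (2 * \<tau>)) (y \<bullet> b)) = (\<Prod>i\<in>UNIV. normal_density 0 (sqrt (2 * \<tau>)) (y $ i))"
    by (simp add: Basis_vec_def UNION_singleton_eq_range prod.reindex inj_on_def axis_eq_axis inner_axis)
  also have "\<dots> = (\<Prod>i\<in>UNIV. 1 / sqrt (4 * pi * \<tau>) * exp (- (y $ i)\<^sup>2 / (4 * \<tau>)))"
    using assms by (simp add: normal_density_def mult_ac)
  also have "\<dots> = gauss \<tau> y"
    unfolding prod.distrib
    by (simp add: gauss_def norm_sq_sum exp_sum[symmetric] sum_divide_distrib sum_negf)
  finally show ?thesis by simp
qed

lemma gauss_pos: "\<tau> > 0 \<Longrightarrow> 0 < gauss \<tau> y"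
  by (simp add: gauss_def)

lemma gauss_continuous: "continuous_on S (gauss \<tau>)"
  unfolding gauss_def by (cases "\<tau> = 0") (auto intro!: continuous_intros)

lemma gauss_measurable [measurable]: "gauss \<tau> \<in> borel_measurable borel"
  by (intro borel_measurable_continuous_onI gauss_continuous)

lemma gauss_nn_integral:
  assumes "\<tau> > 0"
  shows "(\<integral>\<^sup>+y. ennreal (gauss \<tau> (y::real^'n)) \<partial>lborel) = 1"
proof -
  have 1: "(\<integral>\<^sup>+x. ennreal (normal_density 0 (sqrt (2 * \<tau>)) x) \<partial>lborel) = 1"
  proof -
    interpret prob_space "density lborel (normal_density 0 (sqrt (2 * \<tau>)))"
      using assms by (intro prob_space_normal_density) simp
    show ?thesis using emeasure_space_1 by (simp add: emeasure_density)
  qed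
  have "(\<integral>\<^sup>+y. ennreal (gauss \<tau> (y::real^'n)) \<partial>lborel) = (\<integral>\<^sup>+y. (\<Prod>b\<in>Basis. ennreal (normal_density 0 (sqrt (2 * \<tau>)) ((y::real^'n) \<bullet> b))) \<partial>lborel)"
    by (simp add: gauss_prod[OF assms] prod_ennreal)
  also have "\<dots> = (\<Prod>b\<in>(Basis::(real^'n) set). (\<integral>\<^sup>+x. ennreal (normal_density 0 (sqrt (2 * \<tau>)) x) \<partial>lborel))"
    by (rule nn_integral_lborel_prod) auto
  also have "\<dots> = 1" unfolding 1 by simp
  finally show ?thesis .
qed

lemma gauss_integral:
  assumes "\<tau> > 0"
  shows "integrable lborel (gauss \<tau> :: real^'n \<Rightarrow> real)" "(LINT y|lborel. gauss \<tau> (y::real^'n)) = 1"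
proof -
  have nn: "AE y in lborel. 0 \<le> gauss \<tau> (y::real^'n)"
    by (intro AE_I2 less_imp_le gauss_pos assms)
  show "integrable lborel (gauss \<tau> :: real^'n \<Rightarrow> real)"
  proof (rule integrableI_nonneg)
    show "(\<integral>\<^sup>+y. ennreal (gauss \<tau> (y::real^'n)) \<partial>lborel) < \<infinity>"
      unfolding gauss_nn_integral[OF assms] by simp
  qed (use nn in auto)
  show "(LINT y|lborel. gauss \<tau> (y::real^'n)) = 1"
    using nn gauss_nn_integral[OF assms] by (simp add: integral_eq_nn_integral)
qed

text \<open>The substitution \<open>y = t *\<^sub>R z\<close> moves the dependence on time from the
  Gaussian into the argument of \<open>F\<close>, where limits can be taken pointwise.\<close>

lemma gauss_scale:
  assumes t: "t > 0" and F: "F \<in> borel_measurable borel"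
  shows "(LINT y|lborel. gauss (t\<^sup>2) y * F y) = (LINT z|lborel. gauss 1 z * F (t *\<^sub>R (z::real^'n)))"
proof -
  let ?D = "distr lborel borel (\<lambda>x::real^'n. 0 + t *\<^sub>R x)"
  have "(LINT y|lborel. gauss (t\<^sup>2) y * F y) = (LINT y|density ?D (\<lambda>_. ennreal (\<bar>t\<bar> ^ DIM(real^'n))). gauss (t\<^sup>2) y * F y)"
    using lborel_affine[of t "0::real^'n"] t by simp
  also have "\<dots> = (LINT y|?D. \<bar>t\<bar> ^ DIM(real^'n) * (gauss (t\<^sup>2) y * F y))"
    using F by (subst integral_density) auto
  also have "\<dots> = (LINT z|lborel. \<bar>t\<bar> ^ DIM(real^'n) * (gauss (t\<^sup>2) (0 + t *\<^sub>R z) * F (0 + t *\<^sub>R z)))"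
    using F by (subst integral_distr) auto
  also have "\<dots> = (LINT z|lborel. gauss 1 z * F (t *\<^sub>R z))"
  proof (rule Bochner_Integration.integral_cong[OF refl])
    fix z :: "real^'n"
    have "sqrt (4 * pi * t\<^sup>2) = t * sqrt (4 * pi)" using t by (simp add: real_sqrt_mult)
    then have "\<bar>t\<bar> ^ DIM(real^'n) * gauss (t\<^sup>2) (t *\<^sub>R z) = gauss 1 z"
      using t by (simp add: gauss_def power_mult_distrib power_divide)
    then show "\<bar>t\<bar> ^ DIM(real^'n) * (gauss (t\<^sup>2) (0 + t *\<^sub>R z) * F (0 + t *\<^sub>R z)) = gauss 1 z * F (t *\<^sub>R z)"
      by (simp add: mult.assoc[symmetric])
  qed
  finally show ?thesis .
qed

text \<open>A polynomial times the Gaussian is dominated by a multiple of the wider Gaussian with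
  parameter \<open>2\<close>.\<close>

lemma gauss_integrable_poly:
  assumes P: "P \<in> borel_measurable borel" and b: "\<And>z::real^'n. \<bar>P z\<bar> \<le> C * (1 + (norm z)\<^sup>2) ^ 3"
  shows "integrable lborel (\<lambda>z. gauss 1 z * P z)"
proof (rule Bochner_Integration.integrable_bound)
  let ?c = "(1 / sqrt (4 * pi)) ^ CARD('n)" and ?d = "(1 / sqrt (8 * pi)) ^ CARD('n)"
  show "integrable lborel (\<lambda>z::real^'n. (C * 24 ^ 3 * ?c / ?d) * gauss 2 z)"
    by (intro integrable_mult_right gauss_integral) simp
  show "(\<lambda>z. gauss 1 z * P z) \<in> borel_measurable lborel" using P by simp
  show "AE z in lborel. norm (gauss 1 z * P z) \<le> norm ((C * 24 ^ 3 * ?c / ?d) * gauss 2 z)"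
  proof (rule AE_I2)
    fix z :: "real^'n"
    have C: "0 \<le> C" using b[of 0] by simp
    \<comment> \<open>The constant is \<open>24 = 3 * 8\<close>: the cube of
      \<open>exp (u / 24)\<close> is \<open>exp (u / 8)\<close>, and multiplying
      \<open>exp (- u / 4)\<close> by it leaves the exponent \<open>- u / 8\<close> of
      \<open>gauss 2\<close>.\<close>
    have "(1 + (norm z)\<^sup>2 / 24) ^ 3 \<le> exp ((norm z)\<^sup>2 / 24) ^ 3"
      by (intro power_mono) (auto simp: add_increasing)
    also have "exp ((norm z)\<^sup>2 / 24) ^ 3 = exp ((norm z)\<^sup>2 / 8)"
      by (simp add: exp_of_nat_mult[symmetric])
    finally have e: "(1 + (norm z)\<^sup>2 / 24) ^ 3 \<le> exp ((norm z)\<^sup>2 / 8)" .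
    have "(1 + (norm z)\<^sup>2) ^ 3 \<le> (24 * (1 + (norm z)\<^sup>2 / 24)) ^ 3"
      by (intro power_mono) auto
    also have "\<dots> \<le> 24 ^ 3 * exp ((norm z)\<^sup>2 / 8)" unfolding power_mult_distrib using e by simp
    finally have "\<bar>P z\<bar> \<le> C * (24 ^ 3 * exp ((norm z)\<^sup>2 / 8))"
      using b[of z] C by (meson mult_left_mono order_trans)
    then have "norm (gauss 1 z * P z) \<le> gauss 1 z * (C * (24 ^ 3 * exp ((norm z)\<^sup>2 / 8)))"
      using gauss_pos[of 1 z] by (simp add: abs_mult mult_left_mono)
    also have "\<dots> = C * 24 ^ 3 * ?c * (exp (- (norm z)\<^sup>2 / 4) * exp ((norm z)\<^sup>2 / 8))"
      by (simp add: gauss_def)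
    also have "exp (- (norm z)\<^sup>2 / 4) * exp ((norm z)\<^sup>2 / 8) = exp (- (norm z)\<^sup>2 / 8)"
      by (simp add: exp_add[symmetric])
    also have "C * 24 ^ 3 * ?c * exp (- (norm z)\<^sup>2 / 8) = (C * 24 ^ 3 * ?c / ?d) * gauss 2 z"
      by (simp add: gauss_def)
    also have "\<dots> \<le> norm \<dots>" unfolding real_norm_def by (rule abs_ge_self)
    finally show "norm (gauss 1 z * P z) \<le> norm ((C * 24 ^ 3 * ?c / ?d) * gauss 2 z)" .
  qed
qed

lemma smooth_on_norm_sq: "smooth_on UNIV (\<lambda>y::real^'n. (norm y)\<^sup>2)"
  unfolding norm_sq_sum by (intro smooth_intros open_UNIV)

lemma partial_deriv_norm_sq: "partial_deriv i (\<lambda>y::real^'n. (norm y)\<^sup>2) y = 2 * y $ i"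
proof -
  have d: "(\<lambda>y::real^'n. y $ a) differentiable (at y)" for a
    by (rule smooth_on_differentiable[OF smooth_on_coord[OF open_UNIV]]) simp
  have "(\<lambda>y::real^'n. (norm y)\<^sup>2) = (\<lambda>y. \<Sum>a\<in>UNIV. y $ a * y $ a)"
    unfolding norm_sq_sum by (simp add: power2_eq_square)
  then show ?thesis
    using d
    by (simp add: partial_deriv_sum partial_deriv_mult differentiable_mult partial_deriv_coord sum.distrib
        if_distrib[of "\<lambda>a. a * _"] if_distrib[of "\<lambda>a. _ * a"] cong: if_cong)
qed

lemma smooth_on_gauss: "smooth_on UNIV (gauss \<tau> :: real^'n \<Rightarrow> real)"
proof -
  define c where "c = (1 / sqrt (4 * pi * \<tau>)) ^ CARD('n)"
  define d where "d = - inverse (4 * \<tau>)"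
  have "smooth_on UNIV (\<lambda>y::real^'n. d * (norm y)\<^sup>2)"
    by (rule smooth_on_mult[OF open_UNIV smooth_on_const smooth_on_norm_sq])
  then have "smooth_on UNIV (\<lambda>y::real^'n. c * exp (d * (norm y)\<^sup>2))"
    by (intro smooth_on_mult[OF open_UNIV smooth_on_const] smooth_on_exp smooth_on_norm_sq open_UNIV)
  moreover have "gauss \<tau> = (\<lambda>y::real^'n. c * exp (d * (norm y)\<^sup>2))"
  proof
    fix y :: "real^'n"
    have "- (norm y)\<^sup>2 / (4 * \<tau>) = d * (norm y)\<^sup>2"
      unfolding d_def divide_inverse minus_mult_left[symmetric] by (rule arg_cong[where f=uminus], rule mult.commute)
    then show "gauss \<tau> y = c * exp (d * (norm y)\<^sup>2)" by (simp only: gauss_def c_def)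
  qed
  ultimately show ?thesis by simp
qed

lemma partial_deriv_gauss:
  assumes "\<tau> > 0"
  shows "partial_deriv i (gauss \<tau>) y = - (y $ i) / (2 * \<tau>) * gauss \<tau> y"
proof -
  let ?c = "(1 / sqrt (4 * pi * \<tau>)) ^ CARD('a)"
  have "((\<lambda>s. ?c * exp (- s / (4 * \<tau>))) has_real_derivative ?c * (exp (- (norm y)\<^sup>2 / (4 * \<tau>)) * (- 1 / (4 * \<tau>)))) (at ((norm y)\<^sup>2))"
    using assms by (auto intro!: derivative_eq_intros)
  from partial_deriv_chain_real[where f="\<lambda>y. (norm y)\<^sup>2", OF _ this, of i]
  show ?thesis
    using smooth_on_differentiable[OF smooth_on_norm_sq, of y]
    by (simp add: gauss_def[abs_def] partial_deriv_norm_sq)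
qed

lemma coord_bound: "\<bar>(z::real^'n) $ a\<bar> \<le> 1 + (norm z)\<^sup>2"
proof -
  have "\<bar>z $ a\<bar> \<le> norm z" by (rule component_le_norm_cart)
  also have "norm z \<le> 1 + (norm z)\<^sup>2"
  proof -
    have "0 \<le> (norm z - 1)\<^sup>2" by simp
    also have "(norm z - 1)\<^sup>2 = (norm z)\<^sup>2 + 1 - 2 * norm z" by (simp add: power2_diff)
    finally show ?thesis using norm_ge_zero[of z] by linarith
  qed
  finally show ?thesis .
qed

lemma coord2_bound: "\<bar>(z::real^'n) $ a * z $ b\<bar> \<le> 1 + (norm z)\<^sup>2"
proof -
  have "\<bar>z $ a\<bar> * \<bar>z $ b\<bar> \<le> norm z * norm z"
    by (intro mult_mono component_le_norm_cart) auto
  then show ?thesis by (simp add: abs_mult power2_eq_square)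
qed

lemma coord4_bound: "\<bar>(z::real^'n) $ a * z $ b * z $ c * z $ d\<bar> \<le> 1 * (1 + (norm z)\<^sup>2) ^ 3"
proof -
  have "\<bar>z $ a * z $ b\<bar> * \<bar>z $ c * z $ d\<bar> \<le> (1 + (norm z)\<^sup>2) * (1 + (norm z)\<^sup>2)"
    by (intro mult_mono coord2_bound) auto
  also have "\<dots> \<le> (1 + (norm z)\<^sup>2) ^ 3"
    using mult_left_mono[of 1 "1 + (norm z)\<^sup>2" "(1 + (norm z)\<^sup>2) * (1 + (norm z)\<^sup>2)"] by (simp add: power3_eq_cube)
  finally show ?thesis by (simp add: abs_mult mult.assoc)
qed

lemma coord2_bound': "\<bar>(z::real^'n) $ a * z $ b\<bar> \<le> 1 * (1 + (norm z)\<^sup>2) ^ 3"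
  using coord2_bound[of z a b] self_le_power[of "1 + (norm z)\<^sup>2" 3] by simp

text \<open>Integration by parts, since \<open>\<partial>\<^sub>a\<close> of the Gaussian is \<open>- z\<^sub>a / 2\<close> times the Gaussian.\<close>

lemma gauss_by_parts:
  fixes P :: "real^'n \<Rightarrow> real"
  assumes P: "smooth_on UNIV P"
    and i: "integrable lborel (\<lambda>z. gauss 1 z * P z)" "integrable lborel (\<lambda>z. gauss 1 z * (z $ a * P z))"
      "integrable lborel (\<lambda>z. gauss 1 z * partial_deriv a P z)"
  shows "(LINT z|lborel. gauss 1 z * (z $ a * P z)) = 2 * (LINT z|lborel. gauss 1 z * partial_deriv a P z)"
proof -
  have d: "partial_deriv a (\<lambda>z. gauss 1 z * P z) z = gauss 1 z * partial_deriv a P z - (1/2) * (gauss 1 z * (z $ a * P z))" for z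
    using smooth_on_differentiable[OF P, of z] smooth_on_differentiable[OF smooth_on_gauss, of z 1]
    by (simp add: partial_deriv_mult partial_deriv_gauss)
  have int: "integrable lborel (partial_deriv a (\<lambda>z. gauss 1 z * P z))"
    using i by (simp add: d[abs_def])
  have "(LINT z|lborel. partial_deriv a (\<lambda>z. gauss 1 z * P z) z) = 0"
    by (rule integral_partial_deriv_zero[OF _ i(1) int]) (intro smooth_on_mult smooth_on_gauss P open_UNIV)
  then show ?thesis using i by (simp add: d)
qed

lemma gauss_moment2:
  "integrable lborel (\<lambda>z::real^'n. gauss 1 z * (z $ a * z $ b))"
  "(LINT z|lborel. gauss 1 z * ((z::real^'n) $ a * z $ b)) = (if a = b then 2 else 0)"
proof -
  show i: "integrable lborel (\<lambda>z::real^'n. gauss 1 z * (z $ a * z $ b))" for a b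
    by (rule gauss_integrable_poly[OF _ coord2_bound']) simp
  have i1: "integrable lborel (\<lambda>z::real^'n. gauss 1 z * z $ b)"
    using coord_bound[of _ b] self_le_power[of "1 + (norm _)\<^sup>2" 3]
    by (intro gauss_integrable_poly[of _ 1]) (auto intro: order_trans)
  have "(LINT z|lborel. gauss 1 z * ((z::real^'n) $ a * z $ b)) = 2 * (LINT z|lborel. gauss 1 z * partial_deriv a (\<lambda>z::real^'n. z $ b) z)"
    using i i1 gauss_integral(1)[of 1] by (intro gauss_by_parts smooth_on_coord) (auto simp: partial_deriv_coord)
  then show "(LINT z|lborel. gauss 1 z * ((z::real^'n) $ a * z $ b)) = (if a = b then 2 else 0)"
    by (simp add: partial_deriv_coord gauss_integral)
qed

text \<open>Isserlis' formula for covariance \<open>2\<close>. One integration by parts in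
  \<open>z $ a\<close> reduces it to second moments: every pairing contributes
  \<open>2 * 2\<close>.\<close>

lemma gauss_moment4:
  "integrable lborel (\<lambda>z::real^'n. gauss 1 z * (z $ a * z $ b * z $ c * z $ d))"
  "(LINT z|lborel. gauss 1 z * ((z::real^'n) $ a * z $ b * z $ c * z $ d))
    = 4 * ((if a = b \<and> c = d then 1 else 0) + (if a = c \<and> b = d then 1 else 0) + (if a = d \<and> b = c then 1 else 0))"
proof -
  show i: "integrable lborel (\<lambda>z::real^'n. gauss 1 z * (z $ a * z $ b * z $ c * z $ d))"
    by (rule gauss_integrable_poly[OF _ coord4_bound]) simp
  let ?P = "\<lambda>z::real^'n. z $ b * z $ c * z $ d"
  have co: "(\<lambda>y::real^'n. y $ a) differentiable (at y)" for a y
    by (rule smooth_on_differentiable[OF smooth_on_coord[OF open_UNIV]]) simp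
  have dP: "partial_deriv a ?P z = (if a = b then 1 else 0) * (z $ c * z $ d) + (if a = c then 1 else 0) * (z $ b * z $ d)
      + (if a = d then 1 else 0) * (z $ b * z $ c)" for z
    using co by (simp add: partial_deriv_mult differentiable_mult partial_deriv_coord algebra_simps)
  have i3: "integrable lborel (\<lambda>z. gauss 1 z * ?P z)"
  proof (rule gauss_integrable_poly[of _ 1])
    fix z :: "real^'n"
    have "\<bar>z $ b * z $ c\<bar> * \<bar>z $ d\<bar> \<le> (1 + (norm z)\<^sup>2) * (1 + (norm z)\<^sup>2)"
      by (intro mult_mono coord2_bound coord_bound) auto
    also have "\<dots> \<le> (1 + (norm z)\<^sup>2) ^ 3"
      using mult_left_mono[of 1 "1 + (norm z)\<^sup>2" "(1 + (norm z)\<^sup>2) * (1 + (norm z)\<^sup>2)"] by (simp add: power3_eq_cube)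
    finally show "\<bar>?P z\<bar> \<le> 1 * (1 + (norm z)\<^sup>2) ^ 3" by (simp add: abs_mult)
  qed simp
  have split: "gauss 1 z * partial_deriv a ?P z = (if a = b then 1 else 0) * (gauss 1 z * (z $ c * z $ d))
      + (if a = c then 1 else 0) * (gauss 1 z * (z $ b * z $ d)) + (if a = d then 1 else 0) * (gauss 1 z * (z $ b * z $ c))" for z
    unfolding dP by (simp add: algebra_simps)
  have i2: "integrable lborel (\<lambda>z. gauss 1 z * partial_deriv a ?P z)"
    unfolding split by (intro Bochner_Integration.integrable_add integrable_mult_right gauss_moment2)
  have "(LINT z|lborel. gauss 1 z * (z $ a * ?P z)) = 2 * (LINT z|lborel. gauss 1 z * partial_deriv a ?P z)"
    using i by (intro gauss_by_parts i2 i3 smooth_intros open_UNIV) (simp add: mult.assoc)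
  also have "(LINT z|lborel. gauss 1 z * partial_deriv a ?P z) = (if a = b then 1 else 0) * (if c = d then 2 else 0)
      + (if a = c then 1 else 0) * (if b = d then 2 else 0) + (if a = d then 1 else 0) * (if b = c then 2 else 0)"
    unfolding split
    by (simp only: Bochner_Integration.integral_add Bochner_Integration.integrable_add integrable_mult_right
        gauss_moment2 integral_mult_right_zero)
  finally show "(LINT z|lborel. gauss 1 z * ((z::real^'n) $ a * z $ b * z $ c * z $ d))
    = 4 * ((if a = b \<and> c = d then 1 else 0) + (if a = c \<and> b = d then 1 else 0) + (if a = d \<and> b = c then 1 else 0))"
    by (simp add: mult.assoc algebra_simps)
qed

section \<open>The entropy of a Gaussian test function\<close>

text \<open>The form in which the hypothesis enters the analysis: smooth compactly supported
  functions in one coordinate domain, with ordinary integrals.\<close>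

definition euclid_log_sobolev :: "(real^'n) set \<Rightarrow> (real^'n \<Rightarrow> real^'n^'n) \<Rightarrow> real \<Rightarrow> bool" where
  "euclid_log_sobolev \<Omega> G \<tau>\<^sub>0 \<longleftrightarrow> (\<forall>\<psi> \<tau>. test_function \<Omega> \<psi> \<longrightarrow>
     (LINT x|lborel. (\<psi> x)\<^sup>2 * sqrt (det (G x))) = 1 \<longrightarrow> 0 < \<tau> \<longrightarrow> \<tau> < \<tau>\<^sub>0 \<longrightarrow>
     (LINT x|lborel. (\<psi> x)\<^sup>2 * ln ((\<psi> x)\<^sup>2) * sqrt (det (G x)))
       \<le> 4 * \<tau> * (LINT x|lborel. energy G \<psi> x * sqrt (det (G x))) - real CARD('n) - real CARD('n) / 2 * ln (4 * pi * \<tau>))"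

locale cutoff_field = metric_field \<Omega> G for \<Omega> :: "(real^'n) set" and G +
  fixes r :: real and \<eta> :: "real^'n \<Rightarrow> real"
  assumes r: "r > 0" and ball: "cball 0 (2 * r) \<subseteq> \<Omega>"
    and \<eta>: "smooth_on UNIV \<eta>" "\<And>y. 0 \<le> \<eta> y" "\<And>y. \<eta> y \<le> 1"
      "\<And>y. norm y \<le> r \<Longrightarrow> \<eta> y = 1" "\<And>y. norm y \<ge> 2 * r \<Longrightarrow> \<eta> y = 0"
begin

abbreviation "K \<equiv> cball (0::real^'n) (2 * r)"

lemma \<eta>_zero: "y \<notin> K \<Longrightarrow> \<eta> y = 0"
  using \<eta>(5)[of y] by simp

text \<open>Chosen to guarantee integrability against every Gaussian. Boundedness and measurability,
  rather than smoothness, accommodate the term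
  \<open>\<eta>\<^sup>2 * ln (\<eta>\<^sup>2)\<close>.\<close>

definition adm :: "(real^'n \<Rightarrow> real) \<Rightarrow> bool" where
  "adm f \<longleftrightarrow> f \<in> borel_measurable borel \<and> (\<exists>C. \<forall>x. \<bar>f x\<bar> \<le> C) \<and> (\<forall>x. x \<notin> K \<longrightarrow> f x = 0)"

lemma adm_continuous:
  assumes "continuous_on \<Omega> f" "\<And>x. x \<notin> K \<Longrightarrow> f x = 0"
  shows "adm f"
proof -
  have c: "continuous_on K f" using assms(1) ball by (rule continuous_on_subset)
  have "bounded (f ` K)" by (intro compact_imp_bounded compact_continuous_image c compact_cball)
  then obtain C where "\<forall>z\<in>f ` K. \<bar>z\<bar> \<le> C" unfolding bounded_iff real_norm_def by blast
  then have C: "x \<in> K \<Longrightarrow> \<bar>f x\<bar> \<le> C" for x by blast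
  have "\<bar>f x\<bar> \<le> max C 0" for x
    using C[of x] assms(2)[of x] by (cases "x \<in> K") auto
  moreover have "(\<lambda>x. indicator K x *\<^sub>R f x) \<in> borel_measurable borel"
    by (intro borel_measurable_continuous_on_indicator c) simp
  moreover have "(\<lambda>x. indicator K x *\<^sub>R f x) = f" using assms(2) by (auto simp: fun_eq_iff indicator_def)
  ultimately show ?thesis unfolding adm_def using assms(2) by auto
qed

lemma adm_smooth: "smooth_on \<Omega> f \<Longrightarrow> (\<And>x. x \<notin> K \<Longrightarrow> f x = 0) \<Longrightarrow> adm f"
  by (intro adm_continuous smooth_on_continuous_on)

lemma adm_add:
  assumes "adm f" "adm h"
  shows "adm (\<lambda>x. f x + h x)"
proof -
  obtain C D where "\<And>x. \<bar>f x\<bar> \<le> C" "\<And>x. \<bar>h x\<bar> \<le> D" using assms by (auto simp: adm_def)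
  then have "\<bar>f x + h x\<bar> \<le> C + D" for x using abs_triangle_ineq[of "f x" "h x"] by (meson add_mono order_trans)
  then show ?thesis using assms by (auto simp: adm_def)
qed

lemma adm_scale: assumes "adm f" shows "adm (\<lambda>x. c * f x)"
proof -
  obtain C where "\<And>x. \<bar>f x\<bar> \<le> C" using assms by (auto simp: adm_def)
  then have "\<bar>c * f x\<bar> \<le> \<bar>c\<bar> * C" for x by (simp add: abs_mult mult_left_mono)
  then show ?thesis using assms by (auto simp: adm_def)
qed

lemma adm_diff: "adm f \<Longrightarrow> adm h \<Longrightarrow> adm (\<lambda>x. f x - h x)"
  using adm_add[of f "\<lambda>x. (-1) * h x"] adm_scale[of h "-1"] by simp

lemma adm_gauss:
  assumes "adm f" "\<tau> > 0"
  shows "integrable lborel (\<lambda>y. gauss \<tau> y * f y)"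
proof -
  obtain C where C: "\<And>x. \<bar>f x\<bar> \<le> C" using assms by (auto simp: adm_def)
  have 1: "integrable lborel (\<lambda>y::real^'n. C * gauss \<tau> y)"
    by (intro integrable_mult_right gauss_integral assms)
  have "f \<in> borel_measurable borel" using assms by (simp add: adm_def)
  then have 2: "(\<lambda>y. gauss \<tau> y * f y) \<in> borel_measurable lborel" by simp
  have C0: "0 \<le> C" using C[of 0] by linarith
  have "norm (gauss \<tau> y * f y) \<le> norm (C * gauss \<tau> y)" for y
    using C[of y] C0 gauss_pos[OF assms(2), of y] by (simp add: abs_mult mult.commute mult_left_mono)
  then show ?thesis by (intro Bochner_Integration.integrable_bound[OF 1 2] AE_I2)
qed

text \<open>
  The amplitude \<open>b\<close> is such that the test function \<open>psi = b \<surd>gauss \<tau>\<close> has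
  \<open>psi\<^sup>2 dvol = \<eta>\<^sup>2 gauss \<tau> dy\<close>. Up to the divergence of \<open>gauss \<tau> (\<tau> p + q)\<close>, energy minus entropy
  is \<open>gauss \<tau> (\<tau> e1 + e0)\<close>; near the origin \<open>e1\<close> is quadratic in the Christoffel symbols minus
  the scalar curvature, and \<open>e0 = (ln det G + tr G\<^sup>-\<^sup>1 - n) / 2\<close>, which is of fourth order in normal coordinates.
\<close>

definition s :: "real^'n \<Rightarrow> real" where "s x = sqrt (det (G x))"
definition b :: "real^'n \<Rightarrow> real" where "b y = \<eta> y * det (G y) powr (-1/4)"
definition p :: "'n \<Rightarrow> real^'n \<Rightarrow> real" where
  "p i y = (\<eta> y)\<^sup>2 * (Gc i y - (\<Sum>k\<in>UNIV. Gi y $ i $ k * w k y))"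
definition q :: "'n \<Rightarrow> real^'n \<Rightarrow> real" where
  "q i y = (-1/2) * (\<eta> y)\<^sup>2 * ((\<Sum>k\<in>UNIV. Gi y $ i $ k * y $ k) + y $ i)"
definition db :: "'n \<Rightarrow> real^'n \<Rightarrow> real" where "db i = partial_deriv i b"
definition E2 :: "real^'n \<Rightarrow> real" where
  "E2 y = (\<Sum>i\<in>UNIV. \<Sum>k\<in>UNIV. Gi y $ k $ i * db k y * db i y)"
definition B1 :: "real^'n \<Rightarrow> real" where
  "B1 y = (\<Sum>i\<in>UNIV. \<Sum>k\<in>UNIV. Gi y $ k $ i * db k y * y $ i)"
definition Y0 :: "real^'n \<Rightarrow> real" where
  "Y0 y = (\<Sum>i\<in>UNIV. \<Sum>k\<in>UNIV. Gi y $ k $ i * y $ k * y $ i)"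
definition e1 :: "real^'n \<Rightarrow> real" where
  "e1 y = 4 * s y * E2 y - (\<Sum>i\<in>UNIV. partial_deriv i (p i) y)"
definition e0 :: "real^'n \<Rightarrow> real" where
  "e0 y = - 2 * b y * s y * B1 y - (\<eta> y)\<^sup>2 * ln ((\<eta> y)\<^sup>2) + (1/2) * (\<eta> y)\<^sup>2 * ln (det (G y))
     - real CARD('n) * (\<eta> y)\<^sup>2 - (\<Sum>i\<in>UNIV. partial_deriv i (q i) y) + (1/2) * (\<Sum>i\<in>UNIV. y $ i * p i y)"

lemma det_smooth: "smooth_on \<Omega> (\<lambda>y. det (G y))"
  by (intro smooth_on_det op smooth)

lemma \<eta>_smooth: "smooth_on S \<eta>"
  using \<eta>(1) by (rule smooth_on_subset) simp

lemma b_smooth: "smooth_on UNIV b"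
  unfolding b_def[abs_def]
proof (rule smooth_zero_extension[OF op _ closed_cball ball])
  show "smooth_on \<Omega> (\<lambda>y. \<eta> y * det (G y) powr (- 1 / 4))"
    by (intro smooth_on_mult smooth_on_powr op \<eta>_smooth det_smooth det_pos)
qed (simp add: \<eta>_zero)

lemma p_smooth: "smooth_on UNIV (p i)"
  unfolding p_def[abs_def]
proof (rule smooth_zero_extension[OF op _ closed_cball ball])
  show "smooth_on \<Omega> (\<lambda>y. (\<eta> y)\<^sup>2 * (Gc i y - (\<Sum>k\<in>UNIV. Gi y $ i $ k * w k y)))"
    by (intro smooth_intros op \<eta>_smooth Gc_smooth Gi_smooth w_smooth)
qed (simp add: \<eta>_zero)

lemma q_smooth: "smooth_on UNIV (q i)"
  unfolding q_def[abs_def]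
proof (rule smooth_zero_extension[OF op _ closed_cball ball])
  show "smooth_on \<Omega> (\<lambda>y. (-1/2) * (\<eta> y)\<^sup>2 * ((\<Sum>k\<in>UNIV. Gi y $ i $ k * y $ k) + y $ i))"
    by (intro smooth_intros op \<eta>_smooth Gi_smooth)
qed (simp add: \<eta>_zero)

lemma b_zero: "y \<notin> K \<Longrightarrow> b y = 0" and p_zero: "y \<notin> K \<Longrightarrow> p i y = 0" and q_zero: "y \<notin> K \<Longrightarrow> q i y = 0"
  by (simp_all add: b_def p_def q_def \<eta>_zero)

lemma db_zero: "y \<notin> K \<Longrightarrow> db i y = 0"
  unfolding db_def by (rule partial_deriv_zero_off[OF closed_cball b_zero])

lemma db_smooth: "smooth_on S (db i)"
  unfolding db_def by (rule smooth_on_subset[OF smooth_on_partial_deriv[OF b_smooth]]) simp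

lemma s_smooth: "smooth_on \<Omega> s"
proof -
  have "smooth_on \<Omega> (\<lambda>y. det (G y) powr (1/2))"
    by (intro smooth_on_powr op det_smooth det_pos)
  then show ?thesis
    by (subst smooth_on_cong[OF op, of s "\<lambda>y. det (G y) powr (1/2)"]) (simp_all add: s_def powr_half_sqrt less_imp_le det_pos)
qed

text \<open>The exponent \<open>-1/4\<close> in \<open>b\<close> is fixed by this: its square
  compensates the square root in the volume density.\<close>

lemma b2s: "y \<in> \<Omega> \<Longrightarrow> (b y)\<^sup>2 * s y = (\<eta> y)\<^sup>2"
proof -
  assume "y \<in> \<Omega>"
  then have d: "det (G y) > 0" by (rule det_pos)
  have "(det (G y) powr (-1/4))\<^sup>2 * sqrt (det (G y)) = det (G y) powr (-1/4 + -1/4 + 1/2)"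
    unfolding powr_add power2_eq_square using d by (simp add: powr_half_sqrt)
  then show ?thesis using d by (simp add: b_def s_def power_mult_distrib)
qed

lemma B1_sym: "y \<in> \<Omega> \<Longrightarrow> (\<Sum>i\<in>UNIV. \<Sum>k\<in>UNIV. Gi y $ k $ i * y $ k * db i y) = B1 y"
  unfolding B1_def by (subst sum.swap) (simp add: Gi_sym mult_ac)

lemma ln_adm: "adm (\<lambda>y. (\<eta> y)\<^sup>2 * ln ((\<eta> y)\<^sup>2))"
proof -
  have "\<bar>t * ln t\<bar> \<le> 1" if "0 \<le> t" "t \<le> 1" for t :: real
  proof (cases "t = 0")
    case False
    then have t: "t > 0" using that by simp
    have "- ln t \<le> 1 / t" using ln_le_minus_one[of "1/t"] t by (simp add: ln_div)
    then have "t * (- ln t) \<le> t * (1 / t)" using t by (intro mult_left_mono) auto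
    moreover have "t * ln t \<le> 0" using t that by (intro mult_nonneg_nonpos) auto
    ultimately show ?thesis using t by simp
  qed simp
  moreover have "(\<eta> y)\<^sup>2 \<le> 1" for y using \<eta>(2,3)[of y] by (simp add: power_le_one)
  ultimately have "\<bar>(\<eta> y)\<^sup>2 * ln ((\<eta> y)\<^sup>2)\<bar> \<le> 1" for y by simp
  moreover have "\<eta> \<in> borel_measurable borel"
    by (intro borel_measurable_continuous_onI smooth_on_continuous_on \<eta>)
  ultimately show ?thesis by (auto simp: adm_def \<eta>_zero)
qed

lemma ln_det_continuous: "continuous_on \<Omega> (\<lambda>y. ln (det (G y)))"
  using det_nz by (intro continuous_on_ln smooth_on_continuous_on det_smooth) auto

lemma Gi_continuous: "continuous_on \<Omega> (\<lambda>y. Gi y $ i $ j)"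
  by (rule smooth_on_continuous_on[OF Gi_smooth])

lemma E2_smooth: "smooth_on \<Omega> E2" and B1_smooth: "smooth_on \<Omega> B1" and Y0_smooth: "smooth_on \<Omega> Y0"
  unfolding E2_def[abs_def] B1_def[abs_def] Y0_def[abs_def]
  by (intro smooth_intros op db_smooth Gi_smooth)+

lemma dp_zero: "y \<notin> K \<Longrightarrow> partial_deriv i (p j) y = 0" and dq_zero: "y \<notin> K \<Longrightarrow> partial_deriv i (q j) y = 0"
  by (rule partial_deriv_zero_off[OF closed_cball p_zero], assumption+)
    (rule partial_deriv_zero_off[OF closed_cball q_zero], assumption+)

lemma e1_smooth: "smooth_on \<Omega> e1"
  unfolding e1_def[abs_def]
  by (intro smooth_intros op s_smooth E2_smooth) (rule smooth_on_subset[OF p_smooth], simp)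

lemma e1_adm: "adm e1"
  by (rule adm_smooth[OF e1_smooth]) (simp add: e1_def E2_def db_zero dp_zero)

lemma e0_adm: "adm e0"
proof -
  have 1: "adm (\<lambda>y. - 2 * b y * s y * B1 y)"
    by (intro adm_smooth smooth_intros op s_smooth B1_smooth smooth_on_subset[OF b_smooth]) (simp_all add: b_zero)
  have 2: "adm (\<lambda>y. (1/2) * (\<eta> y)\<^sup>2 * ln (det (G y)))"
    by (intro adm_continuous continuous_on_mult continuous_on_const continuous_on_power ln_det_continuous
        smooth_on_continuous_on \<eta>_smooth) (simp add: \<eta>_zero)
  have 3: "adm (\<lambda>y. real CARD('n) * (\<eta> y)\<^sup>2)"
    by (intro adm_smooth smooth_intros op \<eta>_smooth) (simp add: \<eta>_zero)
  have 4: "adm (\<lambda>y. \<Sum>i\<in>UNIV. partial_deriv i (q i) y)"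
    by (intro adm_smooth smooth_intros op smooth_on_subset[OF q_smooth]) (simp_all add: dq_zero)
  have 5: "adm (\<lambda>y. (1/2) * (\<Sum>i\<in>UNIV. y $ i * p i y))"
    by (intro adm_smooth smooth_intros op smooth_on_subset[OF p_smooth]) (simp_all add: p_zero)
  show ?thesis
    unfolding e0_def[abs_def] by (intro adm_add adm_diff 1 2 3 4 5 ln_adm)
qed

section \<open>Energy and entropy of the Gaussian test function\<close>

context
  fixes \<tau> :: real
  assumes \<tau>: "\<tau> > 0"
begin

text \<open>\<open>rg\<close> is the square root of \<open>gauss \<tau>\<close>, hence a multiple of \<open>gauss (2 \<tau>)\<close>.\<close>

definition rg :: "real^'n \<Rightarrow> real" where
  "rg y = sqrt ((1 / sqrt (4 * pi * \<tau>)) ^ CARD('n)) / (1 / sqrt (4 * pi * (2 * \<tau>))) ^ CARD('n) * gauss (2 * \<tau>) y"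

definition psi :: "real^'n \<Rightarrow> real" where "psi y = b y * rg y"

lemma rg_smooth: "smooth_on UNIV rg"
  unfolding rg_def[abs_def] by (intro smooth_on_mult smooth_on_const smooth_on_gauss open_UNIV)

lemma rg_sq: "(rg y)\<^sup>2 = gauss \<tau> y"
proof -
  let ?d = "(1 / sqrt (4 * pi * (2 * \<tau>))) ^ CARD('n)" and ?c = "(1 / sqrt (4 * pi * \<tau>)) ^ CARD('n)"
  have d: "?d > 0" and c: "?c \<ge> 0" using \<tau> by simp_all
  have "rg y = sqrt ?c * (1 / ?d * ?d) * exp (- (norm y)\<^sup>2 / (4 * (2 * \<tau>)))"
    unfolding rg_def gauss_def by simp
  also have "\<dots> = sqrt ?c * exp (- (norm y)\<^sup>2 / (4 * (2 * \<tau>)))" using d by simp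
  finally have "(rg y)\<^sup>2 = ?c * (exp (- (norm y)\<^sup>2 / (4 * (2 * \<tau>))))\<^sup>2" using c by (simp add: power_mult_distrib)
  also have "(exp (- (norm y)\<^sup>2 / (4 * (2 * \<tau>))))\<^sup>2 = exp (- (norm y)\<^sup>2 / (4 * \<tau>))"
    by (simp add: power2_eq_square exp_add[symmetric])
  finally show ?thesis by (simp add: gauss_def)
qed

lemma d_rg: "partial_deriv i rg y = - (y $ i) / (4 * \<tau>) * rg y"
  unfolding rg_def[abs_def] using \<tau>
  by (subst partial_deriv_cmult) (simp_all add: smooth_on_differentiable[OF smooth_on_gauss] partial_deriv_gauss mult_ac)

lemma psi_test: "test_function \<Omega> psi"
proof (rule test_functionI[OF _ compact_cball ball])
  show "smooth_on UNIV psi"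
    unfolding psi_def[abs_def] by (intro smooth_on_mult b_smooth rg_smooth open_UNIV)
qed (simp add: psi_def b_zero)

lemma d_psi: "partial_deriv i psi y = rg y * (db i y - y $ i / (4 * \<tau>) * b y)"
  unfolding psi_def[abs_def] db_def
  by (subst partial_deriv_mult) (simp_all add: smooth_on_differentiable[OF b_smooth] smooth_on_differentiable[OF rg_smooth] d_rg algebra_simps)

definition EN :: "real^'n \<Rightarrow> real" where
  "EN y = s y * E2 y - (1 / (2 * \<tau>)) * (b y * s y * B1 y) + (1 / (16 * \<tau>\<^sup>2)) * ((\<eta> y)\<^sup>2 * Y0 y)"

definition LG :: "real^'n \<Rightarrow> real" where
  "LG y = (\<eta> y)\<^sup>2 * ln ((\<eta> y)\<^sup>2) - (1/2) * ((\<eta> y)\<^sup>2 * ln (det (G y)))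
     - (real CARD('n) / 2 * ln (4 * pi * \<tau>)) * (\<eta> y)\<^sup>2 - (1 / (4 * \<tau>)) * ((\<eta> y)\<^sup>2 * (norm y)\<^sup>2)"

lemma EN_adm: "adm EN"
proof -
  have 1: "adm (\<lambda>y. s y * E2 y)"
    by (intro adm_smooth smooth_intros op s_smooth E2_smooth) (simp add: E2_def db_zero)
  have 2: "adm (\<lambda>y. b y * s y * B1 y)"
    by (intro adm_smooth smooth_intros op s_smooth B1_smooth smooth_on_subset[OF b_smooth]) (simp_all add: b_zero)
  have 3: "adm (\<lambda>y. (\<eta> y)\<^sup>2 * Y0 y)"
    by (intro adm_smooth smooth_intros op \<eta>_smooth Y0_smooth) (simp add: \<eta>_zero)
  show ?thesis unfolding EN_def[abs_def] by (intro adm_add adm_diff adm_scale 1 2 3)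
qed

lemma \<eta>2_adm: "adm (\<lambda>y. (\<eta> y)\<^sup>2)"
  by (intro adm_smooth smooth_intros op \<eta>_smooth) (simp add: \<eta>_zero)

lemma LG_adm: "adm LG"
proof -
  have 1: "adm (\<lambda>y. (\<eta> y)\<^sup>2 * ln (det (G y)))"
    by (intro adm_continuous continuous_on_mult continuous_on_power ln_det_continuous
        smooth_on_continuous_on \<eta>_smooth) (simp add: \<eta>_zero)
  have 2: "adm (\<lambda>y. (\<eta> y)\<^sup>2 * (norm y)\<^sup>2)"
    by (intro adm_smooth smooth_intros op \<eta>_smooth smooth_on_subset[OF smooth_on_norm_sq]) (simp_all add: \<eta>_zero)
  show ?thesis unfolding LG_def[abs_def] by (intro adm_add adm_diff adm_scale 1 2 ln_adm \<eta>2_adm)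
qed

lemma psi_sq: "(psi y)\<^sup>2 * s y = gauss \<tau> y * (\<eta> y)\<^sup>2"
proof (cases "y \<in> K")
  case True
  then have "y \<in> \<Omega>" using ball by auto
  from b2s[OF this] show ?thesis by (simp add: psi_def power_mult_distrib rg_sq[symmetric] mult_ac)
qed (simp add: psi_def b_zero \<eta>_zero)

lemma psi_ln: "(psi y)\<^sup>2 * ln ((psi y)\<^sup>2) * s y = gauss \<tau> y * LG y"
proof (cases "\<eta> y = 0")
  case True
  then show ?thesis by (simp add: psi_def b_def LG_def)
next
  case False
  then have "y \<in> K" using \<eta>_zero[of y] by blast
  then have "y \<in> \<Omega>" using ball by blast
  then have d: "det (G y) > 0" by (rule det_pos)
  have g: "gauss \<tau> y > 0" by (rule gauss_pos[OF \<tau>])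
  have "(psi y)\<^sup>2 = (\<eta> y)\<^sup>2 * (det (G y) powr (-1/4))\<^sup>2 * gauss \<tau> y"
    by (simp add: psi_def b_def power_mult_distrib rg_sq)
  also have "(det (G y) powr (-1/4))\<^sup>2 = det (G y) powr (-1/2)"
    by (simp add: power2_eq_square powr_add[symmetric])
  finally have "ln ((psi y)\<^sup>2) = ln ((\<eta> y)\<^sup>2) - (1/2) * ln (det (G y)) + ln (gauss \<tau> y)"
    using False d g by (simp add: ln_mult ln_powr)
  also have "ln (gauss \<tau> y) = - (real CARD('n) / 2 * ln (4 * pi * \<tau>)) - (norm y)\<^sup>2 / (4 * \<tau>)"
    using \<tau> by (simp add: gauss_def ln_mult ln_realpow ln_div ln_sqrt)
  finally have l: "ln ((psi y)\<^sup>2) = ln ((\<eta> y)\<^sup>2) - (1/2) * ln (det (G y))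
     + (- (real CARD('n) / 2 * ln (4 * pi * \<tau>)) - (norm y)\<^sup>2 / (4 * \<tau>))" .
  have "(psi y)\<^sup>2 * ln ((psi y)\<^sup>2) * s y = ((psi y)\<^sup>2 * s y) * ln ((psi y)\<^sup>2)" by simp
  then show ?thesis unfolding psi_sq l by (simp add: LG_def algebra_simps)
qed

lemma psi_energy: "energy G psi y * s y = gauss \<tau> y * EN y"
proof (cases "y \<in> K")
  case True
  then have y: "y \<in> \<Omega>" using ball by auto
  have "energy G psi y = gauss \<tau> y * (\<Sum>i\<in>UNIV. \<Sum>k\<in>UNIV. Gi y $ k $ i * (db k y - y $ k / (4 * \<tau>) * b y) * (db i y - y $ i / (4 * \<tau>) * b y))"
    by (simp add: energy_def d_psi rg_sq[symmetric] power2_eq_square sum_distrib_left mult_ac)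
  also have "(\<Sum>i\<in>UNIV. \<Sum>k\<in>UNIV. Gi y $ k $ i * (db k y - y $ k / (4 * \<tau>) * b y) * (db i y - y $ i / (4 * \<tau>) * b y))
    = E2 y - (b y / (4 * \<tau>)) * B1 y - (b y / (4 * \<tau>)) * (\<Sum>i\<in>UNIV. \<Sum>k\<in>UNIV. Gi y $ k $ i * y $ k * db i y)
      + ((b y)\<^sup>2 / (16 * \<tau>\<^sup>2)) * Y0 y"
    unfolding E2_def B1_def Y0_def sum_distrib_left sum.distrib[symmetric] sum_subtractf[symmetric]
    using \<tau> by (intro sum.cong refl) (simp add: field_simps power2_eq_square)
  also have "(\<Sum>i\<in>UNIV. \<Sum>k\<in>UNIV. Gi y $ k $ i * y $ k * db i y) = B1 y" by (rule B1_sym[OF y])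
  finally have e: "energy G psi y = gauss \<tau> y * (E2 y - (b y / (4 * \<tau>)) * B1 y - (b y / (4 * \<tau>)) * B1 y + ((b y)\<^sup>2 / (16 * \<tau>\<^sup>2)) * Y0 y)" .
  have "energy G psi y * s y = gauss \<tau> y * (s y * E2 y - (1 / (2 * \<tau>)) * (b y * s y * B1 y) + ((b y)\<^sup>2 * s y) / (16 * \<tau>\<^sup>2) * Y0 y)"
    unfolding e by (simp add: algebra_simps)
  then show ?thesis unfolding b2s[OF y] EN_def by simp
next
  case False
  then show ?thesis
    by (simp add: energy_def d_psi db_zero b_zero EN_def E2_def \<eta>_zero)
qed

definition F :: "'n \<Rightarrow> real^'n \<Rightarrow> real" where "F i y = gauss \<tau> y * (\<tau> * p i y + q i y)"

lemma F_int: "integrable lborel (partial_deriv i (F i))" "(LINT y|lborel. partial_deriv i (F i) y) = 0"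
proof -
  have "smooth_on UNIV (F i)"
    unfolding F_def[abs_def] by (intro smooth_intros smooth_on_gauss p_smooth q_smooth open_UNIV)
  note * = integral_partial_deriv_compact_support[where K=K and i=i, OF this compact_cball]
  show "integrable lborel (partial_deriv i (F i))" "(LINT y|lborel. partial_deriv i (F i) y) = 0"
    by (rule *; simp add: F_def p_zero q_zero)+
qed

text \<open>A derivative of the Gaussian yields the factor \<open>- y $ i / (2 * \<tau>)\<close>.
  Hence \<open>q\<close> is chosen so that its divergence term absorbs the two contributions of
  order \<open>1 / \<tau>\<close>, namely \<open>Y0\<close> from the energy and
  \<open>(norm y)\<^sup>2\<close> from the logarithm. The field \<open>p\<close> is the one whose
  divergence occurs in \<open>Scal_identity\<close>; its product with the same factor is given back
  in \<open>e0\<close>.\<close>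

lemma entropy_identity:
  "4 * \<tau> * (gauss \<tau> y * EN y) - gauss \<tau> y * LG y - (real CARD('n) + real CARD('n) / 2 * ln (4 * pi * \<tau>)) * (gauss \<tau> y * (\<eta> y)\<^sup>2)
    = (\<Sum>i\<in>UNIV. partial_deriv i (F i) y) + gauss \<tau> y * (\<tau> * e1 y + e0 y)"
proof (cases "y \<in> K")
  case True
  then have y: "y \<in> \<Omega>" using ball by auto
  have dF: "partial_deriv i (F i) y = gauss \<tau> y * (\<tau> * partial_deriv i (p i) y + partial_deriv i (q i) y
      - (1/2) * (y $ i * p i y) - (1 / (2 * \<tau>)) * (y $ i * q i y))" for i
  proof -
    have "partial_deriv i (F i) y = partial_deriv i (gauss \<tau>) y * (\<tau> * p i y + q i y)
      + gauss \<tau> y * (\<tau> * partial_deriv i (p i) y + partial_deriv i (q i) y)"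
      unfolding F_def[abs_def]
      using smooth_on_differentiable[OF smooth_on_gauss, of y \<tau>] smooth_on_differentiable[OF p_smooth, of y i]
        smooth_on_differentiable[OF q_smooth, of y i]
      by (simp add: partial_deriv_mult partial_deriv_add differentiable_mult differentiable_add)
    then show ?thesis using \<tau> by (simp add: partial_deriv_gauss field_simps)
  qed
  have yq: "(\<Sum>i\<in>UNIV. y $ i * q i y) = (-1/2) * (\<eta> y)\<^sup>2 * (Y0 y + (norm y)\<^sup>2)"
  proof -
    have "(\<Sum>i\<in>UNIV. y $ i * q i y) = (-1/2) * (\<eta> y)\<^sup>2 * ((\<Sum>i\<in>UNIV. \<Sum>k\<in>UNIV. Gi y $ i $ k * y $ i * y $ k) + (\<Sum>i\<in>UNIV. (y $ i)\<^sup>2))"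
      unfolding q_def by (simp add: sum_distrib_left sum.distrib[symmetric] algebra_simps power2_eq_square)
    also have "(\<Sum>i\<in>UNIV. \<Sum>k\<in>UNIV. Gi y $ i $ k * y $ i * y $ k) = Y0 y"
      unfolding Y0_def by (subst sum.swap) simp
    finally show ?thesis by (simp add: norm_sq_sum)
  qed
  have "(\<Sum>i\<in>UNIV. partial_deriv i (F i) y) = gauss \<tau> y * (\<tau> * (\<Sum>i\<in>UNIV. partial_deriv i (p i) y) + (\<Sum>i\<in>UNIV. partial_deriv i (q i) y)
      - (1/2) * (\<Sum>i\<in>UNIV. y $ i * p i y) - (1 / (2 * \<tau>)) * (\<Sum>i\<in>UNIV. y $ i * q i y))"
    unfolding dF by (simp only: sum_distrib_left[symmetric] sum.distrib sum_subtractf)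
  note sF = this
  have main: "4 * \<tau> * EN y - LG y - (real CARD('n) + real CARD('n) / 2 * ln (4 * pi * \<tau>)) * (\<eta> y)\<^sup>2
     = \<tau> * (\<Sum>i\<in>UNIV. partial_deriv i (p i) y) + (\<Sum>i\<in>UNIV. partial_deriv i (q i) y)
      - (1/2) * (\<Sum>i\<in>UNIV. y $ i * p i y) - (1 / (2 * \<tau>)) * (\<Sum>i\<in>UNIV. y $ i * q i y) + (\<tau> * e1 y + e0 y)"
    unfolding yq EN_def LG_def e1_def e0_def using \<tau> by (simp add: field_simps power2_eq_square)
  have "4 * \<tau> * (gauss \<tau> y * EN y) - gauss \<tau> y * LG y - (real CARD('n) + real CARD('n) / 2 * ln (4 * pi * \<tau>)) * (gauss \<tau> y * (\<eta> y)\<^sup>2)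
    = gauss \<tau> y * (4 * \<tau> * EN y - LG y - (real CARD('n) + real CARD('n) / 2 * ln (4 * pi * \<tau>)) * (\<eta> y)\<^sup>2)"
    by (simp add: algebra_simps)
  then show ?thesis unfolding main sF distrib_left .
next
  case False
  have "partial_deriv i (F i) y = 0" for i
    by (rule partial_deriv_zero_off[OF closed_cball _ False]) (simp add: F_def p_zero q_zero)
  then show ?thesis
    using False e1_adm e0_adm EN_adm LG_adm \<eta>_zero[OF False] by (simp add: adm_def)
qed

text \<open>Because of the cutoff, \<open>psi\<close> has mass \<open>Z \<le> 1\<close>, and the
  inequality is applied to \<open>psi / sqrt Z\<close>. The divergence part of
  \<open>entropy_identity\<close> then integrates to \<open>0\<close>.\<close>

lemma entropy_nonneg:
  assumes lsi: "euclid_log_sobolev \<Omega> G \<tau>\<^sub>0" and less: "\<tau> < \<tau>\<^sub>0"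
  shows "0 \<le> (LINT y|lborel. gauss \<tau> y * (\<tau> * e1 y + e0 y))"
proof -
  note int = adm_gauss[OF EN_adm \<tau>] adm_gauss[OF LG_adm \<tau>] adm_gauss[OF \<eta>2_adm \<tau>]
  define Z where "Z = (LINT y|lborel. gauss \<tau> y * (\<eta> y)\<^sup>2)"
  let ?n = "real CARD('n)"
  have Z1: "Z \<le> 1"
  proof -
    have "Z \<le> (LINT y|lborel. gauss \<tau> (y::real^'n))"
      unfolding Z_def
    proof (intro integral_mono int gauss_integral \<tau>)
      fix y show "gauss \<tau> y * (\<eta> y)\<^sup>2 \<le> gauss \<tau> y"
        using gauss_pos[OF \<tau>, of y] \<eta>(2,3)[of y] by (intro mult_left_le power_le_one) auto
    qed
    then show ?thesis using gauss_integral(2)[OF \<tau>, where 'n='n] by simp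
  qed
  have Z0: "Z > 0"
  proof -
    have nn: "0 \<le> gauss \<tau> y * (\<eta> y)\<^sup>2" for y using gauss_pos[OF \<tau>, of y] by simp
    then have "Z \<ge> 0" unfolding Z_def by (intro integral_nonneg_AE AE_I2)
    moreover have "Z \<noteq> 0"
    proof
      assume "Z = 0"
      then have "AE y in lborel. gauss \<tau> y * (\<eta> y)\<^sup>2 = 0"
        unfolding Z_def using nn by (subst (asm) integral_nonneg_eq_0_iff_AE[OF int(3)]) auto
      then have "AE y in lborel. y \<notin> ball (0::real^'n) r"
      proof (rule AE_mp, intro AE_I2 impI notI)
        fix y assume "gauss \<tau> y * (\<eta> y)\<^sup>2 = 0" "y \<in> ball (0::real^'n) r"
        then show False using gauss_pos[OF \<tau>, of y] \<eta>(4)[of y] by simp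
      qed
      then have "emeasure lborel (ball (0::real^'n) r) = 0"
        by (subst (asm) AE_iff_measurable[of "ball 0 r"]) auto
      then show False using content_ball_pos[OF r, of "0::real^'n"] by (simp add: measure_def)
    qed
    ultimately show ?thesis by simp
  qed
  let ?\<psi> = "\<lambda>y. (1 / sqrt Z) * psi y"
  have sq: "(?\<psi> y)\<^sup>2 = (1 / Z) * (psi y)\<^sup>2" for y using Z0 by (simp add: power_mult_distrib power_divide)
  have t: "test_function \<Omega> ?\<psi>"
  proof (rule test_functionI[OF _ compact_cball ball])
    show "smooth_on UNIV ?\<psi>"
      using test_functionD(1)[OF psi_test] by (intro smooth_on_mult smooth_on_const open_UNIV)
  qed (simp add: psi_def b_zero)
  have 1: "(LINT y|lborel. (?\<psi> y)\<^sup>2 * sqrt (det (G y))) = 1"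
  proof -
    have "(?\<psi> y)\<^sup>2 * sqrt (det (G y)) = (1 / Z) * (gauss \<tau> y * (\<eta> y)\<^sup>2)" for y
      unfolding sq using psi_sq[of y] by (simp add: s_def)
    then show ?thesis using Z0 by (simp add: Z_def[symmetric])
  qed
  have 2: "(LINT y|lborel. (?\<psi> y)\<^sup>2 * ln ((?\<psi> y)\<^sup>2) * sqrt (det (G y))) = (1 / Z) * (LINT y|lborel. gauss \<tau> y * LG y) - ln Z"
  proof -
    have "(?\<psi> y)\<^sup>2 * ln ((?\<psi> y)\<^sup>2) * sqrt (det (G y)) = (1 / Z) * (gauss \<tau> y * LG y) - (ln Z / Z) * (gauss \<tau> y * (\<eta> y)\<^sup>2)" for y
    proof -
      have e: "(psi y)\<^sup>2 * ln ((1 / Z) * (psi y)\<^sup>2) = (psi y)\<^sup>2 * (ln ((psi y)\<^sup>2) - ln Z)"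
        using Z0 by (cases "psi y = 0") (auto simp: ln_mult ln_div)
      have "(?\<psi> y)\<^sup>2 * ln ((?\<psi> y)\<^sup>2) * sqrt (det (G y)) = (1 / Z) * ((psi y)\<^sup>2 * ln ((1 / Z) * (psi y)\<^sup>2)) * s y"
        unfolding sq by (simp add: s_def)
      also have "\<dots> = (1 / Z) * ((psi y)\<^sup>2 * ln ((psi y)\<^sup>2) * s y) - (ln Z / Z) * ((psi y)\<^sup>2 * s y)"
        unfolding e by (simp add: algebra_simps)
      finally have "(?\<psi> y)\<^sup>2 * ln ((?\<psi> y)\<^sup>2) * sqrt (det (G y)) = (1 / Z) * ((psi y)\<^sup>2 * ln ((psi y)\<^sup>2) * s y) - (ln Z / Z) * ((psi y)\<^sup>2 * s y)"
        .
      then show ?thesis by (simp only: psi_sq psi_ln)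
    qed
    then show ?thesis using int Z0 by (simp add: Z_def[symmetric])
  qed
  have 3: "(LINT y|lborel. energy G ?\<psi> y * sqrt (det (G y))) = (1 / Z) * (LINT y|lborel. gauss \<tau> y * EN y)"
  proof -
    have d: "partial_deriv i ?\<psi> y = (1 / sqrt Z) * partial_deriv i psi y" for i y
      by (rule partial_deriv_cmult[OF smooth_on_differentiable[OF test_functionD(1)[OF psi_test]]]) simp
    have "energy G ?\<psi> y = (1 / Z) * energy G psi y" for y
    proof -
      have "(1 / sqrt Z) * (1 / sqrt Z) = 1 / Z" using Z0 by simp
      then have "matrix_inv (G y) $ k $ i * ((1 / sqrt Z) * a) * ((1 / sqrt Z) * c) = (1 / Z) * (matrix_inv (G y) $ k $ i * a * c)" for a c k i
        by (metis (no_types, opaque_lifting) mult.assoc mult.left_commute)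
      then show ?thesis unfolding energy_def d by (simp only: sum_distrib_left)
    qed
    then have "energy G ?\<psi> y * sqrt (det (G y)) = (1 / Z) * (gauss \<tau> y * EN y)" for y
      using psi_energy[of y] by (simp add: s_def)
    then show ?thesis by simp
  qed
  have "(1 / Z) * (LINT y|lborel. gauss \<tau> y * LG y) - ln Z
    \<le> 4 * \<tau> * ((1 / Z) * (LINT y|lborel. gauss \<tau> y * EN y)) - ?n - ?n / 2 * ln (4 * pi * \<tau>)"
    using lsi[unfolded euclid_log_sobolev_def, rule_format, OF t 1 \<tau> less] unfolding 2 3 .
  then have "Z * ((1 / Z) * (LINT y|lborel. gauss \<tau> y * LG y) - ln Z)
    \<le> Z * (4 * \<tau> * ((1 / Z) * (LINT y|lborel. gauss \<tau> y * EN y)) - ?n - ?n / 2 * ln (4 * pi * \<tau>))"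
    using Z0 by (intro mult_left_mono) auto
  then have "(LINT y|lborel. gauss \<tau> y * LG y) - Z * ln Z \<le> 4 * \<tau> * (LINT y|lborel. gauss \<tau> y * EN y) - (?n + ?n / 2 * ln (4 * pi * \<tau>)) * Z"
  proof -
    have "Z * ((1 / Z) * a - ln Z) = a - Z * ln Z" "Z * (4 * \<tau> * ((1 / Z) * a) - ?n - c) = 4 * \<tau> * a - (?n + c) * Z" for a c
      using Z0 by (simp_all add: algebra_simps)
    with \<open>Z * _ \<le> Z * _\<close> show ?thesis by simp
  qed
  \<comment> \<open>The price of normalising is a term with the favourable sign, so it is dropped
    and never estimated.\<close>
  moreover have "Z * ln Z \<le> 0" using Z0 Z1 by (simp add: mult_nonneg_nonpos)
  ultimately have "0 \<le> 4 * \<tau> * (LINT y|lborel. gauss \<tau> y * EN y) - (LINT y|lborel. gauss \<tau> y * LG y) - (?n + ?n / 2 * ln (4 * pi * \<tau>)) * Z"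
    by linarith
  also have "\<dots> = (LINT y|lborel. 4 * \<tau> * (gauss \<tau> y * EN y) - gauss \<tau> y * LG y - (?n + ?n / 2 * ln (4 * pi * \<tau>)) * (gauss \<tau> y * (\<eta> y)\<^sup>2))"
    unfolding Z_def using int by simp
  also have "\<dots> = (LINT y|lborel. (\<Sum>i\<in>UNIV. partial_deriv i (F i) y) + gauss \<tau> y * (\<tau> * e1 y + e0 y))"
    unfolding entropy_identity ..
  also have "\<dots> = (LINT y|lborel. (\<Sum>i\<in>UNIV. partial_deriv i (F i) y)) + (LINT y|lborel. gauss \<tau> y * (\<tau> * e1 y + e0 y))"
    by (intro Bochner_Integration.integral_add Bochner_Integration.integrable_sum F_int adm_gauss \<tau> adm_add adm_scale e1_adm e0_adm)
  also have "(LINT y|lborel. (\<Sum>i\<in>UNIV. partial_deriv i (F i) y)) = 0"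
    by (subst Bochner_Integration.integral_sum) (simp_all add: F_int)
  finally show ?thesis by simp
qed

end

end

section \<open>Small-time asymptotics\<close>

context cutoff_field
begin

lemma cball_sub: "norm y \<le> r \<Longrightarrow> y \<in> \<Omega>"
  using ball r by (intro subsetD[OF ball]) simp

lemma zero_in: "0 \<in> \<Omega>"
  using cball_sub[of 0] r by simp

text \<open>The relative entropy of the centred Gaussian with covariance \<open>Gi y\<close> with
  respect to the standard one. It vanishes to second order at \<open>G = 1\<close>, which in normal
  coordinates means fourth order in \<open>y\<close>.\<close>

definition K0 :: "real^'n \<Rightarrow> real" where
  "K0 y = (1/2) * (ln (det (G y)) + (\<Sum>i\<in>UNIV. Gi y $ i $ i) - real CARD('n))"

lemma div_Gi: "y \<in> \<Omega> \<Longrightarrow> (\<Sum>i\<in>UNIV. partial_deriv i (\<lambda>z. Gi z $ i $ k) y) = - Gc k y - (\<Sum>l\<in>UNIV. Gi y $ k $ l * w l y)"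
proof -
  assume y: "y \<in> \<Omega>"
  have "(\<Sum>i\<in>UNIV. \<Sum>l\<in>UNIV. Gam G i i l y * Gi y $ l $ k) = (\<Sum>l\<in>UNIV. Gi y $ k $ l * w l y)"
    unfolding w_def by (subst sum.swap) (simp add: sum_distrib_left Gi_sym[OF y, of k] mult.commute)
  then show ?thesis
    by (simp add: dGi[OF y] Gc_def sum_subtractf sum_negf mult.commute)
qed

context
  fixes y :: "real^'n"
  assumes y: "norm y < r"
begin

private lemma yb: "y \<in> ball 0 r" using y by simp
private lemma y\<Omega>: "y \<in> \<Omega>" using y by (intro cball_sub) simp

private lemma \<eta>1: "z \<in> ball 0 r \<Longrightarrow> \<eta> z = 1" using \<eta>(4)[of z] by simp

text \<open>Where the cutoff is \<open>1\<close> the amplitude is a power of the determinant, and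
  \<open>partial_deriv_det\<close> gives its logarithmic derivative.\<close>

lemma db_near: "db k y = (-1/2) * w k y * b y"
proof -
  have d: "det (G y) > 0" by (rule det_pos[OF y\<Omega>])
  have "db k y = partial_deriv k (\<lambda>z. det (G z) powr (-1/4)) y"
    unfolding db_def by (rule partial_deriv_cong[OF open_ball yb]) (simp add: b_def \<eta>1 del: mem_ball)
  also have "\<dots> = ((-1/4) * det (G y) powr (-1/4 - 1)) * partial_deriv k (\<lambda>z. det (G z)) y"
  proof (rule partial_deriv_chain_real)
    show "(\<lambda>z. det (G z)) differentiable (at y)" by (rule diffable[OF det_smooth y\<Omega>])
    show "((\<lambda>u. u powr (-1/4)) has_real_derivative (-1/4) * det (G y) powr (-1/4 - 1)) (at (det (G y)))"
      using d by (auto intro!: derivative_eq_intros)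
  qed
  also have "\<dots> = (-1/2) * w k y * (det (G y) powr (-1/4 - 1) * det (G y))"
    by (simp add: partial_deriv_det[OF y\<Omega>])
  also have "det (G y) powr (-1/4 - 1) * det (G y) = det (G y) powr (-1/4)"
    using d powr_add[of "det (G y)" "-1/4 - 1" 1] by simp
  finally show ?thesis using yb by (simp add: b_def \<eta>1 del: mem_ball)
qed

lemma p_near: "p i y = Gc i y - (\<Sum>k\<in>UNIV. Gi y $ i $ k * w k y)"
  using yb by (simp add: p_def \<eta>1 del: mem_ball)

lemma b2s_near: "b y * b y * s y = 1"
  using b2s[OF y\<Omega>] yb by (simp add: \<eta>1 power2_eq_square del: mem_ball)

text \<open>The energy of the amplitude equals the contraction of \<open>Gi\<close> with
  \<open>w\<close> twice. This is the term of \<open>Scal_identity\<close> that is neither a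
  divergence nor \<open>GG\<close>, and it cancels.\<close>

lemma e1_near: "e1 y = GG y - Scal G y"
proof -
  have "4 * s y * E2 y = (b y * b y * s y) * (\<Sum>i\<in>UNIV. \<Sum>k\<in>UNIV. Gi y $ k $ i * w k y * w i y)"
    unfolding E2_def db_near by (simp add: sum_distrib_left mult_ac)
  also have "\<dots> = (\<Sum>i\<in>UNIV. \<Sum>j\<in>UNIV. Gi y $ i $ j * w i y * w j y)"
    unfolding b2s_near by (subst sum.swap) (simp add: mult_ac)
  finally have 1: "4 * s y * E2 y = (\<Sum>i\<in>UNIV. \<Sum>j\<in>UNIV. Gi y $ i $ j * w i y * w j y)" .
  have "partial_deriv i (p i) y = partial_deriv i (\<lambda>y. Gc i y - (\<Sum>k\<in>UNIV. Gi y $ i $ k * w k y)) y" for i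
    by (rule partial_deriv_cong[OF open_ball yb]) (simp add: p_def \<eta>1 del: mem_ball)
  then show ?thesis
    unfolding e1_def 1 using Scal_identity[OF y\<Omega>] by simp
qed

text \<open>The terms linear in \<open>y\<close>, which contain \<open>Gc\<close> and
  \<open>Gi w\<close>, cancel among \<open>B1\<close>, the divergence of \<open>q\<close> and the
  product of \<open>y\<close> with \<open>p\<close>. The divergence of \<open>q\<close> also
  contributes half of the trace of \<open>Gi\<close> and half of the dimension.\<close>

lemma e0_near: "e0 y = K0 y"
proof -
  have D: "(\<lambda>z. Gi z $ i $ k) differentiable (at y)" "(\<lambda>z. z $ k) differentiable (at y)" for i k
    by (rule diffable[OF Gi_smooth y\<Omega>]) (rule smooth_on_differentiable[OF smooth_on_coord[OF open_UNIV]], simp)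
  have dq: "partial_deriv i (q i) y = (-1/2) * ((\<Sum>k\<in>UNIV. partial_deriv i (\<lambda>z. Gi z $ i $ k) y * y $ k) + Gi y $ i $ i + 1)" for i
  proof -
    have "partial_deriv i (q i) y = partial_deriv i (\<lambda>z. (-1/2) * ((\<Sum>k\<in>UNIV. Gi z $ i $ k * z $ k) + z $ i)) y"
      by (rule partial_deriv_cong[OF open_ball yb]) (simp add: q_def \<eta>1 del: mem_ball)
    also have "\<dots> = (-1/2) * ((\<Sum>k\<in>UNIV. partial_deriv i (\<lambda>z. Gi z $ i $ k) y * y $ k + Gi y $ i $ k * (if i = k then 1 else 0)) + 1)"
      using D
      by (subst partial_deriv_cmult)
        (simp_all add: differentiable_add differentiable_sum differentiable_mult partial_deriv_add partial_deriv_sum partial_deriv_mult partial_deriv_coord)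
    finally show ?thesis unfolding sum.distrib by (simp add: if_distrib[of "\<lambda>u. _ * u"] cong: if_cong)
  qed
  have S: "(\<Sum>i\<in>UNIV. \<Sum>k\<in>UNIV. partial_deriv i (\<lambda>z. Gi z $ i $ k) y * y $ k)
      = - (\<Sum>k\<in>UNIV. y $ k * Gc k y) - (\<Sum>k\<in>UNIV. \<Sum>l\<in>UNIV. Gi y $ k $ l * w l y * y $ k)"
  proof -
    have "(\<Sum>i\<in>UNIV. \<Sum>k\<in>UNIV. partial_deriv i (\<lambda>z. Gi z $ i $ k) y * y $ k) = (\<Sum>k\<in>UNIV. (\<Sum>i\<in>UNIV. partial_deriv i (\<lambda>z. Gi z $ i $ k) y) * y $ k)"
      by (subst sum.swap) (simp add: sum_distrib_right)
    then show ?thesis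
      unfolding div_Gi[OF y\<Omega>] by (simp add: algebra_simps sum_subtractf sum_negf sum_distrib_left)
  qed
  have dq': "(\<Sum>i\<in>UNIV. partial_deriv i (q i) y) = (-1/2) * (- (\<Sum>k\<in>UNIV. y $ k * Gc k y)
      - (\<Sum>k\<in>UNIV. \<Sum>l\<in>UNIV. Gi y $ k $ l * w l y * y $ k) + (\<Sum>i\<in>UNIV. Gi y $ i $ i) + real CARD('n))"
    unfolding dq S[symmetric] by (simp only: sum_distrib_left[symmetric] sum.distrib) simp
  have B: "- 2 * b y * s y * B1 y = (\<Sum>k\<in>UNIV. \<Sum>l\<in>UNIV. Gi y $ k $ l * w l y * y $ k)"
  proof -
    have "- 2 * b y * s y * B1 y = (b y * b y * s y) * (\<Sum>i\<in>UNIV. \<Sum>k\<in>UNIV. Gi y $ k $ i * w k y * y $ i)"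
      unfolding B1_def db_near by (simp add: sum_distrib_left mult_ac)
    then show ?thesis unfolding b2s_near by (simp add: Gi_sym[OF y\<Omega>, of _ "_ :: 'n"])
  qed
  have P: "(\<Sum>i\<in>UNIV. y $ i * p i y) = (\<Sum>k\<in>UNIV. y $ k * Gc k y) - (\<Sum>k\<in>UNIV. \<Sum>l\<in>UNIV. Gi y $ k $ l * w l y * y $ k)"
    unfolding p_near by (simp add: algebra_simps sum_subtractf sum_distrib_left)
  show ?thesis
    unfolding e0_def B P dq' K0_def using yb by (simp add: \<eta>1 algebra_simps del: mem_ball)
qed

end

text \<open>The derivative is half the trace of \<open>dG\<close> times
  \<open>Gi - Gi ** Gi\<close>. Writing the second factor as \<open>Gi ** (G - 1) ** Gi\<close>
  displays a product of a first order and a second order quantity; integrated, it gives order four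
  in normal coordinates.\<close>

lemma dK0:
  assumes y: "y \<in> \<Omega>"
  shows "K0 differentiable (at y)"
    and "partial_deriv k K0 y = (1/2) * (\<Sum>a\<in>UNIV. \<Sum>e\<in>UNIV. \<Sum>i\<in>UNIV. \<Sum>j\<in>UNIV.
      dG k a e y * Gi y $ a $ i * (G y $ i $ j - (if i = j then 1 else 0)) * Gi y $ j $ e)"
proof -
  have d: "det (G y) > 0" by (rule det_pos[OF y])
  have dl: "((\<lambda>u. ln u) has_real_derivative inverse (det (G y))) (at (det (G y)))"
    using d by (auto intro!: derivative_eq_intros simp: inverse_eq_divide)
  note dd = diffable[OF det_smooth y]
  have ld: "(\<lambda>z. ln (det (G z))) differentiable (at y)"
    using differentiable_chain_at[OF dd, of ln] dl
    by (auto simp: o_def has_field_derivative_def differentiable_def)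
  have gd: "(\<lambda>z. Gi z $ i $ i) differentiable (at y)" for i by (rule diffable[OF Gi_smooth y])
  show "K0 differentiable (at y)"
    unfolding K0_def[abs_def] using ld gd
    by (auto intro!: differentiable_mult differentiable_diff differentiable_add differentiable_sum)
  have "partial_deriv k K0 y = (1/2) * (partial_deriv k (\<lambda>z. ln (det (G z))) y + (\<Sum>i\<in>UNIV. partial_deriv k (\<lambda>z. Gi z $ i $ i) y))"
    unfolding K0_def[abs_def] using ld gd
    by (subst partial_deriv_cmult) (simp_all add: partial_deriv_diff partial_deriv_add partial_deriv_sum differentiable_diff differentiable_add differentiable_sum)
  also have "partial_deriv k (\<lambda>z. ln (det (G z))) y = (\<Sum>a\<in>UNIV. \<Sum>e\<in>UNIV. Gi y $ a $ e * dG k a e y)"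
    using partial_deriv_chain_real[OF dd dl, of k] d by (simp add: partial_deriv_det[OF y] w_trace[OF y])
  also have "(\<Sum>i\<in>UNIV. partial_deriv k (\<lambda>z. Gi z $ i $ i) y) = - (\<Sum>a\<in>UNIV. \<Sum>e\<in>UNIV. \<Sum>i\<in>UNIV. dG k a e y * Gi y $ a $ i * Gi y $ i $ e)"
  proof -
    have "(\<Sum>i\<in>UNIV. \<Sum>a\<in>UNIV. \<Sum>e\<in>UNIV. Gi y $ i $ a * dG k a e y * Gi y $ e $ i)
      = (\<Sum>a\<in>UNIV. \<Sum>e\<in>UNIV. \<Sum>i\<in>UNIV. dG k a e y * Gi y $ a $ i * Gi y $ i $ e)"
      unfolding sum.cartesian_product UNIV_Times_UNIV
      by (rule sum.reindex_bij_witness[of _ "\<lambda>(a, e, i). (i, a, e)" "\<lambda>(i, a, e). (a, e, i)"]) (auto simp: Gi_sym[OF y])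
    then show ?thesis by (simp add: dGi_aux[OF y] sum_negf)
  qed
  also have "(\<Sum>a\<in>UNIV. \<Sum>e\<in>UNIV. Gi y $ a $ e * dG k a e y) + - (\<Sum>a\<in>UNIV. \<Sum>e\<in>UNIV. \<Sum>i\<in>UNIV. dG k a e y * Gi y $ a $ i * Gi y $ i $ e)
    = (\<Sum>a\<in>UNIV. \<Sum>e\<in>UNIV. dG k a e y * (Gi y $ a $ e - (\<Sum>i\<in>UNIV. Gi y $ a $ i * Gi y $ i $ e)))"
    by (simp add: sum_subtractf[symmetric] sum_distrib_left algebra_simps)
  also have "\<dots> = (\<Sum>a\<in>UNIV. \<Sum>e\<in>UNIV. \<Sum>i\<in>UNIV. \<Sum>j\<in>UNIV.
      dG k a e y * Gi y $ a $ i * (G y $ i $ j - (if i = j then 1 else 0)) * Gi y $ j $ e)"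
  proof (intro sum.cong refl)
    fix a e
    have "(\<Sum>i\<in>UNIV. \<Sum>j\<in>UNIV. Gi y $ a $ i * (G y $ i $ j - (if i = j then 1 else 0)) * Gi y $ j $ e)
      = (\<Sum>i\<in>UNIV. Gi y $ a $ i * (\<Sum>j\<in>UNIV. G y $ i $ j * Gi y $ j $ e)) - (\<Sum>i\<in>UNIV. \<Sum>j\<in>UNIV. Gi y $ a $ i * (if i = j then 1 else 0) * Gi y $ j $ e)"
      by (simp add: algebra_simps sum_subtractf sum_distrib_left)
    also have "\<dots> = Gi y $ a $ e - (\<Sum>i\<in>UNIV. Gi y $ a $ i * Gi y $ i $ e)"
      by (simp add: G_Gi[OF y] if_distrib[of "\<lambda>u. u * _"] if_distrib[of "\<lambda>u. _ * u"] cong: if_cong)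
    finally have f: "(\<Sum>i\<in>UNIV. \<Sum>j\<in>UNIV. Gi y $ a $ i * (G y $ i $ j - (if i = j then 1 else 0)) * Gi y $ j $ e)
      = Gi y $ a $ e - (\<Sum>i\<in>UNIV. Gi y $ a $ i * Gi y $ i $ e)" .
    show "dG k a e y * (Gi y $ a $ e - (\<Sum>i\<in>UNIV. Gi y $ a $ i * Gi y $ i $ e))
      = (\<Sum>i\<in>UNIV. \<Sum>j\<in>UNIV. dG k a e y * Gi y $ a $ i * (G y $ i $ j - (if i = j then 1 else 0)) * Gi y $ j $ e)"
      unfolding f[symmetric] by (simp only: sum_distrib_left mult.assoc)
  qed
  finally show "partial_deriv k K0 y = (1/2) * (\<Sum>a\<in>UNIV. \<Sum>e\<in>UNIV. \<Sum>i\<in>UNIV. \<Sum>j\<in>UNIV.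
      dG k a e y * Gi y $ a $ i * (G y $ i $ j - (if i = j then 1 else 0)) * Gi y $ j $ e)" .
qed

section \<open>Orders of vanishing at the origin\<close>

definition ob :: "nat \<Rightarrow> (real^'n \<Rightarrow> real) \<Rightarrow> bool" where
  "ob m f \<longleftrightarrow> (\<exists>C\<ge>0. \<forall>y. norm y \<le> r \<longrightarrow> \<bar>f y\<bar> \<le> C * norm y ^ m)"

lemma ob_continuous: "continuous_on \<Omega> f \<Longrightarrow> ob 0 f"
proof -
  assume f: "continuous_on \<Omega> f"
  have "cball 0 r \<subseteq> \<Omega>" using cball_sub by auto
  then have "bounded (f ` cball 0 r)"
    by (intro compact_imp_bounded compact_continuous_image continuous_on_subset[OF f] compact_cball)
  then obtain C where "\<forall>z\<in>f ` cball 0 r. \<bar>z\<bar> \<le> C" unfolding bounded_iff real_norm_def by blast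
  then have C: "\<bar>f y\<bar> \<le> C" if "norm y \<le> r" for y using that by simp
  have "0 \<le> C" using C[of 0] r by simp
  then show ?thesis unfolding ob_def using C by (intro exI[of _ C]) auto
qed

lemma ob_add: assumes "ob m f" "ob m h" shows "ob m (\<lambda>y. f y + h y)"
proof -
  obtain C D where "C \<ge> 0" "D \<ge> 0" "\<And>y. norm y \<le> r \<Longrightarrow> \<bar>f y\<bar> \<le> C * norm y ^ m" "\<And>y. norm y \<le> r \<Longrightarrow> \<bar>h y\<bar> \<le> D * norm y ^ m"
    using assms unfolding ob_def by blast
  then show ?thesis
    unfolding ob_def
    by (intro exI[of _ "C + D"]) (auto simp: distrib_right intro: order_trans[OF abs_triangle_ineq] add_mono)
qed

lemma ob_mult: assumes "ob m f" "ob k h" shows "ob (m + k) (\<lambda>y. f y * h y)"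
proof -
  obtain C D where C: "C \<ge> 0" "D \<ge> 0" "\<And>y. norm y \<le> r \<Longrightarrow> \<bar>f y\<bar> \<le> C * norm y ^ m" "\<And>y. norm y \<le> r \<Longrightarrow> \<bar>h y\<bar> \<le> D * norm y ^ k"
    using assms unfolding ob_def by blast
  have "\<bar>f y * h y\<bar> \<le> (C * D) * norm y ^ (m + k)" if "norm y \<le> r" for y
  proof -
    have "\<bar>f y\<bar> * \<bar>h y\<bar> \<le> (C * norm y ^ m) * (D * norm y ^ k)"
      using C that by (intro mult_mono) auto
    then show ?thesis by (simp add: abs_mult power_add mult_ac)
  qed
  then show ?thesis unfolding ob_def using C(1,2) by (intro exI[of _ "C * D"]) auto
qed

lemma ob_const: "ob 0 (\<lambda>y. c)"
  by (rule ob_continuous) auto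

lemma ob_zero: "ob m (\<lambda>y. 0)"
  unfolding ob_def by (intro exI[of _ 0]) auto

lemma ob_sum: "(\<And>i. i \<in> I \<Longrightarrow> ob m (f i)) \<Longrightarrow> ob m (\<lambda>y. \<Sum>i\<in>I. f i y)"
  by (induction I rule: infinite_finite_induct) (auto intro: ob_add ob_zero)

lemma ob_cong: "(\<And>y. norm y \<le> r \<Longrightarrow> f y = h y) \<Longrightarrow> ob m f \<Longrightarrow> ob m h"
  unfolding ob_def by metis

text \<open>The mean value theorem on the segment from the origin to \<open>y\<close>; one factor
  \<open>norm y\<close> comes from the direction of the segment.\<close>

lemma ob_integrate:
  assumes f: "\<And>y. y \<in> \<Omega> \<Longrightarrow> f differentiable (at y)" and f0: "f 0 = 0" and d: "\<And>a. ob m (partial_deriv a f)"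
  shows "ob (Suc m) f"
proof -
  have "\<forall>a. \<exists>C. C \<ge> 0 \<and> (\<forall>y. norm y \<le> r \<longrightarrow> \<bar>partial_deriv a f y\<bar> \<le> C * norm y ^ m)" using d unfolding ob_def by blast
  then obtain C where C: "\<And>a. C a \<ge> 0" "\<And>a y. norm y \<le> r \<Longrightarrow> \<bar>partial_deriv a f y\<bar> \<le> C a * norm y ^ m" by metis
  have "\<bar>f y\<bar> \<le> (\<Sum>a\<in>UNIV. C a) * norm y ^ Suc m" if y: "norm y \<le> r" for y
  proof -
    have nt: "norm (t *\<^sub>R y) \<le> norm y" if "0 \<le> t" "t \<le> 1" for t :: real
      using that by (simp add: mult_left_le_one_le)
    have "\<exists>t. 0 < t \<and> t < 1 \<and> f (0 + 1 *\<^sub>R y) - f (0 + 0 *\<^sub>R y) = (1 - 0) * (\<Sum>a\<in>UNIV. y $ a * partial_deriv a f (0 + t *\<^sub>R y))"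
    proof (rule MVT2)
      fix t :: real assume t: "0 \<le> t" "t \<le> 1"
      show "((\<lambda>t. f (0 + t *\<^sub>R y)) has_real_derivative (\<Sum>a\<in>UNIV. y $ a * partial_deriv a f (0 + t *\<^sub>R y))) (at t)"
        using nt[OF t] y by (intro line_has_real_derivative f cball_sub) simp
    qed simp
    then obtain t where t: "0 < t" "t < 1" and e: "f y = (\<Sum>a\<in>UNIV. y $ a * partial_deriv a f (t *\<^sub>R y))" using f0 by auto
    have n: "norm (t *\<^sub>R y) \<le> norm y" using nt t by simp
    have "\<bar>f y\<bar> \<le> (\<Sum>a\<in>UNIV. \<bar>y $ a * partial_deriv a f (t *\<^sub>R y)\<bar>)" unfolding e by (rule sum_abs)
    also have "\<dots> \<le> (\<Sum>a\<in>UNIV. norm y * (C a * norm y ^ m))"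
    proof (rule sum_mono)
      fix a
      have "\<bar>partial_deriv a f (t *\<^sub>R y)\<bar> \<le> C a * norm (t *\<^sub>R y) ^ m" using C(2) n y by (meson order_trans)
      also have "\<dots> \<le> C a * norm y ^ m" by (intro mult_left_mono power_mono n C) auto
      finally show "\<bar>y $ a * partial_deriv a f (t *\<^sub>R y)\<bar> \<le> norm y * (C a * norm y ^ m)"
        unfolding abs_mult by (intro mult_mono component_le_norm_cart) auto
    qed
    also have "\<dots> = (\<Sum>a\<in>UNIV. C a) * norm y ^ Suc m" by (simp add: sum_distrib_left sum_distrib_right mult_ac)
    finally show ?thesis .
  qed
  then show ?thesis unfolding ob_def using C(1) by (intro exI[of _ "\<Sum>a\<in>UNIV. C a"]) (auto intro: sum_nonneg)
qed

lemma ob_linear: "smooth_on \<Omega> f \<Longrightarrow> f 0 = 0 \<Longrightarrow> ob 1 f"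
  using ob_integrate[of f 0] by (auto intro!: ob_continuous smooth_on_continuous_on smooth_on_partial_deriv diffable)

text \<open>Where \<open>norm y \<ge> r\<close> the uniform bound \<open>D\<close> is at most
  \<open>D / r ^ m * norm y ^ m\<close>. Thus the bound near the origin holds everywhere, and
  polynomial majorants suffice for dominated convergence.\<close>

lemma ob_global:
  assumes f: "adm f" and near: "\<And>y. norm y < r \<Longrightarrow> f y = h y" and h: "ob m h"
  shows "\<exists>C\<ge>0. \<forall>y. \<bar>f y\<bar> \<le> C * norm y ^ m"
proof -
  obtain C where C: "C \<ge> 0" "\<And>y. norm y \<le> r \<Longrightarrow> \<bar>h y\<bar> \<le> C * norm y ^ m" using h unfolding ob_def by blast
  obtain D where D: "\<And>y. \<bar>f y\<bar> \<le> D" using f by (auto simp: adm_def)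
  have D0: "D \<ge> 0" using D[of 0] by linarith
  have "\<bar>f y\<bar> \<le> (C + D / r ^ m) * norm y ^ m" for y
  proof (cases "norm y < r")
    case True
    have "\<bar>f y\<bar> \<le> C * norm y ^ m" using C(2)[of y] near[OF True] True by simp
    also have "\<dots> \<le> (C + D / r ^ m) * norm y ^ m" using D0 r by (intro mult_right_mono) auto
    finally show ?thesis .
  next
    case False
    then have "r ^ m \<le> norm y ^ m" using r by (intro power_mono) auto
    then have "D / r ^ m * r ^ m \<le> D / r ^ m * norm y ^ m" using D0 r by (intro mult_left_mono) auto
    moreover have "D / r ^ m * r ^ m = D" using r by simp
    moreover have "0 \<le> C * norm y ^ m" using C(1) by simp
    ultimately show ?thesis using D[of y] by (simp add: distrib_right)
  qed
  then show ?thesis using C(1) D0 r by (intro exI[of _ "C + D / r ^ m"]) auto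
qed

section \<open>Limits along rays\<close>

lemma line_tendsto: "((\<lambda>t. t *\<^sub>R z) \<longlongrightarrow> (0::real^'n)) (at_right 0)"
  by (rule tendsto_eq_intros refl | simp)+

lemma line_continuous:
  assumes "continuous_on \<Omega> f"
  shows "((\<lambda>t. f (t *\<^sub>R z)) \<longlongrightarrow> f 0) (at_right 0)"
proof -
  have "isCont f 0" using assms op zero_in by (simp add: continuous_on_eq_continuous_at)
  then show ?thesis by (rule isCont_tendsto_compose[OF _ line_tendsto])
qed

lemma line_near: "\<forall>\<^sub>F t in at_right 0. t > 0 \<and> norm (t *\<^sub>R (z::real^'n)) < r"
proof -
  have "\<forall>\<^sub>F t in at_right 0. dist (t *\<^sub>R z) (0::real^'n) < r"
    using tendstoD[OF line_tendsto r] .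
  then show ?thesis by (auto simp: eventually_at_filter elim: eventually_mono)
qed

text \<open>L'Hopital's rule on the ray through \<open>z\<close>. Applied repeatedly it yields exact
  leading coefficients and takes the place of Taylor's formula.\<close>

lemma line_limit:
  assumes f: "\<And>y. y \<in> \<Omega> \<Longrightarrow> f differentiable (at y)" and f0: "f 0 = 0"
    and l: "((\<lambda>t. (\<Sum>a\<in>UNIV. z $ a * partial_deriv a f (t *\<^sub>R z)) / t ^ m) \<longlongrightarrow> l) (at_right 0)"
  shows "((\<lambda>t. f (t *\<^sub>R z) / t ^ Suc m) \<longlongrightarrow> l / real (Suc m)) (at_right 0)"
proof (rule lhopital_right_0)
  have "isCont f 0" using f[OF zero_in] by (rule differentiable_imp_continuous_within)
  from isCont_tendsto_compose[OF this line_tendsto]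
  show "((\<lambda>t. f (t *\<^sub>R z)) \<longlongrightarrow> 0) (at_right 0)" by (simp add: f0)
  show "((\<lambda>t::real. t ^ Suc m) \<longlongrightarrow> 0) (at_right 0)" by (rule tendsto_eq_intros refl | simp)+
  show "\<forall>\<^sub>F t::real in at_right 0. t ^ Suc m \<noteq> 0" by (auto simp: eventually_at_filter)
  show "\<forall>\<^sub>F t::real in at_right 0. real (Suc m) * t ^ m \<noteq> 0"
    using eventually_at_right_less[of 0] by eventually_elim simp
  show "\<forall>\<^sub>F t in at_right 0. ((\<lambda>t. f (t *\<^sub>R z)) has_real_derivative (\<Sum>a\<in>UNIV. z $ a * partial_deriv a f (t *\<^sub>R z))) (at t)"
    using line_near[of z]
  proof eventually_elim
    case (elim t)
    then have "norm (t *\<^sub>R z) \<le> r" by (meson less_imp_le)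
    then have "t *\<^sub>R z \<in> \<Omega>" by (rule cball_sub)
    then show ?case using line_has_real_derivative[of f 0 t z] f by simp
  qed
  show "\<forall>\<^sub>F t in at_right 0. ((\<lambda>t::real. t ^ Suc m) has_real_derivative real (Suc m) * t ^ m) (at t)"
    using DERIV_pow[of "Suc m"] by (intro always_eventually allI) simp
  have "((\<lambda>t. (\<Sum>a\<in>UNIV. z $ a * partial_deriv a f (t *\<^sub>R z)) / t ^ m / real (Suc m)) \<longlongrightarrow> l / real (Suc m)) (at_right 0)"
    by (intro tendsto_divide l tendsto_const) simp
  then show "((\<lambda>t. (\<Sum>a\<in>UNIV. z $ a * partial_deriv a f (t *\<^sub>R z)) / (real (Suc m) * t ^ m)) \<longlongrightarrow> l / real (Suc m)) (at_right 0)"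
    by (simp add: mult.commute)
qed

lemma line_limit1:
  assumes f: "smooth_on \<Omega> f" and f0: "f 0 = 0"
  shows "((\<lambda>t. f (t *\<^sub>R z) / t) \<longlongrightarrow> (\<Sum>a\<in>UNIV. z $ a * partial_deriv a f 0)) (at_right 0)"
proof -
  have "((\<lambda>t. (\<Sum>a\<in>UNIV. z $ a * partial_deriv a f (t *\<^sub>R z)) / t ^ 0) \<longlongrightarrow> (\<Sum>a\<in>UNIV. z $ a * partial_deriv a f 0)) (at_right 0)"
    unfolding power_0 div_by_1
    by (intro tendsto_sum tendsto_mult[OF tendsto_const] line_continuous smooth_on_continuous_on smooth_on_partial_deriv f)
  from line_limit[OF diffable[OF f] f0 this] show ?thesis by simp
qed

end

text \<open>The coordinates are normal to first order only. Second derivatives of the metric at the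
  origin remain free up to third derivatives of the coordinate change, and the cubic gauge exploits
  this freedom.\<close>

locale normal_field = cutoff_field +
  assumes G0: "G 0 $ i $ j = (if i = j then 1 else 0)" and dG0: "dG k i j 0 = 0"
begin

text \<open>The first two indices name the entry of the metric, the last two the directions of
  differentiation; either pair is symmetric. Below, \<open>gam k i j m\<close> is the derivative in
  direction \<open>m\<close> of the Christoffel symbol with upper index \<open>k\<close>, see
  \<open>dGam0\<close>.\<close>

definition hh :: "'a \<Rightarrow> 'a \<Rightarrow> 'a \<Rightarrow> 'a \<Rightarrow> real" where "hh i j k l = partial_deriv l (dG k i j) 0"
definition gam :: "'a \<Rightarrow> 'a \<Rightarrow> 'a \<Rightarrow> 'a \<Rightarrow> real" where
  "gam k i j m = (1/2) * (hh j k i m + hh i k j m - hh i j k m)"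

section \<open>Curvature at the origin in terms of second derivatives of the metric\<close>

lemma hh_sym1: "hh i j k l = hh j i k l"
  unfolding hh_def by (rule partial_deriv_cong[OF op zero_in dG_sym])

lemma hh_sym2: "hh i j k l = hh i j l k"
  unfolding hh_def dG_def[abs_def] by (rule partial_deriv_commute[OF op smooth zero_in])

lemma Gi0: "Gi 0 $ i $ j = (if i = j then 1 else 0)"
proof -
  have "G 0 = mat 1" by (simp add: vec_eq_iff G0 mat_def)
  then have "Gi 0 = mat 1" using matrix_inv_right[OF det_nz[OF zero_in]] by simp
  then show ?thesis by (simp add: mat_def)
qed

lemma lowGam0: "lowGam k i j 0 = 0"
  by (simp add: lowGam_def dG0)

lemma Gam0: "Gam G k i j 0 = 0"
  by (simp add: Gam_low lowGam0)

lemma dGam0: "partial_deriv m (Gam G k i j) 0 = gam k i j m"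
proof -
  note D = diffable[OF dG_smooth zero_in] diffable[OF Gi_smooth zero_in]
  have lsm: "smooth_on \<Omega> (lowGam l i j)" for l
    unfolding lowGam_def[abs_def] by (intro smooth_intros op dG_smooth)
  have dl: "partial_deriv m (lowGam l i j) 0 = gam l i j m" for l
    unfolding lowGam_def[abs_def] using D
    by (subst partial_deriv_cmult) (simp_all add: partial_deriv_add partial_deriv_diff differentiable_add differentiable_diff gam_def hh_def)
  have "partial_deriv m (Gam G k i j) 0 = (\<Sum>l\<in>UNIV. Gi 0 $ k $ l * gam l i j m)"
    unfolding Gam_low[abs_def] using D diffable[OF lsm zero_in]
    by (simp add: partial_deriv_sum partial_deriv_mult differentiable_mult dl lowGam0)
  then show ?thesis by (simp add: Gi0 if_distrib[of "\<lambda>u. u * _"] cong: if_cong)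
qed

lemma Riem0: "Riem G l k i j 0 = gam l j k i - gam l i k j"
  by (simp add: Riem_def dGam0 Gam0)

lemma Scal0: "Scal G 0 = (\<Sum>i\<in>UNIV. \<Sum>j\<in>UNIV. hh i j i j - hh i i j j)"
proof -
  have "Scal G 0 = (\<Sum>j\<in>UNIV. \<Sum>i\<in>UNIV. gam i j j i - gam i i j j)"
    unfolding Scal_def by (simp add: Gi0 Riem0 if_distrib[of "\<lambda>u. u * _"] cong: if_cong)
  also have "\<dots> = (\<Sum>j\<in>UNIV. \<Sum>i\<in>UNIV. hh i j i j - (1/2) * hh j j i i - (1/2) * hh i i j j)"
    by (intro sum.cong refl) (simp add: gam_def hh_sym1[of _ "_::'a"] hh_sym2 algebra_simps)
  also have "\<dots> = (\<Sum>j\<in>UNIV. \<Sum>i\<in>UNIV. hh i j i j) - (1/2) * (\<Sum>j\<in>UNIV. \<Sum>i\<in>UNIV. hh j j i i) - (1/2) * (\<Sum>j\<in>UNIV. \<Sum>i\<in>UNIV. hh i i j j)"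
    by (simp add: sum_subtractf sum_distrib_left)
  also have "(\<Sum>j\<in>UNIV. \<Sum>i\<in>UNIV. hh i i j j) = (\<Sum>i\<in>UNIV. \<Sum>j\<in>UNIV. hh i i j j)" by (rule sum.swap)
  also have "(\<Sum>j\<in>UNIV. \<Sum>i\<in>UNIV. hh i j i j) = (\<Sum>i\<in>UNIV. \<Sum>j\<in>UNIV. hh i j i j)" by (rule sum.swap)
  finally show ?thesis by (simp add: sum_subtractf)
qed

section \<open>Orders and leading terms of \<open>K0\<close> and \<open>GG\<close>\<close>

definition M :: "'a \<Rightarrow> 'a \<Rightarrow> real^'a \<Rightarrow> real" where "M i j y = G y $ i $ j - (if i = j then 1 else 0)"

lemma M_smooth: "smooth_on \<Omega> (M i j)"
  unfolding M_def[abs_def] by (intro smooth_intros op smooth)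

lemma M0: "M i j 0 = 0" by (simp add: M_def G0)

lemma dM: "y \<in> \<Omega> \<Longrightarrow> partial_deriv k (M i j) y = dG k i j y"
  unfolding M_def[abs_def] dG_def using diffable[OF smooth] by (simp add: partial_deriv_diff)

lemma K0_0: "K0 0 = 0"
proof -
  have "G 0 = mat 1" by (simp add: vec_eq_iff G0 mat_def)
  then have "det (G 0) = 1" by simp
  then show ?thesis by (simp add: K0_def Gi0)
qed

lemma cb: "norm y \<le> r \<Longrightarrow> y \<in> \<Omega>" by (rule cball_sub)

lemma ob_dG: "ob 1 (dG k i j)"
  by (rule ob_linear[OF dG_smooth dG0])

lemma ob_M: "ob 2 (M i j)"
  using ob_integrate[of "M i j" 1] diffable[OF M_smooth] M0 ob_cong[OF _ ob_dG] dM[OF cb]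
  by (metis Suc_1)

lemma ob_Gi: "ob 0 (\<lambda>y. Gi y $ i $ j)"
  by (rule ob_continuous[OF Gi_continuous])

lemma ob_Gam: "ob 1 (Gam G k i j)"
  by (rule ob_linear[OF Gam_smooth Gam0])

lemma ob_GG: "ob 2 GG"
proof -
  have "ob (0 + 1 + 1) (\<lambda>y. Gi y $ i $ j * Gam G k i l y * Gam G l j k y)" for i j k l
    by (intro ob_mult ob_Gi ob_Gam)
  then have "ob 2 (\<lambda>y. Gi y $ i $ j * Gam G k i l y * Gam G l j k y)" for i j k l by (simp add: numeral_2_eq_2)
  then show ?thesis unfolding GG_def[abs_def] by (intro ob_sum)
qed

lemma ob_K0: "ob 4 K0"
proof -
  have "ob 3 (partial_deriv k K0)" for k
  proof (rule ob_cong)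
    have "ob (0 + 1 + 0 + 2 + 0) (\<lambda>y. (1/2) * dG k a e y * Gi y $ a $ i * M i j y * Gi y $ j $ e)" for a e i j
      by (intro ob_mult ob_Gi ob_M ob_dG ob_const)
    then have "ob 3 (\<lambda>y. (1/2) * dG k a e y * Gi y $ a $ i * M i j y * Gi y $ j $ e)" for a e i j by (simp add: numeral_3_eq_3)
    then show "ob 3 (\<lambda>y. \<Sum>a\<in>UNIV. \<Sum>e\<in>UNIV. \<Sum>i\<in>UNIV. \<Sum>j\<in>UNIV. (1/2) * dG k a e y * Gi y $ a $ i * M i j y * Gi y $ j $ e)"
      by (intro ob_sum)
    fix y :: "real^'a" assume "norm y \<le> r"
    from dK0(2)[OF cb[OF this], of k]
    show "(\<Sum>a\<in>UNIV. \<Sum>e\<in>UNIV. \<Sum>i\<in>UNIV. \<Sum>j\<in>UNIV. (1/2) * dG k a e y * Gi y $ a $ i * M i j y * Gi y $ j $ e) = partial_deriv k K0 y"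
      by (simp add: M_def sum_distrib_left mult.assoc)
  qed
  from ob_integrate[OF dK0(1) K0_0 this] show ?thesis by (simp add: eval_nat_numeral)
qed

text \<open>The quadratic Taylor polynomial of \<open>G - 1\<close> at the origin.\<close>

definition H :: "real^'a \<Rightarrow> 'a \<Rightarrow> 'a \<Rightarrow> real" where
  "H z i j = (1/2) * (\<Sum>k\<in>UNIV. \<Sum>l\<in>UNIV. hh i j k l * (z $ k * z $ l))"

lemma lim_dG: "((\<lambda>t. dG k i j (t *\<^sub>R z) / t) \<longlongrightarrow> (\<Sum>l\<in>UNIV. z $ l * hh i j k l)) (at_right 0)"
  using line_limit1[OF dG_smooth dG0] by (simp add: hh_def)

lemma in_ev: "\<forall>\<^sub>F t in at_right 0. t *\<^sub>R z \<in> \<Omega>"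
  using line_near[of z] by eventually_elim (meson cball_sub less_imp_le)

lemma lim_M: "((\<lambda>t. M i j (t *\<^sub>R z) / t\<^sup>2) \<longlongrightarrow> H z i j) (at_right 0)"
proof -
  have "((\<lambda>t. \<Sum>a\<in>UNIV. z $ a * (dG a i j (t *\<^sub>R z) / t)) \<longlongrightarrow> (\<Sum>a\<in>UNIV. z $ a * (\<Sum>l\<in>UNIV. z $ l * hh i j a l))) (at_right 0)"
    by (intro tendsto_sum tendsto_mult tendsto_const lim_dG)
  then have "((\<lambda>t. (\<Sum>a\<in>UNIV. z $ a * partial_deriv a (M i j) (t *\<^sub>R z)) / t ^ 1) \<longlongrightarrow> (\<Sum>a\<in>UNIV. z $ a * (\<Sum>l\<in>UNIV. z $ l * hh i j a l))) (at_right 0)"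
  proof (rule Lim_transform_eventually)
    show "\<forall>\<^sub>F t in at_right 0. (\<Sum>a\<in>UNIV. z $ a * (dG a i j (t *\<^sub>R z) / t)) = (\<Sum>a\<in>UNIV. z $ a * partial_deriv a (M i j) (t *\<^sub>R z)) / t ^ 1"
      using in_ev[of z] by eventually_elim (simp add: dM sum_divide_distrib)
  qed
  from line_limit[OF diffable[OF M_smooth] M0 this] show ?thesis
    by (simp add: H_def sum_distrib_left sum_divide_distrib mult_ac numeral_2_eq_2[symmetric])
qed

lemma lim_Gi: "((\<lambda>t. Gi (t *\<^sub>R z) $ i $ j) \<longlongrightarrow> (if i = j then 1 else 0)) (at_right 0)"
  using line_continuous[OF Gi_continuous] by (simp add: Gi0)

text \<open>Near the identity the relative entropy is a quarter of the squared norm of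
  \<open>G - 1\<close>. In the derivative along the ray the factor \<open>dG\<close> contracts with
  \<open>z\<close> to twice \<open>H\<close>, which meets the \<open>H\<close> from
  \<open>G - 1\<close>; l'Hopital's rule divides by \<open>4\<close>.\<close>

lemma lim_K0: "((\<lambda>t. K0 (t *\<^sub>R z) / t ^ 4) \<longlongrightarrow> (1/4) * (\<Sum>a\<in>UNIV. \<Sum>e\<in>UNIV. (H z a e)\<^sup>2)) (at_right 0)"
proof -
  let ?\<delta> = "\<lambda>i j. if i = j then 1 else 0 :: real"
  have Hs: "(\<Sum>k\<in>UNIV. (1/2) * (\<Sum>l\<in>UNIV. hh a e k l * (z $ k * z $ l))) = H z a e" for a e
    by (simp only: H_def sum_distrib_left)
  have delta: "(\<Sum>i\<in>UNIV. \<Sum>j\<in>UNIV. X * ?\<delta> a i * H z i j * ?\<delta> j e) = X * H z a e" for X a e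
    by (simp add: if_distrib[of "\<lambda>u. u * _"] if_distrib[of "\<lambda>u. _ * u"] cong: if_cong)
  have "((\<lambda>t. \<Sum>k\<in>UNIV. z $ k * ((1/2) * (\<Sum>a\<in>UNIV. \<Sum>e\<in>UNIV. \<Sum>i\<in>UNIV. \<Sum>j\<in>UNIV.
      (dG k a e (t *\<^sub>R z) / t) * Gi (t *\<^sub>R z) $ a $ i * (M i j (t *\<^sub>R z) / t\<^sup>2) * Gi (t *\<^sub>R z) $ j $ e)))
    \<longlongrightarrow> (\<Sum>k\<in>UNIV. z $ k * ((1/2) * (\<Sum>a\<in>UNIV. \<Sum>e\<in>UNIV. \<Sum>i\<in>UNIV. \<Sum>j\<in>UNIV.
      (\<Sum>l\<in>UNIV. z $ l * hh a e k l) * ?\<delta> a i * H z i j * ?\<delta> j e)))) (at_right 0)"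
    by (intro tendsto_sum tendsto_mult tendsto_const lim_dG lim_M lim_Gi)
  also have "(\<Sum>k\<in>UNIV. z $ k * ((1/2) * (\<Sum>a\<in>UNIV. \<Sum>e\<in>UNIV. \<Sum>i\<in>UNIV. \<Sum>j\<in>UNIV.
      (\<Sum>l\<in>UNIV. z $ l * hh a e k l) * ?\<delta> a i * H z i j * ?\<delta> j e)))
    = (\<Sum>k\<in>UNIV. \<Sum>a\<in>UNIV. \<Sum>e\<in>UNIV. ((1/2) * (\<Sum>l\<in>UNIV. hh a e k l * (z $ k * z $ l))) * H z a e)"
    unfolding delta by (simp add: sum_distrib_left sum_distrib_right mult_ac)
  also have "\<dots> = (\<Sum>a\<in>UNIV. \<Sum>e\<in>UNIV. \<Sum>k\<in>UNIV. ((1/2) * (\<Sum>l\<in>UNIV. hh a e k l * (z $ k * z $ l))) * H z a e)"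
    by (subst sum.swap, rule sum.cong[OF refl], rule sum.swap)
  also have "\<dots> = (\<Sum>a\<in>UNIV. \<Sum>e\<in>UNIV. (H z a e)\<^sup>2)"
    by (simp only: sum_distrib_right[symmetric] Hs power2_eq_square)
  finally have "((\<lambda>t. (\<Sum>k\<in>UNIV. z $ k * partial_deriv k K0 (t *\<^sub>R z)) / t ^ 3) \<longlongrightarrow> (\<Sum>a\<in>UNIV. \<Sum>e\<in>UNIV. (H z a e)\<^sup>2)) (at_right 0)"
  proof (rule Lim_transform_eventually)
    show "\<forall>\<^sub>F t in at_right 0. (\<Sum>k\<in>UNIV. z $ k * ((1/2) * (\<Sum>a\<in>UNIV. \<Sum>e\<in>UNIV. \<Sum>i\<in>UNIV. \<Sum>j\<in>UNIV.
      (dG k a e (t *\<^sub>R z) / t) * Gi (t *\<^sub>R z) $ a $ i * (M i j (t *\<^sub>R z) / t\<^sup>2) * Gi (t *\<^sub>R z) $ j $ e)))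
      = (\<Sum>k\<in>UNIV. z $ k * partial_deriv k K0 (t *\<^sub>R z)) / t ^ 3"
      using in_ev[of z]
    proof eventually_elim
      case (elim t)
      have "(dG k a e (t *\<^sub>R z) / t) * x * (M i j (t *\<^sub>R z) / t\<^sup>2) * x' = (dG k a e (t *\<^sub>R z) * x * M i j (t *\<^sub>R z) * x') / t ^ 3" for k a e x i j x'
        by (simp add: power2_eq_square power3_eq_cube)
      note eq = this
      show ?case
        unfolding dK0(2)[OF elim] M_def[symmetric] eq
        by (simp only: sum_divide_distrib[symmetric] times_divide_eq_right)
    qed
  qed
  from line_limit[OF dK0(1) K0_0 this] show ?thesis by (simp add: eval_nat_numeral)
qed

lemma lim_GG: "((\<lambda>t. GG (t *\<^sub>R z) / t\<^sup>2) \<longlongrightarrow> (\<Sum>i\<in>UNIV. \<Sum>k\<in>UNIV. \<Sum>l\<in>UNIV.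
   (\<Sum>m\<in>UNIV. z $ m * gam k i l m) * (\<Sum>m\<in>UNIV. z $ m * gam l i k m))) (at_right 0)"
proof -
  let ?\<delta> = "\<lambda>i j. if i = j then 1 else 0 :: real"
  have lG: "((\<lambda>t. Gam G k i l (t *\<^sub>R z) / t) \<longlongrightarrow> (\<Sum>m\<in>UNIV. z $ m * gam k i l m)) (at_right 0)" for k i l
    using line_limit1[OF Gam_smooth Gam0] by (simp add: dGam0)
  have "((\<lambda>t. \<Sum>i\<in>UNIV. \<Sum>j\<in>UNIV. \<Sum>k\<in>UNIV. \<Sum>l\<in>UNIV. Gi (t *\<^sub>R z) $ i $ j * (Gam G k i l (t *\<^sub>R z) / t) * (Gam G l j k (t *\<^sub>R z) / t))
    \<longlongrightarrow> (\<Sum>i\<in>UNIV. \<Sum>j\<in>UNIV. \<Sum>k\<in>UNIV. \<Sum>l\<in>UNIV. ?\<delta> i j * (\<Sum>m\<in>UNIV. z $ m * gam k i l m) * (\<Sum>m\<in>UNIV. z $ m * gam l j k m))) (at_right 0)"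
    by (intro tendsto_sum tendsto_mult lG lim_Gi)
  also have "(\<lambda>t. \<Sum>i\<in>UNIV. \<Sum>j\<in>UNIV. \<Sum>k\<in>UNIV. \<Sum>l\<in>UNIV. Gi (t *\<^sub>R z) $ i $ j * (Gam G k i l (t *\<^sub>R z) / t) * (Gam G l j k (t *\<^sub>R z) / t))
     = (\<lambda>t. GG (t *\<^sub>R z) / t\<^sup>2)"
    by (simp add: GG_def sum_divide_distrib power2_eq_square)
  also have "(\<Sum>i\<in>UNIV. \<Sum>j\<in>UNIV. \<Sum>k\<in>UNIV. \<Sum>l\<in>UNIV. ?\<delta> i j * (\<Sum>m\<in>UNIV. z $ m * gam k i l m) * (\<Sum>m\<in>UNIV. z $ m * gam l j k m))
     = (\<Sum>i\<in>UNIV. \<Sum>k\<in>UNIV. \<Sum>l\<in>UNIV. (\<Sum>m\<in>UNIV. z $ m * gam k i l m) * (\<Sum>m\<in>UNIV. z $ m * gam l i k m))"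
  proof (rule sum.cong[OF refl])
    fix i :: 'a
    have "(\<Sum>k\<in>UNIV. \<Sum>l\<in>UNIV. ?\<delta> i j * (\<Sum>m\<in>UNIV. z $ m * gam k i l m) * (\<Sum>m\<in>UNIV. z $ m * gam l j k m))
      = (if i = j then (\<Sum>k\<in>UNIV. \<Sum>l\<in>UNIV. (\<Sum>m\<in>UNIV. z $ m * gam k i l m) * (\<Sum>m\<in>UNIV. z $ m * gam l j k m)) else 0)" for j
      by simp
    then show "(\<Sum>j\<in>UNIV. \<Sum>k\<in>UNIV. \<Sum>l\<in>UNIV. ?\<delta> i j * (\<Sum>m\<in>UNIV. z $ m * gam k i l m) * (\<Sum>m\<in>UNIV. z $ m * gam l j k m))
     = (\<Sum>k\<in>UNIV. \<Sum>l\<in>UNIV. (\<Sum>m\<in>UNIV. z $ m * gam k i l m) * (\<Sum>m\<in>UNIV. z $ m * gam l i k m))"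
      by simp
  qed
  finally show ?thesis .
qed


section \<open>The rescaled inequality and its limits\<close>

lemma scaled_nonneg:
  assumes lsi: "euclid_log_sobolev \<Omega> G \<tau>\<^sub>0" and t: "t > 0" "t\<^sup>2 < \<tau>\<^sub>0"
  shows "0 \<le> (LINT z|lborel. gauss 1 z * (t\<^sup>2 * e1 (t *\<^sub>R z) + e0 (t *\<^sub>R z)))"
proof -
  have m: "(\<lambda>y. t\<^sup>2 * e1 y + e0 y) \<in> borel_measurable borel"
    using adm_add[OF adm_scale[OF e1_adm] e0_adm] by (simp add: adm_def)
  have "0 < t\<^sup>2" using t by simp
  from entropy_nonneg[OF this lsi t(2)] show ?thesis
    using gauss_scale[OF t(1) m] by simp
qed

text \<open>Dominated convergence is applied along a sequence of scales tending to \<open>0\<close>;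
  all of them are at most \<open>1\<close>, as the bounds require.\<close>

definition ts :: "nat \<Rightarrow> real" where "ts m = inverse (real (Suc m))"

lemma ts_pos: "ts m > 0" by (simp add: ts_def)
lemma ts_le: "ts m \<le> 1" by (simp add: ts_def divide_simps)

lemma ts_lim: "filterlim ts (at_right 0) sequentially"
  unfolding filterlim_at ts_def using LIMSEQ_inverse_real_of_nat by auto

lemma ts_small: "\<tau>\<^sub>0 > 0 \<Longrightarrow> \<forall>\<^sub>F m in sequentially. (ts m)\<^sup>2 < \<tau>\<^sub>0"
proof -
  assume "\<tau>\<^sub>0 > 0"
  have "ts \<longlonglongrightarrow> 0" using ts_lim by (simp add: filterlim_at)
  then have "(\<lambda>m. (ts m)\<^sup>2) \<longlonglongrightarrow> 0\<^sup>2" by (rule tendsto_power)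
  from order_tendstoD(2)[OF this, of \<tau>\<^sub>0] show ?thesis using \<open>\<tau>\<^sub>0 > 0\<close> by simp
qed

lemma meas_line:
  assumes "adm f"
  shows "(\<lambda>z. f (t *\<^sub>R z)) \<in> borel_measurable borel"
proof -
  have "f \<in> borel_measurable borel" using assms by (simp add: adm_def)
  then show ?thesis by measurable
qed

lemma near_ev: "\<forall>\<^sub>F t in at_right 0. e0 (t *\<^sub>R z) = K0 (t *\<^sub>R z) \<and> e1 (t *\<^sub>R z) = GG (t *\<^sub>R z) - Scal G (t *\<^sub>R z)"
  using line_near[of z] by eventually_elim (simp only: e0_near e1_near)

text \<open>Passing to the limit in the rescaled inequality, after division by \<open>t\<^sup>k\<close>.\<close>

lemma limit_nonneg:
  assumes lsi: "euclid_log_sobolev \<Omega> G \<tau>\<^sub>0" and \<tau>: "\<tau>\<^sub>0 > 0"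
    and bound: "\<And>t z. 0 < t \<Longrightarrow> t \<le> 1 \<Longrightarrow> \<bar>t\<^sup>2 * e1 (t *\<^sub>R z) + e0 (t *\<^sub>R z)\<bar> \<le> t ^ k * (C * (1 + (norm z)\<^sup>2) ^ 3)"
    and lim: "\<And>z. ((\<lambda>t. (t\<^sup>2 * e1 (t *\<^sub>R z) + e0 (t *\<^sub>R z)) / t ^ k) \<longlongrightarrow> L z) (at_right 0)"
    and L: "L \<in> borel_measurable borel"
  shows "0 \<le> (LINT z|lborel. gauss 1 z * L z)"
proof -
  let ?f = "\<lambda>m z. gauss 1 z * ((ts m)\<^sup>2 * e1 (ts m *\<^sub>R z) + e0 (ts m *\<^sub>R z)) / ts m ^ k"
  have conv: "(\<lambda>m. LINT z|lborel. ?f m z) \<longlonglongrightarrow> (LINT z|lborel. gauss 1 z * L z)"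
  proof (rule integral_dominated_convergence)
    show "(\<lambda>z. gauss 1 z * L z) \<in> borel_measurable lborel" using L by simp
    show "?f m \<in> borel_measurable lborel" for m
      using meas_line[OF e1_adm, of "ts m"] meas_line[OF e0_adm, of "ts m"] by simp
    show "integrable lborel (\<lambda>z::real^'a. gauss 1 z * (C * (1 + (norm z)\<^sup>2) ^ 3))"
    proof (rule gauss_integrable_poly)
      have "0 \<le> C" using bound[of 1 0] by (simp add: order_trans[OF abs_ge_zero])
      then show "\<bar>C * (1 + (norm z)\<^sup>2) ^ 3\<bar> \<le> C * (1 + (norm z)\<^sup>2) ^ 3" for z :: "real^'a" by simp
    qed simp
    show "AE z in lborel. (\<lambda>m. ?f m z) \<longlonglongrightarrow> gauss 1 z * L z"
    proof (rule AE_I2)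
      fix z
      have "(\<lambda>m. gauss 1 z * (((ts m)\<^sup>2 * e1 (ts m *\<^sub>R z) + e0 (ts m *\<^sub>R z)) / ts m ^ k)) \<longlonglongrightarrow> gauss 1 z * L z"
        by (intro tendsto_mult tendsto_const filterlim_compose[OF lim ts_lim])
      then show "(\<lambda>m. ?f m z) \<longlonglongrightarrow> gauss 1 z * L z" by simp
    qed
    show "AE z in lborel. norm (?f m z) \<le> gauss 1 z * (C * (1 + (norm z)\<^sup>2) ^ 3)" for m
    proof (rule AE_I2)
      fix z
      have "\<bar>(ts m)\<^sup>2 * e1 (ts m *\<^sub>R z) + e0 (ts m *\<^sub>R z)\<bar> / ts m ^ k \<le> C * (1 + (norm z)\<^sup>2) ^ 3"
        using bound[OF ts_pos ts_le, of m z] ts_pos[of m] by (simp add: pos_divide_le_eq mult.commute)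
      then have "gauss 1 z * (\<bar>(ts m)\<^sup>2 * e1 (ts m *\<^sub>R z) + e0 (ts m *\<^sub>R z)\<bar> / ts m ^ k) \<le> gauss 1 z * (C * (1 + (norm z)\<^sup>2) ^ 3)"
        using gauss_pos[of 1 z] by (intro mult_left_mono) auto
      then show "norm (?f m z) \<le> gauss 1 z * (C * (1 + (norm z)\<^sup>2) ^ 3)"
        using gauss_pos[of 1 z] ts_pos[of m] by (simp add: abs_mult)
    qed
  qed
  have "\<forall>\<^sub>F m in sequentially. 0 \<le> (LINT z|lborel. ?f m z)"
    using ts_small[OF \<tau>]
  proof eventually_elim
    case (elim m)
    have "(LINT z|lborel. ?f m z) = (LINT z|lborel. gauss 1 z * ((ts m)\<^sup>2 * e1 (ts m *\<^sub>R z) + e0 (ts m *\<^sub>R z))) / ts m ^ k"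
      by (rule integral_divide_zero)
    also have "\<dots> \<ge> 0" using scaled_nonneg[OF lsi ts_pos elim] ts_pos[of m] by (intro divide_nonneg_pos) auto
    finally show ?case .
  qed
  from tendsto_lowerbound[OF conv this] show ?thesis by simp
qed

lemma poly3_bounds: "1 \<le> (1 + (norm (z::real^'a))\<^sup>2) ^ 3" "(norm z)\<^sup>2 \<le> (1 + (norm z)\<^sup>2) ^ 3" "norm z ^ 4 \<le> (1 + (norm z)\<^sup>2) ^ 3"
proof -
  define u where "u = (norm z)\<^sup>2"
  have u: "u \<ge> 0" by (simp add: u_def)
  have e: "(1 + u) ^ 3 = 1 + 3 * u + 3 * u\<^sup>2 + u ^ 3" by (simp add: power3_eq_cube power2_eq_square algebra_simps)
  have n4: "norm z ^ 4 = u\<^sup>2" by (simp add: u_def flip: power_mult)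
  have "0 \<le> u\<^sup>2" "0 \<le> u ^ 3" using u by simp_all
  with e u show "1 \<le> (1 + (norm z)\<^sup>2) ^ 3" "(norm z)\<^sup>2 \<le> (1 + (norm z)\<^sup>2) ^ 3" "norm z ^ 4 \<le> (1 + (norm z)\<^sup>2) ^ 3"
    unfolding n4 u_def[symmetric] by linarith+
qed

lemma e0_bound: "\<exists>C\<ge>0. \<forall>y. \<bar>e0 y\<bar> \<le> C * norm y ^ 4"
  by (rule ob_global[OF e0_adm e0_near ob_K0])

lemma lim_e0: "((\<lambda>t. e0 (t *\<^sub>R z) / t ^ 4) \<longlongrightarrow> (1/4) * (\<Sum>a\<in>UNIV. \<Sum>e\<in>UNIV. (H z a e)\<^sup>2)) (at_right 0)"
  by (rule Lim_transform_eventually[OF lim_K0]) (use near_ev[of z] in \<open>eventually_elim, simp\<close>)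

text \<open>After division by \<open>t\<^sup>2\<close> the contribution of \<open>e0\<close>, of
  order \<open>t ^ 4\<close>, disappears, and \<open>e1\<close> tends to its value at the origin,
  where the Christoffel symbols vanish.\<close>

lemma Scal_nonpos:
  assumes lsi: "euclid_log_sobolev \<Omega> G \<tau>\<^sub>0" and \<tau>: "\<tau>\<^sub>0 > 0"
  shows "Scal G 0 \<le> 0"
proof -
  obtain C0 where C0: "C0 \<ge> 0" "\<And>y. \<bar>e0 y\<bar> \<le> C0 * norm y ^ 4" using e0_bound by blast
  obtain C1 where C1: "\<And>y. \<bar>e1 y\<bar> \<le> C1" using e1_adm by (auto simp: adm_def)
  have C1p: "C1 \<ge> 0" using C1[of 0] by linarith
  have "0 \<le> (LINT z|lborel. gauss 1 (z::real^'a) * (- Scal G 0))"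
  proof (rule limit_nonneg[OF lsi \<tau>, of 2 "C0 + C1"])
    fix t :: real and z :: "real^'a" assume t: "0 < t" "t \<le> 1"
    have "t ^ 4 \<le> t ^ 2" using t by (intro power_decreasing) auto
    have "\<bar>t\<^sup>2 * e1 (t *\<^sub>R z) + e0 (t *\<^sub>R z)\<bar> \<le> t\<^sup>2 * \<bar>e1 (t *\<^sub>R z)\<bar> + \<bar>e0 (t *\<^sub>R z)\<bar>"
      by (rule order_trans[OF abs_triangle_ineq]) (simp add: abs_mult)
    also have "\<dots> \<le> t\<^sup>2 * C1 + C0 * norm (t *\<^sub>R z) ^ 4"
      by (intro add_mono mult_left_mono C1 C0) auto
    also have "C0 * norm (t *\<^sub>R z) ^ 4 = t ^ 4 * (C0 * norm z ^ 4)" using t by (simp add: power_mult_distrib)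
    also have "\<dots> \<le> t\<^sup>2 * (C0 * norm z ^ 4)" using \<open>t ^ 4 \<le> t ^ 2\<close> C0(1) by (intro mult_right_mono) auto
    also have "t\<^sup>2 * C1 + t\<^sup>2 * (C0 * norm z ^ 4) \<le> t\<^sup>2 * (C1 * (1 + (norm z)\<^sup>2) ^ 3) + t\<^sup>2 * (C0 * (1 + (norm z)\<^sup>2) ^ 3)"
      using poly3_bounds[of z] C0(1) C1p mult_left_mono[OF poly3_bounds(1)[of z] C1p]
      by (intro add_mono mult_left_mono) auto
    finally show "\<bar>t\<^sup>2 * e1 (t *\<^sub>R z) + e0 (t *\<^sub>R z)\<bar> \<le> t ^ 2 * ((C0 + C1) * (1 + (norm z)\<^sup>2) ^ 3)"
      by (simp add: algebra_simps)
  next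
    fix z :: "real^'a"
    have "e1 0 = - Scal G 0" using e1_near[of 0] r by (simp add: GG_def Gam0)
    then have 1: "((\<lambda>t. e1 (t *\<^sub>R z)) \<longlongrightarrow> - Scal G 0) (at_right 0)"
      using line_continuous[OF smooth_on_continuous_on[OF e1_smooth], of z] by simp
    have "((\<lambda>t. t\<^sup>2 * (e0 (t *\<^sub>R z) / t ^ 4)) \<longlongrightarrow> 0\<^sup>2 * ((1/4) * (\<Sum>a\<in>UNIV. \<Sum>e\<in>UNIV. (H z a e)\<^sup>2))) (at_right 0)"
      by (intro tendsto_mult lim_e0 tendsto_power tendsto_ident_at)
    then have 2: "((\<lambda>t. t\<^sup>2 * (e0 (t *\<^sub>R z) / t ^ 4)) \<longlongrightarrow> 0) (at_right 0)" by simp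
    have "((\<lambda>t. e1 (t *\<^sub>R z) + t\<^sup>2 * (e0 (t *\<^sub>R z) / t ^ 4)) \<longlongrightarrow> - Scal G 0) (at_right 0)"
      using tendsto_add[OF 1 2] by simp
    then show "((\<lambda>t. (t\<^sup>2 * e1 (t *\<^sub>R z) + e0 (t *\<^sub>R z)) / t ^ 2) \<longlongrightarrow> - Scal G 0) (at_right 0)"
    proof (rule Lim_transform_eventually)
      show "\<forall>\<^sub>F t in at_right 0. e1 (t *\<^sub>R z) + t\<^sup>2 * (e0 (t *\<^sub>R z) / t ^ 4) = (t\<^sup>2 * e1 (t *\<^sub>R z) + e0 (t *\<^sub>R z)) / t ^ 2"
        using eventually_at_right_less[of "0::real"] by eventually_elim (simp add: field_simps eval_nat_numeral)
    qed
  qed simp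
  also have "(LINT z|lborel. gauss 1 (z::real^'a) * (- Scal G 0)) = - Scal G 0"
    using gauss_integral(2)[of 1, where 'n='a] by simp
  finally show ?thesis by simp
qed

text \<open>With vanishing scalar curvature \<open>e1\<close> equals \<open>GG\<close> near the
  origin and is of second order, so both contributions balance at \<open>t ^ 4\<close>.\<close>

lemma second_order:
  assumes lsi: "euclid_log_sobolev \<Omega> G \<tau>\<^sub>0" and \<tau>: "\<tau>\<^sub>0 > 0" and S: "\<And>y. y \<in> \<Omega> \<Longrightarrow> Scal G y = 0"
  shows "0 \<le> (LINT z|lborel. gauss 1 z * ((1/4) * (\<Sum>a\<in>UNIV. \<Sum>e\<in>UNIV. (H z a e)\<^sup>2)
     + (\<Sum>i\<in>UNIV. \<Sum>k\<in>UNIV. \<Sum>l\<in>UNIV. (\<Sum>m\<in>UNIV. z $ m * gam k i l m) * (\<Sum>m\<in>UNIV. z $ m * gam l i k m))))"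
proof -
  obtain C0 where C0: "C0 \<ge> 0" "\<And>y. \<bar>e0 y\<bar> \<le> C0 * norm y ^ 4" using e0_bound by blast
  have "e1 y = GG y" if "norm y < r" for y
    using e1_near[OF that] S[OF cball_sub[of y]] that by simp
  from ob_global[OF e1_adm this ob_GG]
  obtain C1 where C1: "C1 \<ge> 0" "\<And>y. \<bar>e1 y\<bar> \<le> C1 * norm y ^ 2" by blast
  show ?thesis
  proof (rule limit_nonneg[OF lsi \<tau>, of 4 "C0 + C1"])
    fix t :: real and z :: "real^'a" assume t: "0 < t" "t \<le> 1"
    have "\<bar>t\<^sup>2 * e1 (t *\<^sub>R z) + e0 (t *\<^sub>R z)\<bar> \<le> t\<^sup>2 * \<bar>e1 (t *\<^sub>R z)\<bar> + \<bar>e0 (t *\<^sub>R z)\<bar>"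
      by (rule order_trans[OF abs_triangle_ineq]) (simp add: abs_mult)
    also have "\<dots> \<le> t\<^sup>2 * (C1 * norm (t *\<^sub>R z) ^ 2) + C0 * norm (t *\<^sub>R z) ^ 4"
      by (intro add_mono mult_left_mono C1 C0) auto
    also have "\<dots> = t ^ 4 * (C1 * (norm z)\<^sup>2) + t ^ 4 * (C0 * norm z ^ 4)"
      using t by (simp add: power_mult_distrib eval_nat_numeral)
    also have "\<dots> \<le> t ^ 4 * (C1 * (1 + (norm z)\<^sup>2) ^ 3) + t ^ 4 * (C0 * (1 + (norm z)\<^sup>2) ^ 3)"
      using poly3_bounds[of z] C0(1) C1(1) t by (intro add_mono mult_left_mono) auto
    finally show "\<bar>t\<^sup>2 * e1 (t *\<^sub>R z) + e0 (t *\<^sub>R z)\<bar> \<le> t ^ 4 * ((C0 + C1) * (1 + (norm z)\<^sup>2) ^ 3)"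
      by (simp add: algebra_simps)
  next
    fix z :: "real^'a"
    have "((\<lambda>t. e0 (t *\<^sub>R z) / t ^ 4 + GG (t *\<^sub>R z) / t\<^sup>2) \<longlongrightarrow> (1/4) * (\<Sum>a\<in>UNIV. \<Sum>e\<in>UNIV. (H z a e)\<^sup>2)
     + (\<Sum>i\<in>UNIV. \<Sum>k\<in>UNIV. \<Sum>l\<in>UNIV. (\<Sum>m\<in>UNIV. z $ m * gam k i l m) * (\<Sum>m\<in>UNIV. z $ m * gam l i k m))) (at_right 0)"
      by (intro tendsto_add lim_e0 lim_GG)
    then show "((\<lambda>t. (t\<^sup>2 * e1 (t *\<^sub>R z) + e0 (t *\<^sub>R z)) / t ^ 4) \<longlongrightarrow> (1/4) * (\<Sum>a\<in>UNIV. \<Sum>e\<in>UNIV. (H z a e)\<^sup>2)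
     + (\<Sum>i\<in>UNIV. \<Sum>k\<in>UNIV. \<Sum>l\<in>UNIV. (\<Sum>m\<in>UNIV. z $ m * gam k i l m) * (\<Sum>m\<in>UNIV. z $ m * gam l i k m))) (at_right 0)"
    proof (rule Lim_transform_eventually)
      show "\<forall>\<^sub>F t in at_right 0. e0 (t *\<^sub>R z) / t ^ 4 + GG (t *\<^sub>R z) / t\<^sup>2 = (t\<^sup>2 * e1 (t *\<^sub>R z) + e0 (t *\<^sub>R z)) / t ^ 4"
        using eventually_at_right_less[of "0::real"] near_ev[of z] in_ev[of z]
        by eventually_elim (simp add: S field_simps eval_nat_numeral)
    qed
  next
    show "(\<lambda>z. (1/4) * (\<Sum>a\<in>UNIV. \<Sum>e\<in>UNIV. (H z a e)\<^sup>2)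
     + (\<Sum>i\<in>UNIV. \<Sum>k\<in>UNIV. \<Sum>l\<in>UNIV. (\<Sum>m\<in>UNIV. z $ m * gam k i l m) * (\<Sum>m\<in>UNIV. z $ m * gam l i k m))) \<in> borel_measurable borel"
      unfolding H_def by measurable
  qed
qed

end

section \<open>Gaussian averages of quadratic expressions\<close>

text \<open>Of the three pairings in \<open>gauss_moment4\<close>, one produces the square of the
  trace; the other two agree by the symmetry of \<open>h\<close> and produce its squared
  norm.\<close>

lemma gauss_average_square:
  fixes h :: "'n::finite \<Rightarrow> 'n \<Rightarrow> real"
  assumes sym: "\<And>k l. h k l = h l k"
  shows "integrable lborel (\<lambda>z::real^'n. gauss 1 z * ((1/2) * (\<Sum>k\<in>UNIV. \<Sum>l\<in>UNIV. h k l * (z $ k * z $ l)))\<^sup>2)"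
    and "(LINT z|lborel. gauss 1 z * ((1/2) * (\<Sum>k\<in>UNIV. \<Sum>l\<in>UNIV. h k l * ((z::real^'n) $ k * z $ l)))\<^sup>2)
      = (\<Sum>k\<in>UNIV. h k k)\<^sup>2 + 2 * (\<Sum>k\<in>UNIV. \<Sum>l\<in>UNIV. (h k l)\<^sup>2)"
proof -
  have e: "gauss 1 z * ((1/2) * (\<Sum>k\<in>UNIV. \<Sum>l\<in>UNIV. h k l * (z $ k * z $ l)))\<^sup>2
    = (\<Sum>k\<in>UNIV. \<Sum>l\<in>UNIV. \<Sum>m\<in>UNIV. \<Sum>n\<in>UNIV. (1/4) * h k l * h m n * (gauss 1 z * (z $ k * z $ l * z $ m * z $ n)))" for z :: "real^'n"
  proof -
    have "(\<Sum>k\<in>UNIV. \<Sum>l\<in>UNIV. h k l * (z $ k * z $ l)) * (\<Sum>m\<in>UNIV. \<Sum>n\<in>UNIV. h m n * (z $ m * z $ n))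
      = (\<Sum>k\<in>UNIV. \<Sum>l\<in>UNIV. \<Sum>m\<in>UNIV. \<Sum>n\<in>UNIV. h k l * (z $ k * z $ l) * (h m n * (z $ m * z $ n)))"
      unfolding sum_distrib_right unfolding sum_distrib_left ..
    then have "gauss 1 z * ((1/2) * (\<Sum>k\<in>UNIV. \<Sum>l\<in>UNIV. h k l * (z $ k * z $ l)))\<^sup>2 = gauss 1 z * (1/4) *
      (\<Sum>k\<in>UNIV. \<Sum>l\<in>UNIV. \<Sum>m\<in>UNIV. \<Sum>n\<in>UNIV. h k l * (z $ k * z $ l) * (h m n * (z $ m * z $ n)))"
      by (simp add: power2_eq_square)
    then show ?thesis by (simp add: sum_distrib_left mult_ac)
  qed
  show "integrable lborel (\<lambda>z::real^'n. gauss 1 z * ((1/2) * (\<Sum>k\<in>UNIV. \<Sum>l\<in>UNIV. h k l * (z $ k * z $ l)))\<^sup>2)"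
    unfolding e by (intro Bochner_Integration.integrable_sum integrable_mult_right gauss_moment4)
  let ?\<delta> = "\<lambda>i j. if i = j then 1 else 0 :: real"
  have "(LINT z|lborel. gauss 1 z * ((1/2) * (\<Sum>k\<in>UNIV. \<Sum>l\<in>UNIV. h k l * ((z::real^'n) $ k * z $ l)))\<^sup>2)
    = (\<Sum>k\<in>UNIV. \<Sum>l\<in>UNIV. \<Sum>m\<in>UNIV. \<Sum>n\<in>UNIV. (1/4) * h k l * h m n * (4 * ((if k = l \<and> m = n then 1 else 0)
       + (if k = m \<and> l = n then 1 else 0) + (if k = n \<and> l = m then 1 else 0))))"
    unfolding e
    by (simp only: Bochner_Integration.integral_sum Bochner_Integration.integrable_sum integrable_mult_right
        gauss_moment4 integral_mult_right_zero)
  also have "\<dots> = (\<Sum>k\<in>UNIV. \<Sum>l\<in>UNIV. \<Sum>m\<in>UNIV. \<Sum>n\<in>UNIV. h k l * h m n * (?\<delta> k l * ?\<delta> m n))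
    + (\<Sum>k\<in>UNIV. \<Sum>l\<in>UNIV. \<Sum>m\<in>UNIV. \<Sum>n\<in>UNIV. h k l * h m n * (?\<delta> k m * ?\<delta> l n))
    + (\<Sum>k\<in>UNIV. \<Sum>l\<in>UNIV. \<Sum>m\<in>UNIV. \<Sum>n\<in>UNIV. h k l * h m n * (?\<delta> k n * ?\<delta> l m))"
  proof -
    have alg: "(1/4) * a * b * (4 * (x + y + z)) = a * b * x + a * b * y + a * b * z" for a b x y z :: real
      by (simp add: algebra_simps)
    have cj: "(if P \<and> Q then 1 else 0 :: real) = (if P then 1 else 0) * (if Q then 1 else 0)" for P Q by simp
    show ?thesis unfolding alg cj sum.distrib ..
  qed
  also have "(\<Sum>k\<in>UNIV. \<Sum>l\<in>UNIV. \<Sum>m\<in>UNIV. \<Sum>n\<in>UNIV. h k l * h m n * (?\<delta> k l * ?\<delta> m n)) = (\<Sum>k\<in>UNIV. h k k)\<^sup>2"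
  proof -
    have "(\<Sum>k\<in>UNIV. \<Sum>l\<in>UNIV. \<Sum>m\<in>UNIV. \<Sum>n\<in>UNIV. h k l * h m n * (?\<delta> k l * ?\<delta> m n))
      = (\<Sum>k\<in>UNIV. \<Sum>l\<in>UNIV. h k l * ?\<delta> k l * (\<Sum>m\<in>UNIV. \<Sum>n\<in>UNIV. h m n * ?\<delta> m n))"
      by (simp only: sum_distrib_left mult_ac)
    also have "\<dots> = (\<Sum>k\<in>UNIV. \<Sum>l\<in>UNIV. h k l * ?\<delta> k l) * (\<Sum>m\<in>UNIV. \<Sum>n\<in>UNIV. h m n * ?\<delta> m n)"
      by (simp only: sum_distrib_right)
    finally show ?thesis
      by (simp add: power2_eq_square if_distrib[of "\<lambda>u. _ * u"] cong: if_cong)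
  qed
  also have "(\<Sum>k\<in>UNIV. \<Sum>l\<in>UNIV. \<Sum>m\<in>UNIV. \<Sum>n\<in>UNIV. h k l * h m n * (?\<delta> k m * ?\<delta> l n)) = (\<Sum>k\<in>UNIV. \<Sum>l\<in>UNIV. (h k l)\<^sup>2)"
  proof (intro sum.cong refl)
    fix k l
    have "(\<Sum>n\<in>UNIV. h k l * h m n * (?\<delta> k m * ?\<delta> l n)) = h k l * h m l * ?\<delta> k m" for m
      by (simp add: if_distrib[of "\<lambda>u. _ * u"] cong: if_cong)
    then show "(\<Sum>m\<in>UNIV. \<Sum>n\<in>UNIV. h k l * h m n * (?\<delta> k m * ?\<delta> l n)) = (h k l)\<^sup>2"
      by (simp add: power2_eq_square if_distrib[of "\<lambda>u. _ * u"] cong: if_cong)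
  qed
  also have "(\<Sum>k\<in>UNIV. \<Sum>l\<in>UNIV. \<Sum>m\<in>UNIV. \<Sum>n\<in>UNIV. h k l * h m n * (?\<delta> k n * ?\<delta> l m)) = (\<Sum>k\<in>UNIV. \<Sum>l\<in>UNIV. (h k l)\<^sup>2)"
  proof (intro sum.cong refl)
    fix k l
    have "(\<Sum>n\<in>UNIV. h k l * h m n * (?\<delta> k n * ?\<delta> l m)) = h k l * h m k * ?\<delta> l m" for m
      by (simp add: if_distrib[of "\<lambda>u. _ * u"] if_distrib[of "\<lambda>u. u * _"] cong: if_cong)
    then show "(\<Sum>m\<in>UNIV. \<Sum>n\<in>UNIV. h k l * h m n * (?\<delta> k n * ?\<delta> l m)) = (h k l)\<^sup>2"
      by (simp add: power2_eq_square if_distrib[of "\<lambda>u. _ * u"] sym[of l k] cong: if_cong)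
  qed
  finally show "(LINT z|lborel. gauss 1 z * ((1/2) * (\<Sum>k\<in>UNIV. \<Sum>l\<in>UNIV. h k l * ((z::real^'n) $ k * z $ l)))\<^sup>2)
      = (\<Sum>k\<in>UNIV. h k k)\<^sup>2 + 2 * (\<Sum>k\<in>UNIV. \<Sum>l\<in>UNIV. (h k l)\<^sup>2)" by simp
qed

lemma gauss_average_product:
  fixes u v :: "'n::finite \<Rightarrow> real"
  shows "integrable lborel (\<lambda>z::real^'n. gauss 1 z * ((\<Sum>m\<in>UNIV. z $ m * u m) * (\<Sum>m\<in>UNIV. z $ m * v m)))"
    and "(LINT z|lborel. gauss 1 z * ((\<Sum>m\<in>UNIV. (z::real^'n) $ m * u m) * (\<Sum>m\<in>UNIV. z $ m * v m))) = 2 * (\<Sum>m\<in>UNIV. u m * v m)"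
proof -
  have e: "gauss 1 z * ((\<Sum>m\<in>UNIV. z $ m * u m) * (\<Sum>m\<in>UNIV. z $ m * v m))
    = (\<Sum>m\<in>UNIV. \<Sum>n\<in>UNIV. u m * v n * (gauss 1 z * (z $ m * z $ n)))" for z :: "real^'n"
  proof -
    have "(\<Sum>m\<in>UNIV. z $ m * u m) * (\<Sum>n\<in>UNIV. z $ n * v n) = (\<Sum>m\<in>UNIV. \<Sum>n\<in>UNIV. z $ m * u m * (z $ n * v n))"
      by (rule sum_product)
    then show ?thesis by (simp add: sum_distrib_left mult_ac)
  qed
  show "integrable lborel (\<lambda>z::real^'n. gauss 1 z * ((\<Sum>m\<in>UNIV. z $ m * u m) * (\<Sum>m\<in>UNIV. z $ m * v m)))"
    unfolding e by (intro Bochner_Integration.integrable_sum integrable_mult_right gauss_moment2)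
  have "(LINT z|lborel. gauss 1 z * ((\<Sum>m\<in>UNIV. (z::real^'n) $ m * u m) * (\<Sum>m\<in>UNIV. z $ m * v m)))
    = (\<Sum>m\<in>UNIV. \<Sum>n\<in>UNIV. u m * v n * (if m = n then 2 else 0))"
    unfolding e
    by (simp only: Bochner_Integration.integral_sum Bochner_Integration.integrable_sum integrable_mult_right
        gauss_moment2 integral_mult_right_zero)
  then show "(LINT z|lborel. gauss 1 z * ((\<Sum>m\<in>UNIV. (z::real^'n) $ m * u m) * (\<Sum>m\<in>UNIV. z $ m * v m))) = 2 * (\<Sum>m\<in>UNIV. u m * v m)"
    by (simp add: if_distrib[of "\<lambda>u. _ * u"] sum_distrib_left mult_ac cong: if_cong)
qed

context normal_field
begin

text \<open>The squared norm of \<open>hh\<close> enters twice: with factor \<open>1/2\<close> from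
  the relative entropy and with factor \<open>-1/2\<close> from the Christoffel symbols. It cancels,
  and traces and one mixed product remain.\<close>

lemma second_order_form:
  assumes lsi: "euclid_log_sobolev \<Omega> G \<tau>\<^sub>0" and \<tau>: "\<tau>\<^sub>0 > 0" and S: "\<And>y. y \<in> \<Omega> \<Longrightarrow> Scal G y = 0"
  shows "0 \<le> (1/4) * (\<Sum>a\<in>UNIV. \<Sum>b\<in>UNIV. (\<Sum>k\<in>UNIV. hh a b k k)\<^sup>2)
     + (\<Sum>i\<in>UNIV. \<Sum>k\<in>UNIV. \<Sum>l\<in>UNIV. \<Sum>m\<in>UNIV. hh i k l m * hh i l k m)"
proof -
  define N where "N = (\<Sum>i\<in>UNIV. \<Sum>k\<in>UNIV. \<Sum>l\<in>UNIV. \<Sum>m\<in>UNIV. (hh i k l m)\<^sup>2)"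
  define B where "B = (\<Sum>i\<in>UNIV. \<Sum>k\<in>UNIV. \<Sum>l\<in>UNIV. \<Sum>m\<in>UNIV. hh i k l m * hh i l k m)"
  define A where "A = (\<Sum>a\<in>UNIV. \<Sum>b\<in>UNIV. (\<Sum>k\<in>UNIV. hh a b k k)\<^sup>2)"
  have split: "gauss 1 z * ((1/4) * (\<Sum>a\<in>UNIV. \<Sum>e\<in>UNIV. (H z a e)\<^sup>2)
     + (\<Sum>i\<in>UNIV. \<Sum>k\<in>UNIV. \<Sum>l\<in>UNIV. (\<Sum>m\<in>UNIV. z $ m * gam k i l m) * (\<Sum>m\<in>UNIV. z $ m * gam l i k m)))
    = (1/4) * (\<Sum>a\<in>UNIV. \<Sum>e\<in>UNIV. gauss 1 z * (H z a e)\<^sup>2)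
     + (\<Sum>i\<in>UNIV. \<Sum>k\<in>UNIV. \<Sum>l\<in>UNIV. gauss 1 z * ((\<Sum>m\<in>UNIV. z $ m * gam k i l m) * (\<Sum>m\<in>UNIV. z $ m * gam l i k m)))" for z
    by (simp only: distrib_left sum_distrib_left mult.left_commute)
  have i1: "integrable lborel (\<lambda>z. gauss 1 z * (H z a e)\<^sup>2)"
    "(LINT z|lborel. gauss 1 z * (H z a e)\<^sup>2) = (\<Sum>k\<in>UNIV. hh a e k k)\<^sup>2 + 2 * (\<Sum>k\<in>UNIV. \<Sum>l\<in>UNIV. (hh a e k l)\<^sup>2)" for a e
    unfolding H_def by (rule gauss_average_square[OF hh_sym2])+
  note i2 = gauss_average_product
  have "(LINT z|lborel. gauss 1 z * ((1/4) * (\<Sum>a\<in>UNIV. \<Sum>e\<in>UNIV. (H z a e)\<^sup>2)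
     + (\<Sum>i\<in>UNIV. \<Sum>k\<in>UNIV. \<Sum>l\<in>UNIV. (\<Sum>m\<in>UNIV. z $ m * gam k i l m) * (\<Sum>m\<in>UNIV. z $ m * gam l i k m))))
    = (1/4) * (\<Sum>a\<in>UNIV. \<Sum>e\<in>UNIV. (\<Sum>k\<in>UNIV. hh a e k k)\<^sup>2 + 2 * (\<Sum>k\<in>UNIV. \<Sum>l\<in>UNIV. (hh a e k l)\<^sup>2))
     + (\<Sum>i\<in>UNIV. \<Sum>k\<in>UNIV. \<Sum>l\<in>UNIV. 2 * (\<Sum>m\<in>UNIV. gam k i l m * gam l i k m))"
    unfolding split
    by (simp only: Bochner_Integration.integral_add Bochner_Integration.integral_sum Bochner_Integration.integrable_sum
        integrable_mult_right integral_mult_right_zero i1 i2)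
  also have "(1/4) * (\<Sum>a\<in>UNIV. \<Sum>e\<in>UNIV. (\<Sum>k\<in>UNIV. hh a e k k)\<^sup>2 + 2 * (\<Sum>k\<in>UNIV. \<Sum>l\<in>UNIV. (hh a e k l)\<^sup>2)) = (1/4) * A + (1/2) * N"
    by (simp add: A_def N_def sum.distrib sum_distrib_left[symmetric])
  also have "(\<Sum>i\<in>UNIV. \<Sum>k\<in>UNIV. \<Sum>l\<in>UNIV. 2 * (\<Sum>m\<in>UNIV. gam k i l m * gam l i k m)) = - (1/2) * N + B"
  proof -
    \<comment> \<open>A difference of squares: exchanging \<open>k\<close> and \<open>l\<close>
      keeps the first term of \<open>gam\<close> and changes the sign of the difference of the other
      two.\<close>
    have "gam k i l m * gam l i k m = (1/4) * ((hh l k i m)\<^sup>2 - (hh i k l m)\<^sup>2 - (hh i l k m)\<^sup>2 + 2 * (hh i k l m * hh i l k m))" for i k l m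
      unfolding gam_def using hh_sym1[of l k i m] by (simp add: power2_eq_square algebra_simps)
    note gg = this
    have "(\<Sum>i\<in>UNIV. \<Sum>k\<in>UNIV. \<Sum>l\<in>UNIV. 2 * (\<Sum>m\<in>UNIV. gam k i l m * gam l i k m))
      = (1/2) * ((\<Sum>i\<in>UNIV. \<Sum>k\<in>UNIV. \<Sum>l\<in>UNIV. \<Sum>m\<in>UNIV. (hh l k i m)\<^sup>2) - N - (\<Sum>i\<in>UNIV. \<Sum>k\<in>UNIV. \<Sum>l\<in>UNIV. \<Sum>m\<in>UNIV. (hh i l k m)\<^sup>2) + 2 * B)"
      unfolding N_def B_def gg by (simp add: sum_distrib_left sum.distrib sum_subtractf algebra_simps)
    also have "(\<Sum>i\<in>UNIV. \<Sum>k\<in>UNIV. \<Sum>l\<in>UNIV. \<Sum>m\<in>UNIV. (hh l k i m)\<^sup>2) = N"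
      unfolding N_def sum.cartesian_product UNIV_Times_UNIV
      by (rule sum.reindex_bij_witness[of _ "\<lambda>(i, k, l, m). (l, k, i, m)" "\<lambda>(i, k, l, m). (l, k, i, m)"]) auto
    also have "(\<Sum>i\<in>UNIV. \<Sum>k\<in>UNIV. \<Sum>l\<in>UNIV. \<Sum>m\<in>UNIV. (hh i l k m)\<^sup>2) = N"
      unfolding N_def sum.cartesian_product UNIV_Times_UNIV
      by (rule sum.reindex_bij_witness[of _ "\<lambda>(i, k, l, m). (i, l, k, m)" "\<lambda>(i, k, l, m). (i, l, k, m)"]) auto
    finally show ?thesis by simp
  qed
  finally show ?thesis
    using second_order[OF lsi \<tau> S] unfolding A_def[symmetric] B_def[symmetric] by simp
qed

end

section \<open>Algebra of the second order terms\<close>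

text \<open>
  Split \<open>h\<close> into the parts \<open>P\<close> and \<open>N\<close> that are symmetric and antisymmetric under the exchange of the
  two index pairs. Relabelling the indices cancels all terms of the quadratic form that contain \<open>N\<close>,
  and the cyclic identity for \<open>P\<close> turns the rest into \<open>- |P|\<^sup>2 / 2\<close>.
\<close>

lemma second_order_rigid:
  fixes h :: "'n::finite \<Rightarrow> 'n \<Rightarrow> 'n \<Rightarrow> 'n \<Rightarrow> real"
  assumes s1: "\<And>i j k l. h i j k l = h j i k l" and s2: "\<And>i j k l. h i j k l = h i j l k"
    and s4: "\<And>i j k l. h i j k l + h k l i j + h i k j l + h j l i k + h i l j k + h j k i l = 0"
    and form: "0 \<le> (\<Sum>i\<in>UNIV. \<Sum>k\<in>UNIV. \<Sum>l\<in>UNIV. \<Sum>m\<in>UNIV. h i k l m * h i l k m)"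
  shows "h i j k l = - h k l i j"
proof -
  define P where "P i j k l = (h i j k l + h k l i j) / 2" for i j k l
  define N where "N i j k l = (h i j k l - h k l i j) / 2" for i j k l
  have P1: "P i j k l = P j i k l" "P i j k l = P i j l k" "P i j k l = P k l i j" for i j k l
    using s1[of i j k l] s1[of k l j i] s2[of i j k l] s2[of k l i j] s1[of k l i j] by (auto simp: P_def s1[of k l] s2[of k l])
  have N1: "N i j k l = N j i k l" "N i j k l = N i j l k" "N i j k l = - N k l i j" for i j k l
    using s1[of i j k l] s1[of k l j i] s2[of i j k l] s2[of k l i j] s1[of k l i j]
    by (auto simp: N_def s1[of k l] s2[of k l] field_simps)
  have hPN: "h i j k l = P i j k l + N i j k l" for i j k l
    by (simp add: P_def N_def field_simps)
  let ?S = "\<lambda>f. \<Sum>i\<in>UNIV. \<Sum>k\<in>UNIV. \<Sum>l\<in>UNIV. \<Sum>m\<in>(UNIV::'n set). f i k l m :: real"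
  have flip: "?S f = ?S (\<lambda>i k l m. f m l k i)" for f
    unfolding sum.cartesian_product UNIV_Times_UNIV
    by (rule sum.reindex_bij_witness[of _ "\<lambda>(i, k, l, m). (m, l, k, i)" "\<lambda>(i, k, l, m). (m, l, k, i)"]) auto
  have swap_kl: "?S f = ?S (\<lambda>i k l m. f i l k m)" for f
    unfolding sum.cartesian_product UNIV_Times_UNIV
    by (rule sum.reindex_bij_witness[of _ "\<lambda>(i, k, l, m). (i, l, k, m)" "\<lambda>(i, k, l, m). (i, l, k, m)"]) auto
  have swap_ik: "?S f = ?S (\<lambda>i k l m. f k i l m)" for f
    unfolding sum.cartesian_product UNIV_Times_UNIV
    by (rule sum.reindex_bij_witness[of _ "\<lambda>(i, k, l, m). (k, i, l, m)" "\<lambda>(i, k, l, m). (k, i, l, m)"]) auto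
  have swap_lm: "?S f = ?S (\<lambda>i k l m. f i k m l)" for f
    unfolding sum.cartesian_product UNIV_Times_UNIV
    by (rule sum.reindex_bij_witness[of _ "\<lambda>(i, k, l, m). (i, k, m, l)" "\<lambda>(i, k, l, m). (i, k, m, l)"]) auto
  have neg: "?S (\<lambda>i k l m. - f i k l m) = - ?S f" for f
    by (simp add: sum_negf)
  have PN: "?S (\<lambda>i k l m. P i k l m * N i l k m) = 0"
  proof -
    \<comment> \<open>Reversing the order of all four indices exchanges the pairs in both factors:
      \<open>P\<close> is kept and \<open>N\<close> changes sign, so the sum equals its own
      negative.\<close>
    have "P m l k i * N m k l i = - (P i k l m * N i l k m)" for i k l m
      using P1(3)[of m l k i] P1(1)[of k i m l] P1(2)[of i k m l] N1(3)[of m k l i] N1(1)[of l i m k] N1(2)[of i l m k] by simp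
    then have "?S (\<lambda>i k l m. P m l k i * N m k l i) = ?S (\<lambda>i k l m. - (P i k l m * N i l k m))"
      by (intro sum.cong refl)
    then show ?thesis
      using flip[of "\<lambda>i k l m. P i k l m * N i l k m"] neg[of "\<lambda>i k l m. P i k l m * N i l k m"] by linarith
  qed
  have NP: "?S (\<lambda>i k l m. N i k l m * P i l k m) = 0"
    using PN swap_kl[of "\<lambda>i k l m. P i k l m * N i l k m"] by (simp add: mult.commute)
  have NN: "?S (\<lambda>i k l m. N i k l m * N i l k m) = 0"
  proof -
    have a: "?S (\<lambda>i k l m. N i k l m * N i l k m) = ?S (\<lambda>i k l m. N i k l m * N k l i m)"
      using swap_ik[of "\<lambda>i k l m. N i k l m * N i l k m"] N1(1) by simp
    \<comment> \<open>Exchanging \<open>l\<close> with \<open>m\<close> involves one exchange of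
      pairs and brings a minus sign, while exchanging \<open>i\<close> with \<open>k\<close> leads
      to the same product without it (\<open>a\<close>).\<close>
    have "N i k m l * N i m k l = - (N i k l m * N k l i m)" for i k l m
      using N1(2)[of i k m l] N1(3)[of i m k l] by simp
    then have "?S (\<lambda>i k l m. N i k l m * N i l k m) = - ?S (\<lambda>i k l m. N i k l m * N k l i m)"
      using swap_lm[of "\<lambda>i k l m. N i k l m * N i l k m"] neg[of "\<lambda>i k l m. N i k l m * N k l i m"] by simp
    with a show ?thesis by simp
  qed
  have PP: "?S (\<lambda>i k l m. P i k l m * P i l k m) = - (1/2) * ?S (\<lambda>i k l m. (P i k l m)\<^sup>2)"
  proof -
    have z: "(P i k l m)\<^sup>2 + P i k l m * P i l k m + P i k l m * P i m k l = 0" for i k l m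
    proof -
      \<comment> \<open>Half of \<open>s4\<close>. Multiplied by \<open>P i k l m\<close> and
        summed, its last two products have equal sums, which gives the factor
        \<open>- 1/2\<close>.\<close>
      have "P i k l m + P i l k m + P i m k l = 0"
        using s4[of i k l m] by (simp add: P_def field_simps)
      then have "P i k l m * (P i k l m + P i l k m + P i m k l) = 0" by simp
      then show ?thesis by (simp add: power2_eq_square algebra_simps)
    qed
    have "?S (\<lambda>i k l m. (P i k l m)\<^sup>2 + P i k l m * P i l k m + P i k l m * P i m k l) = 0"
      unfolding z by simp
    then have "?S (\<lambda>i k l m. (P i k l m)\<^sup>2) + ?S (\<lambda>i k l m. P i k l m * P i l k m) + ?S (\<lambda>i k l m. P i k l m * P i m k l) = 0"
      unfolding sum.distrib .
    moreover have "?S (\<lambda>i k l m. P i k l m * P i m k l) = ?S (\<lambda>i k l m. P i k l m * P i l k m)"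
      using swap_lm[of "\<lambda>i k l m. P i k l m * P i m k l"] P1(2) by simp
    ultimately show ?thesis by simp
  qed
  have "?S (\<lambda>i k l m. h i k l m * h i l k m) = ?S (\<lambda>i k l m. P i k l m * P i l k m)"
    using PN NP NN unfolding hPN distrib_left distrib_right sum.distrib by simp
  with form PP have "?S (\<lambda>i k l m. (P i k l m)\<^sup>2) \<le> 0" by simp
  moreover have "(P i j k l)\<^sup>2 \<le> ?S (\<lambda>i k l m. (P i k l m)\<^sup>2)"
  proof -
    have "(P i j k l)\<^sup>2 \<le> (\<Sum>m\<in>UNIV. (P i j k m)\<^sup>2)" by (rule member_le_sum) auto
    also have "\<dots> \<le> (\<Sum>l\<in>UNIV. \<Sum>m\<in>UNIV. (P i j l m)\<^sup>2)" by (rule member_le_sum[of k]) (auto intro!: sum_nonneg)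
    also have "\<dots> \<le> (\<Sum>k\<in>UNIV. \<Sum>l\<in>UNIV. \<Sum>m\<in>UNIV. (P i k l m)\<^sup>2)" by (rule member_le_sum[of j]) (auto intro!: sum_nonneg)
    also have "\<dots> \<le> ?S (\<lambda>i k l m. (P i k l m)\<^sup>2)" by (rule member_le_sum[of i]) (auto intro!: sum_nonneg)
    finally show ?thesis .
  qed
  ultimately have "(P i j k l)\<^sup>2 \<le> 0" by linarith
  then have "P i j k l = 0" by simp
  then show ?thesis by (simp add: P_def field_simps)
qed

text \<open>
  The first cubic correction removes the totally symmetric part of \<open>h\<close>, the second one the traces.
\<close>

lemma cubic_gauge:
  fixes h :: "'n::finite \<Rightarrow> 'n \<Rightarrow> 'n \<Rightarrow> 'n \<Rightarrow> real"
  assumes s1: "\<And>i j k l. h i j k l = h j i k l" and s2: "\<And>i j k l. h i j k l = h i j l k"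
    and tr: "(\<Sum>i\<in>UNIV. \<Sum>j\<in>UNIV. h i j i j - h i i j j) = 0"
  obtains C where "\<And>a i j k. C a i j k = C a j i k" "\<And>a i j k. C a i j k = C a i k j"
    "\<And>h' i j k l. (\<And>i j k l. h' i j k l = h i j k l + C i j k l + C j i k l) \<Longrightarrow>
       h' i j k l + h' k l i j + h' i k j l + h' j l i k + h' i l j k + h' j k i l = 0"
    "\<And>h' i j. (\<And>i j k l. h' i j k l = h i j k l + C i j k l + C j i k l) \<Longrightarrow> (\<Sum>k\<in>UNIV. h' i j k k) = 0"
proof -
  \<comment> \<open>Given the two pair symmetries, these six arrangements represent all permutations
    of the indices, so \<open>S / 6\<close> is the totally symmetric part of
    \<open>h\<close>.\<close>
  define S where "S i j k l = h i j k l + h k l i j + h i k j l + h j l i k + h i l j k + h j k i l" for i j k l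
  have S: "S i j k l = S j i k l" "S i j k l = S i k j l" "S i j k l = S i j l k" for i j k l
    using s1[of i j k l] s2[of k l i j] s2[of i l j k] s1[of j k i l] s2[of i j k l] s1[of k l i j]
    unfolding S_def by linarith+
  define A where "A i j = (\<Sum>k\<in>UNIV. h i j k k - S i j k k / 6)" for i j
  have A: "A i j = A j i" for i j
    unfolding A_def using s1[of i j] S(1)[of i j] by simp
  \<comment> \<open>Up to the factor \<open>- 2/3\<close> this is the hypothesis \<open>tr\<close>,
    which expresses the vanishing of the scalar curvature at the origin, see
    \<open>Scal0\<close>.\<close>
  have trA: "(\<Sum>i\<in>UNIV. A i i) = 0"
  proof -
    have "(\<Sum>i\<in>UNIV. \<Sum>k\<in>UNIV. S i i k k)
       = (\<Sum>i\<in>UNIV. \<Sum>k\<in>UNIV. h i i k k) + (\<Sum>i\<in>UNIV. \<Sum>k\<in>UNIV. h k k i i) + 4 * (\<Sum>i\<in>UNIV. \<Sum>k\<in>UNIV. h i k i k)"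
      using s2[of i _ k i for i k] by (simp add: S_def sum.distrib sum_distrib_left)
    also have "(\<Sum>i\<in>UNIV. \<Sum>k\<in>UNIV. h k k i i) = (\<Sum>i\<in>UNIV. \<Sum>k\<in>UNIV. h i i k k)"
      by (rule sum.swap)
    finally show ?thesis using tr by (simp add: A_def sum_subtractf sum_divide_distrib[symmetric])
  qed
  define n where "n = real CARD('n)"
  have n: "n > 0" by (simp add: n_def)
  define \<delta> where "\<delta> i j = (if i = j then 1 else 0 :: real)" for i j :: 'n
  have \<delta>: "\<delta> i j = \<delta> j i" for i j by (simp add: \<delta>_def)
  \<comment> \<open>Symmetric in the last three indices, as a cubic coefficient must be. Symmetrised
    in the first two indices it becomes \<open>EE\<close>, which is antisymmetric under the exchange
    of the pairs and so leaves the cyclic identity alone, and whose trace over \<open>k = l\<close>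
    is \<open>- A i j\<close> because \<open>A\<close> has trace zero.\<close>
  define E where "E j k l m = - (1 / (2 * n)) * (\<delta> k l * A j m + \<delta> k m * A j l + \<delta> l m * A j k
    - A k l * \<delta> j m - A k m * \<delta> j l - A l m * \<delta> j k)" for j k l m
  \<comment> \<open>The metric changes by \<open>C i j k l + C j i k l\<close>; the denominator
    \<open>12\<close> therefore subtracts \<open>S / 6\<close>.\<close>
  define C where "C i j k l = - S i j k l / 12 + E i j k l" for i j k l
  have EE: "E i j k l + E j i k l = - (1 / n) * (\<delta> k l * A i j - A k l * \<delta> i j)" for i j k l
    unfolding E_def using A[of i j] \<delta>[of i j] A[of i k] n by (simp add: field_simps)
  have C: "h i j k l + C i j k l + C j i k l = h i j k l - S i j k l / 6 - (1 / n) * (\<delta> k l * A i j - A k l * \<delta> i j)" for i j k l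
    using EE[of i j k l] S(1)[of i j k l] by (simp add: C_def)
  show thesis
  proof
    show "C a i j k = C a j i k" "C a i j k = C a i k j" for a i j k
      using S(2)[of a i j k] S(3)[of a i j k] A[of i j] A[of j k] \<delta>[of i j] \<delta>[of j k] by (simp_all add: C_def E_def algebra_simps)
    fix h' :: "'n \<Rightarrow> 'n \<Rightarrow> 'n \<Rightarrow> 'n \<Rightarrow> real"
    assume h'0: "\<And>i j k l. h' i j k l = h i j k l + C i j k l + C j i k l"
    note h' = h'0[unfolded C]
    have pair: "h' i j k l + h' k l i j = h i j k l + h k l i j - S i j k l / 3" for i j k l
    proof -
      have "S k l i j = S i j k l" by (simp add: S_def s1 s2 add_ac)
      then show ?thesis unfolding h' using n by (simp add: field_simps)
    qed
    show "h' i j k l + h' k l i j + h' i k j l + h' j l i k + h' i l j k + h' j k i l = 0" for i j k l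
      using pair[of i j k l] pair[of i k j l] pair[of i l j k] S(2)[of i j k l] S(2)[of i l j k] S(3)[of i j k l] S_def[of i j k l]
      by linarith
    show "(\<Sum>k\<in>UNIV. h' i j k k) = 0" for i j
    proof -
      have "(\<Sum>k\<in>UNIV. h' i j k k) = A i j - (\<Sum>k\<in>UNIV. (1 / n) * (\<delta> k k * A i j - A k k * \<delta> i j))"
        unfolding h' sum_subtractf A_def[of i j] ..
      also have "\<dots> = A i j - (1 / n) * ((\<Sum>k\<in>UNIV. \<delta> k k) * A i j - (\<Sum>k\<in>UNIV. A k k) * \<delta> i j)"
        by (simp only: sum_distrib_left[symmetric] sum_distrib_right sum_subtractf)
      finally have "(\<Sum>k\<in>UNIV. h' i j k k) = A i j - (1 / n) * ((\<Sum>k\<in>UNIV. \<delta> k k) * A i j - (\<Sum>k\<in>UNIV. A k k) * \<delta> i j)" .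
      then show ?thesis using n by (simp add: trA \<delta>_def n_def)
    qed
  qed
qed

section \<open>Change of coordinates in the logarithmic Sobolev inequality\<close>

context metric_change
begin

text \<open>\<open>FM_change\<close> is inverted in steps: the Jacobian on the right is cancelled,
  and the two form indices are freed by contraction with the inverse Jacobian.\<close>

lemma Riem_change_zero:
  assumes y: "y \<in> \<Omega>'" and z: "\<And>l k i j. Riem G' l k i j y = 0"
  shows "Riem G l k i j (T y) = 0"
proof -
  let ?J = "J y" and ?K = "matrix_inv (J y)"
  have JK: "?J ** ?K = mat 1" and KJ: "?K ** ?J = mat 1"
    using matrix_inv_right[OF J_inv[OF y]] matrix_inv_left[OF J_inv[OF y]] by auto
  have "new.FM i j y = 0" for i j
    using z by (simp add: vec_eq_iff new.Riem_FM)
  then have "(\<Sum>b\<in>UNIV. \<Sum>a\<in>UNIV. (?J $ b $ i * ?J $ a $ j) *\<^sub>R old.FM b a (T y)) ** ?J = 0" for i j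
    using FM_change[OF y, of i j] by simp
  moreover have "X = 0" if "X ** ?J = 0" for X
  proof -
    have "X = X ** ?J ** ?K" by (simp only: matrix_mul_assoc[symmetric] JK matrix_mul_rid)
    then show ?thesis using that by (simp add: times0_left)
  qed
  ultimately have z0: "(\<Sum>b\<in>UNIV. \<Sum>a\<in>UNIV. (?J $ b $ i * ?J $ a $ j) *\<^sub>R old.FM b a (T y)) = 0" for i j
    by blast
  have d: "(\<Sum>i\<in>UNIV. ?J $ b $ i * ?K $ i $ p) = (if b = p then 1 else 0)" for b p
    using arg_cong[OF JK, of "\<lambda>M. M $ b $ p"] by (simp add: matrix_matrix_mult_def mat_def)
  have "old.FM p q (T y) $ l $ k = 0" for p q l k
  proof -
    let ?F = "\<lambda>b a. old.FM b a (T y) $ l $ k"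
    have z1: "(\<Sum>b\<in>UNIV. \<Sum>a\<in>UNIV. ?J $ b $ i * ?J $ a $ j * ?F b a) = 0" for i j
      using arg_cong[OF z0[of i j], of "\<lambda>M. M $ l $ k"] by simp
    have "0 = (\<Sum>i\<in>UNIV. \<Sum>j\<in>UNIV. ?K $ i $ p * ?K $ j $ q * (\<Sum>b\<in>UNIV. \<Sum>a\<in>UNIV. ?J $ b $ i * ?J $ a $ j * ?F b a))"
      by (simp add: z1)
    also have "\<dots> = (\<Sum>i\<in>UNIV. \<Sum>j\<in>UNIV. \<Sum>b\<in>UNIV. \<Sum>a\<in>UNIV. ?F b a * (?J $ b $ i * ?K $ i $ p) * (?J $ a $ j * ?K $ j $ q))"
      by (simp add: sum_distrib_left mult_ac)
    also have "\<dots> = (\<Sum>b\<in>UNIV. \<Sum>a\<in>UNIV. \<Sum>i\<in>UNIV. \<Sum>j\<in>UNIV. ?F b a * (?J $ b $ i * ?K $ i $ p) * (?J $ a $ j * ?K $ j $ q))"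
      unfolding sum.cartesian_product UNIV_Times_UNIV
      by (rule sum.reindex_bij_witness[of _ "\<lambda>(b, a, i, j). (i, j, b, a)" "\<lambda>(i, j, b, a). (b, a, i, j)"]) auto
    also have "\<dots> = ?F p q"
    proof -
      have "(\<Sum>i\<in>UNIV. \<Sum>j\<in>UNIV. c * x i * y j) = c * (\<Sum>i\<in>UNIV. x i) * (\<Sum>j\<in>UNIV. y j)"
        for c and x y :: "'n \<Rightarrow> real"
        by (simp add: sum_distrib_left[symmetric] sum_distrib_right[symmetric])
      then show ?thesis
        by (simp add: d if_distrib[of "\<lambda>u. _ * u"] if_distrib[of "\<lambda>u. u * _"] cong: if_cong)
    qed
    finally show ?thesis by simp
  qed
  then show ?thesis by (simp add: old.Riem_FM)
qed

lemma dens_change: "y \<in> \<Omega>' \<Longrightarrow> sqrt (det (G' y)) = \<bar>det (J y)\<bar> * sqrt (det (G (T y)))"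
proof -
  assume y: "y \<in> \<Omega>'"
  have "det (G' y) = (det (J y))\<^sup>2 * det (G (T y))"
    by (simp add: G'[OF y] det_mul det_transpose power2_eq_square)
  then show ?thesis by (simp add: real_sqrt_mult)
qed

lemma T_derivative: "y \<in> \<Omega>' \<Longrightarrow> (T has_derivative (\<lambda>v. J y *v v)) (at y)"
proof -
  assume y: "y \<in> \<Omega>'"
  have "J y = jacobian T y" by (simp add: vec_eq_iff J jacobian_def)
  with jacobian_derivative[OF smooth_on_differentiable[OF T(1) y]] show ?thesis by simp
qed

context
  assumes inj: "inj_on T \<Omega>'"
begin

section \<open>The inverse coordinate change and the transport of the inequality\<close>

lemma T_open: "open (T ` \<Omega>')"
  by (intro invariance_of_domain smooth_on_continuous_on T new.op inj)

definition Tinv :: "real^'n \<Rightarrow> real^'n" where "Tinv = inv_into \<Omega>' T"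

lemma Tinv: "y \<in> \<Omega>' \<Longrightarrow> Tinv (T y) = y" "x \<in> T ` \<Omega>' \<Longrightarrow> T (Tinv x) = x" "x \<in> T ` \<Omega>' \<Longrightarrow> Tinv x \<in> \<Omega>'"
  unfolding Tinv_def using inj by (auto simp: inv_into_into f_inv_into_f)

lemma Tinv_derivative:
  assumes "x \<in> T ` \<Omega>'"
  shows "(Tinv has_derivative (\<lambda>v. matrix_inv (J (Tinv x)) *v v)) (at x)"
proof -
  note y = Tinv(3)[OF assms]
  have "(Tinv has_derivative (\<lambda>v. matrix_inv (J (Tinv x)) *v v)) (at (T (Tinv x)))"
  proof (rule has_derivative_inverse_strong[OF new.op y smooth_on_continuous_on[OF T(1)] Tinv(1) T_derivative[OF y]])
    show "(*v) (J (Tinv x)) \<circ> (*v) (matrix_inv (J (Tinv x))) = id"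
      using matrix_inv_right[OF J_inv[OF y]] by (simp add: fun_eq_iff matrix_vector_mul_assoc)
  qed
  then show ?thesis by (simp add: Tinv(2)[OF assms])
qed

text \<open>Bootstrapping: the derivative of \<open>Tinv\<close> is the smooth function
  \<open>matrix_inv (J y)\<close> composed with \<open>Tinv\<close>, so class \<open>k\<close>
  implies class \<open>Suc k\<close>.\<close>

lemma Tinv_smooth: "smooth_on (T ` \<Omega>') Tinv"
proof -
  have "Ck_on k (T ` \<Omega>') Tinv" for k
  proof (induction k)
    case 0
    show ?case
      using has_derivative_continuous[OF Tinv_derivative] by (auto intro: continuous_at_imp_continuous_on)
  next
    case (Suc k)
    show ?case
    proof (rule Ck_on_SucI'[OF T_open Tinv_derivative])
      fix v
      have sm: "Ck_on k \<Omega>' (\<lambda>y. matrix_inv (J y) *v v)"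
      proof -
        have "smooth_on \<Omega>' (\<lambda>y. matrix_inv (J y) *v v)"
          by (rule smooth_on_vec[OF new.op], unfold matrix_vector_mult_def, simp)
            (intro smooth_intros new.op smooth_on_matrix_inv J_smooth J_inv)
        then show ?thesis by (simp add: smooth_on_def)
      qed
      show "Ck_on k (T ` \<Omega>') (\<lambda>x. matrix_inv (J (Tinv x)) *v v)"
        by (rule Ck_on_compose[OF T_open _ Suc sm]) (use Tinv(3) in auto)
    qed
  qed
  then show ?thesis by (simp add: smooth_on_def)
qed

lemma integral_change:
  assumes u: "(\<lambda>x. indicator (T ` \<Omega>') x * u x) \<in> borel_measurable borel" "\<And>x. x \<notin> T ` \<Omega>' \<Longrightarrow> u x = 0"
    and v: "(\<lambda>y. indicator \<Omega>' y * v y) \<in> borel_measurable borel" "\<And>y. y \<notin> \<Omega>' \<Longrightarrow> v y = 0"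
    and uv: "\<And>y. y \<in> \<Omega>' \<Longrightarrow> v y = u (T y)"
  shows "(LINT x|lborel. u x * sqrt (det (G x))) = (LINT y|lborel. v y * sqrt (det (G' y)))"
proof -
  let ?w = "\<lambda>x. sqrt (det (G x))" and ?w' = "\<lambda>y. sqrt (det (G' y))"
  have sub: "T ` \<Omega>' \<subseteq> \<Omega>" by (rule T)
  have wm: "(\<lambda>x. indicator (T ` \<Omega>') x *\<^sub>R ?w x) \<in> borel_measurable borel"
    by (intro borel_measurable_continuous_on_indicator continuous_on_real_sqrt continuous_on_subset[OF _ sub]
        smooth_on_continuous_on smooth_on_det old.smooth old.op borel_open T_open)
  have wm': "(\<lambda>x. indicator \<Omega>' x *\<^sub>R ?w' x) \<in> borel_measurable borel"
    by (intro borel_measurable_continuous_on_indicator continuous_on_real_sqrt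
        smooth_on_continuous_on smooth_on_det new.smooth new.op borel_open)
  have m: "(\<lambda>x. u x * ?w x) \<in> borel_measurable borel"
  proof -
    have "(\<lambda>x. u x * ?w x) = (\<lambda>x. (indicator (T ` \<Omega>') x * u x) * (indicator (T ` \<Omega>') x *\<^sub>R ?w x))"
      using u(2) by (auto simp: indicator_def)
    then show ?thesis using u(1) wm by simp
  qed
  have m': "(\<lambda>y. v y * ?w' y) \<in> borel_measurable borel"
  proof -
    have "(\<lambda>x. v x * ?w' x) = (\<lambda>x. (indicator \<Omega>' x * v x) * (indicator \<Omega>' x *\<^sub>R ?w' x))"
      using v(2) by (auto simp: indicator_def)
    then show ?thesis using v(1) wm' by simp
  qed
  \<comment> \<open>The factor \<open>s\<close> is used for \<open>1\<close> and \<open>-1\<close>,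
    that is, for the positive and the negative part. Their extended integrals agree, hence so do
    integrability and the Bochner integrals, including the default value \<open>0\<close>.\<close>
  have nn: "(\<integral>\<^sup>+x. ennreal (s * (u x * ?w x)) \<partial>lborel) = (\<integral>\<^sup>+y. ennreal (s * (v y * ?w' y)) \<partial>lborel)" for s :: real
  proof -
    define f where "f x = max 0 (s * (u x * ?w x))" for x
    have M: "matrix ((*v) (J y)) = J y" for y by (rule matrix_of_matrix_vector_mul)
    have f0: "f x = 0" if "x \<notin> T ` \<Omega>'" for x using u(2)[OF that] by (simp add: f_def)
    have fv: "indicator \<Omega>' y * (\<bar>det (matrix ((*v) (J y)))\<bar> * f (T y)) = max 0 (s * (v y * ?w' y))" for y
    proof (cases "y \<in> \<Omega>'")
      case True
      then show ?thesis
        unfolding M f_def using uv[OF True] dens_change[OF True] by (simp add: max_mult_distrib_left mult_ac)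
    qed (simp add: v(2))
    have fi: "indicator (T ` \<Omega>') x * f x = f x" for x using f0[of x] by (auto simp: indicator_def)
    have "(\<integral>\<^sup>+y. ennreal (indicator \<Omega>' y * (\<bar>det (matrix ((*v) (J y)))\<bar> * f (T y))) \<partial>lborel)
      = (\<integral>\<^sup>+x. ennreal (indicator (T ` \<Omega>') x * f x) \<partial>lborel)"
    proof (rule change_of_variables_nn[OF _ _ T_derivative inj])
      show "(\<lambda>y. indicator \<Omega>' y * (\<bar>det (matrix ((*v) (J y)))\<bar> * f (T y))) \<in> borel_measurable borel"
        unfolding fv using m' by simp
      show "(\<lambda>x. indicator (T ` \<Omega>') x * f x) \<in> borel_measurable borel"
        unfolding fi unfolding f_def using m by simp
    qed (auto simp: f_def intro: borel_open T_open new.op)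
    then show ?thesis
      unfolding fv fi unfolding f_def by (simp add: ennreal_max_0)
  qed
  have p: "(\<integral>\<^sup>+x. ennreal (u x * ?w x) \<partial>lborel) = (\<integral>\<^sup>+y. ennreal (v y * ?w' y) \<partial>lborel)"
    "(\<integral>\<^sup>+x. ennreal (- (u x * ?w x)) \<partial>lborel) = (\<integral>\<^sup>+y. ennreal (- (v y * ?w' y)) \<partial>lborel)"
    using nn[of 1] nn[of "-1"] by auto
  have i: "integrable lborel (\<lambda>x. u x * ?w x) \<longleftrightarrow> integrable lborel (\<lambda>y. v y * ?w' y)"
    using m m' by (simp add: real_integrable_def p)
  show ?thesis
  proof (cases "integrable lborel (\<lambda>x. u x * ?w x)")
    case True
    then show ?thesis using i by (simp add: real_lebesgue_integral_def p)
  next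
    case False
    then show ?thesis using i by (simp add: not_integrable_integral_eq)
  qed
qed

lemma energy_change:
  assumes y: "y \<in> \<Omega>'" and \<phi>: "smooth_on UNIV \<phi>" and \<psi>: "\<And>z. z \<in> \<Omega>' \<Longrightarrow> \<psi> z = \<phi> (T z)"
  shows "energy G' \<psi> y = energy G \<phi> (T y)"
proof -
  have d: "partial_deriv i \<psi> y = (\<Sum>a\<in>UNIV. J y $ a $ i * partial_deriv a \<phi> (T y))" for i
  proof -
    have "partial_deriv i \<psi> y = partial_deriv i (\<lambda>z. \<phi> (T z)) y"
      by (rule partial_deriv_cong[OF new.op y \<psi>])
    then show ?thesis using pull_deriv[OF smooth_on_subset[OF \<phi>] y] by simp
  qed
  have "energy G' \<psi> y = (\<Sum>i\<in>UNIV. \<Sum>k\<in>UNIV. \<Sum>a\<in>UNIV. \<Sum>q\<in>UNIV.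
      partial_deriv a \<phi> (T y) * partial_deriv q \<phi> (T y) * (J y $ a $ k * new.Gi y $ k $ i * J y $ q $ i))"
    unfolding energy_def d mult.assoc unfolding sum_product unfolding sum_distrib_left by (simp add: mult_ac)
  also have "\<dots> = (\<Sum>q\<in>UNIV. \<Sum>a\<in>UNIV. \<Sum>k\<in>UNIV. \<Sum>i\<in>UNIV.
      partial_deriv a \<phi> (T y) * partial_deriv q \<phi> (T y) * (J y $ a $ k * new.Gi y $ k $ i * J y $ q $ i))"
    unfolding sum.cartesian_product UNIV_Times_UNIV
    by (rule sum.reindex_bij_witness[of _ "\<lambda>(q, a, k, i). (i, k, a, q)" "\<lambda>(i, k, a, q). (q, a, k, i)"]) auto
  also have "\<dots> = energy G \<phi> (T y)"
    unfolding energy_def sum_distrib_left[symmetric] Gi_change[OF y] by (simp add: sum_distrib_left mult_ac)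
  finally show ?thesis .
qed

text \<open>Volume, gradient and the values of the function are intrinsic, so a test function is
  transported by \<open>Tinv\<close> without changing any integral. This permits testing with
  Gaussians of every coordinate system.\<close>

lemma euclid_log_sobolev_change:
  assumes "euclid_log_sobolev \<Omega> G \<tau>\<^sub>0"
  shows "euclid_log_sobolev \<Omega>' G' \<tau>\<^sub>0"
  unfolding euclid_log_sobolev_def
proof (intro allI impI)
  fix \<psi> \<tau> assume \<psi>: "test_function \<Omega>' \<psi>" and n: "(LINT x|lborel. (\<psi> x)\<^sup>2 * sqrt (det (G' x))) = 1"
    and \<tau>: "0 < \<tau>" "\<tau> < \<tau>\<^sub>0"
  note t = test_functionD[OF \<psi>]
  let ?K = "closure {x. \<psi> x \<noteq> 0}"
  define \<phi> where "\<phi> x = (if x \<in> T ` \<Omega>' then \<psi> (Tinv x) else 0)" for x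
  have cK: "compact (T ` ?K)"
    using t(2,3) by (intro compact_continuous_image continuous_on_subset[OF smooth_on_continuous_on[OF T(1)]])
  have KT: "T ` ?K \<subseteq> T ` \<Omega>'" using t(3) by auto
  have \<phi>0: "\<phi> x = 0" if "x \<notin> T ` ?K" for x
  proof (cases "x \<in> T ` \<Omega>'")
    case True
    then obtain y where y: "y \<in> \<Omega>'" "x = T y" by auto
    with that have "y \<notin> ?K" by auto
    from t(4)[OF this] y True show ?thesis by (simp add: \<phi>_def Tinv(1))
  qed (simp add: \<phi>_def)
  have \<phi>T: "\<psi> y = \<phi> (T y)" if "y \<in> \<Omega>'" for y using that by (simp add: \<phi>_def Tinv(1))
  have sm: "smooth_on UNIV \<phi>"
  proof (rule smooth_zero_extension[OF T_open _ compact_imp_closed[OF cK] KT \<phi>0])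
    have "smooth_on (T ` \<Omega>') (\<lambda>x. \<psi> (Tinv x))"
      by (rule smooth_on_compose[OF T_open Tinv_smooth t(1)]) simp
    then show "smooth_on (T ` \<Omega>') \<phi>"
      by (subst smooth_on_cong[OF T_open, of _ "\<lambda>x. \<psi> (Tinv x)"]) (auto simp: \<phi>_def)
  qed
  have tf: "test_function \<Omega> \<phi>"
    using KT T(2) by (intro test_functionI[OF sm cK _ \<phi>0]) auto
  have \<phi>m [measurable]: "\<phi> \<in> borel_measurable borel" and \<psi>m [measurable]: "\<psi> \<in> borel_measurable borel"
    using sm t(1) by (auto intro!: borel_measurable_continuous_onI smooth_on_continuous_on)
  have [measurable]: "T ` \<Omega>' \<in> sets borel" "\<Omega>' \<in> sets borel" using T_open new.op by auto
  have \<psi>0: "\<psi> y = 0" if "y \<notin> \<Omega>'" for y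
  proof -
    have "y \<notin> ?K" using that t(3) by auto
    from t(4)[OF this] show ?thesis .
  qed
  have \<phi>0': "\<phi> x = 0" if "x \<notin> T ` \<Omega>'" for x using that by (simp add: \<phi>_def)
  have 1: "(LINT x|lborel. (\<phi> x)\<^sup>2 * sqrt (det (G x))) = (LINT x|lborel. (\<psi> x)\<^sup>2 * sqrt (det (G' x)))"
    by (rule integral_change) (auto simp: \<psi>0 \<phi>0' \<phi>T)
  have 2: "(LINT x|lborel. (\<phi> x)\<^sup>2 * ln ((\<phi> x)\<^sup>2) * sqrt (det (G x))) = (LINT x|lborel. (\<psi> x)\<^sup>2 * ln ((\<psi> x)\<^sup>2) * sqrt (det (G' x)))"
    by (rule integral_change) (auto simp: \<psi>0 \<phi>0' \<phi>T)
  have 3: "(LINT x|lborel. energy G \<phi> x * sqrt (det (G x))) = (LINT x|lborel. energy G' \<psi> x * sqrt (det (G' x)))"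
  proof (rule integral_change)
    have "continuous_on (T ` \<Omega>') (energy G \<phi>)"
      unfolding energy_def[abs_def]
      by (intro smooth_on_continuous_on smooth_intros T_open smooth_on_subset[OF old.Gi_smooth T(2)] smooth_on_subset[OF sm]) auto
    then have "(\<lambda>x. indicator (T ` \<Omega>') x *\<^sub>R energy G \<phi> x) \<in> borel_measurable borel"
      by (intro borel_measurable_continuous_on_indicator) auto
    then show "(\<lambda>x. indicator (T ` \<Omega>') x * energy G \<phi> x) \<in> borel_measurable borel" by simp
    have "continuous_on \<Omega>' (energy G' \<psi>)"
      unfolding energy_def[abs_def]
      by (intro smooth_on_continuous_on smooth_intros new.op new.Gi_smooth smooth_on_subset[OF t(1)]) auto
    then have "(\<lambda>x. indicator \<Omega>' x *\<^sub>R energy G' \<psi> x) \<in> borel_measurable borel"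
      by (intro borel_measurable_continuous_on_indicator) auto
    then show "(\<lambda>x. indicator \<Omega>' x * energy G' \<psi> x) \<in> borel_measurable borel" by simp
    show "energy G \<phi> x = 0" if "x \<notin> T ` \<Omega>'" for x
    proof -
      have "x \<notin> T ` ?K" using that KT by auto
      from partial_deriv_zero_off[of "T ` ?K" \<phi>, OF compact_imp_closed[OF cK] \<phi>0 this] show ?thesis by (simp add: energy_def)
    qed
    show "energy G' \<psi> y = 0" if "y \<notin> \<Omega>'" for y
    proof -
      have "y \<notin> ?K" using that t(3) by auto
      from partial_deriv_zero_off[OF closed_closure t(4) this] show ?thesis by (simp add: energy_def)
    qed
    show "energy G' \<psi> y = energy G \<phi> (T y)" if "y \<in> \<Omega>'" for y
      by (rule energy_change[OF that sm \<phi>T])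
  qed
  show "(LINT x|lborel. (\<psi> x)\<^sup>2 * ln ((\<psi> x)\<^sup>2) * sqrt (det (G' x)))
       \<le> 4 * \<tau> * (LINT x|lborel. energy G' \<psi> x * sqrt (det (G' x))) - real CARD('n) - real CARD('n) / 2 * ln (4 * pi * \<tau>)"
    using assms[unfolded euclid_log_sobolev_def, rule_format, OF tf _ \<tau>] n unfolding 1 2 3 by blast
qed

end

end

section \<open>Cubic coordinate changes\<close>

definition cubic_map :: "real^'n \<Rightarrow> ('n \<Rightarrow> 'n \<Rightarrow> real) \<Rightarrow> ('n \<Rightarrow> 'n \<Rightarrow> 'n \<Rightarrow> real) \<Rightarrow> ('n \<Rightarrow> 'n \<Rightarrow> 'n \<Rightarrow> 'n \<Rightarrow> real)
    \<Rightarrow> real^'n \<Rightarrow> real^'n" where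
  "cubic_map b L Q C y = (\<chi> a. b $ a + (\<Sum>i\<in>UNIV. L a i * y $ i) + (\<Sum>i\<in>UNIV. \<Sum>j\<in>UNIV. Q a i j * (y $ i * y $ j))
     + (\<Sum>i\<in>UNIV. \<Sum>j\<in>UNIV. \<Sum>k\<in>UNIV. C a i j k * (y $ i * (y $ j * y $ k))))"

lemma cubic_map_smooth: "smooth_on UNIV (cubic_map b L Q C)"
proof (rule smooth_on_vec[OF open_UNIV])
  show "smooth_on UNIV (\<lambda>x. cubic_map b L Q C x $ a)" for a
    unfolding cubic_map_def vec_lambda_beta by (intro smooth_intros open_UNIV)
qed

lemma cubic_map_0 [simp]: "cubic_map b L Q C 0 = b"
  by (simp add: cubic_map_def vec_eq_iff)

lemma coord_differentiable: "(\<lambda>y::real^'n. y $ i) differentiable (at x)"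
  by (intro bounded_linear_imp_differentiable bounded_linear_vec_nth)

text \<open>The symmetry of the coefficients merges the two, respectively three, terms of the
  product rule, whence the factors \<open>2\<close> and \<open>3\<close>.\<close>

lemma cubic_jacobian:
  assumes Q: "\<And>a i j. Q a i j = Q a j i"
    and C: "\<And>a i j k. C a i j k = C a j i k" "\<And>a i j k. C a i j k = C a i k j"
  shows "jacobian (cubic_map b L Q C) y $ a $ m = L a m + 2 * (\<Sum>j\<in>UNIV. Q a m j * y $ j)
    + 3 * (\<Sum>j\<in>UNIV. \<Sum>k\<in>UNIV. C a m j k * (y $ j * y $ k))"
proof -
  note D = coord_differentiable differentiable_mult differentiable_sum differentiable_add
  have d2: "partial_deriv m (\<lambda>y. y $ i * y $ j) y = (if m = i then y $ j else 0) + (if m = j then y $ i else 0)" for i j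
    by (simp add: partial_deriv_mult D partial_deriv_coord)
  have d3: "partial_deriv m (\<lambda>y. y $ i * (y $ j * y $ k)) y
    = (if m = i then y $ j * y $ k else 0) + (if m = j then y $ i * y $ k else 0) + (if m = k then y $ i * y $ j else 0)" for i j k
    by (simp add: partial_deriv_mult[of "\<lambda>y. y $ i"] D partial_deriv_coord d2 algebra_simps)
  have "jacobian (cubic_map b L Q C) y $ a $ m = (\<Sum>i\<in>UNIV. L a i * (if m = i then 1 else 0))
    + (\<Sum>i\<in>UNIV. \<Sum>j\<in>UNIV. Q a i j * ((if m = i then y $ j else 0) + (if m = j then y $ i else 0)))
    + (\<Sum>i\<in>UNIV. \<Sum>j\<in>UNIV. \<Sum>k\<in>UNIV. C a i j k *
       ((if m = i then y $ j * y $ k else 0) + (if m = j then y $ i * y $ k else 0) + (if m = k then y $ i * y $ j else 0)))"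
    by (simp add: jacobian_def cubic_map_def partial_deriv_add partial_deriv_sum partial_deriv_cmult D d2 d3 partial_deriv_coord)
  also have "\<dots> = L a m + ((\<Sum>j\<in>UNIV. Q a m j * y $ j) + (\<Sum>i\<in>UNIV. Q a i m * y $ i))
    + ((\<Sum>j\<in>UNIV. \<Sum>k\<in>UNIV. C a m j k * (y $ j * y $ k)) + (\<Sum>i\<in>UNIV. \<Sum>k\<in>UNIV. C a i m k * (y $ i * y $ k))
      + (\<Sum>i\<in>UNIV. \<Sum>j\<in>UNIV. C a i j m * (y $ i * y $ j)))"
  proof -
    have e: "(\<Sum>i\<in>UNIV. \<Sum>k\<in>UNIV. if m = i then f i k else 0) = (\<Sum>k\<in>UNIV. f m k)" for f :: "'a \<Rightarrow> 'a \<Rightarrow> real"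
      by (subst sum.swap) simp
    have e3: "(\<Sum>i\<in>UNIV. \<Sum>j\<in>UNIV. \<Sum>k\<in>UNIV. if m = i then f i j k else 0) = (\<Sum>j\<in>UNIV. \<Sum>k\<in>UNIV. f m j k)"
      for f :: "'a \<Rightarrow> 'a \<Rightarrow> 'a \<Rightarrow> real"
    proof -
      have "(\<Sum>i\<in>UNIV. \<Sum>j\<in>UNIV. \<Sum>k\<in>UNIV. if m = i then f i j k else 0) = (\<Sum>i\<in>UNIV. if m = i then \<Sum>j\<in>UNIV. \<Sum>k\<in>UNIV. f i j k else 0)"
        by (intro sum.cong refl) auto
      then show ?thesis by simp
    qed
    show ?thesis
      unfolding distrib_left sum.distrib if_distrib[of "\<lambda>u. _ * u"] mult_zero_right mult_1_right e e3 by simp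
  qed
  also have "\<dots> = L a m + 2 * (\<Sum>j\<in>UNIV. Q a m j * y $ j) + 3 * (\<Sum>j\<in>UNIV. \<Sum>k\<in>UNIV. C a m j k * (y $ j * y $ k))"
    unfolding Q[of a _ m] C(1)[of a _ m] C(2)[of a _ _ m] by (simp add: C(1)[of a _ m])
  finally show ?thesis .
qed

lemma cubic_jacobian_deriv:
  assumes Q: "\<And>a i j. Q a i j = Q a j i"
    and C: "\<And>a i j k. C a i j k = C a j i k" "\<And>a i j k. C a i j k = C a i k j"
  shows "partial_deriv l (\<lambda>y. jacobian (cubic_map b L Q C) y $ a $ m) y = 2 * Q a m l + 6 * (\<Sum>k\<in>UNIV. C a m l k * y $ k)"
proof -
  note D = coord_differentiable differentiable_mult differentiable_sum differentiable_add
  have d2: "partial_deriv l (\<lambda>y. y $ i * y $ j) y = (if l = i then y $ j else 0) + (if l = j then y $ i else 0)" for i j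
    by (simp add: partial_deriv_mult D partial_deriv_coord)
  have "partial_deriv l (\<lambda>y. jacobian (cubic_map b L Q C) y $ a $ m) y
    = 2 * (\<Sum>j\<in>UNIV. Q a m j * (if l = j then 1 else 0))
      + 3 * (\<Sum>j\<in>UNIV. \<Sum>k\<in>UNIV. C a m j k * ((if l = j then y $ k else 0) + (if l = k then y $ j else 0)))"
    unfolding cubic_jacobian[OF assms]
    by (simp add: partial_deriv_add partial_deriv_sum partial_deriv_cmult D d2 partial_deriv_coord)
  also have "\<dots> = 2 * Q a m l + 3 * ((\<Sum>k\<in>UNIV. C a m l k * y $ k) + (\<Sum>j\<in>UNIV. C a m j l * y $ j))"
  proof -
    have e: "(\<Sum>i\<in>UNIV. \<Sum>k\<in>UNIV. if l = i then f i k else 0) = (\<Sum>k\<in>UNIV. f l k)" for f :: "'a \<Rightarrow> 'a \<Rightarrow> real"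
      by (subst sum.swap) simp
    show ?thesis
      unfolding distrib_left[of "C _ _ _ _"] sum.distrib if_distrib[of "\<lambda>u. _ * u"] mult_zero_right mult_1_right e by simp
  qed
  finally show ?thesis unfolding C(2)[of a m _ l] by simp
qed

lemma pos_def_congruence:
  fixes M J :: "real^'n^'n"
  assumes M: "pos_def M" and J: "det J \<noteq> 0"
  shows "pos_def (Finite_Cartesian_Product.transpose J ** M ** J)"
  unfolding pos_def_def
proof (intro conjI allI impI)
  let ?t = "Finite_Cartesian_Product.transpose"
  show "?t (?t J ** M ** J) = ?t J ** M ** J"
    using M by (simp add: pos_def_def matrix_transpose_mul matrix_mul_assoc)
  fix v :: "real^'n" assume v: "v \<noteq> 0"
  have "J *v v \<noteq> 0"
    using v matrix_inv_left[OF J] by (metis matrix_vector_mul_assoc matrix_vector_mul_lid matrix_vector_mult_0_right)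
  then have "0 < (J *v v) \<bullet> (M *v (J *v v))" using M by (simp add: pos_def_def)
  also have "\<dots> = v \<bullet> (?t J ** M ** J *v v)"
  proof -
    have "J *v v = v v* ?t J" using transpose_matrix_vector[of "?t J" v] by simp
    then have "(J *v v) \<bullet> w = v \<bullet> (?t J *v w)" for w by (simp only: dot_lmul_matrix)
    from this[of "M *v (J *v v)"] show ?thesis by (simp only: matrix_vector_mul_assoc matrix_mul_assoc)
  qed
  finally show "0 < v \<bullet> (?t J ** M ** J *v v)" .
qed

context metric_field
begin

text \<open>The domain is shrunk to a ball on which \<open>\<Theta>\<close> stays in
  \<open>\<Omega>\<close>, its Jacobian is invertible and, by the injectivity part of the inverse
  function theorem, \<open>\<Theta>\<close> is one-to-one.\<close>

lemma local_change:
  fixes \<Theta> :: "real^'n \<Rightarrow> real^'n"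
  assumes \<Theta>: "smooth_on UNIV \<Theta>" "\<Theta> 0 \<in> \<Omega>" and J0: "det (jacobian \<Theta> 0) \<noteq> 0"
  obtains \<Omega>' where "0 \<in> \<Omega>'" "inj_on \<Theta> \<Omega>'"
    "metric_change \<Omega> G \<Omega>' (\<lambda>y. Finite_Cartesian_Product.transpose (jacobian \<Theta> y) ** G (\<Theta> y) ** jacobian \<Theta> y) \<Theta> (jacobian \<Theta>)"
proof -
  let ?J = "jacobian \<Theta>"
  let ?G = "\<lambda>y. Finite_Cartesian_Product.transpose (?J y) ** G (\<Theta> y) ** ?J y"
  have Jsm: "smooth_on UNIV (\<lambda>y. ?J y $ a $ i)" for a i
    unfolding jacobian_def by (simp) (intro smooth_on_partial_deriv smooth_on_nth \<Theta> open_UNIV)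
  note Jc = smooth_on_continuous_on[OF Jsm]
  define U where "U = \<Theta> -` \<Omega> \<inter> (\<lambda>y. det (?J y)) -` (- {0})"
  have U: "open U" "0 \<in> U"
    unfolding U_def using \<Theta> J0
    by (auto intro!: open_Int open_vimage op smooth_on_continuous_on smooth_on_det Jsm)
  have der: "(\<Theta> has_derivative (\<lambda>v. ?J y *v v)) (at y)" for y
    by (intro jacobian_derivative smooth_on_differentiable[OF \<Theta>(1)]) simp
  have on: "\<exists>d>0. \<forall>x. dist 0 x < d \<longrightarrow> onorm (\<lambda>v. ?J x *v v - ?J 0 *v v) < e" if e: "e > 0" for e
  proof -
    \<comment> \<open>The operator norm is at most the sum of the absolute entries, which is
      continuous and vanishes at the origin.\<close>
    let ?s = "\<lambda>x. \<Sum>i\<in>UNIV. \<Sum>j\<in>UNIV. \<bar>?J x $ i $ j - ?J 0 $ i $ j\<bar>"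
    have "continuous_on UNIV ?s" by (intro continuous_intros Jc)
    then have "isCont ?s 0" by (simp add: continuous_on_eq_continuous_at)
    then obtain d where d: "d > 0" "\<forall>x. dist x 0 < d \<longrightarrow> dist (?s x) (?s 0) < e"
      using e unfolding continuous_at_eps_delta by blast
    have "onorm (\<lambda>v. ?J x *v v - ?J 0 *v v) < e" if "dist 0 x < d" for x
    proof -
      have "onorm (\<lambda>v. ?J x *v v - ?J 0 *v v) = onorm ((*v) (?J x - ?J 0))"
        by (rule arg_cong[of _ _ onorm]) (simp add: fun_eq_iff matrix_vector_mult_diff_rdistrib)
      also have "\<dots> \<le> ?s x" using onorm_le_matrix_component_sum[of "?J x - ?J 0"] by simp
      also have "\<dots> \<le> dist (?s x) (?s 0)" by (simp add: dist_real_def)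
      also have "\<dots> < e" using d(2)[rule_format, of x] that by (simp only: dist_commute)
      finally show ?thesis .
    qed
    with d(1) show ?thesis by blast
  qed
  have inv: "(*v) (matrix_inv (?J 0)) \<circ> (*v) (?J 0) = id"
    using matrix_inv_left[OF J0] by (simp add: fun_eq_iff matrix_vector_mul_assoc)
  obtain r where r: "r > 0" "ball 0 r \<subseteq> U" "inj_on \<Theta> (ball 0 r)"
    using has_derivative_locally_injective[where f'="\<lambda>x v. ?J x *v v" and f=\<Theta>, OF U(2,1) _ inv der on] by blast
  let ?B = "ball (0::real^'n) r"
  have TB: "\<Theta> ` ?B \<subseteq> \<Omega>" and JB: "\<And>y. y \<in> ?B \<Longrightarrow> det (?J y) \<noteq> 0" using r(2) by (auto simp: U_def)
  have "metric_field ?B ?G"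
  proof
    have "smooth_on ?B (\<lambda>x. G (\<Theta> x) $ i $ j)" for i j
      by (rule smooth_on_compose[OF open_ball smooth_on_subset[OF \<Theta>(1)] smooth TB]) simp
    then show "smooth_on ?B (\<lambda>x. ?G x $ i $ j)" for i j
      unfolding matrix_matrix_mult_def Finite_Cartesian_Product.transpose_def
      by simp (intro smooth_intros open_ball smooth_on_subset[OF Jsm]; simp)
    show "pos_def (?G x)" if "x \<in> ?B" for x
      using that TB by (intro pos_def_congruence pos JB) auto
  qed simp
  then have "metric_change \<Omega> G ?B ?G \<Theta> ?J"
    by (intro metric_change.intro metric_change_axioms.intro metric_field_axioms smooth_on_subset[OF \<Theta>(1)] TB JB)
      (auto simp: jacobian_def)
  then show thesis using that[of ?B] r by simp
qed

lemma normal_fieldI: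
  assumes "0 \<in> \<Omega>" "\<And>i j. G 0 $ i $ j = (if i = j then 1 else 0)" "\<And>k i j. dG k i j 0 = 0"
  obtains r \<eta> where "normal_field \<Omega> G r \<eta>"
proof -
  obtain e where e: "e > 0" "cball 0 e \<subseteq> \<Omega>" using open_contains_cball op assms(1) by blast
  then have e2: "e / 2 > 0" by simp
  obtain \<eta> :: "real^'n \<Rightarrow> real" where \<eta>: "smooth_on UNIV \<eta>" "\<And>y. 0 \<le> \<eta> y" "\<And>y. \<eta> y \<le> 1"
    "\<And>y. norm y \<le> e / 2 \<Longrightarrow> \<eta> y = 1" "\<And>y. norm y \<ge> 2 * (e / 2) \<Longrightarrow> \<eta> y = 0"
    by (rule smooth_cutoff[OF e2]) blast
  have "normal_field \<Omega> G (e / 2) \<eta>"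
    using e e2 \<eta> assms
    by (intro normal_field.intro cutoff_field.intro cutoff_field_axioms.intro normal_field_axioms.intro metric_field_axioms) auto
  then show thesis by (rule that)
qed

text \<open>
  The quadratic part of the coordinate change is \<open>- \<Gamma>/2\<close> in the orthonormal frame \<open>L\<close>.
\<close>

lemma normal_coordinates:
  assumes x: "x \<in> \<Omega>"
  obtains \<Omega>' G' T J r \<eta> where "metric_change \<Omega> G \<Omega>' G' T J" "T 0 = x" "inj_on T \<Omega>'" "normal_field \<Omega>' G' r \<eta>"
proof -
  obtain L :: "real^'n^'n" where L: "Finite_Cartesian_Product.transpose L ** G x ** L = mat 1"
    using pos_def_orthonormal[OF pos[OF x]] by blast
  define Q where "Q a i j = - (1/2) * (\<Sum>b\<in>UNIV. \<Sum>c\<in>UNIV. Gam G a b c x * L $ b $ i * L $ c $ j)" for a i j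
  have Q: "Q a i j = Q a j i" for a i j
    unfolding Q_def by (subst sum.swap) (simp add: Gam_sym[OF x] mult_ac)
  define T where "T = cubic_map x (\<lambda>a i. L $ a $ i) Q (\<lambda>a i j k. 0)"
  have J: "jacobian T y $ a $ i = L $ a $ i + 2 * (\<Sum>j\<in>UNIV. Q a i j * y $ j)" for y a i
    unfolding T_def by (subst cubic_jacobian[OF Q]) simp_all
  have dJ: "partial_deriv l (\<lambda>y. jacobian T y $ a $ m) y = 2 * Q a m l" for l a m y
    unfolding T_def by (subst cubic_jacobian_deriv[OF Q]) simp_all
  have J0: "jacobian T 0 = L" by (simp add: vec_eq_iff J)
  have "det L \<noteq> 0"
  proof
    assume "det L = 0"
    then have "det (Finite_Cartesian_Product.transpose L ** G x ** L) = 0" by (simp add: det_mul)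
    with L show False by simp
  qed
  then have dT: "smooth_on UNIV T" "T 0 \<in> \<Omega>" "det (jacobian T 0) \<noteq> 0"
    using x J0 by (auto simp: T_def cubic_map_smooth)
  let ?G = "\<lambda>y. Finite_Cartesian_Product.transpose (jacobian T y) ** G (T y) ** jacobian T y"
  obtain \<Omega>' where \<Omega>': "0 \<in> \<Omega>'" "inj_on T \<Omega>'" "metric_change \<Omega> G \<Omega>' ?G T (jacobian T)"
    by (rule local_change[OF dT]) blast
  interpret ch: metric_change \<Omega> G \<Omega>' ?G T "jacobian T" by (rule \<Omega>'(3))
  have T0: "T 0 = x" by (simp add: T_def)
  have P: "ch.P i 0 $ a $ k = 2 * Q a k i" for i a k by (simp add: ch.P_entry dJ)
  have G0: "?G 0 $ i $ j = (if i = j then 1 else 0)" for i j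
    by (simp add: T0 J0 L) (simp add: mat_def)
  have PG: "(\<Sum>b\<in>UNIV. \<Sum>e\<in>UNIV. ch.P i 0 $ b $ k * G x $ b $ e * L $ e $ l)
      = - (\<Sum>p\<in>UNIV. \<Sum>q\<in>UNIV. \<Sum>e\<in>UNIV. L $ p $ i * L $ q $ k * L $ e $ l * lowGam e p q x)" for i k l
  proof -
    have "(\<Sum>b\<in>UNIV. \<Sum>e\<in>UNIV. ch.P i 0 $ b $ k * G x $ b $ e * L $ e $ l)
      = - (\<Sum>b\<in>UNIV. \<Sum>e\<in>UNIV. \<Sum>q\<in>UNIV. \<Sum>p\<in>UNIV. L $ p $ i * L $ q $ k * L $ e $ l * (G x $ e $ b * Gam G b p q x))"
      unfolding P Q_def
      by (simp add: sum_distrib_left sum_distrib_right sum_negf[symmetric] mult_ac G_sym[OF x] Gam_sym[OF x])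
    also have "(\<Sum>b\<in>UNIV. \<Sum>e\<in>UNIV. \<Sum>q\<in>UNIV. \<Sum>p\<in>UNIV. L $ p $ i * L $ q $ k * L $ e $ l * (G x $ e $ b * Gam G b p q x))
      = (\<Sum>p\<in>UNIV. \<Sum>q\<in>UNIV. \<Sum>e\<in>UNIV. \<Sum>b\<in>UNIV. L $ p $ i * L $ q $ k * L $ e $ l * (G x $ e $ b * Gam G b p q x))"
      unfolding sum.cartesian_product UNIV_Times_UNIV
      by (rule sum.reindex_bij_witness[of _ "\<lambda>(p, q, e, b). (b, e, q, p)" "\<lambda>(b, e, q, p). (p, q, e, b)"]) auto
    finally show ?thesis unfolding sum_distrib_left[symmetric] low_Gam[OF x] .
  qed
  \<comment> \<open>By \<open>dG_low\<close> the transformed first derivative is a sum of two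
    lowered Christoffel terms; by \<open>PG\<close> the two second-derivative terms of the
    coordinate change are their negatives.\<close>
  have "ch.new.dG i k l 0 = 0" for i k l
  proof -
    have "(\<Sum>p\<in>UNIV. \<Sum>q\<in>UNIV. \<Sum>e\<in>UNIV. L $ p $ i * L $ q $ l * L $ e $ k * lowGam e p q x)
      = (\<Sum>p\<in>UNIV. \<Sum>q\<in>UNIV. \<Sum>e\<in>UNIV. L $ p $ i * L $ q $ k * L $ e $ l * lowGam q p e x)"
      by (rule sum.cong[OF refl], subst sum.swap) (simp add: mult_ac)
    then show ?thesis
      unfolding ch.dG_change[OF \<Omega>'(1)] T0 J0 PG
      by (simp add: dG_low[OF x] distrib_left sum.distrib)
  qed
  from ch.new.normal_fieldI[OF \<Omega>'(1) G0 this]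
  obtain r \<eta> where "normal_field \<Omega>' ?G r \<eta>" by blast
  with that[OF \<Omega>'(3) T0 \<Omega>'(2)] show thesis .
qed

end

context normal_field
begin

text \<open>The map is the identity up to third order, so the value and the first derivatives of the
  metric at the origin are kept. The second derivatives change only through the derivative of the
  Jacobian, once for each index of the metric.\<close>

lemma gauge_change:
  assumes C: "\<And>a i j k. C a i j k = C a j i k" "\<And>a i j k. C a i j k = C a i k j"
  obtains \<Omega>' G' T J r' \<eta>' where "metric_change \<Omega> G \<Omega>' G' T J" "T 0 = 0" "inj_on T \<Omega>'" "normal_field \<Omega>' G' r' \<eta>'"
    "\<And>i j k l. normal_field.hh G' i j k l = hh i j k l + C i j k l + C j i k l"
proof -
  \<comment> \<open>Division by \<open>6\<close> makes \<open>C a i j k\<close> the third partial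
    derivative of the component \<open>a\<close> of \<open>T\<close>.\<close>
  define T where "T = cubic_map 0 (\<lambda>a i. if a = i then 1 else 0) (\<lambda>a i j. 0) (\<lambda>a i j k. C a i j k / 6)"
  have C6: "C a i j k / 6 = C a j i k / 6" "C a i j k / 6 = C a i k j / 6" for a i j k
    using C(1)[of a i j k] C(2)[of a i j k] by simp_all
  have J: "jacobian T y $ a $ m = (if a = m then 1 else 0) + 3 * (\<Sum>j\<in>UNIV. \<Sum>k\<in>UNIV. C a m j k / 6 * (y $ j * y $ k))" for y a m
    unfolding T_def by (subst cubic_jacobian[OF refl C6]) simp
  have dJ: "partial_deriv l (\<lambda>y. jacobian T y $ a $ m) y = 6 * (\<Sum>k\<in>UNIV. C a m l k / 6 * y $ k)" for l a m y
    unfolding T_def by (subst cubic_jacobian_deriv[OF refl C6]) simp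
  have J0: "jacobian T 0 = mat 1" by (simp add: vec_eq_iff J mat_def)
  have J0e: "jacobian T 0 $ a $ i = (if a = i then 1 else 0)" for a i by (simp add: J)
  have dT: "smooth_on UNIV T" "T 0 \<in> \<Omega>" "det (jacobian T 0) \<noteq> 0"
    using zero_in J0 by (auto simp: T_def cubic_map_smooth)
  let ?G = "\<lambda>y. Finite_Cartesian_Product.transpose (jacobian T y) ** G (T y) ** jacobian T y"
  obtain \<Omega>' where \<Omega>': "0 \<in> \<Omega>'" "inj_on T \<Omega>'" "metric_change \<Omega> G \<Omega>' ?G T (jacobian T)"
    by (rule local_change[OF dT]) blast
  interpret ch: metric_change \<Omega> G \<Omega>' ?G T "jacobian T" by (rule \<Omega>'(3))
  have T0: "T 0 = 0" by (simp add: T_def)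
  have P: "ch.P i y $ a $ k = (\<Sum>l\<in>UNIV. C a k i l * y $ l)" for i a k y
    by (simp add: ch.P_entry dJ sum_distrib_left)
  have P0: "ch.P i 0 $ a $ k = 0" for i a k by (simp add: P)
  have G0': "?G 0 $ i $ j = (if i = j then 1 else 0)" for i j
    by (simp add: T0 J0 G0 transpose_mat)
  have dG0': "ch.new.dG k i j 0 = 0" for k i j
    unfolding ch.dG_change[OF \<Omega>'(1)] by (simp add: T0 dG0 P0)
  obtain r' \<eta>' where nf: "normal_field \<Omega>' ?G r' \<eta>'"
    by (rule ch.new.normal_fieldI[OF \<Omega>'(1) G0' dG0']) blast
  have dP: "partial_deriv l (\<lambda>y. ch.P i y $ a $ k) 0 = C a k i l" for l i a k
    unfolding P
    by (simp add: partial_deriv_sum partial_deriv_cmult coord_differentiable partial_deriv_coord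
        if_distrib[of "\<lambda>u. _ * u"] cong: if_cong)
  have ddG: "partial_deriv l (\<lambda>y. dG k i j (T y)) 0 = hh i j k l" for i j k l
    using ch.pull_deriv[OF dG_smooth \<Omega>'(1)]
    by (simp add: J0e T0 hh_def if_distrib[of "\<lambda>u. u * _"] cong: if_cong)
  note D = smooth_on_differentiable[OF ch.J_smooth \<Omega>'(1)] smooth_on_differentiable[OF ch.P_smooth \<Omega>'(1)]
    smooth_on_differentiable[OF ch.pull_smooth[OF smooth] \<Omega>'(1)] smooth_on_differentiable[OF ch.pull_smooth[OF dG_smooth] \<Omega>'(1)]
  have "normal_field.hh ?G i j k l = hh i j k l + C i j k l + C j i k l" for i j k l
  proof -
    have "normal_field.hh ?G i j k l = partial_deriv l (ch.new.dG k i j) 0"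
      by (rule normal_field.hh_def[OF nf])
    also have "\<dots> = partial_deriv l (\<lambda>y.
      (\<Sum>a\<in>UNIV. \<Sum>b\<in>UNIV. \<Sum>e\<in>UNIV. jacobian T y $ a $ k * jacobian T y $ b $ i * jacobian T y $ e $ j * dG a b e (T y))
    + (\<Sum>b\<in>UNIV. \<Sum>e\<in>UNIV. ch.P k y $ b $ i * G (T y) $ b $ e * jacobian T y $ e $ j)
    + (\<Sum>b\<in>UNIV. \<Sum>e\<in>UNIV. ch.P k y $ b $ j * G (T y) $ b $ e * jacobian T y $ e $ i)) 0"
      by (rule partial_deriv_cong[OF ch.new.op \<Omega>'(1) ch.dG_change])
    also have "\<dots> = (\<Sum>a\<in>UNIV. \<Sum>b\<in>UNIV. \<Sum>e\<in>UNIV. (if a = k then 1 else 0) * (if b = i then 1 else 0) * (if e = j then 1 else 0) * hh b e a l)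
      + (\<Sum>b\<in>UNIV. \<Sum>e\<in>UNIV. C b i k l * (if b = e then 1 else 0) * (if e = j then 1 else 0))
      + (\<Sum>b\<in>UNIV. \<Sum>e\<in>UNIV. C b j k l * (if b = e then 1 else 0) * (if e = i then 1 else 0))"
      using D by (simp add: partial_deriv_add partial_deriv_sum partial_deriv_mult differentiable_add differentiable_mult differentiable_sum
          dP ddG P0 T0 dG0 G0 J0e del: mult_1_right mult_zero_right mult_1_left mult_zero_left)
    also have "\<dots> = hh i j k l + C i j k l + C j i k l"
      by (simp add: if_distrib[of "\<lambda>u. u * _"] if_distrib[of "\<lambda>u. _ * u"] cong: if_cong)
    finally show ?thesis .
  qed
  with that[OF \<Omega>'(3) T0 \<Omega>'(2) nf] show thesis .
qed

text \<open>In the gauge of \<open>cubic_gauge\<close> the traces drop out of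
  \<open>second_order_form\<close>, and \<open>second_order_rigid\<close> applies to the second
  derivatives there.\<close>

lemma Riem_zero_if_flat_form:
  assumes lsi: "euclid_log_sobolev \<Omega> G \<tau>\<^sub>0" and \<tau>: "\<tau>\<^sub>0 > 0" and S: "\<And>y. y \<in> \<Omega> \<Longrightarrow> Scal G y = 0"
  shows "Riem G l k i j 0 = 0"
proof -
  have "(\<Sum>i\<in>UNIV. \<Sum>j\<in>UNIV. hh i j i j - hh i i j j) = 0" using Scal0 S[OF zero_in] by simp
  from cubic_gauge[OF hh_sym1 hh_sym2 this] obtain C where C: "\<And>a i j k. C a i j k = C a j i k" "\<And>a i j k. C a i j k = C a i k j"
    and C4: "\<And>h' i j k l. (\<And>i j k l. h' i j k l = hh i j k l + C i j k l + C j i k l) \<Longrightarrow>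
       h' i j k l + h' k l i j + h' i k j l + h' j l i k + h' i l j k + h' j k i l = 0"
    and Ct: "\<And>h' i j. (\<And>i j k l. h' i j k l = hh i j k l + C i j k l + C j i k l) \<Longrightarrow> (\<Sum>k\<in>UNIV. h' i j k k) = 0"
    by blast
  obtain \<Omega>' G' T J r' \<eta>' where ch: "metric_change \<Omega> G \<Omega>' G' T J" "T 0 = 0" "inj_on T \<Omega>'" and nf: "normal_field \<Omega>' G' r' \<eta>'"
    and h': "\<And>i j k l. normal_field.hh G' i j k l = hh i j k l + C i j k l + C j i k l"
    by (rule gauge_change[of C, OF C]) blast
  interpret ch: metric_change \<Omega> G \<Omega>' G' T J by (rule ch)
  interpret nf: normal_field \<Omega>' G' r' \<eta>' by (rule nf)
  have lsi': "euclid_log_sobolev \<Omega>' G' \<tau>\<^sub>0" by (rule ch.euclid_log_sobolev_change[OF ch(3) lsi])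
  have S': "Scal G' y = 0" if "y \<in> \<Omega>'" for y
    using ch.Scal_change[OF that] S that ch.T(2) by auto
  have form: "0 \<le> (\<Sum>i\<in>UNIV. \<Sum>k\<in>UNIV. \<Sum>l\<in>UNIV. \<Sum>m\<in>UNIV. nf.hh i k l m * nf.hh i l k m)"
    using nf.second_order_form[OF lsi' \<tau> S'] by (simp add: Ct[OF h'])
  note anti = second_order_rigid[where h=nf.hh, OF nf.hh_sym1 nf.hh_sym2 C4[OF h'] form]
  \<comment> \<open>At the origin the curvature is a combination of values of \<open>nf.hh\<close>
    in which every entry is accompanied by the one with the pairs exchanged, with the same sign.
    Such sums vanish by \<open>anti\<close>.\<close>
  have "Riem G' l k i j 0 = 0" for l k i j
    unfolding nf.Riem0 nf.gam_def
    using anti[of j l k i] anti[of i l k j] nf.hh_sym1[of k i j l] nf.hh_sym1[of k j i l] nf.hh_sym1[of l j k i] nf.hh_sym1[of l i k j]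
      nf.hh_sym2[of i k j l] nf.hh_sym2[of j k i l] nf.hh_sym1[of k l j i] nf.hh_sym2[of k l i j]
    by (simp add: field_simps)
  then have "Riem G l k i j (T 0) = 0"
    by (rule ch.Riem_change_zero[OF nf.zero_in])
  then show ?thesis by (simp add: ch(2))
qed

end

context metric_field
begin

lemma Scal_nonpos:
  assumes "euclid_log_sobolev \<Omega> G \<tau>\<^sub>0" "\<tau>\<^sub>0 > 0" "x \<in> \<Omega>"
  shows "Scal G x \<le> 0"
proof -
  obtain \<Omega>' G' T J r \<eta> where ch: "metric_change \<Omega> G \<Omega>' G' T J" "T 0 = x" "inj_on T \<Omega>'" and nf: "normal_field \<Omega>' G' r \<eta>"
    by (rule normal_coordinates[OF assms(3)]) blast
  interpret ch: metric_change \<Omega> G \<Omega>' G' T J by (rule ch)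
  interpret nf: normal_field \<Omega>' G' r \<eta> by (rule nf)
  show ?thesis
    using nf.Scal_nonpos[OF ch.euclid_log_sobolev_change[OF ch(3) assms(1)] assms(2)] ch.Scal_change[OF nf.zero_in] ch(2) by simp
qed

lemma Riem_zero:
  assumes "euclid_log_sobolev \<Omega> G \<tau>\<^sub>0" "\<tau>\<^sub>0 > 0" "\<And>y. y \<in> \<Omega> \<Longrightarrow> Scal G y = 0" "x \<in> \<Omega>"
  shows "Riem G l k i j x = 0"
proof -
  obtain \<Omega>' G' T J r \<eta> where ch: "metric_change \<Omega> G \<Omega>' G' T J" "T 0 = x" "inj_on T \<Omega>'" and nf: "normal_field \<Omega>' G' r \<eta>"
    by (rule normal_coordinates[OF assms(4)]) blast
  interpret ch: metric_change \<Omega> G \<Omega>' G' T J by (rule ch)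
  interpret nf: normal_field \<Omega>' G' r \<eta> by (rule nf)
  have "Riem G' l k i j 0 = 0" for l k i j
  proof (rule nf.Riem_zero_if_flat_form[OF ch.euclid_log_sobolev_change[OF ch(3) assms(1)] assms(2)])
    show "Scal G' y = 0" if "y \<in> \<Omega>'" for y
      using ch.Scal_change[OF that] assms(3) that ch.T(2) by auto
  qed
  then have "Riem G l k i j (T 0) = 0"
    by (rule ch.Riem_change_zero[OF nf.zero_in])
  then show ?thesis by (simp add: ch(2))
qed

end

section \<open>Scalar curvature and the logarithmic Sobolev inequality in charts\<close>

context riemannian
begin

lemma metric_field_chart:
  assumes c: "c \<in> A" and V: "open V"
  shows "metric_field (snd c ` (fst c \<inter> V)) (gm c)"
proof
  show "open (snd c ` (fst c \<inter> V))" by (rule chart_image_open[OF c V])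
  show "smooth_on (snd c ` (fst c \<inter> V)) (\<lambda>x. gm c x $ i $ j)" for i j
    by (rule smooth_on_subset[OF gm_smooth[OF c]]) auto
  show "pos_def (gm c x)" if "x \<in> snd c ` (fst c \<inter> V)" for x
    using that by (intro gm_pos_def[OF c]) auto
qed

lemma metric_change_chart:
  assumes c: "c \<in> A" and d: "d \<in> A"
  defines "T \<equiv> \<lambda>x. snd c (chart_inv d x)"
  shows "metric_change (snd c ` (fst c \<inter> UNIV)) (gm c) (snd d ` (fst d \<inter> fst c)) (gm d) T (jacobian T)"
proof (intro metric_change.intro metric_change_axioms.intro metric_field_chart c d chart_open(1) open_UNIV)
  show "smooth_on (snd d ` (fst d \<inter> fst c)) T" unfolding T_def by (rule transition_smooth[OF d c])
  show "T ` snd d ` (fst d \<inter> fst c) \<subseteq> snd c ` (fst c \<inter> UNIV)" using d by (auto simp: T_def)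
  show "jacobian T y $ a $ i = partial_deriv i (\<lambda>y. T y $ a) y" for y a i by (simp add: jacobian_def)
  fix y assume y: "y \<in> snd d ` (fst d \<inter> fst c)"
  \<comment> \<open>The density in the chart \<open>d\<close> is positive and has the determinant of
    the Jacobian as a factor, so the latter cannot vanish.\<close>
  have "0 < sqrt (det (gm d y))" using gm_det_pos[OF d] y by auto
  then show "det (jacobian T y) \<noteq> 0"
    using gm_det_change[OF c d y] by (auto simp: T_def)
  show "gm d y = Finite_Cartesian_Product.transpose (jacobian T y) ** gm c (T y) ** jacobian T y"
    unfolding T_def by (rule gm_change_matrix[OF c d y])
qed

text \<open>The chart picked by \<open>SOME\<close> in the definition is compared with
  \<open>c\<close> through their transition map.\<close>

lemma scalar_curvature_chart:
  assumes c: "c \<in> A" and p: "p \<in> fst c"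
  shows "scalar_curvature A g p = Scal (gm c) (snd c p)"
proof -
  define e where "e = (SOME e. e \<in> A \<and> p \<in> fst e)"
  have "\<exists>e. e \<in> A \<and> p \<in> fst e" using c p by blast
  from someI_ex[OF this] have e: "e \<in> A" "p \<in> fst e" by (auto simp: e_def)
  interpret ch: metric_change "snd e ` (fst e \<inter> UNIV)" "gm e" "snd c ` (fst c \<inter> fst e)" "gm c"
    "\<lambda>x. snd e (chart_inv c x)" "jacobian (\<lambda>x. snd e (chart_inv c x))"
    by (rule metric_change_chart[OF e(1) c])
  have "scalar_curvature A g p = Scal (gm e) (snd e p)"
    by (simp add: scalar_curvature_def Let_def ricci_def riemann_Riem Scal_def flip: e_def)
  also have "\<dots> = Scal (gm c) (snd c p)"
    using ch.Scal_change[of "snd c p"] c p e by simp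
  finally show ?thesis .
qed

context
  fixes V and \<tau>\<^sub>0 :: real
  assumes V: "open V" and \<tau>: "\<tau>\<^sub>0 > 0" and lsi: "log_sobolev A g V \<tau>\<^sub>0"
begin

lemma euclid_log_sobolev_chart:
  assumes c: "c \<in> A"
  shows "euclid_log_sobolev (snd c ` (fst c \<inter> V)) (gm c) \<tau>\<^sub>0"
  unfolding euclid_log_sobolev_def
proof (intro allI impI)
  fix \<psi> \<tau> assume \<psi>: "test_function (snd c ` (fst c \<inter> V)) \<psi>" "(LINT x|lborel. (\<psi> x)\<^sup>2 * sqrt (det (gm c x))) = 1"
    "0 < \<tau>" "\<tau> < \<tau>\<^sub>0"
  show "(LINT x|lborel. (\<psi> x)\<^sup>2 * ln ((\<psi> x)\<^sup>2) * sqrt (det (gm c x)))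
       \<le> 4 * \<tau> * (LINT x|lborel. energy (gm c) \<psi> x * sqrt (det (gm c x))) - real CARD('b) - real CARD('b) / 2 * ln (4 * pi * \<tau>)"
    using log_sobolev_chart[OF c V \<psi>(1) lsi _ \<psi>(3,4)] \<psi>(2) by (simp add: gdens_def)
qed

lemma scalar_curvature_nonpos:
  assumes "p \<in> V"
  shows "scalar_curvature A g p \<le> 0"
proof -
  obtain c where c: "c \<in> A" "p \<in> fst c" using chart_cover by blast
  show ?thesis
    unfolding scalar_curvature_chart[OF c]
    by (rule metric_field.Scal_nonpos[OF metric_field_chart[OF c(1) V] euclid_log_sobolev_chart[OF c(1)] \<tau>])
      (use c assms in auto)
qed

text \<open>A nonpositive function with nonnegative integral vanishes almost everywhere. If it were
  negative at \<open>p\<close>, continuity in a chart would make it negative on a nonempty open set,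
  which has positive volume.\<close>

lemma scalar_curvature_zero:
  assumes ext: "has_extended_integral (volume_on A g V) (scalar_curvature A g)"
    and int: "0 \<le> extended_integral (volume_on A g V) (scalar_curvature A g)" and p: "p \<in> V"
  shows "scalar_curvature A g p = 0"
proof (rule ccontr)
  let ?R = "scalar_curvature A g" and ?M = "volume_on A g V"
  assume "?R p \<noteq> 0"
  then have neg: "?R p < 0" using scalar_curvature_nonpos[OF p] by simp
  have sp: "space ?M = V" by (simp add: volume_on_def space_restrict_space)
  have [measurable]: "?R \<in> borel_measurable ?M" using ext by (simp add: has_extended_integral_def)
  \<comment> \<open>The positive part has integral \<open>0\<close>, so the extended integral is
    minus the integral of the negative part, even if that is infinite.\<close>
  have "(\<integral>\<^sup>+q. ennreal (?R q) \<partial>?M) = (\<integral>\<^sup>+q. 0 \<partial>?M)"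
    by (rule nn_integral_cong) (simp add: sp ennreal_neg scalar_curvature_nonpos)
  then have "enn2ereal (\<integral>\<^sup>+q. ennreal (- ?R q) \<partial>?M) \<le> 0"
    using int by (simp add: extended_integral_def zero_ennreal.rep_eq)
  then have "(\<integral>\<^sup>+q. ennreal (- ?R q) \<partial>?M) = 0"
    by (metis enn2ereal_nonneg antisym enn2ereal_inject zero_ennreal.rep_eq)
  then have "AE q in ?M. ennreal (- ?R q) = 0" by (subst (asm) nn_integral_0_iff_AE) auto
  then have ae: "AE q in vol. q \<in> V \<longrightarrow> \<not> ?R q < 0"
    unfolding volume_on_def using V by (subst (asm) AE_restrict_space_iff) (auto simp: ennreal_eq_0_iff)
  obtain c where c: "c \<in> A" "p \<in> fst c" using chart_cover by blast
  interpret metric_field "snd c ` (fst c \<inter> V)" "gm c" by (rule metric_field_chart[OF c(1) V])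
  \<comment> \<open>The set of negative curvature in the chart: open by continuity of
    \<open>Scal (gm c)\<close>, and nonempty because it contains the image of
    \<open>p\<close>.\<close>
  define W where "W = snd c ` (fst c \<inter> V) \<inter> Scal (gm c) -` {..<0}"
  have W: "open W" unfolding W_def by (intro continuous_open_preimage Scal_continuous op open_lessThan)
  have Wsub: "W \<subseteq> snd c ` fst c" by (auto simp: W_def)
  have Wp: "W \<noteq> {}" using p c neg scalar_curvature_chart[OF c] by (auto simp: W_def)
  define B where "B = fst c \<inter> snd c -` W"
  have B: "open B" unfolding B_def by (intro continuous_open_preimage chart_continuous chart_open c W)
  have BW: "snd c ` B = W" using Wsub by (auto simp: B_def)
  have "q \<in> V \<and> ?R q < 0" if "q \<in> B" for q
  proof -
    have q: "q \<in> fst c" "snd c q \<in> W" using that by (auto simp: B_def)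
    then obtain q' where q': "q' \<in> fst c" "q' \<in> V" "snd c q = snd c q'" by (auto simp: W_def)
    then have "q = q'" using chart_inv_left[OF c(1)] q(1) by metis
    then show ?thesis using q q' scalar_curvature_chart[OF c(1) q(1)] by (auto simp: W_def)
  qed
  then have "AE q in vol. q \<notin> B" using ae by (auto elim!: eventually_mono)
  then have "emeasure vol B = 0"
    using B by (subst (asm) AE_iff_null_sets[symmetric]) auto
  also have "emeasure vol B = (\<integral>\<^sup>+x. ennreal (gdens c x) * indicator W x \<partial>lborel)"
    using volume_spec_chart[OF volume_spec_vol c(1), of B] emeasure_chart_measure[OF c(1), of B] B BW
    by (auto simp: B_def)
  also have "\<dots> = (\<integral>\<^sup>+x. ennreal (indicator W x * gdens c x) \<partial>lborel)"
    by (intro nn_integral_cong) (auto simp: indicator_def)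
  finally have "AE x in lborel. ennreal (indicator W x * gdens c x) = 0"
    using gdens_borel[OF c(1) borel_open[OF W] Wsub] by (subst (asm) nn_integral_0_iff_AE) auto
  then have "AE x in lborel. x \<notin> W"
  proof (rule eventually_mono)
    show "x \<notin> W" if "ennreal (indicator W x * gdens c x) = 0" for x
      using that gdens_pos[OF c(1), of x] Wsub by (auto simp: ennreal_eq_0_iff)
  qed
  then have "W \<in> null_sets lborel" using W by (subst AE_iff_null_sets) auto
  then have "negligible W" by (simp add: negligible_iff_null_sets null_sets_completionI)
  with open_not_negligible[OF W Wp] show False by simp
qed

lemma flat_on_log_sobolev:
  assumes "has_extended_integral (volume_on A g V) (scalar_curvature A g)"
    and "0 \<le> extended_integral (volume_on A g V) (scalar_curvature A g)"
  shows "flat_on A g V"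
  unfolding flat_on_def riemann_Riem
proof (intro ballI allI)
  fix c p l k i j assume c: "c \<in> A" and p: "p \<in> fst c \<inter> V"
  have "Scal (gm c) y = 0" if "y \<in> snd c ` (fst c \<inter> V)" for y
    using that scalar_curvature_zero[OF assms] scalar_curvature_chart[OF c] by force
  then show "Riem (gm c) l k i j (snd c p) = 0"
    using p by (intro metric_field.Riem_zero[OF metric_field_chart[OF c V] euclid_log_sobolev_chart[OF c] \<tau>]) auto
qed

end

end

theorem theorem1p5:
  fixes A :: "('a::{t2_space, second_countable_topology}, 'n::finite) chart set"
    and g :: "'a metric"
    and V :: "'a set"
    and \<tau>\<^sub>0 :: real
  assumes "smooth_atlas A"
    and "riemannian_metric A g"
    and "open V"
    and "has_extended_integral (volume_on A g V) (scalar_curvature A g)"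
    and "0 \<le> extended_integral (volume_on A g V) (scalar_curvature A g)"
    and "0 < \<tau>\<^sub>0"
    and "\<And>f X \<tau>. f \<in> W12_0 A g V \<Longrightarrow> weak_gradient A g V f X \<Longrightarrow>
           (LINT p|volume_on A g V. (f p)\<^sup>2) = 1 \<Longrightarrow> 0 < \<tau> \<Longrightarrow> \<tau> < \<tau>\<^sub>0 \<Longrightarrow>
           has_extended_integral (volume_on A g V) (\<lambda>p. (f p)\<^sup>2 * ln ((f p)\<^sup>2)) \<Longrightarrow>
           extended_integral (volume_on A g V) (\<lambda>p. (f p)\<^sup>2 * ln ((f p)\<^sup>2))
             \<le> ereal ((LINT p|volume_on A g V. 4 * \<tau> * g p (X p) (X p))
                  - real CARD('n) - real CARD('n) / 2 * ln (4 * pi * \<tau>))"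
  shows "flat_on A g V"
proof -
  interpret riemannian A g
    using assms(1,2)
    by (intro riemannian.intro metric_atlas.intro atlas.intro metric_atlas_axioms.intro riemannian_axioms.intro)
      (auto simp: riemannian_metric_def)
  have "log_sobolev A g V \<tau>\<^sub>0"
    unfolding log_sobolev_def using assms(7) by blast
  from flat_on_log_sobolev[OF assms(3,6) this assms(4,5)] show ?thesis .
qed

end
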